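(* Let $\Sigma$ be a sofic approximation to $G$ and let $(X,\mu,T)$ be a $G$-system. It is always the case that $$\mathrm h^{\mathrm{ps}}_\Sigma(\mu,T)\ \ge\ \mathrm h^{\mathrm{dq}}_\Sigma(\mu,T),$$ and this is an equality if $(X,\mu,T)$ has a finite generating partition.
   Context: $G$ is a countable discrete sofic group. A sofic approximation $\Sigma=(\sigma_n)_{n\ge1}$ to $G$ is a sequence of nonempty finite sets $V_n$ and maps $\sigma_n:G\to\mathrm{Sym}(V_n)$, $g\mapsto\sigma_n^g$ (not necessarily homomorphisms), such that for all $g,h\in G$ the proportion of $v\in V_n$ with $\sigma_n^g(\sigma_n^h(v))=\sigma_n^{gh}(v)$ tends to $1$, and for all $g\ne e$ the proportion of $v\in V_n$ with $\sigma_n^g(v)\neq v$ tends to $1$. A $G$-system $(X,\mu,T)$ is a standard probability space with a measurable $\mu$-preserving action $T$ of $G$. A finite generating partition is a finite measurable partition of $X$ whose translates under $T$ generate the $\sigma$-algebra modulo $\mu$-null sets. A metric $G$-process $(\mathcal{X}^G,\mu,S,d)$ consists of a standard measurable space $\mathcal{X}$, a compact metric $d$ on $\mathcal X$ whose Borel $\sigma$-algebra is that of $\mathcal X$, the right-shift action $S^g((x_h)_{h})=(x_{hg})_{h}$, and an $S$-invariant probability measure $\mu$ on $\mathcal{X}^G$. $\mathcal{X}^G$ has the product topology from $d$, and $\mathrm{Prob}(\mathcal X^G)$ the resulting weak$^\ast$ topology. For a finite set $V$, a map $\sigma:G\to\mathrm{Sym}(V)$, $\mathbf{x}\in\mathcal{X}^V$,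 $v\in V$: $\Pi^\sigma_v(\mathbf{x})=(x_{\sigma^g(v)})_{g\in G}\in\mathcal{X}^G$; $P^\sigma_{\mathbf x}=\frac1{|V|}\sum_{v}\delta_{\Pi^\sigma_v(\mathbf x)}$; $\Omega(\mathcal O,\sigma)=\{\mathbf x\in\mathcal X^V: P^\sigma_{\mathbf x}\in\mathcal O\}$ for $\mathcal{O}\subseteq\mathrm{Prob}(\mathcal X^G)$; $d^{(V)}(\mathbf x,\mathbf x')=\frac1{|V|}\sum_v d(x_v,x'_v)$. For a metric space $(Y,d_Y)$, $\mathrm{cov}_\delta(Z,d_Y)$ is the minimum cardinality of a $\delta$-dense subset of $Z\subseteq Y$ (with $\log 0=-\infty$), and for a Borel probability $\nu$ on $Y$, $\mathrm{cov}_{\varepsilon,\delta}(\nu,d_Y)=\min\{|F|: F\subseteq Y,\ \nu(B_\delta(F))>1-\varepsilon\}$, with $B_\delta(F)$ the $\delta$-neighbourhood of $F$. Sofic entropy of a metric $G$-process: $$\mathrm h_\Sigma(\mu)=\sup_{\delta>0}\inf_{\mathcal O}\limsup_{n\to\infty}\tfrac1{|V_n|}\log\mathrm{cov}_\delta(\Omega(\mathcal O,\sigma_n),d^{(V_n)}),$$ where $\mathcal O$ ranges over weak$^\ast$ neighbourhoods of $\mu$. A sequence $\mu_i\in\mathrm{Prob}(\mathcal X^{V_{n_i}})$ quenched converges to $\mu$ over $(\sigma_{n_i})_{i\ge1}$ if for every weak$^\ast$ neighbourhood $\mathcal O$ of $\mu$ the proportion of $v\in V_{n_i}$ with $(\Pi^{\sigma_{n_i}}_v)_\ast\mu_i\in\mathcal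 O$ tends to $1$ and $\mu_i(\Omega(\mathcal O,\sigma_{n_i}))\to1$. It doubly-quenched converges to $\mu$ if $\mu_i\times\mu_i\in\mathrm{Prob}((\mathcal X\times\mathcal X)^{V_{n_i}})$ quenched converges to $\mu\times\mu$ (on $(\mathcal X\times\mathcal X)^G$, with the average of the two copies of $d$). Then $$\mathrm h^{\mathrm{dq}}_\Sigma(\mu)=\sup\Big\{\sup_{\delta,\varepsilon>0}\limsup_{i\to\infty}\tfrac1{|V_{n_i}|}\log\mathrm{cov}_{\varepsilon,\delta}(\mu_i,d^{(V_{n_i})})\Big\},$$ the outer supremum being over all subsequences $n_i\uparrow\infty$ and all sequences $(\mu_i)$ doubly-quenched converging to $\mu$ over $(\sigma_{n_i})_{i\ge1}$ (and $\sup\emptyset=-\infty$). These quantities do not depend on $d$ and are isomorphism invariants of the underlying system. Every $G$-system is isomorphic to a $G$-process (via $x\mapsto(T^hx)_{h\in G}\in X^G$), and the quantities for $(X,\mu,T)$ are defined as those of any isomorphic metric $G$-process. Power-stabilized sofic entropy: $\mathrm h^{\mathrm{ps}}_\Sigma(\mu,T)=\lim_{k\to\infty}\frac1k\mathrm h_\Sigma(\mu^{\times k},T^{\times k})$, where $(X^k,\mu^{\times k},T^{\times k})$ is the $k$-fold Cartesian power with diagonal action (the limit exists by subadditivity of $\mathrm h_\Sigma$). *)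

theory Defs
  imports "HOL-Probability.Probability" "HOL-Algebra.Group"
begin

(* A sofic approximation is a sequence V of finite sets together with a sequence sigma,
   where "\<sigma> n g" is the permutation of "V n" assigned to g. *)

definition proportion :: "'v set \<Rightarrow> ('v \<Rightarrow> bool) \<Rightarrow> real" where
  "proportion V P = real (card {v \<in> V. P v}) / real (card V)"

definition sofic_approximation ::
  "('g, 'b) monoid_scheme \<Rightarrow> (nat \<Rightarrow> 'v set) \<Rightarrow> (nat \<Rightarrow> 'g \<Rightarrow> 'v \<Rightarrow> 'v) \<Rightarrow> bool" where
  "sofic_approximation G V \<sigma> \<longleftrightarrow>
     (\<forall>n. finite (V n) \<and> V n \<noteq> {}) \<and>
     (\<forall>n. \<forall>g\<in>carrier G. \<sigma> n g permutes V n) \<and>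
     (\<forall>g\<in>carrier G. \<forall>h\<in>carrier G.
        (\<lambda>n. proportion (V n) (\<lambda>v. \<sigma> n g (\<sigma> n h v) = \<sigma> n (g \<otimes>\<^bsub>G\<^esub> h) v)) \<longlonglongrightarrow> 1) \<and>
     (\<forall>g\<in>carrier G - {\<one>\<^bsub>G\<^esub>}. (\<lambda>n. proportion (V n) (\<lambda>v. \<sigma> n g v \<noteq> v)) \<longlonglongrightarrow> 1)"

definition standard_borel :: "'x measure \<Rightarrow> bool" where
  "standard_borel M \<longleftrightarrow>
     (\<exists>\<tau>. topspace \<tau> = space M \<and> completely_metrizable_space \<tau> \<and> second_countable \<tau> \<and>
          sets M = sigma_sets (space M) {U. openin \<tau> U})"

definition G_system ::
  "('g, 'b) monoid_scheme \<Rightarrow> 'x measure \<Rightarrow> ('g \<Rightarrow> 'x \<Rightarrow> 'x) \<Rightarrow> bool" where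
  "G_system G M T \<longleftrightarrow>
     prob_space M \<and> standard_borel M \<and>
     (\<forall>g\<in>carrier G. T g \<in> measurable M M \<and> distr M M (T g) = M) \<and>
     (\<forall>x\<in>space M. T \<one>\<^bsub>G\<^esub> x = x) \<and>
     (\<forall>g\<in>carrier G. \<forall>h\<in>carrier G. \<forall>x\<in>space M. T (g \<otimes>\<^bsub>G\<^esub> h) x = T g (T h x))"

definition isomorphic_systems ::
  "('g, 'b) monoid_scheme \<Rightarrow> 'x measure \<Rightarrow> ('g \<Rightarrow> 'x \<Rightarrow> 'x) \<Rightarrow>
     'y measure \<Rightarrow> ('g \<Rightarrow> 'y \<Rightarrow> 'y) \<Rightarrow> bool" where
  "isomorphic_systems G M T N S \<longleftrightarrow>
     (\<exists>\<phi> \<psi>. \<phi> \<in> measurable M N \<and> \<psi> \<in> measurable N M \<and> distr M N \<phi> = N \<and>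
        (AE x in M. \<psi> (\<phi> x) = x) \<and> (AE y in N. \<phi> (\<psi> y) = y) \<and>
        (\<forall>g\<in>carrier G. AE x in M. \<phi> (T g x) = S g (\<phi> x)))"

definition finite_generating_partition ::
  "('g, 'b) monoid_scheme \<Rightarrow> 'x measure \<Rightarrow> ('g \<Rightarrow> 'x \<Rightarrow> 'x) \<Rightarrow> 'x set set \<Rightarrow> bool" where
  "finite_generating_partition G M T P \<longleftrightarrow>
     finite P \<and> partition_on (space M) P \<and> P \<subseteq> sets M \<and>
     (\<forall>A\<in>sets M.
        \<exists>B\<in>sigma_sets (space M) {T g -` C \<inter> space M |g C. g \<in> carrier G \<and> C \<in> P}.
          (A - B) \<union> (B - A) \<in> null_sets M)"

definition power_space :: "nat \<Rightarrow> 'x measure \<Rightarrow> (nat \<Rightarrow> 'x) measure" where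
  "power_space k M = PiM {..<k} (\<lambda>_. M)"

definition power_action :: "nat \<Rightarrow> ('g \<Rightarrow> 'x \<Rightarrow> 'x) \<Rightarrow> 'g \<Rightarrow> (nat \<Rightarrow> 'x) \<Rightarrow> (nat \<Rightarrow> 'x)" where
  "power_action k T g x = (\<lambda>i\<in>{..<k}. T g (x i))"

definition shift :: "('g, 'b) monoid_scheme \<Rightarrow> 'g \<Rightarrow> ('g \<Rightarrow> 'a) \<Rightarrow> ('g \<Rightarrow> 'a)" where
  "shift G g x = (\<lambda>h\<in>carrier G. x (h \<otimes>\<^bsub>G\<^esub> g))"

(* The underlying set and measurable structure of the alphabet are those of X, which is only
   used as a measurable space; the values of d outside "space X" are irrelevant. *)
definition metric_process ::
  "('g, 'b) monoid_scheme \<Rightarrow> 'a measure \<Rightarrow> ('a \<Rightarrow> 'a \<Rightarrow> real) \<Rightarrow> ('g \<Rightarrow> 'a) measure \<Rightarrow> bool" where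
  "metric_process G X d \<mu> \<longleftrightarrow>
     standard_borel X \<and> Metric_space (space X) d \<and>
     compact_space (Metric_space.mtopology (space X) d) \<and>
     sets X = sigma_sets (space X) {U. openin (Metric_space.mtopology (space X) d) U} \<and>
     prob_space \<mu> \<and> sets \<mu> = sets (PiM (carrier G) (\<lambda>_. X)) \<and>
     (\<forall>g\<in>carrier G. distr \<mu> \<mu> (shift G g) = \<mu>)"

definition config_topology ::
  "('g, 'b) monoid_scheme \<Rightarrow> 'a measure \<Rightarrow> ('a \<Rightarrow> 'a \<Rightarrow> real) \<Rightarrow> ('g \<Rightarrow> 'a) topology" where
  "config_topology G X d =
     product_topology (\<lambda>_. Metric_space.mtopology (space X) d) (carrier G)"

(* The coarsest topology on the set of probability measures on the product space that makes
   integration against each continuous function continuous. *)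
definition weak_star ::
  "('g, 'b) monoid_scheme \<Rightarrow> 'a measure \<Rightarrow> ('a \<Rightarrow> 'a \<Rightarrow> real) \<Rightarrow> ('g \<Rightarrow> 'a) measure topology" where
  "weak_star G X d = topology_generated_by
     {{\<nu>. prob_space \<nu> \<and> sets \<nu> = sets (PiM (carrier G) (\<lambda>_. X)) \<and> integral\<^sup>L \<nu> f \<in> U} |f U.
        continuous_map (config_topology G X d) euclideanreal f \<and> open (U :: real set)}"

(* Open neighbourhoods suffice: they are cofinal among all neighbourhoods, and every condition
   or infimum over neighbourhoods below is monotone in the neighbourhood. *)
definition weak_star_nhds ::
  "('g, 'b) monoid_scheme \<Rightarrow> 'a measure \<Rightarrow> ('a \<Rightarrow> 'a \<Rightarrow> real) \<Rightarrow> ('g \<Rightarrow> 'a) measure \<Rightarrow>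
     ('g \<Rightarrow> 'a) measure set set" where
  "weak_star_nhds G X d \<mu> = {\<O>. openin (weak_star G X d) \<O> \<and> \<mu> \<in> \<O>}"

definition pullback_name ::
  "('g, 'b) monoid_scheme \<Rightarrow> ('g \<Rightarrow> 'v \<Rightarrow> 'v) \<Rightarrow> 'v \<Rightarrow> ('v \<Rightarrow> 'a) \<Rightarrow> ('g \<Rightarrow> 'a)" where
  "pullback_name G s v x = (\<lambda>g\<in>carrier G. x (s g v))"

(* The average over v in V of the point masses at the pullback names of x, written as the
   image of the uniform distribution on V. *)
definition empirical_distribution ::
  "('g, 'b) monoid_scheme \<Rightarrow> 'a measure \<Rightarrow> 'v set \<Rightarrow> ('g \<Rightarrow> 'v \<Rightarrow> 'v) \<Rightarrow> ('v \<Rightarrow> 'a) \<Rightarrow>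
     ('g \<Rightarrow> 'a) measure" where
  "empirical_distribution G X V s x =
     distr (uniform_count_measure V) (PiM (carrier G) (\<lambda>_. X)) (\<lambda>v. pullback_name G s v x)"

definition good_models ::
  "('g, 'b) monoid_scheme \<Rightarrow> 'a measure \<Rightarrow> 'v set \<Rightarrow> ('g \<Rightarrow> 'v \<Rightarrow> 'v) \<Rightarrow>
     ('g \<Rightarrow> 'a) measure set \<Rightarrow> ('v \<Rightarrow> 'a) set" where
  "good_models G X V s \<O> =
     {x \<in> V \<rightarrow>\<^sub>E space X. empirical_distribution G X V s x \<in> \<O>}"

definition hamming_average ::
  "'v set \<Rightarrow> ('a \<Rightarrow> 'a \<Rightarrow> real) \<Rightarrow> ('v \<Rightarrow> 'a) \<Rightarrow> ('v \<Rightarrow> 'a) \<Rightarrow> real" where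
  "hamming_average V d x x' = (\<Sum>v\<in>V. d (x v) (x' v)) / real (card V)"

(* Covering numbers; the value is infinite exactly when no finite set is admissible. *)

definition cov :: "real \<Rightarrow> 'y set \<Rightarrow> ('y \<Rightarrow> 'y \<Rightarrow> real) \<Rightarrow> enat" where
  "cov \<delta> Z d =
     (INF F\<in>{F. finite F \<and> F \<subseteq> Z \<and> (\<forall>z\<in>Z. \<exists>y\<in>F. d z y < \<delta>)}. enat (card F))"

definition cov_measure :: "real \<Rightarrow> real \<Rightarrow> 'y measure \<Rightarrow> ('y \<Rightarrow> 'y \<Rightarrow> real) \<Rightarrow> enat" where
  "cov_measure \<epsilon> \<delta> \<nu> d =
     (INF F\<in>{F. finite F \<and> F \<subseteq> space \<nu> \<and>
                measure \<nu> {z \<in> space \<nu>. \<exists>y\<in>F. d z y < \<delta>} > 1 - \<epsilon>}. enat (card F))"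

definition log_enat :: "enat \<Rightarrow> ereal" where
  "log_enat c =
     (case c of enat m \<Rightarrow> if m = 0 then - \<infinity> else ereal (ln (real m)) | \<infinity> \<Rightarrow> \<infinity>)"

definition process_entropy ::
  "('g, 'b) monoid_scheme \<Rightarrow> (nat \<Rightarrow> 'v set) \<Rightarrow> (nat \<Rightarrow> 'g \<Rightarrow> 'v \<Rightarrow> 'v) \<Rightarrow>
     'a measure \<Rightarrow> ('a \<Rightarrow> 'a \<Rightarrow> real) \<Rightarrow> ('g \<Rightarrow> 'a) measure \<Rightarrow> ereal" where
  "process_entropy G V \<sigma> X d \<mu> =
     (SUP \<delta>\<in>{0<..}. INF \<O>\<in>weak_star_nhds G X d \<mu>.
        limsup (\<lambda>n. log_enat (cov \<delta> (good_models G X (V n) (\<sigma> n) \<O>) (hamming_average (V n) d))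
                     / ereal (real (card (V n)))))"

(* Here V and sigma are already indexed along the subsequence. *)
definition quenched_converges ::
  "('g, 'b) monoid_scheme \<Rightarrow> (nat \<Rightarrow> 'v set) \<Rightarrow> (nat \<Rightarrow> 'g \<Rightarrow> 'v \<Rightarrow> 'v) \<Rightarrow>
     'a measure \<Rightarrow> ('a \<Rightarrow> 'a \<Rightarrow> real) \<Rightarrow> (nat \<Rightarrow> ('v \<Rightarrow> 'a) measure) \<Rightarrow>
     ('g \<Rightarrow> 'a) measure \<Rightarrow> bool" where
  "quenched_converges G V \<sigma> X d m \<mu> \<longleftrightarrow>
     (\<forall>i. prob_space (m i) \<and> sets (m i) = sets (PiM (V i) (\<lambda>_. X))) \<and>
     (\<forall>\<O>\<in>weak_star_nhds G X d \<mu>.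
        (\<lambda>i. proportion (V i)
               (\<lambda>v. distr (m i) (PiM (carrier G) (\<lambda>_. X)) (pullback_name G (\<sigma> i) v) \<in> \<O>))
          \<longlonglongrightarrow> 1 \<and>
        (\<lambda>i. measure (m i) (good_models G X (V i) (\<sigma> i) \<O>)) \<longlonglongrightarrow> 1)"

(* The square of a measure on the power of X with index set I, viewed as a measure on the
   power of the square of X with the same index set. *)
definition square_measure ::
  "'i set \<Rightarrow> 'a measure \<Rightarrow> ('i \<Rightarrow> 'a) measure \<Rightarrow> ('i \<Rightarrow> 'a \<times> 'a) measure" where
  "square_measure I X \<nu> =
     distr (\<nu> \<Otimes>\<^sub>M \<nu>) (PiM I (\<lambda>_. X \<Otimes>\<^sub>M X)) (\<lambda>(x, y). \<lambda>i\<in>I. (x i, y i))"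

definition average_metric :: "('a \<Rightarrow> 'a \<Rightarrow> real) \<Rightarrow> 'a \<times> 'a \<Rightarrow> 'a \<times> 'a \<Rightarrow> real" where
  "average_metric d p q = (d (fst p) (fst q) + d (snd p) (snd q)) / 2"

definition doubly_quenched_converges ::
  "('g, 'b) monoid_scheme \<Rightarrow> (nat \<Rightarrow> 'v set) \<Rightarrow> (nat \<Rightarrow> 'g \<Rightarrow> 'v \<Rightarrow> 'v) \<Rightarrow>
     'a measure \<Rightarrow> ('a \<Rightarrow> 'a \<Rightarrow> real) \<Rightarrow> (nat \<Rightarrow> ('v \<Rightarrow> 'a) measure) \<Rightarrow>
     ('g \<Rightarrow> 'a) measure \<Rightarrow> bool" where
  "doubly_quenched_converges G V \<sigma> X d m \<mu> \<longleftrightarrow>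
     (\<forall>i. prob_space (m i) \<and> sets (m i) = sets (PiM (V i) (\<lambda>_. X))) \<and>
     quenched_converges G V \<sigma> (X \<Otimes>\<^sub>M X) (average_metric d)
       (\<lambda>i. square_measure (V i) X (m i)) (square_measure (carrier G) X \<mu>)"

definition process_dq_entropy ::
  "('g, 'b) monoid_scheme \<Rightarrow> (nat \<Rightarrow> 'v set) \<Rightarrow> (nat \<Rightarrow> 'g \<Rightarrow> 'v \<Rightarrow> 'v) \<Rightarrow>
     'a measure \<Rightarrow> ('a \<Rightarrow> 'a \<Rightarrow> real) \<Rightarrow> ('g \<Rightarrow> 'a) measure \<Rightarrow> ereal" where
  "process_dq_entropy G V \<sigma> X d \<mu> =
     (SUP (r, m)\<in>{(r, m). strict_mono r \<and>
                     doubly_quenched_converges G (V \<circ> r) (\<sigma> \<circ> r) X d m \<mu>}.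
        SUP (\<delta>, \<epsilon>)\<in>{0<..} \<times> {0<..}.
          limsup (\<lambda>i. log_enat (cov_measure \<epsilon> \<delta> (m i) (hamming_average (V (r i)) d))
                       / ereal (real (card (V (r i))))))"

(* The entropies of a system are those of any metric process isomorphic to it.  They are
   isomorphism invariants, so the choice made here is immaterial.  The alphabet of the process
   is taken inside the type of real sequences, with an arbitrary compact metric on it; nothing
   is lost, because every compact metrizable space is homeomorphic to a subset of the Hilbert
   cube. *)
definition isomorphic_process ::
  "('g, 'b) monoid_scheme \<Rightarrow> 'x measure \<Rightarrow> ('g \<Rightarrow> 'x \<Rightarrow> 'x) \<Rightarrow>
     (nat \<Rightarrow> real) measure \<times> ((nat \<Rightarrow> real) \<Rightarrow> (nat \<Rightarrow> real) \<Rightarrow> real) \<times>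
     ('g \<Rightarrow> nat \<Rightarrow> real) measure" where
  "isomorphic_process G M T =
     (SOME (X, d, \<mu>). metric_process G X d \<mu> \<and> isomorphic_systems G M T \<mu> (shift G))"

definition sofic_entropy ::
  "('g, 'b) monoid_scheme \<Rightarrow> (nat \<Rightarrow> 'v set) \<Rightarrow> (nat \<Rightarrow> 'g \<Rightarrow> 'v \<Rightarrow> 'v) \<Rightarrow>
     'x measure \<Rightarrow> ('g \<Rightarrow> 'x \<Rightarrow> 'x) \<Rightarrow> ereal" where
  "sofic_entropy G V \<sigma> M T =
     (case isomorphic_process G M T of (X, d, \<mu>) \<Rightarrow> process_entropy G V \<sigma> X d \<mu>)"

definition dq_entropy ::
  "('g, 'b) monoid_scheme \<Rightarrow> (nat \<Rightarrow> 'v set) \<Rightarrow> (nat \<Rightarrow> 'g \<Rightarrow> 'v \<Rightarrow> 'v) \<Rightarrow>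
     'x measure \<Rightarrow> ('g \<Rightarrow> 'x \<Rightarrow> 'x) \<Rightarrow> ereal" where
  "dq_entropy G V \<sigma> M T =
     (case isomorphic_process G M T of (X, d, \<mu>) \<Rightarrow> process_dq_entropy G V \<sigma> X d \<mu>)"

definition ps_entropy ::
  "('g, 'b) monoid_scheme \<Rightarrow> (nat \<Rightarrow> 'v set) \<Rightarrow> (nat \<Rightarrow> 'g \<Rightarrow> 'v \<Rightarrow> 'v) \<Rightarrow>
     'x measure \<Rightarrow> ('g \<Rightarrow> 'x \<Rightarrow> 'x) \<Rightarrow> ereal" where
  "ps_entropy G V \<sigma> M T =
     lim (\<lambda>k. sofic_entropy G V \<sigma> (power_space k M) (power_action k T) / ereal (real k))"

end

theory Submission
  imports Defs "HOL-Real_Asymp.Real_Asymp"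
begin

text \<open>
Both entropies count good models over the sofic approximation. The proof compares them by
letting a doubly-quenched sequence of measures and a large family of good models of a Cartesian power
produce each other.

\<^bold>\<open>Growth.\<close> Systems are studied through codings: an alphabet with countably many features with values in
the unit interval. A model is good when the vertex averages of finitely many tests on its names are
close to the integrals over the system; tests are Lipschitz functions of finitely many coordinates, and
by the theorem of Stone and Weierstrass the monomials, called words, suffice. A system has growth $c$
if along a subsequence there are at least $\exp(c|V|)$ good models that finitely many features
separate. For a generating coding every good model extends to a good model of any further coding
(\<open>extend_good_models\<close>), and the generating features control all others
(\<open>recover_features\<close>). Hence growth does not depend on the coding (\<open>has_growth_invariant\<close>), and
sofic entropy is the supremum of the rates of growth.

\<^bold>\<open>Limit.\<close> Let $a_k$ be the sofic entropy of the $k$-th power. Cutting the coordinates into blocks gives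
$a_m \le \lceil m/k \rceil a_k$ (\<open>power_growth_of_blocks\<close>), so that $a_k/k$ converges to its infimum.

\<^bold>\<open>Inequality.\<close> Double quenching means that the one- and two-point averages of words are right
(\<open>pair_convergent\<close>). By a second moment bound, $k$ independent samples then form a good model of the
$k$-th power with high probability. If few balls never cover the measure, a greedy choice isolates a set
of positive mass in which all balls are exponentially small; tuples from it yield
$\exp(kb|V|)$ separated good models (\<open>pair_convergent_power_growth\<close>), that is $a_k \ge kb$.

\<^bold>\<open>Equality.\<close> Conversely take $\exp(kb|V|)$ good models of the $k$-th power, with $k$ large and told apart by
the labels of the finite partition. The distribution of a random coordinate of a random one of them is
nearly doubly quenched, by the law of large numbers over the $k$ coordinates. If few balls covered most of
it, most label words would lie near few centres, and there would be too few label tuples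
(\<open>labelled_tuples_count\<close>); so its covering numbers grow at rate $b$
(\<open>doubly_quenched_from_power_growth\<close>). Finiteness of the partition bounds the number of label words
near a centre.
\<close>

abbreviation (input) eventually_in_sequence :: "(nat => bool) => bool" (binder "EV " 10) where
  "eventually_in_sequence P == eventually P sequentially"

abbreviation (input) converges_to :: "(nat => 'a::topological_space) => 'a => bool" (infix "~~>" 60) where
  "f ~~> c == f \<longlonglongrightarrow> c"

abbreviation (input) binary_product (infixr "xM" 80) where
  "M xM N == M \<Otimes>\<^sub>M N"

abbreviation (input) bmeas where
  "bmeas M == borel_measurable M"

abbreviation (input) configs where
  "configs G X == PiM (carrier G) (%_. X)"

section \<open>Averages, names and local tests\<close>

definition vavg :: "'v set => ('v => real) => real" where
 "vavg V f = (\<Sum>v\<in>V. f v) / real (card V)"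

lemma vavg_cong: "(!!v. v : V ==> f v = g v) ==> vavg V f = vavg V g" by (simp add: vavg_def)

lemma vavg_mono: "(!!v. v : V ==> f v <= g v) ==> vavg V f <= vavg V g" by (simp add: vavg_def divide_right_mono sum_mono)

lemma vavg_nonneg: "(!!v. v : V ==> 0 <= f v) ==> 0 <= vavg V f" by (simp add: vavg_def sum_nonneg)

lemma vavg_add: "vavg V (%v. f v + g v) = vavg V f + vavg V g" by (simp add: vavg_def sum.distrib add_divide_distrib)

lemma vavg_diff: "vavg V (%v. f v - g v) = vavg V f - vavg V g" by (simp add: vavg_def sum_subtractf diff_divide_distrib)

lemma vavg_cmult: "vavg V (%v. c * f v) = c * vavg V f" by (simp add: vavg_def sum_distrib_left)

lemma vavg_sum: "vavg V (%v. \<Sum>j\<in>J. f j v) = (\<Sum>j\<in>J. vavg V (f j))" unfolding vavg_def by (subst sum.swap) (simp add: sum_divide_distrib)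

lemma vavg_abs_le: "\<bar>vavg V f\<bar> <= vavg V (%v. \<bar>f v\<bar>)" unfolding vavg_def by (simp add: divide_right_mono sum_abs)

lemma vavg_const: "finite V ==> V ~= {} ==> vavg V (%_. c) = c" by (simp add: vavg_def card_eq_0_iff)

lemma vavg_permutes:
 assumes "p permutes V" shows "vavg V (%v. f (p v)) = vavg V f" using sum.permute[OF assms, of f] by (simp add: vavg_def o_def)

text \<open>Names of points and of models live in this compact set; they vanish off the group so that all indices are legal.\<close>
definition cube :: "('g, 'b) monoid_scheme => ('g \<times> 'j => real) set" where
 "cube G = {q. ALL g j. 0 <= q (g, j) & q (g, j) <= 1 & (g ~: carrier G --> q (g, j) = 0)}"

definition lipschitz_data ::
 "('g, 'b) monoid_scheme => 'j set => (('g \<times> 'j => real) => real) => ('g \<times> 'j) set => real => bool" where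
 "lipschitz_data G I F E C \<longleftrightarrow> finite E & E \<subseteq> carrier G \<times> I & 0 <= C &
  (ALL q:cube G. ALL q':cube G. \<bar>F q - F q'\<bar> <= C * (\<Sum>e\<in>E. \<bar>q e - q' e\<bar>))"

text \<open>The tests: functions of a name that depend on finitely many coordinates, with indices in $I$, in a Lipschitz way.\<close>
definition loc_lip ::
 "('g, 'b) monoid_scheme => 'j set => (('g \<times> 'j => real) => real) => bool" where
 "loc_lip G I F \<longleftrightarrow> (EX E C. lipschitz_data G I F E C)"

lemma lipschitz_dataD:
 assumes "lipschitz_data G I F E C"
 shows "finite E" "E \<subseteq> carrier G \<times> I" "0 <= C"
  "!!q q'. q : cube G ==> q' : cube G ==> \<bar>F q - F q'\<bar> <= C * (\<Sum>e\<in>E. \<bar>q e - q' e\<bar>)" using assms unfolding lipschitz_data_def by blast+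

lemma cubeD: "q : cube G ==> 0 <= q e & q e <= 1" by (cases e) (auto simp: cube_def)

lemma zero_in_cube: "(%_. 0) : cube G" by (simp add: cube_def)

lemma ll_compose:
 assumes K: "finite K" and f: "!!i. i : K ==> loc_lip G I (f i)" and C: "0 <= C"
  and F: "!!q q'. q : cube G ==> q' : cube G ==> \<bar>F q - F q'\<bar> <= C * (\<Sum>i\<in>K. \<bar>f i q - f i q'\<bar>)"
 shows "loc_lip G I F" proof -
 from f have "ALL i:K. EX E C. lipschitz_data G I (f i) E C" unfolding loc_lip_def by blast
 then obtain E D where ED: "!!i. i : K ==> lipschitz_data G I (f i) (E i) (D i)" by metis
 note ED' = lipschitz_dataD[OF ED]
 let ?E = "\<Union>(E ` K)"
 have "\<bar>F q - F q'\<bar> <= (C * (\<Sum>i\<in>K. D i)) * (\<Sum>e\<in>?E. \<bar>q e - q' e\<bar>)" if q: "q : cube G" "q' : cube G" for q q' proof -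
  have "\<bar>f i q - f i q'\<bar> <= D i * (\<Sum>e\<in>?E. \<bar>q e - q' e\<bar>)" if "i : K" for i proof -
  have "\<bar>f i q - f i q'\<bar> <= D i * (\<Sum>e\<in>E i. \<bar>q e - q' e\<bar>)" using that q by (rule ED'(4))
  also have "... <= D i * (\<Sum>e\<in>?E. \<bar>q e - q' e\<bar>)" using that K ED'(1) by (intro mult_left_mono sum_mono2 ED'(3)) auto
  finally show ?thesis .
  qed
  then have "(\<Sum>i\<in>K. \<bar>f i q - f i q'\<bar>) <= (\<Sum>i\<in>K. D i * (\<Sum>e\<in>?E. \<bar>q e - q' e\<bar>))" by (rule sum_mono)
  also have "... = (\<Sum>i\<in>K. D i) * (\<Sum>e\<in>?E. \<bar>q e - q' e\<bar>)" by (simp add: sum_distrib_right)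
  finally have "C * (\<Sum>i\<in>K. \<bar>f i q - f i q'\<bar>) <= C * ((\<Sum>i\<in>K. D i) * (\<Sum>e\<in>?E. \<bar>q e - q' e\<bar>))"
  using C by (rule mult_left_mono)
  with F[OF q] show ?thesis by (simp add: mult.assoc)
 qed
 moreover have "finite ?E" "?E \<subseteq> carrier G \<times> I" using K ED'(1,2) by blast+
 moreover have "0 <= C * (\<Sum>i\<in>K. D i)" using ED'(3) C by (intro mult_nonneg_nonneg sum_nonneg)
 ultimately show ?thesis unfolding loc_lip_def lipschitz_data_def by blast
qed

lemma ll_compose1:
 assumes "loc_lip G I f" "0 <= C" and "!!q q'. q : cube G ==> q' : cube G ==> \<bar>F q - F q'\<bar> <= C * \<bar>f q - f q'\<bar>"
 shows "loc_lip G I F" by (rule ll_compose[of "{()}" G I "%_. f" C]) (simp_all add: assms(1,2), rule assms(3))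

lemma ll_compose2:
 assumes f: "loc_lip G I f" and g: "loc_lip G I g" and C: "0 <= C"
  and F: "!!q q'. q : cube G ==> q' : cube G ==> \<bar>F q - F q'\<bar> <= C * (\<bar>f q - f q'\<bar> + \<bar>g q - g q'\<bar>)"
 shows "loc_lip G I F" proof (rule ll_compose[of UNIV G I "%b. if b then f else g" C])
 show "loc_lip G I (if i then f else g)" for i using f g by auto
 show "\<bar>F q - F q'\<bar> <= C * (\<Sum>i\<in>UNIV. \<bar>(if i then f else g) q - (if i then f else g) q'\<bar>)" if "q : cube G" "q' : cube G" for q q'
  using F[OF that] by (simp add: UNIV_bool add.commute)
qed (use C in auto)

lemma ll_const: "loc_lip G I (%_. c)" by (rule ll_compose[of "{}::nat set" _ _ _ 0]) auto

lemma ll_coord: "g : carrier G ==> j : I ==> loc_lip G I (%q. q (g, j))" unfolding loc_lip_def lipschitz_data_def by (intro exI[of _ "{(g, j)}"] exI[of _ 1]) auto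

lemma ll_bounded:
 assumes "loc_lip G I F"
 shows "\<exists>B>0. ALL q:cube G. \<bar>F q\<bar> <= B" proof -
 obtain E C where EC: "finite E" "0 <= C"
  "!!q q'. q : cube G ==> q' : cube G ==> \<bar>F q - F q'\<bar> <= C * (\<Sum>e\<in>E. \<bar>q e - q' e\<bar>)"
  using assms unfolding loc_lip_def lipschitz_data_def by blast
 have "\<bar>F q\<bar> <= \<bar>F (%_. 0)\<bar> + C * card E + 1" if "q : cube G" for q proof -
  have "(\<Sum>e\<in>E. \<bar>q e - 0\<bar>) <= (\<Sum>e\<in>E. 1)" using cubeD[OF that] by (intro sum_mono) auto
  then have "C * (\<Sum>e\<in>E. \<bar>q e - 0\<bar>) <= C * card E" using EC(2) by (intro mult_left_mono) auto
  with EC(3)[OF that zero_in_cube] show ?thesis by auto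
 qed
 moreover have "0 < \<bar>F (%_. 0)\<bar> + C * card E + 1" using EC(2) by (simp add: add_nonneg_pos)
 ultimately show ?thesis by blast
qed

lemma ll_add: "loc_lip G I f ==> loc_lip G I g ==> loc_lip G I (%q. f q + g q)" by (rule ll_compose2[of _ _ f g 1]) auto

lemma ll_diff: "loc_lip G I f ==> loc_lip G I g ==> loc_lip G I (%q. f q - g q)" by (rule ll_compose2[of _ _ f g 1]) auto

lemma ll_abs: "loc_lip G I f ==> loc_lip G I (%q. \<bar>f q\<bar>)" by (rule ll_compose1[of _ _ f 1]) auto

lemma ll_max: "loc_lip G I f ==> loc_lip G I g ==> loc_lip G I (%q. max (f q) (g q))" by (rule ll_compose2[of _ _ f g 1]) (auto simp: max_def)

lemma ll_min: "loc_lip G I f ==> loc_lip G I g ==> loc_lip G I (%q. min (f q) (g q))" by (rule ll_compose2[of _ _ f g 1]) (auto simp: min_def)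

lemma ll_mult:
 assumes f: "loc_lip G I f" and g: "loc_lip G I g"
 shows "loc_lip G I (%q. f q * g q)" proof -
 obtain A B where A: "A > 0" "!!q. q : cube G ==> \<bar>f q\<bar> <= A" and B: "B > 0" "!!q. q : cube G ==> \<bar>g q\<bar> <= B"
  using ll_bounded[OF f] ll_bounded[OF g] by blast
 show ?thesis proof (rule ll_compose2[OF f g, of "A + B"])
  fix q q' assume q: "q : (cube G :: ('a \<times> 'c => real) set)" "q' : (cube G :: ('a \<times> 'c => real) set)"
  have "f q * g q - f q' * g q' = f q * (g q - g q') + (f q - f q') * g q'" by (simp add: algebra_simps)
  then have "\<bar>f q * g q - f q' * g q'\<bar> <= \<bar>f q\<bar> * \<bar>g q - g q'\<bar> + \<bar>f q - f q'\<bar> * \<bar>g q'\<bar>"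
  by (metis abs_mult abs_triangle_ineq)
  also have "... <= A * \<bar>g q - g q'\<bar> + \<bar>f q - f q'\<bar> * B" using A(2)[OF q(1)] B(2)[OF q(2)] by (intro add_mono mult_right_mono mult_left_mono) auto
  also have "... <= (A + B) * (\<bar>f q - f q'\<bar> + \<bar>g q - g q'\<bar>)" using A(1) B(1) by (simp add: algebra_simps)
  finally show "\<bar>f q * g q - f q' * g q'\<bar> <= (A + B) * (\<bar>f q - f q'\<bar> + \<bar>g q - g q'\<bar>)" .
 qed (use A B in auto)
qed

lemma ll_cmult: "loc_lip G I f ==> loc_lip G I (%q. c * f q)" by (intro ll_mult ll_const)

lemma ll_mono: "loc_lip G I f ==> I \<subseteq> I' ==> loc_lip G I' f" unfolding loc_lip_def lipschitz_data_def by (meson Sigma_mono order_refl subset_trans)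

definition shift_name :: "('g, 'b) monoid_scheme => 'g => ('g \<times> 'j => real) => ('g \<times> 'j => real)" where
 "shift_name G g q = (%(h, j). if h : carrier G then q (h \<otimes>\<^bsub>G\<^esub> g, j) else 0)"

lemma shift_name_in_cube: "q : cube G ==> shift_name G g q : cube G" by (auto simp: cube_def shift_name_def)

lemma ll_shift:
 assumes G: "group G" and g: "g : carrier G" and F: "loc_lip G I F"
 shows "loc_lip G I (%q. F (shift_name G g q))" proof -
 interpret group G by fact
 obtain E C where EC: "finite E" "E \<subseteq> carrier G \<times> I" "0 <= C"
  "!!q q'. q : cube G ==> q' : cube G ==> \<bar>F q - F q'\<bar> <= C * (\<Sum>e\<in>E. \<bar>q e - q' e\<bar>)"
  using F unfolding loc_lip_def lipschitz_data_def by blast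
 show ?thesis proof (rule ll_compose[OF EC(1) _ EC(3)])
  show "loc_lip G I (%q. shift_name G g q e)" if "e : E" for e proof (cases e)
  case (Pair h j)
  then have "h : carrier G" "j : I" using that EC(2) by auto
  then show ?thesis using g Pair by (auto simp: shift_name_def intro: ll_coord)
  qed
  show "\<bar>F (shift_name G g q) - F (shift_name G g q')\<bar> <= C * (\<Sum>e\<in>E. \<bar>shift_name G g q e - shift_name G g q' e\<bar>)"
  if "q : cube G" "q' : cube G" for q q' using that by (intro EC(4) shift_name_in_cube)
 qed
qed

lemma ll_measurable:
 assumes F: "loc_lip G I F" and U: "!!m. m : space N ==> U m : cube G" and meas: "!!e. (%m. U m e) : bmeas N"
 shows "(%m. F (U m)) : bmeas N" proof -
 obtain E C where EC: "finite E" "E \<subseteq> carrier G \<times> I" "0 <= C"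
  "!!q q'. q : cube G ==> q' : cube G ==> \<bar>F q - F q'\<bar> <= C * (\<Sum>e\<in>E. \<bar>q e - q' e\<bar>)"
  using F unfolding loc_lip_def lipschitz_data_def by blast
 define c :: "nat => ('a \<times> 'c => int) => 'a \<times> 'c => real" where
  "c n k = (%e. if e : E then real_of_int (k e) / real (Suc n) else 0)" for n k
 define K where "K n = PiE E (%_. {0..int (Suc n)})" for n
 define fl where "fl n m = (\<lambda>e\<in>E. \<lfloor>real (Suc n) * U m e\<rfloor>)" for n m
 have finK: "finite (K n)" for n unfolding K_def using EC(1) by (intro finite_PiE) auto
 have flK: "fl n m : K n" if m: "m : space N" for n m proof -
  have "0 <= \<lfloor>real (Suc n) * U m e\<rfloor> & \<lfloor>real (Suc n) * U m e\<rfloor> <= int (Suc n)" for e proof -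
  have "0 <= U m e" "U m e <= 1" using cubeD[OF U[OF m]] by auto
  then have "0 <= real (Suc n) * U m e" "real (Suc n) * U m e <= real (Suc n) * 1" by (auto intro!: mult_left_mono)
  then have "real (Suc n) * U m e < real (Suc n) + 1" by (intro le_less_trans[OF \<open>real (Suc n) * U m e <= real (Suc n) * 1\<close>]) simp
  then have "\<lfloor>real (Suc n) * U m e\<rfloor> < int (Suc n) + 1" by (subst floor_less_iff) simp
  with \<open>0 <= real (Suc n) * U m e\<close> show ?thesis by (metis zero_le_floor zle_add1_eq_le)
  qed
  then show ?thesis by (auto simp: fl_def K_def)
 qed
 have cube_c: "c n k : cube G" if "k : K n" for n k proof -
  have "0 <= real_of_int (k e) & real_of_int (k e) <= real (Suc n)" if "e : E" for e proof -
  have "k e : {0..int (Suc n)}" using \<open>k : K n\<close> that unfolding K_def by (rule PiE_mem)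
  then have "0 <= k e" "k e <= int (Suc n)" by auto
  then show ?thesis using of_int_le_iff[of "k e" "int (Suc n)", where 'a = real] by simp
  qed
  then show ?thesis using EC(2) unfolding c_def cube_def by (auto simp: divide_le_eq simp del: of_nat_Suc)
 qed
 have step: "(%m. F (c n (fl n m))) : bmeas N" for n proof -
  have "(%m. \<Sum>k\<in>K n. F (c n k) * (\<Prod>e\<in>E. indicator {real_of_int (k e)..<real_of_int (k e) + 1} (real (Suc n) * U m e)))
  : bmeas N" using meas by measurable
  moreover have "(\<Sum>k\<in>K n. F (c n k) * (\<Prod>e\<in>E. indicator {real_of_int (k e)..<real_of_int (k e) + 1} (real (Suc n) * U m e)))
  = F (c n (fl n m))" if m: "m : space N" for m proof -
  have ind: "(\<Prod>e\<in>E. indicator {real_of_int (k e)..<real_of_int (k e) + 1} (real (Suc n) * U m e)) =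
  (if k = fl n m then 1 else 0 :: real)" if k: "k : K n" for k proof (cases "k = fl n m")
  case True
  then show ?thesis by (auto simp: fl_def indicator_def intro!: prod.neutral)
  next
  case False
  then obtain e where e: "k e ~= fl n m e" by (meson ext)
  have "e : E" proof (rule ccontr)
  assume "e ~: E"
  then have "k e = undefined" "fl n m e = undefined" using k by (auto simp: K_def fl_def intro: PiE_arb)
  with e show False by simp
  qed
  with e have "real (Suc n) * U m e ~: {real_of_int (k e)..<real_of_int (k e) + 1}" by (auto simp: fl_def) (metis floor_unique)
  then have "indicator {real_of_int (k e)..<real_of_int (k e) + 1} (real (Suc n) * U m e) = (0::real)" by (rule indicator_simps(2))
  then have "(\<Prod>e\<in>E. indicator {real_of_int (k e)..<real_of_int (k e) + 1} (real (Suc n) * U m e)) = (0::real)"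
  using \<open>e : E\<close> by (intro prod_zero[OF EC(1)] bexI[of _ e])
  with False show ?thesis by simp
  qed
  have "(\<Sum>k\<in>K n. F (c n k) * (\<Prod>e\<in>E. indicator {real_of_int (k e)..<real_of_int (k e) + 1} (real (Suc n) * U m e)))
  = (\<Sum>k\<in>K n. if k = fl n m then F (c n k) else 0)" by (intro sum.cong refl) (simp only: ind, simp)
  also have "... = F (c n (fl n m))" using finK[of n] flK[OF m, of n] by (simp add: sum.delta)
  finally show ?thesis .
  qed
  ultimately show ?thesis by (simp cong: measurable_cong)
 qed
 show ?thesis proof (rule borel_measurable_LIMSEQ_real[OF _ step])
  fix m assume m: "m : space N"
  have bound: "\<bar>F (c n (fl n m)) - F (U m)\<bar> <= C * real (card E) / real (Suc n)" for n proof -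
  have "\<bar>F (c n (fl n m)) - F (U m)\<bar> <= C * (\<Sum>e\<in>E. \<bar>c n (fl n m) e - U m e\<bar>)" using m by (intro EC(4) cube_c flK U)
  also have "... <= C * (\<Sum>e\<in>E. 1 / real (Suc n))" proof (intro mult_left_mono sum_mono)
  fix e assume "e : E"
  let ?x = "real (Suc n) * U m e"
  have "\<bar>real_of_int \<lfloor>?x\<rfloor> - ?x\<bar> <= 1" by linarith
  then have "\<bar>real_of_int \<lfloor>?x\<rfloor> - ?x\<bar> / real (Suc n) <= 1 / real (Suc n)" by (rule divide_right_mono) simp
  moreover have "\<bar>real_of_int \<lfloor>?x\<rfloor> / real (Suc n) - U m e\<bar> = \<bar>real_of_int \<lfloor>?x\<rfloor> - ?x\<bar> / real (Suc n)"
  by (simp add: field_simps abs_divide del: of_nat_Suc)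
  ultimately show "\<bar>c n (fl n m) e - U m e\<bar> <= 1 / real (Suc n)" using \<open>e : E\<close> by (simp add: c_def fl_def)
  qed (use EC in auto)
  finally show ?thesis by simp
  qed
  have "(%n. C * real (card E) / real (Suc n)) ~~> 0"  by (rule LIMSEQ_Suc[OF lim_const_over_n])
  then have "(%n. F (c n (fl n m)) - F (U m)) ~~> 0" by (rule Lim_null_comparison[rotated]) (use bound in \<open>auto intro!: always_eventually\<close>)
  then show "(%n. F (c n (fl n m))) ~~> F (U m)" by (simp add: LIM_zero_iff)
 qed
qed

definition wval :: "('e => real) => 'e list => real" where
 "wval q w = prod_list (map q w)"

lemma wval_simps [simp]:
 "wval q [] = 1" "wval q (e # w) = q e * wval q w"
 "wval q (w @ w') = wval q w * wval q w'" by (simp_all add: wval_def)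

abbreviation (input) word :: "'e list => ('e => real) => real" where
 "word w == %q. wval q w"

abbreviation name_words :: "('g, 'b) monoid_scheme => ('g \<times> 'j) list set" where
 "name_words G \<equiv> lists (carrier G \<times> UNIV)"

lemma ll_word: "w : lists (carrier G \<times> I) ==> loc_lip G I (word w)" by (induction w) (auto intro: ll_const ll_mult ll_coord)

lemma wval_01: "q : cube G ==> 0 <= wval q w & wval q w <= 1" by (induction w) (auto dest: cubeD intro: mult_le_one mult_nonneg_nonneg simp: cubeD)

lemma continuous_on_cube_ll:
 assumes "loc_lip G I F"
 shows "continuous_on (cube G) F" proof -
 obtain E C where EC: "finite E" "0 <= C"
  "!!q q'. q : cube G ==> q' : cube G ==> \<bar>F q - F q'\<bar> <= C * (\<Sum>e\<in>E. \<bar>q e - q' e\<bar>)"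
  using assms unfolding loc_lip_def lipschitz_data_def by blast
 show ?thesis unfolding continuous_on_def proof
  fix q assume q: "q : (cube G :: ('a \<times> 'c => real) set)"
  have "continuous_on UNIV (%q'. C * (\<Sum>e\<in>E. \<bar>q' e - q e\<bar>))" by (intro continuous_intros continuous_on_product_coordinates)
  then have "((%q'. C * (\<Sum>e\<in>E. \<bar>q' e - q e\<bar>)) \<longlongrightarrow> C * (\<Sum>e\<in>E. \<bar>q e - q e\<bar>)) (at q within cube G)"
  by (simp only: continuous_on_def) (meson UNIV_I tendsto_within_subset top_greatest)
  then have lim: "((%q'. C * (\<Sum>e\<in>E. \<bar>q' e - q e\<bar>)) \<longlongrightarrow> 0) (at q within cube G)" by simp
  have "((%q'. F q' - F q) \<longlongrightarrow> 0) (at q within cube G)" by (rule Lim_null_comparison[OF _ lim])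
  (use EC(3)[OF _ q] in \<open>auto simp: eventually_at_filter intro!: always_eventually\<close>)
  then show "(F \<longlongrightarrow> F q) (at q within cube G)" by (simp add: LIM_zero_iff)
 qed
qed

lemma compact_cube: "compact (cube G :: ('g \<times> 'j => real) set)" proof -
 let ?S = "%e::'g \<times> 'j. if fst e : carrier G then {0..1::real} else {0}"
 have "compactin (product_topology (%_. euclidean) UNIV) (PiE UNIV ?S)" by (subst compactin_PiE) auto
 moreover have "PiE UNIV ?S = cube G" proof (rule equalityI; rule subsetI)
  fix q assume q: "q : PiE UNIV ?S"
  have "0 <= q (g, j) & q (g, j) <= 1 & (g ~: carrier G --> q (g, j) = 0)" for g j using PiE_mem[OF q, of "(g, j)"] by (auto split: if_splits)
  then show "q : cube G" unfolding cube_def by blast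
 next
  fix q :: "'g \<times> 'j => real" assume "q : cube G"
  then show "q : PiE UNIV ?S" by (auto simp: cube_def)
 qed
 ultimately show ?thesis by (simp add: euclidean_product_topology)
qed

inductive_set name_polynomials :: "('g, 'b) monoid_scheme => (('g \<times> 'j => real) => real) set" for G where
 np_const: "(%_. c) : name_polynomials G"
| np_coord: "g : carrier G ==> (%q. q (g, j)) : name_polynomials G"
| np_add: "f : name_polynomials G ==> f' : name_polynomials G ==> (%q. f q + f' q) : name_polynomials G"
| np_mult: "f : name_polynomials G ==> f' : name_polynomials G ==> (%q. f q * f' q) : name_polynomials G"

lemma name_polynomial_as_words:
 assumes "f : name_polynomials G"
 shows "EX cs. (\<forall>(c, w)\<in>set cs. w : name_words G) & f = (%q. \<Sum>(c, w)\<leftarrow>cs. c * wval q w)" using assms proof induction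
 case (np_const c)
 show ?case by (rule exI[of _ "[(c, [])]"]) auto
next
 case (np_coord g j)
 then show ?case by (intro exI[of _ "[(1, [(g, j)])]"]) auto
next
 case (np_add f f')
 then obtain cs cs' where "\<forall>(c, w)\<in>set cs. w : name_words G" "f = (%q. \<Sum>(c, w)\<leftarrow>cs. c * wval q w)"
  "\<forall>(c, w)\<in>set cs'. w : name_words G" "f' = (%q. \<Sum>(c, w)\<leftarrow>cs'. c * wval q w)" by blast
 then show ?case by (intro exI[of _ "cs @ cs'"]) auto
next
 case (np_mult f f')
 then obtain cs cs' where cs: "\<forall>(c, w)\<in>set cs. w : name_words G" "f = (%q. \<Sum>(c, w)\<leftarrow>cs. c * wval q w)"
  and cs': "\<forall>(c, w)\<in>set cs'. w : name_words G" "f' = (%q. \<Sum>(c, w)\<leftarrow>cs'. c * wval q w)" by blast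
 define ds where "ds = concat (map (%(c, w). map (%(c', w'). (c * c', w @ w')) cs') cs)"
 have "(\<Sum>(c, w)\<leftarrow>ds. c * wval q w) = f q * f' q" for q proof -
  have inner: "(\<Sum>(c', w')\<leftarrow>map (%(c', w'). (c * c', w @ w')) xs. c' * wval q w') =
  c * wval q w * (\<Sum>(c', w')\<leftarrow>xs. c' * wval q w')" for c w xs by (induction xs) (auto simp: algebra_simps)
  have "(\<Sum>(c, w)\<leftarrow>concat (map (%(c, w). map (%(c', w'). (c * c', w @ w')) cs') xs). c * wval q w) =
  (\<Sum>(c, w)\<leftarrow>xs. c * wval q w) * f' q" for xs proof (induction xs)
  case (Cons a xs)
  obtain c w where a: "a = (c, w)" by (cases a)
  show ?case using Cons inner[of c w cs'] by (simp add: a cs'(2) algebra_simps)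
  qed simp
  then show ?thesis by (simp add: ds_def cs(2))
 qed
 moreover have "\<forall>(c, w)\<in>set ds. w : name_words G" using cs(1) cs'(1) by (fastforce simp: ds_def)
 ultimately show ?case by (intro exI[of _ ds]) auto
qed

text \<open>Words separate the points of the cube and are closed under products, so the theorem of Stone and Weierstrass applies to their span.\<close>
lemma word_approximation:
 fixes F :: "('g \<times> 'j::countable => real) => real" and G :: "('g, 'b) monoid_scheme"
 assumes G: "countable (carrier G)" and K: "compact K" "K \<subseteq> cube G" and F: "continuous_on K F" and e: "e > 0"
 shows "EX cs. (\<forall>(c, w)\<in>set cs. w : name_words G) & (ALL q:K. \<bar>F q - (\<Sum>(c, w)\<leftarrow>cs. c * wval q w)\<bar> < e)" proof -
 let ?W = "carrier G \<times> (UNIV :: 'j set)"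
 have W: "countable ?W" using G by blast
 define \<Phi> :: "(nat => real) => 'g \<times> 'j => real" where
  "\<Phi> x = (%e. if e : ?W then x (to_nat_on ?W e) else 0)" for x
 define \<Psi> :: "('g \<times> 'j => real) => nat => real" where
  "\<Psi> q = (%n. q (from_nat_into ?W n))" for q
 have inv: "\<Phi> (\<Psi> q) = q" if "q : K" for q using that K(2) W by (auto simp: \<Phi>_def \<Psi>_def fun_eq_iff cube_def)
 have contPhi: "continuous_on S \<Phi>" for S proof (rule continuous_on_coordinatewise_then_product)
  show "continuous_on S (%x. \<Phi> x e)" for e by (cases "e : ?W")
  (auto simp only: \<Phi>_def if_True if_False
  intro: continuous_on_const continuous_on_subset[OF continuous_on_product_coordinates])
 qed
 have contPsi: "continuous_on S \<Psi>" for S unfolding \<Psi>_def by (intro continuous_on_coordinatewise_then_product)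
  (auto intro: continuous_on_subset[OF continuous_on_product_coordinates])
 let ?K = "\<Psi> ` K" and ?R = "(%f. f o \<Phi>) ` (name_polynomials G :: (('g \<times> 'j => real) => real) set)"
 have np_cont: "continuous_on S f" if "f : name_polynomials G" for f :: "('g \<times> 'j => real) => real" and S using that
  by induction (auto intro!: continuous_intros intro: continuous_on_subset[OF continuous_on_product_coordinates])
 interpret function_ring_on ?R ?K proof
  show "compact ?K" using K(1) contPsi by (intro compact_continuous_image)
  show "continuous_on ?K f" if "f : ?R" for f using that by (auto intro!: continuous_on_compose contPhi np_cont)
  show "(%x. f x + g x) : ?R" if fg: "f : ?R" "g : ?R" for f g proof -
  obtain f' g' where "f' : name_polynomials G" "g' : name_polynomials G" "f = f' o \<Phi>" "g = g' o \<Phi>" using fg by blast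
  then show ?thesis by (intro image_eqI[of _ _ "%q. f' q + g' q"]) (auto intro: np_add)
  qed
  show "(%x. f x * g x) : ?R" if fg: "f : ?R" "g : ?R" for f g proof -
  obtain f' g' where "f' : name_polynomials G" "g' : name_polynomials G" "f = f' o \<Phi>" "g = g' o \<Phi>" using fg by blast
  then show ?thesis by (intro image_eqI[of _ _ "%q. f' q * g' q"]) (auto intro: np_mult)
  qed
  show "(%_. c) : ?R" for c by (intro image_eqI[of _ _ "%_. c"]) (auto intro: np_const)
  show "EX f:?R. f x ~= f y" if xy: "x : ?K" "y : ?K" "x ~= y" for x y proof -
  obtain p q where pq: "p : K" "q : K" "x = \<Psi> p" "y = \<Psi> q" using xy by blast
  with xy have "p ~= q" by auto
  then obtain g j where gj: "p (g, j) ~= q (g, j)" by (auto simp: fun_eq_iff)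
  have "g : carrier G" proof (rule ccontr)
  assume "g ~: carrier G"
  then have "p (g, j) = 0" "q (g, j) = 0" using pq K(2) by (auto simp: cube_def)
  with gj show False by simp
  qed
  with gj pq show ?thesis by (intro bexI[of _ "(%q. q (g, j)) o \<Phi>"] imageI np_coord) (simp_all add: inv)
  qed
 qed
 have "continuous_on ?K (F o \<Phi>)" proof (rule continuous_on_compose[OF contPhi])
  have "\<Phi> ` ?K = K" using inv by force
  then show "continuous_on (\<Phi> ` ?K) F" using F by simp
 qed
 then obtain f where f: "f : ?R" "ALL x:?K. \<bar>(F o \<Phi>) x - f x\<bar> < e" using Stone_Weierstrass_basic[OF _ e] by blast
 then obtain f' where f': "f' : name_polynomials G" "f = f' o \<Phi>" by blast
 have "\<bar>F q - f' q\<bar> < e" if "q : K" for q using f(2) that f'(2) inv[OF that] by auto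
 with name_polynomial_as_words[OF f'(1)] show ?thesis by metis
qed

section \<open>Codings and good models\<close>

text \<open>The choice of words and tolerance depends on the test only. This uniformity lets one statement serve for the system, for single models and for measures on models.\<close>
lemma words_determine_integrals:
 fixes F :: "('g \<times> 'j::countable => real) => real" and G :: "('g, 'b) monoid_scheme"
 assumes G: "countable (carrier G)" and K: "compact K" "K \<subseteq> cube G" and F: "continuous_on K F" and e: "e > 0"
 shows "EX W d. finite W & W \<subseteq> name_words G & d > 0 &
  (\<forall>(P :: 'p measure) Z (P' :: 'q measure) Z'.
  prob_space P --> prob_space P' -->
  (ALL p:space P. Z p : K) --> (ALL p:space P'. Z' p : K) -->
  (ALL e. (%p. Z p e) : bmeas P) --> (ALL e. (%p. Z' p e) : bmeas P') -->
  (%p. F (Z p)) : bmeas P --> (%p. F (Z' p)) : bmeas P' -->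
  (ALL w:W. \<bar>(LINT p|P. wval (Z p) w) - (LINT p|P'. wval (Z' p) w)\<bar> < d) -->
  \<bar>(LINT p|P. F (Z p)) - (LINT p|P'. F (Z' p))\<bar> < e)" proof -
 from e have "e / 3 > 0" by simp
 from word_approximation[OF G K F this] obtain cs :: "(real \<times> ('g \<times> 'j) list) list" where cs: "\<forall>(c, w)\<in>set cs. w : name_words G"
  and app: "!!q. q : K ==> \<bar>F q - (\<Sum>(c, w)\<leftarrow>cs. c * wval q w)\<bar> < e / 3" by blast
 define Q where "Q q = (\<Sum>(c, w)\<leftarrow>cs. c * wval q w)" for q :: "'g \<times> 'j => real"
 define B where "B = (\<Sum>(c, w)\<leftarrow>cs. \<bar>c\<bar>)"
 have B0: "B >= 0" unfolding B_def by (rule sum_list_nonneg) auto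
 define d where "d = e / (3 * (B + 1))"
 have d: "d > 0" "B * d < e / 3" using e B0 by (auto simp: d_def field_simps)
 show ?thesis proof (intro exI[of _ "snd ` set cs"] exI[of _ d] conjI allI impI)
  show "snd ` set cs \<subseteq> name_words G" proof
  fix w assume "w : snd ` set cs"
  then obtain c where "(c, w) : set cs" by auto
  from bspec[OF cs this] show "w : name_words G" by (simp only: prod.case)
  qed
 next
  fix P :: "'p measure" and Z and P' :: "'q measure" and Z'
  assume P: "prob_space P" and P': "prob_space P'" and Z: "ALL p:space P. Z p : K" and Z': "ALL p:space P'. Z' p : K"
  and mZ: "ALL e. (%p. Z p e) : bmeas P" and mZ': "ALL e. (%p. Z' p e) : bmeas P'" and mF: "(%p. F (Z p)) : bmeas P" and mF': "(%p. F (Z' p)) : bmeas P'"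
  and close: "ALL w:snd ` set cs. \<bar>(LINT p|P. wval (Z p) w) - (LINT p|P'. wval (Z' p) w)\<bar> < d"
  have expand: "integrable R (%p. Q (Y p)) & (LINT p|R. Q (Y p)) = (\<Sum>(c, w)\<leftarrow>cs. c * (LINT p|R. wval (Y p) w))"
  if R: "prob_space R" and Y: "ALL p:space R. Y p : K" and mY: "ALL e. (%p. Y p e) : bmeas R" for R :: "'r measure" and Y proof -
  interpret R: prob_space R by fact
  have int: "integrable R (%p. wval (Y p) w)" for w proof (rule R.integrable_const_bound[of _ 1])
  show "(%p. wval (Y p) w) : bmeas R" using mY[rule_format] by (induction w) (simp_all add: borel_measurable_times)
  have "0 <= wval (Y p) w & wval (Y p) w <= 1" if "p : space R" for p using Y K(2) that by (intro wval_01[of _ G]) blast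
  then show "AE x in R. norm (wval (Y x) w) <= 1" by (auto intro!: AE_I2)
  qed
  have "integrable R (%p. \<Sum>(c, w)\<leftarrow>xs. c * wval (Y p) w) &
  (LINT p|R. (\<Sum>(c, w)\<leftarrow>xs. c * wval (Y p) w)) = (\<Sum>(c, w)\<leftarrow>xs. c * (LINT p|R. wval (Y p) w))" for xs
  by (induction xs) (auto simp: int)
  then show ?thesis by (simp add: Q_def)
  qed
  have approx: "\<bar>(LINT p|R. F (Y p)) - (LINT p|R. Q (Y p))\<bar> <= e / 3"
  if R: "prob_space R" and Y: "ALL p:space R. Y p : K" and mY: "ALL e. (%p. Y p e) : bmeas R" and mF: "(%p. F (Y p)) : bmeas R" for R :: "'r measure" and Y proof -
  interpret R: prob_space R by fact
  have iQ: "integrable R (%p. Q (Y p))" using expand[OF R Y mY] by blast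
  have b: "\<bar>F (Y p) - Q (Y p)\<bar> <= e / 3" if "p : space R" for p using app[of "Y p"] Y that by (auto simp: Q_def intro: less_imp_le)
  have iD: "integrable R (%p. F (Y p) - Q (Y p))" by (rule R.integrable_const_bound[of _ "e / 3"]) (use b mF iQ in \<open>auto intro!: AE_I2\<close>)
  have iF: "integrable R (%p. F (Y p))" using Bochner_Integration.integrable_add[OF iD iQ] by simp
  have "\<bar>\<integral>p. F (Y p) - Q (Y p) \<partial>R\<bar> <= (LINT p|R. \<bar>F (Y p) - Q (Y p)\<bar>)" by (rule integral_abs_bound)
  also have "... <= (LINT p|R. e / 3)" using iD b by (intro integral_mono) auto
  also have "... = e / 3" by (simp add: R.prob_space)
  finally show ?thesis using iF iQ by simp
  qed
  have "\<bar>(\<Sum>(c, w)\<leftarrow>xs. c * (LINT p|P. wval (Z p) w)) - (\<Sum>(c, w)\<leftarrow>xs. c * (LINT p|P'. wval (Z' p) w))\<bar>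
  <= (\<Sum>(c, w)\<leftarrow>xs. \<bar>c\<bar>) * d" if "set xs \<subseteq> set cs" for xs using that proof (induction xs)
  case (Cons a xs)
  obtain c w where a: "a = (c, w)" by (cases a)
  let ?D = "(LINT p|P. wval (Z p) w) - (LINT p|P'. wval (Z' p) w)"
  have "w : snd ` set cs" using Cons.prems a by force
  then have "\<bar>?D\<bar> <= d" using close by (auto intro: less_imp_le)
  then have "\<bar>c * ?D\<bar> <= \<bar>c\<bar> * d" by (simp add: abs_mult mult_left_mono)
  moreover have "\<bar>(\<Sum>(c, w)\<leftarrow>xs. c * (LINT p|P. wval (Z p) w)) - (\<Sum>(c, w)\<leftarrow>xs. c * (LINT p|P'. wval (Z' p) w))\<bar>
  <= (\<Sum>(c, w)\<leftarrow>xs. \<bar>c\<bar>) * d" using Cons by auto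
  ultimately show ?case unfolding a by (simp add: algebra_simps) 
  qed simp
  from this[of cs] have "\<bar>(LINT p|P. Q (Z p)) - (LINT p|P'. Q (Z' p))\<bar> <= B * d" using expand[OF P Z mZ] expand[OF P' Z' mZ'] by (simp add: B_def)
  moreover note approx[OF P Z mZ mF] approx[OF P' Z' mZ' mF'] d(2)
  ultimately show "\<bar>(LINT p|P. F (Z p)) - (LINT p|P'. F (Z' p))\<bar> < e" by linarith
 qed (use d in auto)
qed

text \<open>One formula for the names of points ($s$ is the action and $x$ the coding map) and of vertices of a model ($s$ is the family of permutations and $x$ the model).\<close>
definition name ::
 "('g, 'b) monoid_scheme => ('j => 'a => real) => ('g => 'p => 'p) => ('p => 'a) => 'p => ('g \<times> 'j => real)" where
 "name G u s x p = (%(g, j). if g : carrier G then u j (x (s g p)) else 0)"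

definition features :: "'a set => ('j => 'a => real) => bool" where
 "features A u \<longleftrightarrow> (ALL j. ALL a:A. 0 <= u j a & u j a <= 1)"

lemma name_in_cube:
 assumes "features A u" "!!g. g : carrier G ==> x (s g p) : A"
 shows "name G u s x p : cube G" using assms unfolding name_def cube_def features_def by simp

definition coding :: "'x measure => 'a set => ('j => 'a => real) => ('x => 'a) => bool" where
 "coding N A u \<xi> \<longleftrightarrow> features A u & (ALL m:space N. \<xi> m : A) & (ALL j. (%m. u j (\<xi> m)) : bmeas N)"

locale pmp_action = group G + prob_space N for G :: "('g, 'b) monoid_scheme" (structure) and N :: "'x measure" and T :: "'g => 'x => 'x" +
 assumes countable_group: "countable (carrier G)" and T_measurable: "g : carrier G ==> T g : measurable N N" and T_preserves: "g : carrier G ==> distr N N (T g) = N"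
  and T_one: "x : space N ==> T \<one> x = x" and T_mult: "g : carrier G ==> h : carrier G ==> x : space N ==> T (g \<otimes> h) x = T g (T h x)"
begin

lemma T_space: "g : carrier G ==> x : space N ==> T g x : space N" by (rule measurable_space[OF T_measurable])

lemma integral_T:
 fixes f :: "'x => real"
 assumes "g : carrier G" "f : bmeas N"
 shows "(LINT m|N. f (T g m)) = (LINT m|N. f m)" using integral_distr[OF T_measurable[OF assms(1)] assms(2)] T_preserves[OF assms(1)] by simp

lemma orbit_name_in_cube: "coding N A u \<xi> ==> m : space N ==> name G u T \<xi> m : cube G" by (rule name_in_cube[of A]) (auto simp: coding_def T_space)

lemma orbit_name_measurable: "coding N A u \<xi> ==> (%m. name G u T \<xi> m e) : bmeas N" proof (cases e)
 case (Pair g j)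
 assume "coding N A u \<xi>"
 then have "(%m. u j (\<xi> m)) : bmeas N" by (simp add: coding_def)
 from measurable_compose[OF T_measurable this] show ?thesis by (cases "g : carrier G") (auto simp: Pair name_def)
qed

lemma test_measurable: "coding N A u \<xi> ==> loc_lip G I F ==> (%m. F (name G u T \<xi> m)) : bmeas N"
 by (rule ll_measurable) (auto intro: orbit_name_in_cube orbit_name_measurable)

lemma integrable_bounded:
 fixes f :: "'x => real"
 assumes "f : bmeas N" "!!m. m : space N ==> \<bar>f m\<bar> <= B"
 shows "integrable N f" using assms by (intro integrable_const_bound[of _ B]) (auto intro!: AE_I2)

lemma test_integrable:
 assumes "coding N A u \<xi>" "loc_lip G I F"
 shows "integrable N (%m. F (name G u T \<xi> m))" proof -
 obtain B where B: "ALL q:cube G. \<bar>F q\<bar> <= B" using ll_bounded[OF assms(2)] by blast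
 show ?thesis by (rule integrable_bounded[of _ B]) (use B assms in \<open>auto intro: test_measurable orbit_name_in_cube\<close>)
qed

lemma shift_orbit_name:
 assumes "g : carrier G" "m : space N"
 shows "shift_name G g (name G u T \<xi> m) = name G u T \<xi> (T g m)" using assms by (auto simp: shift_name_def name_def T_mult)

end

definition model_error ::
 "('g, 'b) monoid_scheme => 'x measure => ('g => 'x => 'x) => ('j => 'a => real) => ('x => 'a) =>
  'v set => ('g => 'v => 'v) => (('g \<times> 'j => real) => real) => ('v => 'a) => real" where
 "model_error G N T u \<xi> V s F x =
  \<bar>vavg V (%v. F (name G u s x v)) - (LINT m|N. F (name G u T \<xi> m))\<bar>"

definition good_seq ::
 "('g, 'b) monoid_scheme => 'x measure => ('g => 'x => 'x) => 'a set => ('j => 'a => real) => ('x => 'a) =>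
  (nat => 'v set) => (nat => 'g => 'v => 'v) => (nat => ('v => 'a) set) => bool" where
 "good_seq G N T A u \<xi> V \<sigma> S \<longleftrightarrow>
  (ALL i. ALL x:S i. ALL v:V i. x v : A) &
  (ALL F. loc_lip G UNIV F --> (\<forall>e>0. EV i. ALL x:S i.
  model_error G N T u \<xi> (V i) (\<sigma> i) F x < e))"

definition almost_action ::
 "('g, 'b) monoid_scheme => (nat => 'v set) => (nat => 'g => 'v => 'v) => bool" where
 "almost_action G V \<sigma> \<longleftrightarrow>
  (ALL n. finite (V n) & V n ~= {}) & (ALL n. ALL g:carrier G. \<sigma> n g permutes V n) &
  (ALL g:carrier G. ALL h:carrier G.
  (%n. vavg (V n) (%v. if \<sigma> n g (\<sigma> n h v) = \<sigma> n (g \<otimes>\<^bsub>G\<^esub> h) v then 0 else 1)) ~~> 0)"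

lemma almost_actionD:
 assumes "almost_action G V \<sigma>"
 shows "finite (V n)" "V n ~= {}" "g : carrier G ==> \<sigma> n g permutes V n"
  "g : carrier G ==> v : V n ==> \<sigma> n g v : V n" using assms by (auto simp: almost_action_def dest: permutes_in_image)

lemma proportion_compl:
 assumes "finite V" "V ~= {}"
 shows "vavg V (%v. if P v then 0 else 1) = 1 - proportion V P" proof -
 have "vavg V (%v. if P v then 0 else 1) = vavg V (%v. 1 - (if P v then 1 else 0))" by (rule vavg_cong) simp
 also have "... = 1 - vavg V (%v. if P v then 1 else 0)" by (simp add: vavg_diff vavg_const assms)
 also have "vavg V (%v. if P v then 1 else 0) = proportion V P" unfolding vavg_def proportion_def using assms(1) by (simp add: sum.inter_filter[symmetric])
 finally show ?thesis .
qed

lemma almost_action_sofic: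
 assumes "sofic_approximation G V \<sigma>"
 shows "almost_action G V \<sigma>" proof -
 have V: "finite (V n)" "V n ~= {}" for n using assms by (auto simp: sofic_approximation_def)
 have "(%n. 1 - proportion (V n) (%v. \<sigma> n g (\<sigma> n h v) = \<sigma> n (g \<otimes>\<^bsub>G\<^esub> h) v)) ~~> 1 - 1"
  if "g : carrier G" "h : carrier G" for g h using assms that by (intro tendsto_diff tendsto_const) (auto simp: sofic_approximation_def)
 then show ?thesis using assms V by (simp add: almost_action_def sofic_approximation_def proportion_compl)
qed

lemma almost_action_subseq:
 assumes "almost_action G V \<sigma>" "strict_mono r"
 shows "almost_action G (V o r) (\<sigma> o r)" proof -
 have "(%n. vavg (V (r n)) (%v. if \<sigma> (r n) g (\<sigma> (r n) h v) = \<sigma> (r n) (g \<otimes>\<^bsub>G\<^esub> h) v then 0 else 1)) ~~> 0"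
  if "g : carrier G" "h : carrier G" for g h
  using assms(1) that LIMSEQ_subseq_LIMSEQ[OF _ assms(2), of "%n. vavg (V n) (%v. if \<sigma> n g (\<sigma> n h v) = \<sigma> n (g \<otimes>\<^bsub>G\<^esub> h) v then 0 else 1)" 0]
  unfolding almost_action_def by (simp add: o_def)
 then show ?thesis using assms(1) unfolding almost_action_def by simp
qed

lemma good_seq_subseq:
 assumes "good_seq G N T A u \<xi> V \<sigma> S" "strict_mono r"
 shows "good_seq G N T A u \<xi> (V o r) (\<sigma> o r) (S o r)" unfolding good_seq_def proof (intro conjI allI impI)
 show "ALL x:(S o r) i. ALL v:(V o r) i. x v : A" for i using assms(1) unfolding good_seq_def by simp
 fix F :: "('a \<times> 'e => real) => real" and e :: real assume "loc_lip G UNIV F" "0 < e"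
 with assms(1) have ev: "EV i. ALL x:S i. model_error G N T u \<xi> (V i) (\<sigma> i) F x < e" unfolding good_seq_def by blast
 from eventually_compose_filterlim[OF ev filterlim_subseq[OF assms(2)]]
 show "EV i. ALL x:(S o r) i. model_error G N T u \<xi> ((V o r) i) ((\<sigma> o r) i) F x < e" by simp
qed

lemma vavg_eq_integral: "finite V ==> vavg V f = (LINT v|uniform_count_measure V. f v)" by (simp add: vavg_def integral_uniform_count_measure)

lemma model_name_in_cube:
 assumes "almost_action G V \<sigma>" "features A u" "!!v. v : V i ==> x v : A" "v : V i"
 shows "name G u (\<sigma> i) x v : cube G" using assms by (intro name_in_cube[of A]) (auto dest: almost_actionD(4))

lemma (in pmp_action) good_seq_words:
 fixes u :: "'j::countable => 'a => real" and V :: "nat => 'v set"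
 assumes cod: "coding N A u \<xi>" and act: "almost_action G V \<sigma>" and A: "!!i x v. x : S i ==> v : V i ==> x v : A"
  and words: "!!w e. w : name_words G ==> e > 0 ==>
  EV i. ALL x:S i. model_error G N T u \<xi> (V i) (\<sigma> i) (word w) x < e"
 shows "good_seq G N T A u \<xi> V \<sigma> S" unfolding good_seq_def proof (intro conjI allI impI)
 fix F :: "('g \<times> 'j => real) => real" and e :: real
 assume F: "loc_lip G UNIV F" and e: "e > 0"
 obtain W d where Wd: "finite W" "W \<subseteq> name_words G" "d > 0" and
  det: "!!(P :: 'v measure) Z (P' :: 'x measure) Z'.
  prob_space P ==> prob_space P' ==>
  (ALL p:space P. Z p : cube G) ==> (ALL p:space P'. Z' p : cube G) ==>
  (ALL e. (%p. Z p e) : bmeas P) ==> (ALL e. (%p. Z' p e) : bmeas P') ==>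
  (%p. F (Z p)) : bmeas P ==> (%p. F (Z' p)) : bmeas P' ==>
  (ALL w:W. \<bar>(LINT p|P. wval (Z p) w) - (LINT p|P'. wval (Z' p) w)\<bar> < d) ==>
  \<bar>(LINT p|P. F (Z p)) - (LINT p|P'. F (Z' p))\<bar> < e"
  using words_determine_integrals[OF countable_group compact_cube subset_refl continuous_on_cube_ll[OF F] e, where 'p = 'v and 'q = 'x] by metis
 have "EV i. ALL w:W. ALL x:S i. model_error G N T u \<xi> (V i) (\<sigma> i) (word w) x < d" using Wd words by (intro eventually_ball_finite) blast+
 then show "EV i. ALL x:S i. model_error G N T u \<xi> (V i) (\<sigma> i) F x < e" proof eventually_elim
  case (elim i)
  show ?case proof
  fix x assume x: "x : S i"
  note V = almost_actionD(1,2)[OF act, of i]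
  have feat: "features A u" using cod by (simp add: coding_def)
  show "model_error G N T u \<xi> (V i) (\<sigma> i) F x < e" unfolding model_error_def vavg_eq_integral[OF V(1)] proof (rule det)
  show "prob_space (uniform_count_measure (V i))" by (rule prob_space_uniform_count_measure[OF V(1,2)])
  show "ALL p:space (uniform_count_measure (V i)). name G u (\<sigma> i) x p : cube G"
  using model_name_in_cube[OF act feat] A[OF x] by (simp add: space_uniform_count_measure)
  show "ALL e. (%p. name G u (\<sigma> i) x p e) : bmeas (uniform_count_measure (V i))"
  "(%p. F (name G u (\<sigma> i) x p)) : bmeas (uniform_count_measure (V i))" by (auto simp: uniform_count_measure_def)
  show "ALL w:W. \<bar>(LINT p|uniform_count_measure (V i). wval (name G u (\<sigma> i) x p) w) - (LINT m|N. wval (name G u T \<xi> m) w)\<bar> < d"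
  using elim x unfolding model_error_def vavg_eq_integral[OF V(1)] by blast
  qed (use cod F in \<open>auto intro: prob_space_axioms orbit_name_in_cube orbit_name_measurable test_measurable\<close>)
  qed
 qed
qed (use A in auto)

section \<open>Extending good models to a further coding\<close>

definition generates ::
 "('g, 'b) monoid_scheme => 'x measure => ('g => 'x => 'x) => ('j => 'a => real) => ('x => 'a) => 'j set => bool" where
 "generates G N T u \<xi> I \<longleftrightarrow>
  (ALL f:bmeas N. (ALL m:space N. 0 <= f m & f m <= 1) --> (\<forall>e>0. EX F. loc_lip G I F &
  (ALL q:cube G. 0 <= F q & F q <= 1) & (LINT m|N. \<bar>f m - F (name G u T \<xi> m)\<bar>) < e))"

lemma generatesD:
 assumes "generates G N T u \<xi> I" "f : bmeas N" "!!m. m : space N ==> 0 <= f m"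
  "!!m. m : space N ==> f m <= 1" "e > 0"
 shows "EX F. loc_lip G I F & (ALL q:cube G. 0 <= F q & F q <= 1) &
  (LINT m|N. \<bar>f m - F (name G u T \<xi> m)\<bar>) < e" using assms unfolding generates_def by simp

lemma eventually_sequence_diagonal:
 fixes \<Phi> :: "nat => nat => nat => bool"
 assumes "!!c. EX t0. \<forall>t\<ge>t0. EV i. \<Phi> c t i"
 shows "EX \<tau>. ALL c. EV i. \<Phi> c (\<tau> i) i" proof -
 obtain t0 where t0: "!!c t. t >= t0 c ==> EV i. \<Phi> c t i" using assms by metis
 define P where "P t i \<longleftrightarrow> (\<forall>c<t. t0 c <= t --> \<Phi> c t i)" for t i
 have ev: "EV i. P t i" for t proof -
  have "EV i. ALL c:{..<t}. t0 c <= t --> \<Phi> c t i" by (intro eventually_ball_finite ballI) (auto intro: eventually_mono[OF t0])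
  then show ?thesis by eventually_elim (simp add: P_def)
 qed
 define \<tau> where "\<tau> i = Max {t. t <= i & P t i}" for i
 have fin: "finite {t. t <= i & P t i}" for i by simp
 have P0: "P 0 i" for i by (simp add: P_def)
 have mem: "\<tau> i : {t. t <= i & P t i}" for i unfolding \<tau>_def by (rule Max_in[OF fin]) (use P0 in auto)
 have "EV i. \<Phi> c (\<tau> i) i" for c proof -
  let ?t = "max (Suc c) (t0 c)"
  have "EV i. P ?t i & ?t <= i" by (intro eventually_conj ev eventually_ge_at_top)
  then show ?thesis proof eventually_elim
  case (elim i)
  then have "?t <= \<tau> i" unfolding \<tau>_def by (intro Max_ge fin) auto
  moreover have "P (\<tau> i) i" using mem[of i] by simp
  ultimately show ?case by (simp add: P_def)
  qed
 qed
 then show ?thesis by blast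
qed

definition pair_feat :: "('i => 'a => real) => ('j => 'c => real) => 'i + 'j => 'a \<times> 'c => real" where
 "pair_feat u w k p = (case k of Inl i => u i (fst p) | Inr j => w j (snd p))"

lemma pair_feat_simps [simp]:
 "pair_feat u w (Inl i) p = u i (fst p)" "pair_feat u w (Inr j) p = w j (snd p)" by (simp_all add: pair_feat_def)

lemma features_pair: "features A u ==> features B w ==> features (A \<times> B) (pair_feat u w)" by (auto simp: features_def pair_feat_def split: sum.splits)

lemma coding_pair:
 assumes "coding N A u \<xi>" "coding N B w \<eta>"
 shows "coding N (A \<times> B) (pair_feat u w) (%m. (\<xi> m, \<eta> m))" proof -
 have "(%m. pair_feat u w k (\<xi> m, \<eta> m)) : bmeas N" for k using assms by (cases k) (auto simp: coding_def)
 then show ?thesis using assms by (auto simp: coding_def features_pair)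
qed

lemma wval_diff_le:
 assumes "!!e. e : set w ==> 0 <= f e & f e <= 1" "!!e. e : set w ==> 0 <= g e & g e <= 1"
 shows "\<bar>wval f w - wval g w\<bar> <= (\<Sum>e\<leftarrow>w. \<bar>f e - g e\<bar>)" using assms proof (induction w)
 case (Cons e w)
 have b: "0 <= wval h w & wval h w <= 1" if "!!e. e : set w ==> 0 <= h e & h e <= 1" for h using that by (induction w) (auto intro: mult_le_one)
 have "f e * wval f w - g e * wval g w =
  f e * (wval f w - wval g w) + (f e - g e) * wval g w" by (simp add: algebra_simps)
 then have "\<bar>f e * wval f w - g e * wval g w\<bar> \<le>
  \<bar>f e\<bar> * \<bar>wval f w - wval g w\<bar> + \<bar>f e - g e\<bar> * \<bar>wval g w\<bar>" by (metis abs_mult abs_triangle_ineq)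
 also have "... <= 1 * \<bar>wval f w - wval g w\<bar> + \<bar>f e - g e\<bar> * 1" using Cons.prems b[of g] by (intro add_mono mult_right_mono mult_left_mono) auto
 also have "... <= (\<Sum>e\<leftarrow>e # w. \<bar>f e - g e\<bar>)" using Cons by auto
 finally show ?case by simp
qed simp

lemma abs_diff_INF_le:
 fixes f g :: "'a => real"
 assumes "B ~= {}" "!!b. b : B ==> 0 <= f b" "!!b. b : B ==> 0 <= g b" "!!b. b : B ==> \<bar>f b - g b\<bar> <= c"
 shows "\<bar>(INF b\<in>B. f b) - (INF b\<in>B. g b)\<bar> <= c" proof -
 have *: "(INF b\<in>B. f b) <= (INF b\<in>B. g b) + c" if "!!b. b : B ==> 0 <= f b" "!!b. b : B ==> \<bar>f b - g b\<bar> <= c" for f g :: "'a => real" proof -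
  have "(INF b\<in>B. f b) - c <= (INF b\<in>B. g b)" proof (rule cINF_greatest[OF assms(1)])
  fix b assume b: "b : B"
  have "(INF b\<in>B. f b) <= f b" using that(1) b by (intro cINF_lower bdd_belowI2[of _ 0]) auto
  with that(2)[OF b] show "(INF b\<in>B. f b) - c <= g b" by linarith
  qed
  then show ?thesis by simp
 qed
 from *[of f g] *[of g f] assms show ?thesis by (fastforce simp: abs_le_iff abs_minus_commute)
qed

lemma vavg_permuted_name:
 assumes act: "almost_action G V \<sigma>" and g: "g : carrier G"
 shows "vavg (V i) (%v. f (\<sigma> i g v)) = vavg (V i) f" using almost_actionD(3)[OF act g] by (rule vavg_permutes)

text \<open>A test reads finitely many group elements, and for most vertices the permutations multiply correctly on all of them.\<close>
lemma shifted_test_error: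
 assumes G: "group G" and act: "almost_action G V \<sigma>" and feat: "features A u" and F: "loc_lip G I F" and g: "g : carrier G" and e: "e > 0"
 shows "EV i. ALL x. (ALL v:V i. x v : A) -->
  vavg (V i) (%v. \<bar>F (name G u (\<sigma> i) x (\<sigma> i g v)) - F (shift_name G g (name G u (\<sigma> i) x v))\<bar>) < e" proof -
 interpret group G by fact
 from F obtain E C where "lipschitz_data G I F E C" unfolding loc_lip_def by blast
 note EC = lipschitz_dataD[OF this]
 define bad where "bad i h v = (if \<sigma> i h (\<sigma> i g v) = \<sigma> i (h \<otimes>\<^bsub>G\<^esub> g) v then 0 else 1 :: real)" for i h v
 have "(%i. C * (\<Sum>e\<in>E. vavg (V i) (bad i (fst e)))) ~~> C * (\<Sum>e\<in>E. 0)" proof (intro tendsto_intros)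
  fix e assume "e : E"
  then have "fst e : carrier G" using EC(2) by auto
  with act g show "(%i. vavg (V i) (bad i (fst e))) ~~> 0" unfolding almost_action_def bad_def by blast
 qed
 then have "EV i. C * (\<Sum>e\<in>E. vavg (V i) (bad i (fst e))) < e" using e by (intro order_tendstoD(2)) auto
 then show ?thesis proof (eventually_elim, intro allI impI)
  fix i and x :: "'c => 'd" assume small: "C * (\<Sum>e\<in>E. vavg (V i) (bad i (fst e))) < e" and x: "ALL v:V i. x v : A"
  have cub: "name G u (\<sigma> i) x v : cube G" if "v : V i" for v using model_name_in_cube[OF act feat] x that by blast
  have "vavg (V i) (%v. \<bar>F (name G u (\<sigma> i) x (\<sigma> i g v)) - F (shift_name G g (name G u (\<sigma> i) x v))\<bar>)
  <= vavg (V i) (%v. C * (\<Sum>e\<in>E. bad i (fst e) v))" proof (rule vavg_mono)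
  fix v assume v: "v : V i"
  have gv: "\<sigma> i g v : V i" using almost_actionD(4)[OF act g v] .
  have "\<bar>F (name G u (\<sigma> i) x (\<sigma> i g v)) - F (shift_name G g (name G u (\<sigma> i) x v))\<bar> \<le>
  C * (\<Sum>e\<in>E. \<bar>name G u (\<sigma> i) x (\<sigma> i g v) e - shift_name G g (name G u (\<sigma> i) x v) e\<bar>)"
  by (intro EC(4) cub gv shift_name_in_cube v)
  also have "... <= C * (\<Sum>e\<in>E. bad i (fst e) v)" proof (intro mult_left_mono sum_mono EC(3))
  fix e assume e: "e : E"
  obtain h j where hj: "e = (h, j)" by (cases e)
  have h: "h : carrier G" using EC(2) e hj by auto
  have "0 <= u j a & u j a <= 1" if "a : A" for a using feat that by (simp add: features_def)
  moreover have "x (\<sigma> i h (\<sigma> i g v)) : A" "x (\<sigma> i (h \<otimes>\<^bsub>G\<^esub> g) v) : A" using x almost_actionD(4)[OF act] h g v gv by auto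
  ultimately have "\<bar>u j (x (\<sigma> i h (\<sigma> i g v))) - u j (x (\<sigma> i (h \<otimes>\<^bsub>G\<^esub> g) v))\<bar> <= 1" by (smt (verit))
  then show "\<bar>name G u (\<sigma> i) x (\<sigma> i g v) e - shift_name G g (name G u (\<sigma> i) x v) e\<bar> <= bad i (fst e) v"
  using h g by (auto simp: hj name_def shift_name_def bad_def)
  qed
  finally show "\<bar>F (name G u (\<sigma> i) x (\<sigma> i g v)) - F (shift_name G g (name G u (\<sigma> i) x v))\<bar> <= C * (\<Sum>e\<in>E. bad i (fst e) v)" .
  qed
  also have "... = C * (\<Sum>e\<in>E. vavg (V i) (bad i (fst e)))" by (simp add: vavg_cmult vavg_sum)
  finally show "vavg (V i) (%v. \<bar>F (name G u (\<sigma> i) x (\<sigma> i g v)) - F (shift_name G g (name G u (\<sigma> i) x v))\<bar>) < e" using small by linarith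
 qed
qed

lemma identity_error:
 assumes G: "group G" and act: "almost_action G V \<sigma>" and e: "e > 0"
 shows "EV i. vavg (V i) (%v. if \<sigma> i \<one>\<^bsub>G\<^esub> v = v then 0 else 1) < (e::real)" proof -
 interpret group G by fact
 have eq: "(\<sigma> i \<one>\<^bsub>G\<^esub> (\<sigma> i \<one>\<^bsub>G\<^esub> v) = \<sigma> i (\<one>\<^bsub>G\<^esub> \<otimes>\<^bsub>G\<^esub> \<one>\<^bsub>G\<^esub>) v) \<longleftrightarrow> \<sigma> i \<one>\<^bsub>G\<^esub> v = v" for i v
  by (simp add: inj_eq[OF permutes_inj[OF almost_actionD(3)[OF act one_closed]]])
 have "(%n. vavg (V n) (%v. if \<sigma> n \<one>\<^bsub>G\<^esub> (\<sigma> n \<one>\<^bsub>G\<^esub> v) = \<sigma> n (\<one>\<^bsub>G\<^esub> \<otimes>\<^bsub>G\<^esub> \<one>\<^bsub>G\<^esub>) v then 0 else 1)) ~~> 0"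
  using act one_closed unfolding almost_action_def by blast
 then have "(%n. vavg (V n) (%v. if \<sigma> n \<one>\<^bsub>G\<^esub> v = v then 0 else (1::real))) ~~> 0" unfolding eq .
 then show ?thesis using e by (rule order_tendstoD(2))
qed

definition fdist :: "('j => 'c => real) => 'j set => 'v set => ('v => 'c) => ('v => 'c) => real" where
 "fdist u J V x y = vavg V (%v. \<Sum>j\<in>J. \<bar>u j (x v) - u j (y v)\<bar>)"

lemma vavg_sum_list: "vavg V (%v. \<Sum>e\<leftarrow>w. f e v) = (\<Sum>e\<leftarrow>w. vavg V (f e))" by (induction w) (simp_all add: vavg_add, simp add: vavg_def)

lemma sum_list_le_const:
 "(!!e. e : set w ==> f e <= (c::real)) ==> (\<Sum>e\<leftarrow>w. f e) <= real (length w) * c" by (induction w) (auto simp: algebra_simps intro: add_mono)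

context pmp_action begin

lemma good_seq_less:
 assumes "good_seq G N T A u \<xi> V \<sigma> S" "loc_lip G UNIV F" "e > 0" "(LINT m|N. F (name G u T \<xi> m)) <= c"
 shows "EV i. ALL x:S i. vavg (V i) (%v. F (name G u (\<sigma> i) x v)) < c + e" proof -
 have "EV i. ALL x:S i. model_error G N T u \<xi> (V i) (\<sigma> i) F x < e" using assms unfolding good_seq_def by blast
 then show ?thesis proof eventually_elim
  case (elim i)
  show ?case proof
  fix x assume "x : S i"
  with elim have "model_error G N T u \<xi> (V i) (\<sigma> i) F x < e" by blast
  with assms(4) show "vavg (V i) (%v. F (name G u (\<sigma> i) x v)) < c + e" unfolding model_error_def by linarith
  qed
 qed
qed

text \<open>Approximate the new features in $L^1$ by tests on the names of the generating coding. Read off along a good model, these tests yield approximate new features at each vertex, which are rounded to a nearly nearest letter of the new alphabet. The accuracy is driven to zero along the sequence by a diagonal choice.\<close>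
theorem extend_good_models:
 fixes u :: "'i::countable => 'a => real" and w :: "'j::countable => 'c => real" and V :: "nat => 'v set"
 assumes cA: "coding N A u \<xi>" and gen: "generates G N T u \<xi> UNIV" and cB: "coding N B w \<eta>"
  and act: "almost_action G V \<sigma>" and good: "good_seq G N T A u \<xi> V \<sigma> S"
 shows "EX f. good_seq G N T (A \<times> B) (pair_feat u w) (%m. (\<xi> m, \<eta> m)) V \<sigma>
  (%i. (%x v. (x v, f i x v)) ` S i)" proof -
 have featA: "features A u" and featB: "features B w" using cA cB by (auto simp: coding_def)
 have SA: "x v : A" if "x : S i" "v : V i" for i x v using good that unfolding good_seq_def by blast
 have Bne: "B ~= {}" using cB not_empty unfolding coding_def by blast
 have w01: "0 <= w j b & w j b <= 1" if "b : B" for j b using featB that unfolding features_def by blast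
 have meas_w: "(%m. w j (\<eta> m)) : bmeas N" for j using cB by (simp add: coding_def)
 have \<eta>B: "\<eta> m : B" if "m : space N" for m using cB that by (simp add: coding_def)
 define App where "App t j F \<longleftrightarrow> loc_lip G UNIV F & (ALL q:cube G. 0 <= F q & F q <= 1) &
  (LINT m|N. \<bar>w j (\<eta> m) - F (name G u T \<xi> m)\<bar>) < 1 / (real (Suc t) * real (Suc t))" for t j F
 have "EX F. App t j F" for t j unfolding App_def by (rule generatesD[OF gen meas_w]) (simp_all add: w01 \<eta>B)
 then obtain p where p: "!!t j. App t j (p t j)" by metis
 have ll_p: "!!t j. loc_lip G UNIV (p t j)" and p01: "!!t j q. q : cube G ==> 0 <= p t j q & p t j q <= 1"
  and p_close: "!!t j. (LINT m|N. \<bar>w j (\<eta> m) - p t j (name G u T \<xi> m)\<bar>) < 1 / (real (Suc t) * real (Suc t))" using p unfolding App_def by blast+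
 define J where "J t = {j::'j. to_nat j < t}" for t
 have finJ: "finite (J t)" for t unfolding J_def by (rule finite_imageD[of to_nat]) (auto intro: finite_subset[of _ "{..<t}"] inj_onI)
 have cardJ: "card (J t) <= t" for t using card_inj_on_le[of to_nat "J t" "{..<t}"] by (auto simp: J_def inj_on_def)
 define \<kappa> where "\<kappa> t q = (INF b\<in>B. \<Sum>j\<in>J t. \<bar>w j b - p t j q\<bar>)" for t q
 have \<kappa>_le: "\<kappa> t q <= (\<Sum>j\<in>J t. \<bar>w j b - p t j q\<bar>)" if "b : B" for t q b
  unfolding \<kappa>_def using that by (intro cINF_lower bdd_belowI2[of _ 0]) (auto intro: sum_nonneg)
 have ll_\<kappa>: "loc_lip G UNIV (\<kappa> t)" for t proof (rule ll_compose[OF finJ ll_p, of 1])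
  fix q q' :: "'g \<times> 'i => real"
  have "\<bar>\<kappa> t q - \<kappa> t q'\<bar> <= (\<Sum>j\<in>J t. \<bar>p t j q - p t j q'\<bar>)" unfolding \<kappa>_def proof (rule abs_diff_INF_le[OF Bne])
  fix b
  have "\<bar>(\<Sum>j\<in>J t. \<bar>w j b - p t j q\<bar>) - (\<Sum>j\<in>J t. \<bar>w j b - p t j q'\<bar>)\<bar>
  <= (\<Sum>j\<in>J t. \<bar>\<bar>w j b - p t j q\<bar> - \<bar>w j b - p t j q'\<bar>\<bar>)" by (simp only: sum_subtractf[symmetric]) (rule sum_abs)
  also have "... <= (\<Sum>j\<in>J t. \<bar>p t j q - p t j q'\<bar>)" by (intro sum_mono) linarith
  finally show "\<bar>(\<Sum>j\<in>J t. \<bar>w j b - p t j q\<bar>) - (\<Sum>j\<in>J t. \<bar>w j b - p t j q'\<bar>)\<bar>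
  <= (\<Sum>j\<in>J t. \<bar>p t j q - p t j q'\<bar>)" .
  qed (auto intro: sum_nonneg)
  then show "\<bar>\<kappa> t q - \<kappa> t q'\<bar> <= 1 * (\<Sum>j\<in>J t. \<bar>p t j q - p t j q'\<bar>)" by simp
 qed simp
 have int_wp: "integrable N (%m. \<bar>w j (\<eta> m) - p t j (name G u T \<xi> m)\<bar>)" for t j
  using test_integrable[OF cA ll_p] integrable_bounded[OF meas_w, where B = 1] w01 \<eta>B
  by (intro integrable_abs Bochner_Integration.integrable_diff) (auto simp: abs_le_iff intro: order_trans[of _ 0])
 have int_\<kappa>: "(LINT m|N. \<kappa> t (name G u T \<xi> m)) <= 1 / real (Suc t)" for t proof -
  have "(LINT m|N. \<kappa> t (name G u T \<xi> m)) <= (LINT m|N. (\<Sum>j\<in>J t. \<bar>w j (\<eta> m) - p t j (name G u T \<xi> m)\<bar>))"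
  by (intro integral_mono test_integrable[OF cA ll_\<kappa>] Bochner_Integration.integrable_sum int_wp \<kappa>_le \<eta>B)
  also have "... = (\<Sum>j\<in>J t. \<integral>m. \<bar>w j (\<eta> m) - p t j (name G u T \<xi> m)\<bar> \<partial>N)"
  by (intro Bochner_Integration.integral_sum int_wp)
  also have "... <= (\<Sum>j\<in>J t. 1 / (real (Suc t) * real (Suc t)))" by (intro sum_mono less_imp_le p_close)
  also have "... <= real (Suc t) * (1 / (real (Suc t) * real (Suc t)))" unfolding sum_constant using cardJ[of t] by (intro mult_right_mono) auto
  also have "... = 1 / real (Suc t)" by (simp del: of_nat_Suc)
  finally show ?thesis .
 qed
 define y where "y t i x v = (SOME b. b : B &
  (\<Sum>j\<in>J t. \<bar>w j b - p t j (name G u (\<sigma> i) x v)\<bar>) < \<kappa> t (name G u (\<sigma> i) x v) + 1 / real (Suc t))" for t i x v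
 have y: "y t i x v : B &
  (\<Sum>j\<in>J t. \<bar>w j (y t i x v) - p t j (name G u (\<sigma> i) x v)\<bar>) < \<kappa> t (name G u (\<sigma> i) x v) + 1 / real (Suc t)" for t i x v proof -
  have "\<kappa> t (name G u (\<sigma> i) x v) < \<kappa> t (name G u (\<sigma> i) x v) + 1 / real (Suc t)" by simp
  from cInf_lessD[OF _ this[unfolded \<kappa>_def]] Bne
  have "EX b. b : B & (\<Sum>j\<in>J t. \<bar>w j b - p t j (name G u (\<sigma> i) x v)\<bar>) < \<kappa> t (name G u (\<sigma> i) x v) + 1 / real (Suc t)"
  unfolding \<kappa>_def by auto
  then show ?thesis unfolding y_def by (rule someI_ex)
 qed
 let ?W = "pair_feat u w" and ?\<zeta> = "%m. (\<xi> m, \<eta> m)"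
 let ?z = "%t i x v. (x v, y t i x v)"
 note cAB = coding_pair[OF cA cB]
 have featAB: "features (A \<times> B) ?W" using cAB by (simp add: coding_def)
 define L where "L t e q = (case snd e of Inl k => q (fst e, k) | Inr j => p t j (shift_name G (fst e) q))" for t and e :: "'g \<times> ('i + 'j)" and q
 have ll_L: "loc_lip G UNIV (L t e)" if "fst e : carrier G" for t e
  using that by (cases "snd e") (auto simp: L_def[abs_def] intro!: ll_coord ll_shift[OF group_axioms _ ll_p])
 have L01: "0 <= L t e q & L t e q <= 1" if "q : cube G" for t e q using cubeD[OF that] p01[OF shift_name_in_cube[OF that]] by (auto simp: L_def split: sum.split)
 have cubeA: "name G u (\<sigma> i) x v : cube G" if "x : S i" "v : V i" for i x v using model_name_in_cube[OF act featA] SA[OF that(1)] that(2) by blast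
 have cubeAB: "name G ?W (\<sigma> i) (?z t i x) v : cube G" if "x : S i" "v : V i" for t i x v
  using model_name_in_cube[OF act featAB, of i "?z t i x"] SA[OF that(1)] that(2) y by blast
 have letter_model: "EV i. ALL x:S i.
  vavg (V i) (%v. \<bar>name G ?W (\<sigma> i) (?z t i x) v e - L t e (name G u (\<sigma> i) x v)\<bar>) <= 4 / real (Suc t)"
  if e: "fst e : carrier G" "!!j. snd e = Inr j ==> to_nat j < t" for t e proof (cases "snd e")
  case (Inl k)
  then have "name G ?W (\<sigma> i) (?z t i x) v e = L t e (name G u (\<sigma> i) x v)" for i x v using e(1) by (cases e) (simp add: name_def L_def)
  then show ?thesis by (simp add: vavg_def)
 next
  case (Inr j)
  obtain g where eg: "e = (g, Inr j)" using Inr by (cases e) auto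
  have g: "g : carrier G" and jt: "j : J t" using e Inr eg by (auto simp: J_def)
  have pos: "1 / real (Suc t) > 0" by simp
  have "EV i. ALL x:S i. vavg (V i) (%v. \<kappa> t (name G u (\<sigma> i) x v)) < 1 / real (Suc t) + 1 / real (Suc t)"
  by (rule good_seq_less[OF good ll_\<kappa> pos int_\<kappa>])
  moreover note shifted_test_error[OF group_axioms act featA ll_p[of t j] g pos]
  ultimately show ?thesis proof eventually_elim
  case (elim i)
  show ?case proof
  fix x assume x: "x : S i"
  note V = almost_actionD(1,2)[OF act, of i]
  let ?n = "name G u (\<sigma> i) x"
  have "vavg (V i) (%v. \<bar>w j (y t i x v) - p t j (?n v)\<bar>) <= vavg (V i) (%v. \<kappa> t (?n v) + 1 / real (Suc t))" proof (rule vavg_mono)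
  fix v
  have "\<bar>w j (y t i x v) - p t j (?n v)\<bar> <= (\<Sum>j\<in>J t. \<bar>w j (y t i x v) - p t j (?n v)\<bar>)" by (rule member_le_sum[OF jt _ finJ]) simp
  with y[of t i x v] show "\<bar>w j (y t i x v) - p t j (?n v)\<bar> <= \<kappa> t (?n v) + 1 / real (Suc t)" by linarith
  qed
  also have "... <= 3 * (1 / real (Suc t))" using elim(1) x by (auto simp: vavg_add vavg_const[OF V] simp del: of_nat_Suc)
  finally have 1: "vavg (V i) (%v. \<bar>w j (y t i x v) - p t j (?n v)\<bar>) <= 3 * (1 / real (Suc t))" .
  have 2: "vavg (V i) (%v. \<bar>p t j (?n (\<sigma> i g v)) - p t j (shift_name G g (?n v))\<bar>) < 1 / real (Suc t)" using elim(2) SA[OF x] by blast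
  have "vavg (V i) (%v. \<bar>name G ?W (\<sigma> i) (?z t i x) v e - L t e (?n v)\<bar>) \<le>
  vavg (V i) (%v. \<bar>w j (y t i x (\<sigma> i g v)) - p t j (?n (\<sigma> i g v))\<bar> + \<bar>p t j (?n (\<sigma> i g v)) - p t j (shift_name G g (?n v))\<bar>)"
  using g by (intro vavg_mono) (auto simp: eg name_def L_def)
  also have "... = vavg (V i) (%v. \<bar>w j (y t i x v) - p t j (?n v)\<bar>) +
  vavg (V i) (%v. \<bar>p t j (?n (\<sigma> i g v)) - p t j (shift_name G g (?n v))\<bar>)"
  using vavg_permuted_name[OF act g, of i "%v. \<bar>w j (y t i x v) - p t j (?n v)\<bar>"] by (simp add: vavg_add)
  also have "... <= 4 / real (Suc t)" using 1 2 by (simp del: of_nat_Suc)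
  finally show "vavg (V i) (%v. \<bar>name G ?W (\<sigma> i) (?z t i x) v e - L t e (?n v)\<bar>) <= 4 / real (Suc t)" .
  qed
  qed
 qed
 have letter_system: "integrable N (%m. \<bar>name G ?W T ?\<zeta> m e - L t e (name G u T \<xi> m)\<bar>) &
  (LINT m|N. \<bar>name G ?W T ?\<zeta> m e - L t e (name G u T \<xi> m)\<bar>) <= 1 / real (Suc t)" if e: "fst e : carrier G" for t e proof
  have "integrable N (%m. name G ?W T ?\<zeta> m e)" using orbit_name_measurable[OF cAB] cubeD[OF orbit_name_in_cube[OF cAB]]
  by (intro integrable_bounded[of _ 1]) (auto simp: abs_le_iff intro: order_trans[of _ 0])
  then show "integrable N (%m. \<bar>name G ?W T ?\<zeta> m e - L t e (name G u T \<xi> m)\<bar>)"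
  using test_integrable[OF cA ll_L[OF e]] by (intro integrable_abs Bochner_Integration.integrable_diff)
  show "(LINT m|N. \<bar>name G ?W T ?\<zeta> m e - L t e (name G u T \<xi> m)\<bar>) <= 1 / real (Suc t)" proof (cases "snd e")
  case (Inl k)
  then have "name G ?W T ?\<zeta> m e = L t e (name G u T \<xi> m)" for m using e by (cases e) (simp add: name_def L_def)
  then show ?thesis by simp
  next
  case (Inr j)
  obtain g where eg: "e = (g, Inr j)" using Inr by (cases e) auto
  have g: "g : carrier G" using e eg by simp
  have "(LINT m|N. \<bar>name G ?W T ?\<zeta> m e - L t e (name G u T \<xi> m)\<bar>) =
  (LINT m|N. \<bar>w j (\<eta> (T g m)) - p t j (name G u T \<xi> (T g m))\<bar>)"
  using g by (intro Bochner_Integration.integral_cong refl) (simp add: eg L_def shift_orbit_name, simp add: name_def)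
  also have "... = (LINT m|N. \<bar>w j (\<eta> m) - p t j (name G u T \<xi> m)\<bar>)" by (rule integral_T[OF g]) (use int_wp in blast)
  also have "... <= 1 / (real (Suc t) * real (Suc t))" by (rule less_imp_le[OF p_close])
  also have "... <= 1 / real (Suc t)" by (rule divide_left_mono) auto
  finally show ?thesis .
  qed
 qed
 have word_stage: "EX t0. \<forall>t\<ge>t0. EV i. ALL x:S i.
  model_error G N T ?W ?\<zeta> (V i) (\<sigma> i) (%q. wval q \<omega>) (?z t i x) <= (5 * real (length \<omega>) + 1) / real (Suc t)"
  if \<omega>: "\<omega> : name_words G" for \<omega> proof (intro exI allI impI)
  fix t assume t: "(\<Sum>e\<leftarrow>\<omega>. case snd e of Inl _ => 0 | Inr j => Suc (to_nat j)) <= t"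
  have let_t: "to_nat j < t" if "e : set \<omega>" "snd e = Inr j" for e j proof -
  have "(case snd e of Inl _ => 0 | Inr j => Suc (to_nat j)) <= (\<Sum>e\<leftarrow>\<omega>. case snd e of Inl _ => 0 | Inr j => Suc (to_nat j))"
  using that(1) by (intro member_le_sum_list) auto
  with t that(2) show ?thesis by simp
  qed
  have let_g: "fst e : carrier G" if "e : set \<omega>" for e using \<omega> that by auto
  define Q where "Q q = wval (%e. L t e q) \<omega>" for q
  have ll_Q: "loc_lip G UNIV Q" proof -
  have "loc_lip G UNIV (%q. wval (%e. L t e q) ws)" if "set ws \<subseteq> set \<omega>" for ws
  using that let_g by (induction ws) (auto intro!: ll_const ll_mult ll_L)
  then show ?thesis unfolding Q_def by blast
  qed
  have "EV i. ALL e:set \<omega>. ALL x:S i.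
  vavg (V i) (%v. \<bar>name G ?W (\<sigma> i) (?z t i x) v e - L t e (name G u (\<sigma> i) x v)\<bar>) <= 4 / real (Suc t)"
  using let_t let_g by (intro eventually_ball_finite ballI letter_model) auto
  moreover have "EV i. ALL x:S i. model_error G N T u \<xi> (V i) (\<sigma> i) Q x < 1 / real (Suc t)" proof -
  have "1 / real (Suc t) > 0" by simp
  then show ?thesis using good ll_Q unfolding good_seq_def by blast
  qed
  ultimately show "EV i. ALL x:S i.
  model_error G N T ?W ?\<zeta> (V i) (\<sigma> i) (%q. wval q \<omega>) (?z t i x) <= (5 * real (length \<omega>) + 1) / real (Suc t)" proof eventually_elim
  case (elim i)
  show ?case proof
  fix x assume x: "x : S i"
  let ?nz = "name G ?W (\<sigma> i) (?z t i x)" and ?n = "name G u (\<sigma> i) x"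
  have "\<bar>vavg (V i) (%v. wval (?nz v) \<omega>) - vavg (V i) (%v. Q (?n v))\<bar>
  <= vavg (V i) (%v. \<bar>wval (?nz v) \<omega> - Q (?n v)\<bar>)" unfolding vavg_diff[symmetric] by (rule vavg_abs_le)
  also have "... <= vavg (V i) (%v. \<Sum>e\<leftarrow>\<omega>. \<bar>?nz v e - L t e (?n v)\<bar>)"
  unfolding Q_def using cubeD[OF cubeAB[OF x]] L01[OF cubeA[OF x]] by (intro vavg_mono wval_diff_le) auto
  also have "... <= real (length \<omega>) * (4 / real (Suc t))" unfolding vavg_sum_list using elim(1) x by (intro sum_list_le_const) blast
  finally have 1: "\<bar>vavg (V i) (%v. wval (?nz v) \<omega>) - vavg (V i) (%v. Q (?n v))\<bar> <= real (length \<omega>) * (4 / real (Suc t))" .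
  have 2: "\<bar>vavg (V i) (%v. Q (?n v)) - (LINT m|N. Q (name G u T \<xi> m))\<bar> <= 1 / real (Suc t)"
  using elim(2) x unfolding model_error_def by (auto intro: less_imp_le)
  have iW: "integrable N (%m. wval (name G ?W T ?\<zeta> m) \<omega>)" using \<omega> by (intro test_integrable[OF cAB ll_word[of _ _ UNIV]]) auto
  have iQ: "integrable N (%m. Q (name G u T \<xi> m))" by (rule test_integrable[OF cA ll_Q])
  have int_list: "integrable N (%m. \<Sum>e\<leftarrow>ws. \<bar>name G ?W T ?\<zeta> m e - L t e (name G u T \<xi> m)\<bar>) &
  (LINT m|N. (\<Sum>e\<leftarrow>ws. \<bar>name G ?W T ?\<zeta> m e - L t e (name G u T \<xi> m)\<bar>)) <= real (length ws) * (1 / real (Suc t))"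
  if "set ws \<subseteq> set \<omega>" for ws using that proof (induction ws)
  case (Cons e ws)
  have "real (length (e # ws)) * (1 / real (Suc t)) = 1 / real (Suc t) + real (length ws) * (1 / real (Suc t))" by (simp add: add_divide_distrib)
  with Cons letter_system[OF let_g[of e], of t] show ?case by auto
  qed simp
  have "\<bar>(LINT m|N. Q (name G u T \<xi> m)) - (LINT m|N. wval (name G ?W T ?\<zeta> m) \<omega>)\<bar>
  <= (LINT m|N. \<bar>Q (name G u T \<xi> m) - wval (name G ?W T ?\<zeta> m) \<omega>\<bar>)"
  using iQ iW by (simp add: Bochner_Integration.integral_diff[symmetric] integral_abs_bound del: Bochner_Integration.integral_diff)
  also have "... <= (LINT m|N. (\<Sum>e\<leftarrow>\<omega>. \<bar>name G ?W T ?\<zeta> m e - L t e (name G u T \<xi> m)\<bar>))"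
  proof (intro integral_mono integrable_abs Bochner_Integration.integrable_diff iQ iW)
  fix m assume m: "m : space N"
  show "\<bar>Q (name G u T \<xi> m) - wval (name G ?W T ?\<zeta> m) \<omega>\<bar> <= (\<Sum>e\<leftarrow>\<omega>. \<bar>name G ?W T ?\<zeta> m e - L t e (name G u T \<xi> m)\<bar>)"
  unfolding Q_def abs_minus_commute[of "wval (%e. L t e (name G u T \<xi> m)) \<omega>"]
  using cubeD[OF orbit_name_in_cube[OF cAB m]] L01[OF orbit_name_in_cube[OF cA m]] by (intro wval_diff_le) auto
  qed (use int_list[of \<omega>] in blast)
  also have "... <= real (length \<omega>) * (1 / real (Suc t))" using int_list[of \<omega>] by blast
  finally have 3: "\<bar>(LINT m|N. Q (name G u T \<xi> m)) - (LINT m|N. wval (name G ?W T ?\<zeta> m) \<omega>)\<bar> <= real (length \<omega>) * (1 / real (Suc t))" .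
  have "(5 * a + 1) / D = a * (4 / D) + 1 / D + a * (1 / D)" for a D :: real by (simp add: add_divide_distrib)
  from this[of "real (length \<omega>)" "real (Suc t)"]
  have "(5 * real (length \<omega>) + 1) / real (Suc t) = real (length \<omega>) * (4 / real (Suc t)) + 1 / real (Suc t) + real (length \<omega>) * (1 / real (Suc t))" .
  with 1 2 3 show "model_error G N T ?W ?\<zeta> (V i) (\<sigma> i) (%q. wval q \<omega>) (?z t i x) <= (5 * real (length \<omega>) + 1) / real (Suc t)"
  unfolding model_error_def by linarith
  qed
  qed
 qed
 let ?Words = "name_words G :: ('g \<times> ('i + 'j)) list set"
 have cW: "countable ?Words" using countable_group by (intro countable_lists countable_SIGMA) auto
 define \<Phi> where "\<Phi> c t i \<longleftrightarrow> (ALL x:S i. model_error G N T ?W ?\<zeta> (V i) (\<sigma> i)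
  (%q. wval q (from_nat_into ?Words (fst (prod_decode c)))) (?z t i x) < 1 / real (Suc (snd (prod_decode c))))" for c t i
 have "EX t0. \<forall>t\<ge>t0. EV i. \<Phi> c t i" for c proof -
  obtain s e where se: "prod_decode c = (s, e)" by (cases "prod_decode c")
  define \<omega> where "\<omega> = from_nat_into ?Words s"
  have "\<omega> : ?Words" unfolding \<omega>_def by (rule from_nat_into) (auto intro: exI[of _ "[]"])
  from word_stage[OF this] obtain t0 where t0: "!!t. t >= t0 ==> EV i. ALL x:S i.
  model_error G N T ?W ?\<zeta> (V i) (\<sigma> i) (%q. wval q \<omega>) (?z t i x) <= (5 * real (length \<omega>) + 1) / real (Suc t)" by blast
  have "(%t. (5 * real (length \<omega>) + 1) / real (Suc t)) ~~> 0" by (rule LIMSEQ_Suc[OF lim_const_over_n])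
  then have "EV t. (5 * real (length \<omega>) + 1) / real (Suc t) < 1 / real (Suc e)" by (rule order_tendstoD(2)) simp
  then obtain t1 where t1: "!!t. t >= t1 ==> (5 * real (length \<omega>) + 1) / real (Suc t) < 1 / real (Suc e)" unfolding eventually_sequentially by blast
  have "EV i. \<Phi> c t i" if "t >= max t0 t1" for t using t0[of t] that t1[of t] unfolding \<Phi>_def se \<omega>_def[symmetric] fst_conv snd_conv
  by (auto elim!: eventually_mono intro: le_less_trans)
  then show ?thesis by blast
 qed
 from eventually_sequence_diagonal[of \<Phi>, OF this] obtain \<tau> where \<tau>: "!!c. EV i. \<Phi> c (\<tau> i) i" by blast
 have "good_seq G N T (A \<times> B) ?W ?\<zeta> V \<sigma> (%i. (%x v. (x v, y (\<tau> i) i x v)) ` S i)" proof (rule good_seq_words[OF cAB act])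
  fix \<omega> :: "('g \<times> ('i + 'j)) list" and e :: real
  assume \<omega>: "\<omega> : name_words G" and e: "e > 0"
  obtain s where s: "\<omega> = from_nat_into ?Words s" using from_nat_into_surj[OF cW \<omega>] by metis
  obtain k where k: "1 / real (Suc k) < e" using e by (metis nat_approx_posE)
  from \<tau>[of "prod_encode (s, k)"]
  show "EV i. ALL z:(%x v. (x v, y (\<tau> i) i x v)) ` S i. model_error G N T ?W ?\<zeta> (V i) (\<sigma> i) (%q. wval q \<omega>) z < e" proof eventually_elim
  case (elim i)
  then show ?case unfolding \<Phi>_def prod_encode_inverse fst_conv snd_conv s[symmetric] using k by (auto intro: less_trans)
  qed
 qed (use SA y in auto)
 then show ?thesis by (intro exI[of _ "%i x v. y (\<tau> i) i x v"])
qed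

end

section \<open>Recovering features from a generating family\<close>

lemma vavg_le_const:
 assumes "finite V" "V ~= {}" "!!v. v : V ==> f v <= c"
 shows "vavg V f <= c" using vavg_mono[of V f "%_. c"] assms by (simp add: vavg_const)

lemma fdist_nonneg: "0 <= fdist u J V x y" unfolding fdist_def by (intro vavg_nonneg sum_nonneg) auto

lemma single_feature_le:
 assumes "finite J" "j : J"
 shows "vavg V (%v. \<bar>u j (x v) - u j (y v)\<bar>) <= fdist u J V x y" unfolding fdist_def using assms by (intro vavg_mono member_le_sum) auto

context pmp_action begin

text \<open>Each feature in $J$ is $L^1$-close to a test in the features from $I$. Good models inherit this closeness, and the test is Lipschitz in the features from $I$.\<close>
theorem recover_features:
 fixes u :: "'i => 'a => real" and V :: "nat => 'v set"
 assumes cA: "coding N A u \<xi>" and gen: "generates G N T u \<xi> I" and act: "almost_action G V \<sigma>" and good: "good_seq G N T A u \<xi> V \<sigma> S"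
  and J: "finite J" and e: "e > 0"
 shows "EX J' C. finite J' & J' \<subseteq> I & 0 <= C & (EV i. ALL x:S i. ALL y:S i.
  fdist u J (V i) x y <= e + C * fdist u J' (V i) x y)" proof -
 have feat: "features A u" using cA by (simp add: coding_def)
 have SA: "x v : A" if "x : S i" "v : V i" for i x v using good that unfolding good_seq_def by blast
 define d where "d = e / (6 * (real (card J) + 1))"
 have d: "d > 0" "real (card J) * (6 * d) <= e" using e by (auto simp: d_def field_simps)
 have meas_u: "(%m. u j (\<xi> m)) : bmeas N" for j using cA by (simp add: coding_def)
 have u01: "0 <= u j (\<xi> m) & u j (\<xi> m) <= 1" if "m : space N" for j m using cA that unfolding coding_def features_def by blast
 define App where "App j F \<longleftrightarrow> loc_lip G I F & (ALL q:cube G. 0 <= F q & F q <= 1) &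
  (LINT m|N. \<bar>u j (\<xi> m) - F (name G u T \<xi> m)\<bar>) < d" for j F
 have "EX F. App j F" for j unfolding App_def by (rule generatesD[OF gen meas_u]) (simp_all add: u01 d)
 then obtain F where F: "!!j. App j (F j)" by metis
 then have "EX E C. lipschitz_data G I (F j) E C" for j unfolding App_def loc_lip_def by blast
 then obtain E D where "!!j. lipschitz_data G I (F j) (E j) (D j)" by metis
 note ED = lipschitz_dataD[OF this]
 define J' where "J' = (\<Union>j\<in>J. snd ` E j)"
 have J': "finite J'" "J' \<subseteq> I" unfolding J'_def using J ED(1,2) by fastforce+
 define C where "C = (\<Sum>j\<in>J. D j * real (card (E j)))"
 have C0: "0 <= C" unfolding C_def using ED(3) by (intro sum_nonneg mult_nonneg_nonneg) auto
 have llD: "loc_lip G UNIV (%q. \<bar>q (\<one>, j) - F j q\<bar>)" for j using F[of j] unfolding App_def by (intro ll_abs ll_diff ll_coord) (auto intro: ll_mono)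
 have intD: "(LINT m|N. \<bar>name G u T \<xi> m (\<one>, j) - F j (name G u T \<xi> m)\<bar>) <= d" for j proof -
  have "(LINT m|N. \<bar>name G u T \<xi> m (\<one>, j) - F j (name G u T \<xi> m)\<bar>) = (LINT m|N. \<bar>u j (\<xi> m) - F j (name G u T \<xi> m)\<bar>)"
  by (intro Bochner_Integration.integral_cong refl) (simp add: name_def T_one)
  also have "... <= d" using F[of j] unfolding App_def by simp
  finally show ?thesis .
 qed
 have "EV i. ALL j:J. ALL x:S i.
  vavg (V i) (%v. \<bar>name G u (\<sigma> i) x v (\<one>, j) - F j (name G u (\<sigma> i) x v)\<bar>) < d + d"
  using J by (intro eventually_ball_finite ballI good_seq_less[OF good llD d(1) intD]) auto
 moreover note identity_error[OF group_axioms act d(1)]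
 ultimately have "EV i. ALL x:S i. ALL y:S i.
  fdist u J (V i) x y <= e + C * fdist u J' (V i) x y" proof eventually_elim
  case (elim i)
  show ?case proof (intro ballI)
  fix x y assume xy: "x : S i" "y : S i"
  have cub: "name G u (\<sigma> i) z v : cube G" if "z : S i" "v : V i" for z v using model_name_in_cube[OF act feat] SA[OF that(1)] that(2) by blast
  have own: "vavg (V i) (%v. \<bar>u j (z v) - F j (name G u (\<sigma> i) z v)\<bar>) <= 3 * d" if z: "z : S i" and j: "j : J" for z j proof -
  have "vavg (V i) (%v. \<bar>u j (z v) - F j (name G u (\<sigma> i) z v)\<bar>) \<le>
  vavg (V i) (%v. \<bar>name G u (\<sigma> i) z v (\<one>, j) - F j (name G u (\<sigma> i) z v)\<bar> + (if \<sigma> i \<one> v = v then 0 else 1))"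
  proof (rule vavg_mono)
  fix v assume v: "v : V i"
  have "z v : A" "z (\<sigma> i \<one> v) : A" using SA[OF z] v almost_actionD(4)[OF act one_closed v] by auto
  then have "0 <= u j (z v)" "u j (z v) <= 1" "0 <= u j (z (\<sigma> i \<one> v))" "u j (z (\<sigma> i \<one> v)) <= 1"
  using feat unfolding features_def by blast+
  then show "\<bar>u j (z v) - F j (name G u (\<sigma> i) z v)\<bar> \<le>
  \<bar>name G u (\<sigma> i) z v (\<one>, j) - F j (name G u (\<sigma> i) z v)\<bar> + (if \<sigma> i \<one> v = v then 0 else 1)" by (auto simp: name_def)
  qed
  also have "... <= 3 * d" using elim z j by (auto simp: vavg_add dest!: bspec)
  finally show ?thesis .
  qed
  have coord: "vavg (V i) (%v. \<bar>name G u (\<sigma> i) x v k - name G u (\<sigma> i) y v k\<bar>) <= fdist u J' (V i) x y" if "k : E j" "j : J" for k j proof -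
  obtain g a where k: "k = (g, a)" by (cases k)
  have g: "g : carrier G" using ED(2)[of j] that(1) k by auto
  have "a : J'" unfolding J'_def using that k by force
  have "vavg (V i) (%v. \<bar>name G u (\<sigma> i) x v k - name G u (\<sigma> i) y v k\<bar>) =
  vavg (V i) (%v. \<bar>u a (x (\<sigma> i g v)) - u a (y (\<sigma> i g v))\<bar>)" using g by (simp add: k name_def)
  also have "... = vavg (V i) (%v. \<bar>u a (x v) - u a (y v)\<bar>)" by (rule vavg_permuted_name[OF act g, of i "%v. \<bar>u a (x v) - u a (y v)\<bar>"])
  also have "... <= fdist u J' (V i) x y" by (rule single_feature_le[OF J'(1) \<open>a : J'\<close>])
  finally show ?thesis .
  qed
  have feature: "vavg (V i) (%v. \<bar>u j (x v) - u j (y v)\<bar>) <= 6 * d + D j * real (card (E j)) * fdist u J' (V i) x y" if j: "j : J" for j proof -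
  have "vavg (V i) (%v. \<bar>u j (x v) - u j (y v)\<bar>) \<le>
  vavg (V i) (%v. (\<bar>u j (x v) - F j (name G u (\<sigma> i) x v)\<bar> + \<bar>u j (y v) - F j (name G u (\<sigma> i) y v)\<bar>) +
  D j * (\<Sum>k\<in>E j. \<bar>name G u (\<sigma> i) x v k - name G u (\<sigma> i) y v k\<bar>))" proof (rule vavg_mono)
  fix v assume v: "v : V i"
  show "\<bar>u j (x v) - u j (y v)\<bar> <= (\<bar>u j (x v) - F j (name G u (\<sigma> i) x v)\<bar> + \<bar>u j (y v) - F j (name G u (\<sigma> i) y v)\<bar>) +
  D j * (\<Sum>k\<in>E j. \<bar>name G u (\<sigma> i) x v k - name G u (\<sigma> i) y v k\<bar>)"
  using ED(4)[OF cub[OF xy(1) v] cub[OF xy(2) v], of j] by linarith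
  qed
  also have "... = vavg (V i) (%v. \<bar>u j (x v) - F j (name G u (\<sigma> i) x v)\<bar>) + vavg (V i) (%v. \<bar>u j (y v) - F j (name G u (\<sigma> i) y v)\<bar>) +
  D j * (\<Sum>k\<in>E j. vavg (V i) (%v. \<bar>name G u (\<sigma> i) x v k - name G u (\<sigma> i) y v k\<bar>))" by (simp only: vavg_add vavg_cmult vavg_sum)
  also have "... <= 3 * d + 3 * d + D j * (\<Sum>k\<in>E j. fdist u J' (V i) x y)" using j xy ED(3)[of j] by (intro add_mono own mult_left_mono sum_mono coord) auto
  finally show ?thesis by (simp add: mult.assoc)
  qed
  have "fdist u J (V i) x y = (\<Sum>j\<in>J. vavg (V i) (%v. \<bar>u j (x v) - u j (y v)\<bar>))" by (simp add: fdist_def vavg_sum)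
  also have "... <= (\<Sum>j\<in>J. 6 * d + D j * real (card (E j)) * fdist u J' (V i) x y)" by (intro sum_mono feature)
  also have "... = real (card J) * (6 * d) + C * fdist u J' (V i) x y" by (simp add: sum.distrib C_def sum_distrib_right)
  also have "... <= e + C * fdist u J' (V i) x y" using d(2) by simp
  finally show "fdist u J (V i) x y <= e + C * fdist u J' (V i) x y" .
  qed
 qed
 with J' C0 show ?thesis by blast
qed

text \<open>The class of functions that tests approximate in $L^1$. Its closure properties turn a generating family of sets into a generating family of features.\<close>
definition approximable :: "('j => 'a => real) => ('x => 'a) => 'j set => ('x => real) => bool" where
 "approximable u \<xi> I f \<longleftrightarrow> f : bmeas N & (ALL m:space N. 0 <= f m & f m <= 1) &
  (\<forall>e>0. EX F. loc_lip G I F & (ALL q:cube G. 0 <= F q & F q <= 1) &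
  (LINT m|N. \<bar>f m - F (name G u T \<xi> m)\<bar>) < e)"

lemma approximable_limit:
 assumes f: "f : bmeas N" "!!m. m : space N ==> 0 <= f m & f m <= 1" and close: "!!e. e > 0 ==> EX h. approximable u \<xi> I h & (LINT m|N. \<bar>f m - h m\<bar>) < e"
  and cod: "coding N A u \<xi>"
 shows "approximable u \<xi> I f" unfolding approximable_def proof (intro conjI allI impI)
 fix e :: real assume "e > 0"
 then have e2: "e / 2 > 0" by simp
 obtain h where h: "approximable u \<xi> I h" "(LINT m|N. \<bar>f m - h m\<bar>) < e / 2" using close[OF e2] by blast
 then obtain F where F: "loc_lip G I F" "ALL q:cube G. 0 <= F q & F q <= 1"
  "(LINT m|N. \<bar>h m - F (name G u T \<xi> m)\<bar>) < e / 2" using e2 unfolding approximable_def by blast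
 have if': "integrable N f" using f by (intro integrable_bounded[of _ 1]) auto
 have ih: "integrable N h" using h(1) unfolding approximable_def by (intro integrable_bounded[of _ 1]) auto
 note iF = test_integrable[OF cod F(1)]
 have "(LINT m|N. \<bar>f m - F (name G u T \<xi> m)\<bar>) <= (LINT m|N. \<bar>f m - h m\<bar> + \<bar>h m - F (name G u T \<xi> m)\<bar>)"
  using if' ih iF by (intro integral_mono) auto
 also have "... = (LINT m|N. \<bar>f m - h m\<bar>) + (LINT m|N. \<bar>h m - F (name G u T \<xi> m)\<bar>)"
  using if' ih iF by (intro Bochner_Integration.integral_add) auto
 also have "... < e" using h(2) F(3) by simp
 finally show "EX F. loc_lip G I F & (ALL q:cube G. 0 <= F q & F q <= 1) & (LINT m|N. \<bar>f m - F (name G u T \<xi> m)\<bar>) < e" using F by blast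
qed (use f in auto)

lemma approximable_compose2:
 assumes cod: "coding N A u \<xi>" and f: "approximable u \<xi> I f" and h: "approximable u \<xi> I h"
  and H: "!!a b a' b'. \<bar>H a b - H a' b'\<bar> <= \<bar>a - a'\<bar> + \<bar>b - b'\<bar>"
  and H01: "!!a b. 0 <= a ==> a <= 1 ==> 0 <= b ==> b <= 1 ==> 0 <= H a b & H a b <= 1" and k: "k : bmeas N" "!!m. m : space N ==> k m = H (f m) (h m)"
 shows "approximable u \<xi> I k" unfolding approximable_def proof (intro conjI allI impI)
 fix e :: real assume "e > 0"
 then have e2: "e / 2 > 0" by simp
 obtain F where F: "loc_lip G I F" "ALL q:cube G. 0 <= F q & F q <= 1"
  "(LINT m|N. \<bar>f m - F (name G u T \<xi> m)\<bar>) < e / 2" using f e2 unfolding approximable_def by blast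
 obtain K where K: "loc_lip G I K" "ALL q:cube G. 0 <= K q & K q <= 1"
  "(LINT m|N. \<bar>h m - K (name G u T \<xi> m)\<bar>) < e / 2" using h e2 unfolding approximable_def by blast
 have ll: "loc_lip G I (%q. H (F q) (K q))" by (rule ll_compose2[OF F(1) K(1), of 1]) (use H in auto)
 have if': "integrable N f" using f unfolding approximable_def by (intro integrable_bounded[of _ 1]) auto
 have ih: "integrable N h" using h unfolding approximable_def by (intro integrable_bounded[of _ 1]) auto
 have ik: "integrable N k" using k f h H01 unfolding approximable_def by (intro integrable_bounded[of _ 1]) auto
 note iF = test_integrable[OF cod F(1)] and iK = test_integrable[OF cod K(1)]
 have "(LINT m|N. \<bar>k m - H (F (name G u T \<xi> m)) (K (name G u T \<xi> m))\<bar>)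
  <= (LINT m|N. \<bar>f m - F (name G u T \<xi> m)\<bar> + \<bar>h m - K (name G u T \<xi> m)\<bar>)"
  using if' ih iF iK ik test_integrable[OF cod ll] H k(2) by (intro integral_mono) auto
 also have "... = (LINT m|N. \<bar>f m - F (name G u T \<xi> m)\<bar>) + (LINT m|N. \<bar>h m - K (name G u T \<xi> m)\<bar>)"
  using if' ih iF iK by (intro Bochner_Integration.integral_add) auto
 also have "... < e" using F(3) K(3) by simp
 finally show "EX F. loc_lip G I F & (ALL q:cube G. 0 <= F q & F q <= 1) & (LINT m|N. \<bar>k m - F (name G u T \<xi> m)\<bar>) < e"
  using F K ll H01 by (intro exI[of _ "%q. H (F q) (K q)"]) auto
qed (use k f h H01 in \<open>auto simp: approximable_def\<close>)

lemma approximable_test: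
 assumes "coding N A u \<xi>" "loc_lip G I F" "!!q. q : cube G ==> 0 <= F q & F q <= 1"
 shows "approximable u \<xi> I (%m. F (name G u T \<xi> m))" using assms test_measurable[OF assms(1,2)] orbit_name_in_cube[OF assms(1)]
 unfolding approximable_def by (auto intro!: exI[of _ F])

lemma approximable_pointwise_limit:
 assumes cod: "coding N A u \<xi>" and f: "f : bmeas N" and h: "!!n. approximable u \<xi> I (h n)" and lim: "!!m. m : space N ==> (%n. h n m) ~~> f m"
 shows "approximable u \<xi> I f" proof -
 have h01: "0 <= h n m & h n m <= 1" if "m : space N" for n m using h that unfolding approximable_def by blast
 have f01: "0 <= f m & f m <= 1" if "m : space N" for m using h01[OF that] lim[OF that] by (auto intro: LIMSEQ_le_const LIMSEQ_le_const2)
 have hm: "h n : bmeas N" for n using h unfolding approximable_def by blast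
 show ?thesis proof (rule approximable_limit[OF f f01 _ cod])
  fix e :: real assume e: "e > 0"
  have "(%n. \<integral>m. \<bar>f m - h n m\<bar> \<partial>N) ~~> (LINT m|N. 0)" proof (rule integral_dominated_convergence[of _ _ _ "%_. 1"])
  show "AE m in N. (%n. \<bar>f m - h n m\<bar>) ~~> 0" proof (rule AE_I2)
  fix m assume "m : space N"
  from tendsto_diff[OF tendsto_const lim[OF this], of "f m"]
  show "(%n. \<bar>f m - h n m\<bar>) ~~> 0" by (intro tendsto_rabs_zero) simp
  qed
  show "AE m in N. norm \<bar>f m - h n m\<bar> <= 1" for n proof (rule AE_I2)
  fix m assume "m : space N"
  with f01[OF this] h01[OF this, of n] show "norm \<bar>f m - h n m\<bar> <= 1" by auto
  qed
  qed (use f hm in auto)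
  then have "\<forall>\<^sub>F n in sequentially. (LINT m|N. \<bar>f m - h n m\<bar>) < e" using e by (intro order_tendstoD(2)) auto
  then obtain n where "(LINT m|N. \<bar>f m - h n m\<bar>) < e" by (auto simp: eventually_sequentially)
  with h show "EX h. approximable u \<xi> I h & (LINT m|N. \<bar>f m - h m\<bar>) < e" by blast
 qed
qed

lemma approximable_halfspace:
 assumes cod: "coding N A u \<xi>" and g: "g : carrier G" and j: "j : I" and D: "D = {m : space N. u j (\<xi> (T g m)) < r}"
 shows "D : sets N" "approximable u \<xi> I (indicator D)" proof -
 have nm: "u j (\<xi> (T g m)) = name G u T \<xi> m (g, j)" for m using g by (simp add: name_def)
 have Dm: "D : sets N" unfolding D nm using orbit_name_measurable[OF cod, of "(g, j)"] by measurable
 define F where "F n q = min 1 (max 0 (real n * (r - q (g, j))))" for n :: nat and q :: "'g \<times> 'c => real"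
 have F_app: "approximable u \<xi> I (%m. F n (name G u T \<xi> m))" for n proof (rule approximable_test[OF cod])
  show "loc_lip G I (F n)" unfolding F_def by (intro ll_min ll_max ll_const ll_cmult ll_diff ll_coord g j)
 qed (auto simp: F_def)
 have "approximable u \<xi> I (indicator D)" proof (rule approximable_pointwise_limit[OF cod _ F_app])
  fix m assume m: "m : space N"
  show "(%n. F n (name G u T \<xi> m)) ~~> indicator D m" proof (cases "name G u T \<xi> m (g, j) < r")
  case True
  then have s: "r - name G u T \<xi> m (g, j) > 0" by simp
  have "\<forall>\<^sub>F n in sequentially. F n (name G u T \<xi> m) = 1" proof -
  define z where "z = r - name G u T \<xi> m (g, j)"
  obtain n0 :: nat where n0: "1 < real n0 * z" using reals_Archimedean3[OF s] unfolding z_def by blast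
  have "1 <= real n * z" if "n >= n0" for n proof -
  have "real n0 * z <= real n * z" using that s unfolding z_def by (intro mult_right_mono) simp_all
  with n0 show ?thesis by linarith
  qed
  then have "1 <= real n * (r - name G u T \<xi> m (g, j))" if "n >= n0" for n using that unfolding z_def by blast
  then show ?thesis unfolding F_def eventually_sequentially by (intro exI[of _ n0]) (simp add: max.coboundedI2 min_absorb1)
  qed
  moreover have "indicator D m = (1::real)" using True m by (simp add: D nm)
  ultimately show ?thesis by (simp add: tendsto_eventually)
  next
  case False
  then have "F n (name G u T \<xi> m) = 0" for n by (simp add: F_def mult_nonneg_nonpos max_absorb1)
  moreover have "indicator D m = (0::real)" using False by (simp add: D nm)
  ultimately show ?thesis by simp
  qed
 qed (use Dm in simp)
 with Dm show "D : sets N" "approximable u \<xi> I (indicator D)" by blast+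
qed

lemma approximable_sigma_sets:
 assumes cod: "coding N A u \<xi>" and basic: "!!B. B : \<B> ==> B : sets N & approximable u \<xi> I (indicator B)" and D: "D : sigma_sets (space N) \<B>"
 shows "D : sets N & approximable u \<xi> I (indicator D)" using D proof induction
 case (Basic D)
 then show ?case by (rule basic)
next
 case Empty
 have "approximable u \<xi> I (%m. 0)" by (rule approximable_test[OF cod ll_const]) auto
 then show ?case by (simp add: indicator_def)
next
 case (Compl D)
 have IH: "approximable u \<xi> I (indicator D)" and Dm: "D : sets N" using Compl by blast+
 have "approximable u \<xi> I (indicator (space N - D))" by (rule approximable_compose2[OF cod IH IH, where H = "%a b. 1 - a"])
  (use Dm in \<open>auto simp: indicator_def\<close>)
 with Compl show ?case by auto
next
 case (Union D)
 have fin: "approximable u \<xi> I (indicator (\<Union>i<n. D i))" for n proof (induction n)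
  case 0
  have "approximable u \<xi> I (%m. 0)" by (rule approximable_test[OF cod ll_const]) auto
  then show ?case by (simp add: indicator_def)
 next
  case (Suc n)
  have IH: "approximable u \<xi> I (indicator (D n))" and Dm: "D i : sets N" for i using Union by blast+
  show ?case by (rule approximable_compose2[OF cod Suc IH, where H = max]) (use Dm in \<open>auto simp: indicator_def lessThan_Suc max_def\<close>)
 qed
 have "approximable u \<xi> I (indicator (\<Union>i. D i))" proof (rule approximable_pointwise_limit[OF cod _ fin])
  show "(%n. indicator (\<Union>i<n. D i) m) ~~> (indicator (\<Union>i. D i) m :: real)" for m using LIMSEQ_indicator_UN[of D m] by simp
 qed (use Union in \<open>auto intro!: borel_measurable_indicator sets.countable_UN\<close>)
 with Union show ?case by auto
qed

lemma generates_if_indicators: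
 assumes cod: "coding N A u \<xi>" and ind: "!!D. D : sets N ==> approximable u \<xi> I (indicator D)"
 shows "generates G N T u \<xi> I" proof -
 have "approximable u \<xi> I f" if f: "f : bmeas N" "!!m. m : space N ==> 0 <= f m & f m <= 1" for f proof (rule approximable_pointwise_limit[OF cod f(1)])
  define s where "s K n m = (\<Sum>l=1..K. indicator {m\<in>space N. f m >= real l / real (Suc n)} m) / real (Suc n)" for K n m
  have "approximable u \<xi> I (s K n)" if "K <= Suc n" for K n using that proof (induction K)
  case 0
  have "approximable u \<xi> I (%m. 0)" by (rule approximable_test[OF cod ll_const]) auto
  then show ?case by (simp add: s_def[abs_def])
  next
  case (Suc K)
  let ?D = "{m\<in>space N. f m >= real (Suc K) / real (Suc n)}"
  have Dm: "?D : sets N" using f(1) by measurable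
  have bound: "0 <= s K n m & s K n m <= real K / real (Suc n)" for K m proof -
  have "(\<Sum>l=1..K. indicator {m\<in>space N. f m >= real l / real (Suc n)} m) <= (\<Sum>l=1..K. 1::real)" by (intro sum_mono) (auto simp: indicator_def)
  then show ?thesis unfolding s_def by (auto intro!: divide_right_mono sum_nonneg divide_nonneg_nonneg)
  qed
  have eq: "s (Suc K) n m = s K n m + indicator ?D m / real (Suc n)" for m by (simp add: s_def add_divide_distrib del: of_nat_Suc)
  have sm: "s (Suc K) n : bmeas N" unfolding eq[abs_def] using Suc Dm by (auto simp: approximable_def)
  show ?case proof (rule approximable_compose2[OF cod, where f = "s K n" and h = "indicator ?D" and H = "%a b. min 1 (max 0 (a + b / real (Suc n)))"])
  fix a b a' b' :: real
  have "\<bar>b / real (Suc n) - b' / real (Suc n)\<bar> = \<bar>b - b'\<bar> / real (Suc n)" by (simp add: diff_divide_distrib[symmetric] del: of_nat_Suc)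
  also have "... <= \<bar>b - b'\<bar> / 1" by (intro divide_left_mono) auto
  finally show "\<bar>min 1 (max 0 (a + b / real (Suc n))) - min 1 (max 0 (a' + b' / real (Suc n)))\<bar> <= \<bar>a - a'\<bar> + \<bar>b - b'\<bar>"
  by (simp add: min_def max_def del: of_nat_Suc) linarith
  next
  fix m assume "m : space N"
  have "real (Suc K) / real (Suc n) <= 1" using Suc.prems by (simp del: of_nat_Suc)
  with bound[of "Suc K" m] have "0 <= s (Suc K) n m" "s (Suc K) n m <= 1" by (blast intro: order_trans)+
  then show "s (Suc K) n m = min 1 (max 0 (s K n m + indicator ?D m / real (Suc n)))" unfolding eq by simp
  qed (use Suc ind[OF Dm] sm in auto)
  qed
  then show "approximable u \<xi> I (s (Suc n) n)" for n by simp
  fix m assume m: "m : space N"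
  have val: "s (Suc n) n m = real_of_int \<lfloor>f m * real (Suc n)\<rfloor> / real (Suc n)" for n proof -
  have fl: "0 <= \<lfloor>f m * real (Suc n)\<rfloor>" "\<lfloor>f m * real (Suc n)\<rfloor> <= int (Suc n)" proof -
  show "0 <= \<lfloor>f m * real (Suc n)\<rfloor>" using f(2)[OF m] by simp
  have "f m * real (Suc n) <= 1 * real (Suc n)" using f(2)[OF m] by (intro mult_right_mono) auto
  then have "f m * real (Suc n) < real (Suc n) + 1" by (rule le_less_trans) simp
  then have "\<lfloor>f m * real (Suc n)\<rfloor> < int (Suc n) + 1" by (subst floor_less_iff) simp
  then show "\<lfloor>f m * real (Suc n)\<rfloor> <= int (Suc n)" by simp
  qed
  have "{l\<in>{1..Suc n}. f m >= real l / real (Suc n)} = {1..nat \<lfloor>f m * real (Suc n)\<rfloor>}" proof (rule Set.set_eqI)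
  fix l
  have "f m >= real l / real (Suc n) \<longleftrightarrow> real l <= f m * real (Suc n)" by (subst pos_divide_le_eq) auto
  also have "... \<longleftrightarrow> int l <= \<lfloor>f m * real (Suc n)\<rfloor>" by (simp only: le_floor_iff of_int_of_nat_eq)
  finally show "l : {l\<in>{1..Suc n}. f m >= real l / real (Suc n)} \<longleftrightarrow> l : {1..nat \<lfloor>f m * real (Suc n)\<rfloor>}" using fl by auto
  qed
  moreover have "(\<Sum>l=1..Suc n. indicator {m\<in>space N. f m >= real l / real (Suc n)} m :: real) =
  real (card {l\<in>{1..Suc n}. f m >= real l / real (Suc n)})" proof -
  have "(\<Sum>l=1..Suc n. indicator {m\<in>space N. f m >= real l / real (Suc n)} m :: real) =
  (\<Sum>l\<in>{1..Suc n}. if f m >= real l / real (Suc n) then 1 else 0)" using m by (intro sum.cong refl) (simp add: indicator_def del: of_nat_Suc)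
  also have "... = (\<Sum>l\<in>{l\<in>{1..Suc n}. f m >= real l / real (Suc n)}. 1)" by (rule sum.inter_filter[symmetric]) simp
  finally show ?thesis by (simp only: sum_constant mult_1_right)
  qed
  ultimately show ?thesis using fl(1) by (simp add: s_def del: of_nat_Suc)
  qed
  have bd: "\<bar>s (Suc n) n m - f m\<bar> <= 1 / real (Suc n)" for n proof -
  have "\<bar>real_of_int \<lfloor>f m * real (Suc n)\<rfloor> - f m * real (Suc n)\<bar> <= 1" by linarith
  then have "\<bar>real_of_int \<lfloor>f m * real (Suc n)\<rfloor> - f m * real (Suc n)\<bar> / real (Suc n) <= 1 / real (Suc n)" by (intro divide_right_mono) auto
  moreover have "\<bar>real_of_int \<lfloor>f m * real (Suc n)\<rfloor> - f m * real (Suc n)\<bar> / real (Suc n) = \<bar>s (Suc n) n m - f m\<bar>" proof -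
  have "\<bar>a - b * D\<bar> / D = \<bar>a / D - b\<bar>" if "D > 0" for a b D :: real proof -
  have "\<bar>a - b * D\<bar> / D = \<bar>(a - b * D) / D\<bar>" using that by (simp add: abs_divide)
  also have "(a - b * D) / D = a / D - b" using that by (simp add: diff_divide_distrib)
  finally show ?thesis .
  qed
  then show ?thesis unfolding val by (simp only: of_nat_0_less_iff zero_less_Suc)
  qed
  ultimately show ?thesis by simp
  qed
  have "(%n. s (Suc n) n m - f m) ~~> 0" by (rule Lim_null_comparison[OF _ LIMSEQ_Suc[OF lim_const_over_n[of 1]]])
  (use bd in \<open>auto intro!: always_eventually\<close>)
  then show "(%n. s (Suc n) n m) ~~> f m" by (simp add: LIM_zero_iff)
 qed
 then show ?thesis unfolding generates_def approximable_def by blast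
qed

theorem generatesI:
 assumes cod: "coding N A u \<xi>" and gen: "!!D. D : sets N ==>
  EX B:sigma_sets (space N) {{m : space N. u j (\<xi> (T g m)) < r} | g j r. g : carrier G & j : I}.
  (D - B) \<union> (B - D) : null_sets N"
 shows "generates G N T u \<xi> I" proof (rule generates_if_indicators[OF cod])
 have basic: "B : sets N & approximable u \<xi> I (indicator B)" if "B : {{m : space N. u j (\<xi> (T g m)) < r} | g j r. g : carrier G & j : I}" for B proof -
  from that obtain g j r where "g : carrier G" "j : I" "B = {m : space N. u j (\<xi> (T g m)) < r}" by blast
  from approximable_halfspace[OF cod this] show ?thesis by blast
 qed
 show "approximable u \<xi> I (indicator D)" if D: "D : sets N" for D proof (rule approximable_limit[OF _ _ _ cod])
  fix e :: real assume e: "e > 0"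
  obtain B where B: "B : sigma_sets (space N) {{m : space N. u j (\<xi> (T g m)) < r} | g j r. g : carrier G & j : I}"
  and null: "(D - B) \<union> (B - D) : null_sets N" using gen[OF D] by blast
  have "AE m in N. \<bar>indicator D m - indicator B m :: real\<bar> = 0" using AE_not_in[OF null] by eventually_elim (auto simp: indicator_def)
  then have "(LINT m|N. \<bar>indicator D m - indicator B m :: real\<bar>) = 0" by (rule integral_eq_zero_AE)
  with e approximable_sigma_sets[OF cod basic B]
  show "EX h. approximable u \<xi> I h & (LINT m|N. \<bar>indicator D m - h m\<bar>) < e" by auto
 qed (use D in auto)
qed

end

section \<open>Growth and powers\<close>

lemma ll_reindex:
 assumes "loc_lip G I F"
 shows "loc_lip G (\<iota> ` I) (%q. F (%(g, j). q (g, \<iota> j)))" proof -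
 obtain E C where "lipschitz_data G I F E C" using assms unfolding loc_lip_def by blast
 note EC = lipschitz_dataD[OF this]
 show ?thesis proof (rule ll_compose[OF EC(1) _ EC(3)])
  show "loc_lip G (\<iota> ` I) (%q. (%(g, j). q (g, \<iota> j)) e)" if "e : E" for e using that EC(2) by (cases e) (auto intro: ll_coord)
  fix q q' :: "'a \<times> 'd => real" assume "q : cube G" "q' : cube G"
  then have "(%(g, j). q (g, \<iota> j)) : cube G" "(%(g, j). q' (g, \<iota> j)) : cube G" by (auto simp: cube_def)
  then show "\<bar>F (%(g, j). q (g, \<iota> j)) - F (%(g, j). q' (g, \<iota> j))\<bar> \<le>
  C * (\<Sum>e\<in>E. \<bar>(%(g, j). q (g, \<iota> j)) e - (%(g, j). q' (g, \<iota> j)) e\<bar>)" by (rule EC(4))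
 qed
qed

lemma name_reindex:
 assumes "!!g j. g : carrier G ==> w j (y (s' g p')) = u (\<iota> j) (x (s g p))"
 shows "name G w s' y p' = (%(g, j). name G u s x p (g, \<iota> j))" using assms by (auto simp: name_def fun_eq_iff)

text \<open>A factor map that acts letter by letter carries good models to good models, since every test pulls back to a test.\<close>
theorem good_seq_factor:
 fixes G :: "('g, 'b) monoid_scheme" and u :: "'i => 'a => real" and w :: "'j => 'c => real" and V :: "nat => 'v set"
 assumes N: "pmp_action G N T" and N': "pmp_action G N' T'" and cA: "coding N A u \<xi>" and cB: "coding N' B w \<eta>" and p: "p : measurable N N'" "distr N N' p = N'"
  and names: "!!g j m. g : carrier G ==> m : space N ==> w j (\<eta> (T' g (p m))) = u (\<iota> j) (\<xi> (T g m))"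
  and \<pi>: "!!a. a : A ==> \<pi> a : B" "!!a j. a : A ==> w j (\<pi> a) = u (\<iota> j) a"
  and act: "almost_action G V \<sigma>" and good: "good_seq G N T A u \<xi> V \<sigma> S"
 shows "good_seq G N' T' B w \<eta> V \<sigma> (%i. (%x v. \<pi> (x v)) ` S i)" unfolding good_seq_def proof (intro conjI allI impI)
 interpret N: pmp_action G N T by fact
 interpret N': pmp_action G N' T' by fact
 have SA: "x v : A" if "x : S i" "v : V i" for i x v using good that unfolding good_seq_def by blast
 show "ALL y:(%x v. \<pi> (x v)) ` S i. ALL v:V i. y v : B" for i using SA \<pi> by blast
 fix F :: "('g \<times> 'j => real) => real" and e :: real
 assume F: "loc_lip G UNIV F" and e: "e > 0"
 define F' where "F' q = F (%(g, j). q (g, \<iota> j))" for q :: "'g \<times> 'i => real"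
 have "loc_lip G UNIV F'" unfolding F'_def using ll_reindex[OF F, of \<iota>] by (rule ll_mono) simp
 with good e have "EV i. ALL x:S i. model_error G N T u \<xi> (V i) (\<sigma> i) F' x < e" unfolding good_seq_def by blast
 then show "EV i. ALL y:(%x v. \<pi> (x v)) ` S i. model_error G N' T' w \<eta> (V i) (\<sigma> i) F y < e" proof eventually_elim
  case (elim i)
  have "model_error G N' T' w \<eta> (V i) (\<sigma> i) F (%v. \<pi> (x v)) = model_error G N T u \<xi> (V i) (\<sigma> i) F' x" if x: "x : S i" for x proof -
  have "F (name G w (\<sigma> i) (%v. \<pi> (x v)) v) = F' (name G u (\<sigma> i) x v)" if v: "v : V i" for v
  unfolding F'_def using \<pi>(2) SA[OF x almost_actionD(4)[OF act _ v]]
  by (subst name_reindex[of G w "%v. \<pi> (x v)" "\<sigma> i" v u \<iota> x "\<sigma> i" v]) auto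
  then have 1: "vavg (V i) (%v. F (name G w (\<sigma> i) (%v. \<pi> (x v)) v)) = vavg (V i) (%v. F' (name G u (\<sigma> i) x v))" by (rule vavg_cong)
  have "(LINT m|N'. F (name G w T' \<eta> m)) = (LINT m|N. F (name G w T' \<eta> (p m)))" using integral_distr[OF p(1) N'.test_measurable[OF cB F]] p(2) by simp
  also have "... = (LINT m|N. F' (name G u T \<xi> m))" unfolding F'_def using names by (intro Bochner_Integration.integral_cong refl arg_cong[of _ _ F] name_reindex)
  finally show ?thesis unfolding model_error_def 1 by simp
  qed
  with elim show ?case by auto
 qed
qed

context pmp_action begin

lemma generates_reindex:
 fixes u :: "'i => 'a => real" and w :: "'j => 'c => real"
 assumes "generates G N T w \<eta> I" "!!m j. m : space N ==> w j (\<eta> m) = u (\<iota> j) (\<xi> m)"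
 shows "generates G N T u \<xi> (\<iota> ` I)" unfolding generates_def proof (intro ballI impI allI)
 fix f :: "'x => real" and e :: real assume f: "f : bmeas N" "ALL m:space N. 0 <= f m & f m <= 1" and e: "e > 0"
 obtain F where F: "loc_lip G I F" "ALL q:cube G. 0 <= F q & F q <= 1" "(LINT m|N. \<bar>f m - F (name G w T \<eta> m)\<bar>) < e"
  using generatesD[OF assms(1) f(1) _ _ e] f(2) by blast
 have "(LINT m|N. \<bar>f m - F (%(g, j). name G u T \<xi> m (g, \<iota> j))\<bar>) = (LINT m|N. \<bar>f m - F (name G w T \<eta> m)\<bar>)"
  by (intro Bochner_Integration.integral_cong refl)
  (subst name_reindex[of G w \<eta> T _ u \<iota> \<xi> T], auto simp: assms(2) T_space)
 moreover have "(%(g, j). q (g, \<iota> j)) : cube G" if "q : cube G" for q :: "'g \<times> 'i => real" using that by (auto simp: cube_def)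
 ultimately show "EX F. loc_lip G (\<iota> ` I) F & (ALL q:cube G. 0 <= F q & F q <= 1) & (LINT m|N. \<bar>f m - F (name G u T \<xi> m)\<bar>) < e"
  using F by (intro exI[of _ "%q. F (%(g, j). q (g, \<iota> j))"] conjI ll_reindex) auto
qed

end

text \<open>The witnesses behind exponential growth at rate $c$, stated with features in place of a metric so that different codings can be compared.\<close>
definition growth_wit ::
 "('g, 'b) monoid_scheme => 'x measure => ('g => 'x => 'x) => 'a set => ('j => 'a => real) => ('x => 'a) =>
  (nat => 'v set) => (nat => 'g => 'v => 'v) => real => (nat => nat) => (nat => ('v => 'a) set) => 'j set => real => bool" where
 "growth_wit G N T A u \<xi> V \<sigma> c r S J \<eta> \<longleftrightarrow>
  strict_mono r & good_seq G N T A u \<xi> (V o r) (\<sigma> o r) S & finite J & \<eta> > 0 &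
  (ALL i. finite (S i) & exp (c * real (card (V (r i)))) <= real (card (S i)) &
  (ALL x:S i. ALL y:S i. x ~= y --> \<eta> <= fdist u J (V (r i)) x y))"

definition has_growth ::
 "('g, 'b) monoid_scheme => 'x measure => ('g => 'x => 'x) => 'a set => ('j => 'a => real) => ('x => 'a) =>
  (nat => 'v set) => (nat => 'g => 'v => 'v) => real => bool" where
 "has_growth G N T A u \<xi> V \<sigma> c \<longleftrightarrow> (EX r S J \<eta>. growth_wit G N T A u \<xi> V \<sigma> c r S J \<eta>)"

lemma growth_witD:
 assumes "growth_wit G N T A u \<xi> V \<sigma> c r S J \<eta>"
 shows "strict_mono r" "good_seq G N T A u \<xi> (V o r) (\<sigma> o r) S" "finite J" "\<eta> > 0"
  "finite (S i)" "exp (c * real (card (V (r i)))) <= real (card (S i))"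
  "x : S i ==> y : S i ==> x ~= y ==> \<eta> <= fdist u J (V (r i)) x y" using assms unfolding growth_wit_def by simp_all

lemma has_growthI:
 assumes r: "strict_mono r" and good: "good_seq G N T A u \<xi> (V o r) (\<sigma> o r) S" and J: "finite J" and \<eta>: "\<eta> > 0"
  and ev: "EV i. finite (S i) & exp (c * real (card (V (r i)))) <= real (card (S i)) &
  (ALL x:S i. ALL y:S i. x ~= y --> \<eta> <= fdist u J (V (r i)) x y)"
 shows "has_growth G N T A u \<xi> V \<sigma> c" proof -
 obtain k where k: "!!i. i >= k ==> finite (S i) & exp (c * real (card (V (r i)))) <= real (card (S i)) &
  (ALL x:S i. ALL y:S i. x ~= y --> \<eta> <= fdist u J (V (r i)) x y)" using ev unfolding eventually_sequentially by blast
 have m: "strict_mono (%i. i + k)" by (simp add: strict_mono_def)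
 show ?thesis unfolding has_growth_def growth_wit_def proof (intro exI[of _ "r o (%i. i + k)"] exI[of _ "S o (%i. i + k)"] exI[of _ J] exI[of _ \<eta>] conjI)
  show "strict_mono (r o (%i. i + k))" using strict_mono_o[OF r m] .
  show "good_seq G N T A u \<xi> (V o (r o (%i. i + k))) (\<sigma> o (r o (%i. i + k))) (S o (%i. i + k))" using good_seq_subseq[OF good m] by (simp add: o_assoc)
 qed (use J \<eta> k in auto)
qed

context pmp_action begin

theorem has_growth_pair:
 fixes u :: "'i::countable => 'a => real" and w :: "'j::countable => 'c => real" and V :: "nat => 'v set"
 assumes cA: "coding N A u \<xi>" and gen: "generates G N T u \<xi> UNIV" and cB: "coding N B w \<eta>"
  and act: "almost_action G V \<sigma>" and growth: "has_growth G N T A u \<xi> V \<sigma> c"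
 shows "has_growth G N T (A \<times> B) (pair_feat u w) (%m. (\<xi> m, \<eta> m)) V \<sigma> c" proof -
 obtain r S J d where wit: "growth_wit G N T A u \<xi> V \<sigma> c r S J d" using growth unfolding has_growth_def by blast
 note r = growth_witD(1)[OF wit] and good = growth_witD(2)[OF wit] and J = growth_witD(3)[OF wit]
  and d = growth_witD(4)[OF wit] and S = growth_witD(5,6)[OF wit] and sep = growth_witD(7)[OF wit]
 note act' = almost_action_subseq[OF act r]
 obtain f where f: "good_seq G N T (A \<times> B) (pair_feat u w) (%m. (\<xi> m, \<eta> m)) (V o r) (\<sigma> o r)
  (%i. (%x v. (x v, f i x v)) ` S i)" using extend_good_models[OF cA gen cB act' good] by blast
 have inj: "inj_on (%x v. (x v, f i x v)) (S i)" for i by (auto simp: inj_on_def fun_eq_iff)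
 have dist: "fdist (pair_feat u w) (Inl ` J) (V (r i)) (%v. (x v, f i x v)) (%v. (y v, f i y v)) =
  fdist u J (V (r i)) x y" for i x y unfolding fdist_def by (subst sum.reindex) auto
 define h where "h i x = (%v. (x v, f i x v))" for i x
 have sep': "d <= fdist (pair_feat u w) (Inl ` J) (V (r i)) z z'" if "z : h i ` S i" "z' : h i ` S i" "z ~= z'" for i z z' proof -
  from that(1,2) obtain x y where xy: "x : S i" "z = h i x" "y : S i" "z' = h i y" by blast
  then have "x ~= y" using that(3) by blast
  then show ?thesis unfolding xy unfolding h_def dist using xy by (intro sep)
 qed
 show ?thesis by (rule has_growthI[OF r f[folded h_def] _ d, of "Inl ` J"]) (use J S in \<open>simp_all add: card_image[OF inj[folded h_def]] sep'\<close>)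
qed

theorem has_growth_snd:
 fixes u :: "'i::countable => 'a => real" and w :: "'j::countable => 'c => real" and V :: "nat => 'v set"
 assumes cA: "coding N A u \<xi>" and cB: "coding N B w \<eta>" and gen: "generates G N T w \<eta> UNIV" and act: "almost_action G V \<sigma>"
  and growth: "has_growth G N T (A \<times> B) (pair_feat u w) (%m. (\<xi> m, \<eta> m)) V \<sigma> c"
 shows "has_growth G N T B w \<eta> V \<sigma> c" proof -
 note cAB = coding_pair[OF cA cB]
 obtain r S J d where wit: "growth_wit G N T (A \<times> B) (pair_feat u w) (%m. (\<xi> m, \<eta> m)) V \<sigma> c r S J d"
  using growth unfolding has_growth_def by blast
 note r = growth_witD(1)[OF wit] and good = growth_witD(2)[OF wit] and J = growth_witD(3)[OF wit]
  and d = growth_witD(4)[OF wit] and S = growth_witD(5,6)[OF wit] and sep = growth_witD(7)[OF wit]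
 note act' = almost_action_subseq[OF act r]
 have gen': "generates G N T (pair_feat u w) (%m. (\<xi> m, \<eta> m)) (range Inr)" by (rule generates_reindex[OF gen]) simp
 have d2: "d / 2 > 0" using d by simp
 obtain J' C where J': "finite J'" "J' \<subseteq> range Inr" and C: "0 <= C" and rec: "EV i. ALL x:S i. ALL y:S i.
  fdist (pair_feat u w) J ((V o r) i) x y <= d / 2 + C * fdist (pair_feat u w) J' ((V o r) i) x y" using recover_features[OF cAB gen' act' good J d2] by blast
 define K where "K = Inr -` J'"
 have K: "finite K" "J' = Inr ` K" using J' unfolding K_def by (auto intro: finite_vimageI)
 have dist: "fdist (pair_feat u w) J' W x y = fdist w K W (%v. snd (x v)) (%v. snd (y v))" for W :: "'v set" and x y :: "'v => 'a \<times> 'c"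
  unfolding fdist_def K(2) by (subst sum.reindex) auto
 define \<theta> where "\<theta> = d / (2 * (C + 1))"
 have \<theta>: "\<theta> > 0" using d C by (simp add: \<theta>_def)
 have good': "good_seq G N T B w \<eta> (V o r) (\<sigma> o r) (%i. (%x v. snd (x v)) ` S i)"
  by (rule good_seq_factor[OF pmp_action_axioms pmp_action_axioms cAB cB _ _ _ _ _ act' good, of "%m. m" Inr])
  (auto simp: distr_id)
 show ?thesis proof (rule has_growthI[OF r good' K(1) \<theta>])
  show "EV i. finite ((%x v. snd (x v)) ` S i) &
  exp (c * real (card (V (r i)))) <= real (card ((%x v. snd (x v)) ` S i)) &
  (ALL x:(%x v. snd (x v)) ` S i. ALL y:(%x v. snd (x v)) ` S i. x ~= y --> \<theta> <= fdist w K (V (r i)) x y)" using rec proof eventually_elim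
  case (elim i)
  define h where "h x = (%v. snd (x v))" for x :: "'v => 'a \<times> 'c"
  have far: "\<theta> <= fdist w K (V (r i)) (%v. snd (x v)) (%v. snd (y v))" if "x : S i" "y : S i" "x ~= y" for x y proof -
  let ?D = "fdist w K (V (r i)) (%v. snd (x v)) (%v. snd (y v))"
  have "fdist (pair_feat u w) J (V (r i)) x y <= d / 2 + C * ?D" using elim that(1,2) unfolding dist o_def by blast
  with sep[OF that] have "d / 2 <= C * ?D" by linarith
  also have "... <= (C + 1) * ?D" using fdist_nonneg[of w K "V (r i)"] by (simp add: distrib_right)
  finally show ?thesis using C by (simp add: \<theta>_def divide_le_eq algebra_simps)
  qed
  have inj: "inj_on (%x v. snd (x v)) (S i)" proof (rule inj_onI, rule ccontr)
  fix x y assume xy: "x : S i" "y : S i" "(%v. snd (x v)) = (%v. snd (y v))" "x ~= y"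
  have "fdist w K (V (r i)) (%v. snd (x v)) (%v. snd (y v)) = 0" unfolding xy(3) by (simp add: fdist_def vavg_def)
  with far[OF xy(1,2,4)] \<theta> show False by linarith
  qed
  have "\<theta> <= fdist w K (V (r i)) z z'" if "z : h ` S i" "z' : h ` S i" "z ~= z'" for z z' proof -
  from that(1,2) obtain x y where xy: "x : S i" "z = h x" "y : S i" "z' = h y" by blast
  then have "x ~= y" using that(3) by blast
  then show ?thesis unfolding xy unfolding h_def using xy by (intro far)
  qed
  then show ?case using S unfolding h_def[symmetric] by (simp add: card_image[OF inj[folded h_def]])
  qed
 qed
qed

text \<open>Attach the second coding to the models, then forget the first one.\<close>
corollary has_growth_invariant:
 fixes u :: "'i::countable => 'a => real" and w :: "'j::countable => 'c => real" and V :: "nat => 'v set"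
 assumes "coding N A u \<xi>" "generates G N T u \<xi> UNIV" "coding N B w \<eta>" "generates G N T w \<eta> UNIV"
  and "almost_action G V \<sigma>" "has_growth G N T A u \<xi> V \<sigma> c"
 shows "has_growth G N T B w \<eta> V \<sigma> c" using has_growth_snd[OF assms(1,3,4,5)] has_growth_pair[OF assms(1,2,3,5,6)] .

end

definition pow_feat :: "nat => ('j => 'a => real) => nat \<times> 'j => (nat => 'a) => real" where
 "pow_feat k u p x = (if fst p < k then u (snd p) (x (fst p)) else 0)"

definition pow_code :: "nat => ('x => 'a) => (nat => 'x) => nat => 'a" where
 "pow_code k \<xi> m = (\<lambda>l\<in>{..<k}. \<xi> (m l))"

abbreviation pow_alpha :: "nat => 'a set => (nat => 'a) set" where
 "pow_alpha k A \<equiv> PiE {..<k} (%_. A)"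

abbreviation (input) power_growth where
 "power_growth G N T k A u x ==
 has_growth G (power_space k N) (power_action k T) (pow_alpha k A) (pow_feat k u) (pow_code k x)"

abbreviation (input) power_error where
 "power_error G N T k u x == model_error G (power_space k N) (power_action k T) (pow_feat k u) (pow_code k x)"

abbreviation (input) separated_models where
 "separated_models c V A W e err \<eta> u J == EX S. finite S & exp (c * real (card V)) <= real (card S) &
 (ALL x:S. (ALL v:V. x v : A) & (ALL w:W. err (word w) x < e)) & (ALL x:S. ALL y:S. x ~= y --> \<eta> <= fdist u J V x y)"

abbreviation (input) cov_rate where
 "cov_rate V d \<epsilon> \<delta> \<nu> == log_enat (cov_measure \<epsilon> \<delta> \<nu> (hamming_average V d)) / ereal (real (card V))"

lemma space_power_space: "space (power_space k N) = PiE {..<k} (%_. space N)" by (simp add: power_space_def space_PiM)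

context pmp_action begin

lemma prob_space_power_space: "prob_space (power_space k N)" unfolding power_space_def by (intro prob_space_PiM prob_space_axioms)

lemma power_component_measurable: "l < k ==> (%m. m l) : measurable (power_space k N) N" unfolding power_space_def by (rule measurable_component_singleton) simp

lemma power_component_distr: "l < k ==> distr (power_space k N) N (%m. m l) = N"
 unfolding power_space_def by (rule distr_PiM_component[where M = "%_. N"]) (auto intro: prob_space_axioms)

lemma pmp_action_power: "pmp_action G (power_space k N) (power_action k T)" proof -
 interpret P: prob_space "power_space k N" by (rule prob_space_power_space)
 have act_eq: "power_action k T g m = compose {..<k} (T g) m" for g m by (simp add: power_action_def compose_def)
 show ?thesis proof
  show "countable (carrier G)" by (rule countable_group)
  show "power_action k T g : measurable (power_space k N) (power_space k N)" if "g : carrier G" for g proof -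
  have "(%m. T g (m l)) : measurable (power_space k N) N" if "l : {..<k}" for l
  using measurable_compose[OF power_component_measurable T_measurable[OF \<open>g : carrier G\<close>], of l k] that by simp
  then have "(%m. \<lambda>l\<in>{..<k}. T g (m l)) : measurable (power_space k N) (PiM {..<k} (%_. N))" by (rule measurable_restrict)
  then show ?thesis by (simp add: power_action_def[abs_def] power_space_def)
  qed
  show "distr (power_space k N) (power_space k N) (power_action k T g) = power_space k N" if g: "g : carrier G" for g
  using distr_PiM_finite_prob_space'[of "{..<k}" "%_. N" "%_. N" "T g"] T_measurable[OF g] T_preserves[OF g] prob_space_axioms
  unfolding power_space_def act_eq by (auto cong: PiM_cong)
  show "power_action k T \<one> m = m" if "m : space (power_space k N)" for m proof
  fix l
  have m: "m : PiE {..<k} (%_. space N)" using that by (simp only: space_power_space)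
  show "power_action k T \<one> m l = m l" proof (cases "l < k")
  case True
  then have "m l : space N" using PiE_mem[OF m, of l] by simp
  then show ?thesis using True by (simp add: power_action_def T_one)
  next
  case False
  then have "m l = undefined" using PiE_arb[OF m, of l] by simp
  then show ?thesis using False by (simp add: power_action_def)
  qed
  qed
  show "power_action k T (g \<otimes> h) m = power_action k T g (power_action k T h m)" if gh: "g : carrier G" "h : carrier G" "m : space (power_space k N)" for g h m
  proof
  fix l
  have "m l : space N" if "l < k" using PiE_mem[OF gh(3)[unfolded space_power_space], of l] that by simp
  then show "power_action k T (g \<otimes> h) m l = power_action k T g (power_action k T h m) l" using gh(1,2) by (simp add: power_action_def T_mult)
  qed
 qed
qed

lemma coding_power:
 assumes cod: "coding N A u \<xi>"
 shows "coding (power_space k N) (pow_alpha k A) (pow_feat k u) (pow_code k \<xi>)" unfolding coding_def proof (intro conjI ballI allI)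
 show "features (pow_alpha k A) (pow_feat k u)" proof -
  have "0 <= u j (x l) & u j (x l) <= 1" if "x : pow_alpha k A" "l < k" for x l j proof -
  have "x l : A" using PiE_mem[OF that(1), of l] that(2) by simp
  moreover have "features A u" using cod unfolding coding_def by blast
  ultimately show ?thesis unfolding features_def by blast
  qed
  then show ?thesis by (simp add: features_def pow_feat_def)
 qed
 show "pow_code k \<xi> m : pow_alpha k A" if "m : space (power_space k N)" for m using cod that by (auto simp: coding_def pow_code_def space_power_space)
 show "(%m. pow_feat k u p (pow_code k \<xi> m)) : bmeas (power_space k N)" for p
  using cod measurable_compose[OF power_component_measurable[of "fst p" k], of "%m. u (snd p) (\<xi> m)" borel]
  by (cases "fst p < k") (auto simp: pow_feat_def pow_code_def coding_def)
qed

lemma name_power_component: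
 assumes "l < k" "m : space (power_space k N)"
 shows "name G u T \<xi> (m l) = (%(g, j). name G (pow_feat k u) (power_action k T) (pow_code k \<xi>) m (g, (l, j)))"
 using assms by (auto simp: name_def pow_feat_def pow_code_def power_action_def fun_eq_iff)

lemma generates_power:
 fixes u :: "'d => 'a => real"
 assumes cod: "coding N A u \<xi>" and gen: "generates G N T u \<xi> UNIV"
 shows "generates G (power_space k N) (power_action k T) (pow_feat k u) (pow_code k \<xi>) UNIV" proof -
 interpret P: pmp_action G "power_space k N" "power_action k T" by (rule pmp_action_power)
 note codP = coding_power[OF cod, of k]
 let ?\<B> = "{{m : PiE {..<k} (%_. space N). m l : B} | l B. l : {..<k} & B : sets N}"
 have sets: "sets (power_space k N) = sigma_sets (space (power_space k N)) ?\<B>" unfolding space_power_space unfolding power_space_def by (rule sets_PiM_single)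
 have basic: "D : sets (power_space k N) & P.approximable (pow_feat k u) (pow_code k \<xi>) UNIV (indicator D)" if D: "D : ?\<B>" for D proof
  obtain l B where l: "l < k" and B: "B : sets N" and D_eq: "D = {m : PiE {..<k} (%_. space N). m l : B}" using D by blast
  show Dm: "D : sets (power_space k N)" unfolding sets using D by (rule sigma_sets.Basic)
  show "P.approximable (pow_feat k u) (pow_code k \<xi>) UNIV (indicator D)" unfolding P.approximable_def proof (intro conjI allI impI)
  fix e :: real assume e: "e > 0"
  obtain F where F: "loc_lip G UNIV F" "ALL q:cube G. 0 <= F q & F q <= 1"
  "(LINT m|N. \<bar>indicator B m - F (name G u T \<xi> m)\<bar>) < e" using generatesD[OF gen _ _ _ e, of "indicator B"] B by auto
  define F' where "F' q = F (%(g, j). q (g, (l, j)))" for q :: "'g \<times> (nat \<times> 'd) => real"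
  have ll: "loc_lip G UNIV F'" unfolding F'_def using ll_reindex[OF F(1), of "Pair l"] by (rule ll_mono) simp
  have c: "(%(g, j). q (g, (l, j))) : cube G" if "q : cube G" for q :: "'g \<times> (nat \<times> 'd) => real" using that by (auto simp: cube_def)
  have m1: "(%m. \<bar>indicator B m - F (name G u T \<xi> m)\<bar>) : bmeas N" using B test_measurable[OF cod F(1)] by measurable
  have "(LINT m|power_space k N. \<bar>indicator D m - F' (name G (pow_feat k u) (power_action k T) (pow_code k \<xi>) m)\<bar>) =
  (LINT m|power_space k N. \<bar>indicator B (m l) - F (name G u T \<xi> (m l))\<bar>)" unfolding F'_def using l by (intro Bochner_Integration.integral_cong refl)
  (subst name_power_component[where k = k], auto simp: D_eq space_power_space indicator_def)
  also have "... = (LINT m|N. \<bar>indicator B m - F (name G u T \<xi> m)\<bar>)"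
  using integral_distr[OF power_component_measurable[OF l] m1] power_component_distr[OF l] by simp
  finally show "EX F. loc_lip G UNIV F & (ALL q:cube G. 0 <= F q & F q <= 1) &
  (LINT m|power_space k N. \<bar>indicator D m - F (name G (pow_feat k u) (power_action k T) (pow_code k \<xi>) m)\<bar>) < e"
  using ll F(2,3) c by (intro exI[of _ F']) (auto simp: F'_def)
  qed (use Dm in auto)
 qed
 show ?thesis by (rule P.generates_if_indicators[OF codP]) (use P.approximable_sigma_sets[OF codP basic] sets in blast)
qed

end

section \<open>Words and the weak-star topology\<close>

definition cname :: "('g, 'b) monoid_scheme => ('j => 'a => real) => ('g => 'a) => ('g \<times> 'j => real)" where
 "cname G u x = (%(g, j). if g : carrier G then u j (x g) else 0)"

definition metric_features :: "'a measure => ('a => 'a => real) => ('j => 'a => real) => bool" where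
 "metric_features X d u \<longleftrightarrow> Metric_space (space X) d & compact_space (Metric_space.mtopology (space X) d) &
  (ALL j. u j : bmeas X) & features (space X) u &
  (\<exists>L>0. ALL j. ALL x:space X. ALL y:space X. \<bar>u j x - u j y\<bar> <= L * d x y) &
  (ALL x:space X. ALL y:space X. (ALL j. u j x = u j y) --> x = y)"

lemma cname_in_cube:
 assumes "features A u" "x : PiE (carrier G) (%_. A)"
 shows "cname G u x : cube G" proof -
 have "0 <= u j (x g) & u j (x g) <= 1" if "g : carrier G" for g j using assms(1) PiE_mem[OF assms(2) that] unfolding features_def by blast
 then show ?thesis by (simp add: cname_def cube_def)
qed

lemma name_eq_cname: "name G u s x v = cname G u (pullback_name G s v x)" by (auto simp: name_def cname_def pullback_name_def fun_eq_iff)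

lemma cname_measurable:
 assumes "!!j. u j : bmeas X" "sets \<nu> = sets (configs G X)"
 shows "(%x. cname G u x e) : bmeas \<nu>" proof (cases e)
 case (Pair g j)
 have "(%x. u j (x g)) : bmeas (configs G X)" if "g : carrier G" proof -
  have "(%x. x g) : measurable (configs G X) X" using measurable_component_singleton[OF that, of "%_. X"] by simp
  from measurable_compose[OF this assms(1)] show ?thesis .
 qed
 then show ?thesis by (cases "g : carrier G") (auto simp: Pair cname_def measurable_cong_sets[OF assms(2) refl])
qed

lemma topspace_config_topology:
 "Metric_space (space X) d ==> topspace (config_topology G X d) = PiE (carrier G) (%_. space X)" by (simp add: config_topology_def Metric_space.topspace_mtopology)

lemma continuous_map_lipschitz_real:
 assumes "Metric_space M d" "L > 0" "!!x y. x : M ==> y : M ==> \<bar>f x - f y\<bar> <= L * d x y"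
 shows "continuous_map (Metric_space.mtopology M d) euclideanreal f" proof -
 interpret Metric_space M d by fact
 show ?thesis unfolding continuous_map_def proof (intro conjI allI impI)
  fix U :: "real set" assume "openin euclideanreal U"
  then have U: "open U" by simp
  show "openin mtopology {x : topspace mtopology. f x : U}" unfolding openin_mtopology proof (intro conjI allI impI)
  fix x assume x: "x : {x : topspace mtopology. f x : U}"
  then obtain e where e: "e > 0" "!!z. \<bar>z - f x\<bar> < e ==> z : U" using U by (auto simp: open_dist dist_real_def)
  have "mball x (e / L) \<subseteq> {x : topspace mtopology. f x : U}" proof
  fix y assume y: "y : mball x (e / L)"
  then have "L * d y x < e" using assms(2) by (simp add: commute less_divide_eq mult.commute)
  then have "\<bar>f y - f x\<bar> < e" using assms(3)[of y x] y by auto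
  then show "y : {x : topspace mtopology. f x : U}" using e(2) y by auto
  qed
  then show "\<exists>r>0. mball x r \<subseteq> {x : topspace mtopology. f x : U}" using e(1) assms(2) by (intro exI[of _ "e / L"]) auto
  qed auto
 qed auto
qed

lemma continuous_feature:
 assumes "metric_features X d u" "g : carrier G"
 shows "continuous_map (config_topology G X d) euclideanreal (%x. u j (x g))" proof -
 have M: "Metric_space (space X) d" using assms(1) unfolding metric_features_def by blast
 obtain L where L: "L > 0" "!!j x y. x : space X ==> y : space X ==> \<bar>u j x - u j y\<bar> <= L * d x y" using assms(1) unfolding metric_features_def by blast
 have "continuous_map (Metric_space.mtopology (space X) d) euclideanreal (u j)" by (rule continuous_map_lipschitz_real[OF M L])
 from continuous_map_compose[OF continuous_map_product_projection[OF assms(2)] this]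
 show ?thesis unfolding config_topology_def by (simp add: o_def)
qed

lemma continuous_config_word:
 assumes "metric_features X d u" "w : name_words G"
 shows "continuous_map (config_topology G X d) euclideanreal (%x. wval (cname G u x) w)" using assms(2) proof (induction w)
 case (Cons e w)
 then show ?case using continuous_feature[OF assms(1), of "fst e" G "snd e"] by (cases e) (auto simp: cname_def intro!: continuous_map_real_mult)
qed simp

lemma continuous_cname:
 assumes "metric_features X d u"
 shows "continuous_map (config_topology G X d) euclidean (cname G u)" proof -
 have "continuous_map (config_topology G X d) euclideanreal (%x. cname G u x e)" for e using continuous_feature[OF assms, of "fst e" G "snd e"]
  by (cases "fst e : carrier G") (auto simp: cname_def case_prod_beta)
 then show ?thesis by (simp add: euclidean_product_topology[symmetric] continuous_map_componentwise_UNIV)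
qed

lemma cname_inj:
 assumes "metric_features X d u"
 shows "inj_on (cname G u) (PiE (carrier G) (%_. space X))" proof (rule inj_onI)
 fix x y assume x: "x : PiE (carrier G) (%_. space X)" and y: "y : PiE (carrier G) (%_. space X)" and eq: "cname G u x = cname G u y"
 show "x = y" proof (rule PiE_ext[OF x y])
  fix g assume g: "g : carrier G"
  have "u j (x g) = u j (y g)" for j using fun_cong[OF eq, of "(g, j)"] g by (simp add: cname_def)
  then show "x g = y g" using assms PiE_mem[OF x g] PiE_mem[OF y g] unfolding metric_features_def by blast
 qed
qed

text \<open>On the compact space of configurations the name map is continuous and injective, hence an embedding.\<close>
lemma continuous_map_factors_through_names:
 assumes mf: "metric_features X d u" and f: "continuous_map (config_topology G X d) euclideanreal f"
 shows "EX F. continuous_on (cname G u ` PiE (carrier G) (%_. space X)) F &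
  (ALL x:PiE (carrier G) (%_. space X). F (cname G u x) = f x)"
  "compact (cname G u ` PiE (carrier G) (%_. space X))" proof -
 let ?S = "PiE (carrier G) (%_. space X)" and ?J = "cname G u"
 have M: "Metric_space (space X) d" and comp: "compact_space (Metric_space.mtopology (space X) d)" using mf unfolding metric_features_def by blast+
 have top: "topspace (config_topology G X d) = ?S" by (rule topspace_config_topology[OF M])
 have compS: "compact_space (config_topology G X d)" unfolding config_topology_def using comp by (simp add: compact_space_product_topology)
 note cont = continuous_cname[OF mf, of G]
 have "compactin euclidean (?J ` ?S)" using image_compactin[OF compS[unfolded compact_space_def] cont] unfolding top .
 then show "compact (?J ` ?S)" by simp
 define F where "F q = f (inv_into ?S ?J q)" for q
 have FJ: "F (?J x) = f x" if "x : ?S" for x using inv_into_f_f[OF cname_inj[OF mf] that] by (simp add: F_def)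
 have cont': "continuous_map (config_topology G X d) (top_of_set (?J ` ?S)) ?J" using cont top by (simp add: continuous_map_in_subtopology)
 have "Hausdorff_space (top_of_set (?J ` ?S))" unfolding euclidean_product_topology[symmetric]
  by (intro Hausdorff_space_subtopology) (simp add: Hausdorff_space_product_topology)
 then have "closed_map (config_topology G X d) (top_of_set (?J ` ?S)) ?J" by (intro continuous_imp_closed_map_gen compS cont' Hausdorff_imp_kc_space)
 then have "quotient_map (config_topology G X d) (top_of_set (?J ` ?S)) ?J" by (intro continuous_closed_imp_quotient_map cont') (simp_all add: top)
 moreover have "continuous_map (config_topology G X d) euclideanreal (F o ?J)" by (rule continuous_map_eq[OF f]) (simp add: top FJ)
 ultimately have "continuous_map (top_of_set (?J ` ?S)) euclideanreal F" by (rule continuous_compose_quotient_map)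
 then show "EX F. continuous_on (?J ` ?S) F & (ALL x:?S. F (?J x) = f x)" using FJ by (intro exI[of _ F]) simp
qed

lemma config_word_measurable:
 assumes "!!j. u j : bmeas X" "sets \<nu> = sets (configs G X)"
 shows "(%x. wval (cname G u x) w) : bmeas \<nu>" proof -
 have m: "(%x. cname G u x e) : bmeas \<nu>" for e by (rule cname_measurable[of u X, OF assms])
 show ?thesis by (induction w) (simp_all add: m borel_measurable_times)
qed

lemma continuous_map_config_measurable:
 fixes u :: "'j::countable => 'a => real"
 assumes G: "countable (carrier G)" and mf: "metric_features X d u"
  and f: "continuous_map (config_topology G X d) euclideanreal f" and \<nu>: "sets \<nu> = sets (configs G X)"
 shows "f : bmeas \<nu>" proof -
 let ?S = "PiE (carrier G) (%_. space X)"
 have sp: "space \<nu> = ?S" using sets_eq_imp_space_eq[OF \<nu>] by (simp add: space_PiM)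
 have u: "u j : bmeas X" for j using mf unfolding metric_features_def by blast
 have feat: "features (space X) u" using mf unfolding metric_features_def by blast
 obtain F where F: "continuous_on (cname G u ` ?S) F" "!!x. x : ?S ==> F (cname G u x) = f x" using continuous_map_factors_through_names(1)[OF mf f] by blast
 have sub: "cname G u ` ?S \<subseteq> cube G" using cname_in_cube[OF feat] by blast
 define good where "good n cs \<longleftrightarrow> (\<forall>(c, w)\<in>set cs. w : name_words G) &
  (ALL q:cname G u ` ?S. \<bar>F q - (\<Sum>(c, w)\<leftarrow>cs. c * wval q w)\<bar> < 1 / real (Suc n))" for n cs
 have "EX cs. good n cs" for n unfolding good_def by (rule word_approximation[OF G continuous_map_factors_through_names(2)[OF mf f] sub F(1)]) simp
 then obtain cs where cs: "!!n. good n (cs n)" by metis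
 show ?thesis proof (rule borel_measurable_LIMSEQ_real)
  show "(%x. \<Sum>(c, w)\<leftarrow>cs n. c * wval (cname G u x) w) : bmeas \<nu>" for n proof -
  have "(%x. \<Sum>(c, w)\<leftarrow>ds. c * wval (cname G u x) w) : bmeas \<nu>" for ds
  using config_word_measurable[OF u \<nu>] by (induction ds) (auto intro!: borel_measurable_add borel_measurable_times)
  then show ?thesis .
  qed
  fix x assume "x : space \<nu>"
  then have x: "x : ?S" using sp by simp
  let ?s = "%n. \<Sum>(c, w)\<leftarrow>cs n. c * wval (cname G u x) w"
  have "\<bar>?s n - f x\<bar> <= 1 / real (Suc n)" for n proof -
  have "\<bar>F (cname G u x) - ?s n\<bar> < 1 / real (Suc n)" using cs[of n] x unfolding good_def by blast
  then show ?thesis unfolding F(2)[OF x] by linarith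
  qed
  then have "(%n. ?s n - f x) ~~> 0" by (intro Lim_null_comparison[OF _ LIMSEQ_Suc[OF lim_const_over_n[of 1]]]) (auto intro!: always_eventually)
  then show "?s ~~> f x" by (simp add: LIM_zero_iff)
 qed
qed

definition word_nhd ::
 "('g, 'b) monoid_scheme => 'a measure => ('j => 'a => real) => ('g => 'a) measure => ('g \<times> 'j) list set => real => ('g => 'a) measure set" where
 "word_nhd G X u \<mu> W e = {\<nu>. prob_space \<nu> & sets \<nu> = sets (configs G X) &
  (ALL w:W. \<bar>(LINT x|\<nu>. wval (cname G u x) w) - (LINT x|\<mu>. wval (cname G u x) w)\<bar> < e)}"

lemma weak_star_openD:
 fixes u :: "'j::countable => 'a => real" and G :: "('g, 'b) monoid_scheme"
 assumes G: "countable (carrier G)" and mf: "metric_features X d u" and \<O>: "openin (weak_star G X d) \<O>" and \<mu>: "\<mu> : \<O>"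
 shows "prob_space \<mu> & sets \<mu> = sets (configs G X) &
  (EX W e. finite W & W \<subseteq> name_words G & e > 0 & word_nhd G X u \<mu> W e \<subseteq> \<O>)" proof -
 let ?B = "{{\<nu>. prob_space \<nu> & sets \<nu> = sets (configs G X) & integral\<^sup>L \<nu> f : U} |f U.
  continuous_map (config_topology G X d) euclideanreal f & open (U :: real set)}"
 define P where "P \<O> \<mu> \<longleftrightarrow> prob_space \<mu> & sets \<mu> = sets (configs G X) &
  (EX W e. finite W & W \<subseteq> name_words G & e > 0 & word_nhd G X u \<mu> W e \<subseteq> \<O>)" for \<O> \<mu>
 have PI: "P \<O> \<mu>" if "prob_space \<mu>" "sets \<mu> = sets (configs G X)"
  "finite W" "W \<subseteq> name_words G" "e > 0" "word_nhd G X u \<mu> W e \<subseteq> \<O>" for \<O> \<mu> W e using that unfolding P_def by blast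
 have PD: "prob_space \<mu>" "sets \<mu> = sets (configs G X)"
  "EX W e. finite W & W \<subseteq> name_words G & e > 0 & word_nhd G X u \<mu> W e \<subseteq> \<O>" if "P \<O> \<mu>" for \<O> \<mu>
  using that unfolding P_def by blast+
 have "generate_topology_on ?B \<O>" using \<O> unfolding weak_star_def by (rule openin_topology_generated_by)
 then have "ALL \<mu>:\<O>. P \<O> \<mu>" proof induction
  case Empty
  then show ?case by simp
 next
  case (Int a b)
  show ?case proof
  fix \<mu> assume m: "\<mu> : a \<inter> b"
  then have Pa: "P a \<mu>" and Pb: "P b \<mu>" using Int.IH by simp_all
  obtain W e where W: "finite W" "W \<subseteq> name_words G" "e > 0" "word_nhd G X u \<mu> W e \<subseteq> a" using PD(3)[OF Pa] by (elim exE conjE)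
  obtain W' e' where W': "finite W'" "W' \<subseteq> name_words G" "e' > 0" "word_nhd G X u \<mu> W' e' \<subseteq> b" using PD(3)[OF Pb] by (elim exE conjE)
  have "word_nhd G X u \<mu> (W \<union> W') (min e e') \<subseteq> word_nhd G X u \<mu> W e"
  "word_nhd G X u \<mu> (W \<union> W') (min e e') \<subseteq> word_nhd G X u \<mu> W' e'" unfolding word_nhd_def by auto
  then have sub: "word_nhd G X u \<mu> (W \<union> W') (min e e') \<subseteq> a \<inter> b" using W(4) W'(4) by blast
  show "P (a \<inter> b) \<mu>" by (rule PI[OF PD(1,2)[OF Pa] _ _ _ sub]) (use W W' in simp_all)
  qed
 next
  case (UN K)
  show ?case proof
  fix \<mu> assume "\<mu> : \<Union>K"
  then obtain k where k: "k : K" "\<mu> : k" by blast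
  have Pk: "P k \<mu>" using UN.IH[OF k(1)] k(2) by simp
  obtain W e where W: "finite W" "W \<subseteq> name_words G" "e > 0" "word_nhd G X u \<mu> W e \<subseteq> k" using PD(3)[OF Pk] by (elim exE conjE)
  have "word_nhd G X u \<mu> W e \<subseteq> \<Union>K" using W(4) k(1) by (rule order_trans[OF _ Union_upper])
  then show "P (\<Union>K) \<mu>" by (rule PI[OF PD(1,2)[OF Pk] W(1-3)])
  qed
 next
  case (Basis s)
  then obtain f U where s: "s = {\<nu>. prob_space \<nu> & sets \<nu> = sets (configs G X) & integral\<^sup>L \<nu> f : U}"
  and f: "continuous_map (config_topology G X d) euclideanreal f" and U: "open U" by blast
  show ?case proof
  fix \<mu> assume "\<mu> : s"
  then have p: "prob_space \<mu>" "sets \<mu> = sets (configs G X)" and i: "integral\<^sup>L \<mu> f : U" using s by auto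
  obtain r where r: "r > 0" "!!z. \<bar>z - integral\<^sup>L \<mu> f\<bar> < r ==> z : U" using U i by (auto simp: open_dist dist_real_def)
  let ?S = "PiE (carrier G) (%_. space X)" and ?J = "cname G u"
  have u: "u j : bmeas X" for j using mf unfolding metric_features_def by blast
  have feat: "features (space X) u" using mf unfolding metric_features_def by blast
  obtain F where F: "continuous_on (?J ` ?S) F" "!!x. x : ?S ==> F (?J x) = f x" using continuous_map_factors_through_names(1)[OF mf f] by blast
  have sub: "?J ` ?S \<subseteq> cube G" using cname_in_cube[OF feat] by blast
  obtain W e where W: "finite W" "W \<subseteq> name_words G" "e > 0" and det:
  "\<forall>(P :: ('g => 'a) measure) Z (P' :: ('g => 'a) measure) Z'.
  prob_space P --> prob_space P' -->
  (ALL p:space P. Z p : ?J ` ?S) --> (ALL p:space P'. Z' p : ?J ` ?S) -->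
  (ALL e. (%p. Z p e) : bmeas P) --> (ALL e. (%p. Z' p e) : bmeas P') -->
  (%p. F (Z p)) : bmeas P --> (%p. F (Z' p)) : bmeas P' -->
  (ALL w:W. \<bar>(LINT p|P. wval (Z p) w) - (LINT p|P'. wval (Z' p) w)\<bar> < e) -->
  \<bar>(LINT p|P. F (Z p)) - (LINT p|P'. F (Z' p))\<bar> < r" using words_determine_integrals[OF G continuous_map_factors_through_names(2)[OF mf f] sub F(1) r(1),
  where 'p = "'g => 'a" and 'q = "'g => 'a"] by (elim exE conjE)
  have sp: "space \<nu> = ?S" if "sets \<nu> = sets (configs G X)" for \<nu> :: "('g => 'a) measure" using sets_eq_imp_space_eq[OF that] by (simp add: space_PiM)
  have Ff: "(LINT x|\<nu>. F (?J x)) = integral\<^sup>L \<nu> f" "(%x. F (?J x)) : bmeas \<nu>" if "sets \<nu> = sets (configs G X)" for \<nu> proof -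
  show "(LINT x|\<nu>. F (?J x)) = integral\<^sup>L \<nu> f" by (intro Bochner_Integration.integral_cong refl) (simp add: sp[OF that] F(2))
  show "(%x. F (?J x)) : bmeas \<nu>" using continuous_map_config_measurable[OF G mf f that]
  by (subst measurable_cong[of \<nu> _ f]) (simp_all add: sp[OF that] F(2))
  qed
  have "word_nhd G X u \<mu> W e \<subseteq> s" proof
  fix \<nu> assume n: "\<nu> : word_nhd G X u \<mu> W e"
  then have pn: "prob_space \<nu>" "sets \<nu> = sets (configs G X)" unfolding word_nhd_def by auto
  have "\<bar>(LINT x|\<nu>. F (?J x)) - (LINT x|\<mu>. F (?J x))\<bar> < r" by (rule det[rule_format, OF pn(1) p(1)])
  (use n pn p in \<open>auto simp: sp word_nhd_def intro: Ff(2) cname_measurable[OF u]\<close>)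
  then have "integral\<^sup>L \<nu> f : U" unfolding Ff(1)[OF pn(2)] Ff(1)[OF p(2)] by (rule r(2))
  with pn show "\<nu> : s" unfolding s by simp
  qed
  then show "P s \<mu>" by (rule PI[OF p W])
  qed
 qed
 with \<mu> have "P \<O> \<mu>" by simp
 then show ?thesis unfolding P_def .
qed

lemma word_nhd_nhd:
 fixes G :: "('g, 'b) monoid_scheme"
 assumes mf: "metric_features X d u" and \<mu>: "prob_space \<mu>" "sets \<mu> = sets (configs G X)" and W: "finite W" "W \<subseteq> name_words G" and e: "e > 0"
 shows "word_nhd G X u \<mu> W e : weak_star_nhds G X d \<mu>" proof -
 let ?I = "%w \<nu>. \<integral>x. wval (cname G u x) w \<partial>\<nu>"
 let ?B = "{{\<nu>. prob_space \<nu> & sets \<nu> = sets (configs G X) & integral\<^sup>L \<nu> f : U} |f U.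
  continuous_map (config_topology G X d) euclideanreal f & open (U :: real set)}"
 have basic: "openin (weak_star G X d) {\<nu>. prob_space \<nu> & sets \<nu> = sets (configs G X) & integral\<^sup>L \<nu> f : U}"
  if "continuous_map (config_topology G X d) euclideanreal f" "open U" for f and U :: "real set"
  unfolding weak_star_def by (rule topology_generated_by_Basis) (use that in blast)
 have word_open: "openin (weak_star G X d) (word_nhd G X u \<mu> {w} e)" if "w : W" for w proof -
  have "open {z. \<bar>z - ?I w \<mu>\<bar> < e}" by (intro open_Collect_less continuous_intros)
  from basic[OF continuous_config_word[OF mf, of w G] this] that W(2)
  show ?thesis unfolding word_nhd_def by auto
 qed
 have empty_open: "openin (weak_star G X d) (word_nhd G X u \<mu> {} e)" using basic[of "%_. 0" UNIV] by (simp add: word_nhd_def)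
 have "openin (weak_star G X d) (word_nhd G X u \<mu> W e)" using W(1) word_open proof (induction W)
  case (insert w W)
  have "word_nhd G X u \<mu> (insert w W) e = word_nhd G X u \<mu> {w} e \<inter> word_nhd G X u \<mu> W e" unfolding word_nhd_def by auto
  then show ?case using insert by (metis insertCI openin_Int)
 qed (rule empty_open)
 moreover have "\<mu> : word_nhd G X u \<mu> W e" unfolding word_nhd_def using \<mu> e by simp
 ultimately show ?thesis unfolding weak_star_nhds_def by blast
qed

section \<open>Sofic entropy as growth\<close>

text \<open>What is needed from a metric process that represents the system: its features generate, its words have the right integrals, and finitely many features dominate the metric up to an error.\<close>
definition metric_coding ::
 "('g, 'b) monoid_scheme => 'x measure => ('g => 'x => 'x) => 'a measure => ('a => 'a => real) => ('j => 'a => real) =>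
  ('g => 'a) measure => ('x => 'a) => bool" where
 "metric_coding G N T X d u \<mu> \<xi> \<longleftrightarrow>
  metric_features X d u & prob_space \<mu> & sets \<mu> = sets (configs G X) &
  coding N (space X) u \<xi> & generates G N T u \<xi> UNIV &
  (ALL w:name_words G. (LINT x|\<mu>. wval (cname G u x) w) = (LINT m|N. wval (name G u T \<xi> m) w)) &
  (\<forall>\<delta>>0. EX J C. finite J & 0 <= C & (ALL x:space X. ALL y:space X. d x y <= \<delta> + C * (\<Sum>j\<in>J. \<bar>u j x - u j y\<bar>)))"

lemma metric_codingD:
 assumes "metric_coding G N T X d u \<mu> \<xi>"
 shows "metric_features X d u" "prob_space \<mu>" "sets \<mu> = sets (configs G X)"
  "coding N (space X) u \<xi>" "generates G N T u \<xi> UNIV"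
  "w : name_words G ==> (LINT x|\<mu>. wval (cname G u x) w) = (LINT m|N. wval (name G u T \<xi> m) w)"
  "\<delta> > 0 ==> EX J C. finite J & 0 <= C & (ALL x:space X. ALL y:space X. d x y <= \<delta> + C * (\<Sum>j\<in>J. \<bar>u j x - u j y\<bar>))"
 using assms unfolding metric_coding_def by blast+

lemma frequently_less_limsup:
 fixes f :: "nat => ereal"
 assumes "c < limsup f"
 shows "\<exists>\<^sub>F n in sequentially. c < f n" using assms Limsup_bounded[of f c sequentially] by (force simp: frequently_def not_less)

lemma limsup_ge_frequently:
 fixes f :: "nat => ereal"
 assumes "\<exists>\<^sub>F n in sequentially. c <= f n"
 shows "c <= limsup f" proof (rule ccontr)
 assume "~ c <= limsup f"
 then have "\<forall>\<^sub>F n in sequentially. f n < c" by (intro Limsup_lessD) auto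
 with assms show False by (auto simp: frequently_def not_le)
qed

lemma frequently_subsequence:
 assumes "!!t::nat. \<exists>\<^sub>F n in sequentially. P t n"
 shows "\<exists>r::nat => nat. strict_mono r & (ALL t. P t (r t))" proof -
 have ex: "\<exists>n>m. P t n" for t m using assms[of t] unfolding frequently_def eventually_sequentially by (metis Suc_le_eq)
 have "EX r. ALL t. P t (r t) & r t < r (Suc t)" by (rule dependent_nat_choice) (use ex in blast)+
 then show ?thesis by (auto simp: strict_mono_Suc_iff)
qed

lemma separated_subset_exists:
 assumes far: "!!F. finite F ==> F \<subseteq> Z ==> card F < K ==> EX z:Z. ALL y:F. ~ D z y" and D: "!!z. z : Z ==> D z z" "!!y z. D y z ==> D z y"
 shows "\<exists>S\<subseteq>Z. finite S & card S = K & (ALL x:S. ALL y:S. x ~= y --> ~ D x y)" proof -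
 have "k <= K ==> \<exists>S\<subseteq>Z. finite S & card S = k & (ALL x:S. ALL y:S. x ~= y --> ~ D x y)" for k proof (induction k)
  case 0
  then show ?case by (intro exI[of _ "{}"]) simp
 next
  case (Suc k)
  then obtain S where S: "S \<subseteq> Z" "finite S" "card S = k" "ALL x:S. ALL y:S. x ~= y --> ~ D x y" by auto
  then obtain z where z: "z : Z" "ALL y:S. ~ D z y" using far[of S] Suc.prems by auto
  then have "z ~: S" using D(1) by blast
  with S z D(2) show ?case by (intro exI[of _ "insert z S"]) auto
 qed
 then show ?thesis by blast
qed

lemma pullback_name_in_PiE:
 assumes "!!v. v : V ==> x v : A" "!!g v. g : carrier G ==> v : V ==> s g v : V" "v : V"
 shows "pullback_name G s v x : PiE (carrier G) (%_. A)" using assms by (auto simp: pullback_name_def)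

lemma empirical_distribution_props:
 assumes V: "finite V" "V ~= {}" and x: "!!v. v : V ==> x v : space X" and s: "!!g v. g : carrier G ==> v : V ==> s g v : V"
 shows "prob_space (empirical_distribution G X V s x)"
  "sets (empirical_distribution G X V s x) = sets (configs G X)"
  "f : bmeas (configs G X) ==>
  integral\<^sup>L (empirical_distribution G X V s x) f = vavg V (%v. f (pullback_name G s v x))" proof -
 have m: "(%v. pullback_name G s v x) : measurable (uniform_count_measure V) (configs G X)" proof (rule measurableI)
  show "pullback_name G s v x : space (configs G X)" if "v : space (uniform_count_measure V)" for v
  using that pullback_name_in_PiE[of V x "space X" G s] x s by (simp add: space_uniform_count_measure space_PiM)
 qed (auto simp: space_uniform_count_measure sets_uniform_count_measure)
 show "prob_space (empirical_distribution G X V s x)" unfolding empirical_distribution_def using m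
  by (rule prob_space.prob_space_distr[OF prob_space_uniform_count_measure[OF V]])
 show "sets (empirical_distribution G X V s x) = sets (configs G X)" by (simp add: empirical_distribution_def)
 show "integral\<^sup>L (empirical_distribution G X V s x) f = vavg V (%v. f (pullback_name G s v x))" if "f : bmeas (configs G X)"
  unfolding empirical_distribution_def integral_distr[OF m that] by (simp add: vavg_eq_integral[OF V(1)])
qed

lemma empirical_word:
 assumes act: "almost_action G V \<sigma>" and x: "!!v. v : V n ==> x v : space X" and u: "!!j. u j : bmeas X"
 shows "(LINT y|empirical_distribution G X (V n) (\<sigma> n) x. wval (cname G u y) w) =
  vavg (V n) (%v. wval (name G u (\<sigma> n) x v) w)" proof -
 have m: "(%y. wval (cname G u y) w) : bmeas (configs G X)" by (rule config_word_measurable[of u X, OF u refl])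
 show ?thesis using empirical_distribution_props(3)[OF almost_actionD(1,2)[OF act] x almost_actionD(4)[OF act] m] by (simp add: name_eq_cname)
qed

lemma good_models_wordD:
 assumes act: "almost_action G V \<sigma>" and mc: "metric_coding G N T X d u \<mu> \<xi>" and W: "W \<subseteq> name_words G"
  and x: "x : good_models G X (V n) (\<sigma> n) (word_nhd G X u \<mu> W e)" and w: "w : W"
 shows "model_error G N T u \<xi> (V n) (\<sigma> n) (word w) x < e" proof -
 have xs: "!!v. v : V n ==> x v : space X" and ed: "empirical_distribution G X (V n) (\<sigma> n) x : word_nhd G X u \<mu> W e" using x unfolding good_models_def by auto
 have u: "!!j. u j : bmeas X" using metric_codingD(1)[OF mc] unfolding metric_features_def by blast
 from ed w have "\<bar>(LINT y|empirical_distribution G X (V n) (\<sigma> n) x. wval (cname G u y) w) -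
  (LINT x|\<mu>. wval (cname G u x) w)\<bar> < e" unfolding word_nhd_def by blast
 moreover have "w : name_words G" using w W by blast
 moreover have "(LINT y|empirical_distribution G X (V n) (\<sigma> n) x. wval (cname G u y) w) =
  vavg (V n) (%v. wval (name G u (\<sigma> n) x v) w)" by (rule empirical_word[OF act xs u])
 ultimately show ?thesis unfolding model_error_def by (simp add: metric_codingD(6)[OF mc])
qed

lemma hamming_average_eq_vavg: "hamming_average V d x y = vavg V (%v. d (x v) (y v))" by (simp add: hamming_average_def vavg_def)

lemma hamming_le_features:
 assumes V: "finite V" "V ~= {}" and dom: "!!a b. a : A ==> b : A ==> d a b <= \<delta> + C * (\<Sum>j\<in>J. \<bar>u j a - u j b\<bar>)"
  and x: "!!v. v : V ==> x v : A" and y: "!!v. v : V ==> y v : A"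
 shows "hamming_average V d x y <= \<delta> + C * fdist u J V x y" proof -
 have "hamming_average V d x y <= vavg V (%v. \<delta> + C * (\<Sum>j\<in>J. \<bar>u j (x v) - u j (y v)\<bar>))"
  unfolding hamming_average_eq_vavg by (intro vavg_mono dom x y)
 also have "... = \<delta> + C * fdist u J V x y" by (simp add: vavg_add vavg_const[OF V] vavg_cmult fdist_def)
 finally show ?thesis .
qed

lemma log_enat_less_card:
 assumes "c < log_enat (cov \<delta> Z D) / ereal (real n)" "0 < n" "finite F" "F \<subseteq> Z" "ALL z:Z. EX y:F. D z y < \<delta>"
 shows "F ~= {}" "c = ereal b ==> exp (b * real n) < real (card F)" proof -
 have "cov \<delta> Z D <= enat (card F)" unfolding cov_def by (rule INF_lower) (use assms in auto)
 then obtain k where k: "cov \<delta> Z D = enat k" "k <= card F" by (cases "cov \<delta> Z D") auto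
 have k0: "k ~= 0" proof
  assume "k = 0"
  then have "log_enat (cov \<delta> Z D) / ereal (real n) = - \<infinity>" using assms(2) by (simp add: k log_enat_def)
  with assms(1) show False by simp
 qed
 with k show "F ~= {}" by auto
 show "exp (b * real n) < real (card F)" if "c = ereal b" proof -
  have "b < ln (real k) / real n" using assms(1,2) k0 that by (simp add: k log_enat_def)
  then have "b * real n < ln (real k)" using assms(2) by (simp add: less_divide_eq)
  then have "exp (b * real n) < real k" using k0 by (metis exp_less_mono exp_ln of_nat_0_less_iff not_gr_zero)
  with k(2) show ?thesis by linarith
 qed
qed

lemma Metric_space_hamming:
 assumes "Metric_space M d"
 shows "(!!v. v : V ==> x v : M) ==> hamming_average V d x x = 0"
  "hamming_average V d x y = hamming_average V d y x"
  "(!!v. v : V ==> x v : M) ==> (!!v. v : V ==> y v : M) ==> (!!v. v : V ==> z v : M) ==>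
  hamming_average V d x z <= hamming_average V d x y + hamming_average V d y z" proof -
 interpret Metric_space M d by fact
 show "hamming_average V d x x = 0" if "!!v. v : V ==> x v : M" using that by (simp add: hamming_average_def)
 show "hamming_average V d x y = hamming_average V d y x" by (simp add: hamming_average_def commute)
 show "hamming_average V d x z <= hamming_average V d x y + hamming_average V d y z" if "!!v. v : V ==> x v : M" "!!v. v : V ==> y v : M" "!!v. v : V ==> z v : M"
  unfolding hamming_average_eq_vavg vavg_add[symmetric] using that by (intro vavg_mono triangle) auto
qed

context pmp_action begin

text \<open>A diagonal sequence: at stage $t$ the first $t$ words are required to be correct up to $1/(t+1)$.\<close>
lemma has_growthI_words:
 fixes u :: "'j::countable => 'a => real" and V :: "nat => 'v set"
 assumes cod: "coding N A u \<xi>" and act: "almost_action G V \<sigma>" and J: "finite J" and \<eta>: "\<eta> > 0"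
  and freq: "!!W e. finite W ==> W \<subseteq> name_words G ==> e > 0 ==> \<exists>\<^sub>F i in sequentially. separated_models (c) (V i) (A) W e (model_error G N T u \<xi> (V i) (\<sigma> i)) \<eta> u J"
 shows "has_growth G N T A u \<xi> V \<sigma> c" proof -
 let ?Words = "name_words G :: ('g \<times> 'j) list set"
 have cW: "countable ?Words" using countable_group by (intro countable_lists countable_SIGMA) auto
 define W where "W t = from_nat_into ?Words ` {..t}" for t :: nat
 have Wsub: "W t \<subseteq> ?Words" for t proof -
  have "[] : ?Words" by simp
  then have "?Words ~= {}" by blast
  from from_nat_into[OF this] show ?thesis unfolding W_def by (rule image_subsetI)
 qed
 define ok where "ok t i S \<longleftrightarrow> finite S & exp (c * real (card (V i))) <= real (card S) &
  (ALL x:S. (ALL v:V i. x v : A) & (ALL w:W t. model_error G N T u \<xi> (V i) (\<sigma> i) (word w) x < 1 / real (Suc t))) &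
  (ALL x:S. ALL y:S. x ~= y --> \<eta> <= fdist u J (V i) x y)" for t i S
 have "\<exists>\<^sub>F i in sequentially. EX S. ok t i S" for t unfolding ok_def by (rule freq[OF _ Wsub]) (auto simp: W_def)
 from frequently_subsequence[of "%t i. EX S. ok t i S", OF this]
 obtain r where r: "strict_mono r" and "ALL t. EX S. ok t (r t) S" by blast
 then obtain S where S: "!!t. ok t (r t) (S t)" by metis
 have good: "good_seq G N T A u \<xi> (V o r) (\<sigma> o r) S" proof (rule good_seq_words[OF cod almost_action_subseq[OF act r]])
  show "x v : A" if "x : S i" "v : (V o r) i" for i x v using that S[of i] unfolding ok_def by auto
  fix w :: "('g \<times> 'j) list" and e :: real assume w: "w : name_words G" and e: "e > 0"
  obtain s where s: "w = from_nat_into ?Words s" using from_nat_into_surj[OF cW w] by metis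
  obtain k where k: "1 / real (Suc k) < e" using e by (metis nat_approx_posE)
  show "EV i. ALL x:S i. model_error G N T u \<xi> ((V o r) i) ((\<sigma> o r) i) (word w) x < e" unfolding eventually_sequentially
  proof (intro exI[of _ "max s k"] allI impI ballI)
  fix t x assume t: "max s k <= t" and x: "x : S t"
  have "w : W t" using t s by (auto simp: W_def)
  with x S[of t] have "model_error G N T u \<xi> (V (r t)) (\<sigma> (r t)) (word w) x < 1 / real (Suc t)" unfolding ok_def by blast
  also have "... <= 1 / real (Suc k)" using t by (intro divide_left_mono) auto
  finally show "model_error G N T u \<xi> ((V o r) t) ((\<sigma> o r) t) (word w) x < e" using k by simp
  qed
 qed
 show ?thesis proof (rule has_growthI[OF r good J \<eta>], rule always_eventually, rule allI)
  fix t
  show "finite (S t) & exp (c * real (card (V (r t)))) <= real (card (S t)) &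
  (ALL x:S t. ALL y:S t. x ~= y --> \<eta> <= fdist u J (V (r t)) x y)" using S[of t] unfolding ok_def by blast
 qed
qed

text \<open>A set that cannot be covered by few small balls contains many separated points, and separated points differ in finitely many features.\<close>
theorem process_entropy_imp_growth:
 fixes u :: "'j::countable => 'a => real" and V :: "nat => 'v set"
 assumes mc: "metric_coding G N T X d u \<mu> \<xi>" and act: "almost_action G V \<sigma>"
  and ent: "c < process_entropy G V \<sigma> X d \<mu>" and c: "c = ereal b & 0 <= b \<or> c = - \<infinity> & b = 0"
 shows "has_growth G N T (space X) u \<xi> V \<sigma> b" proof -
 note mf = metric_codingD(1)[OF mc] and cod = metric_codingD(4)[OF mc]
 have M: "Metric_space (space X) d" using mf unfolding metric_features_def by blast
 obtain \<delta> where \<delta>: "\<delta> > 0" and inf: "c < (INF \<O>\<in>weak_star_nhds G X d \<mu>.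
  limsup (%n. log_enat (cov \<delta> (good_models G X (V n) (\<sigma> n) \<O>) (hamming_average (V n) d)) / ereal (real (card (V n)))))"
  using ent unfolding process_entropy_def less_SUP_iff by auto
 note V = almost_actionD(1,2)[OF act]
 have Vc: "card (V n) > 0" for n using V[of n] by (simp add: card_gt_0_iff)
 obtain J C where J: "finite J" and C: "0 <= C" and dom: "!!x y. x : space X ==> y : space X ==> d x y <= \<delta> / 2 + C * (\<Sum>j\<in>J. \<bar>u j x - u j y\<bar>)"
  using metric_codingD(7)[OF mc, of "\<delta> / 2"] \<delta> by auto
 define \<eta> where "\<eta> = \<delta> / (2 * (C + 1))"
 have \<eta>: "\<eta> > 0" using \<delta> C by (simp add: \<eta>_def)
 show ?thesis proof (rule has_growthI_words[OF cod act J \<eta>])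
  fix W :: "('g \<times> 'j) list set" and e :: real assume W: "finite W" "W \<subseteq> name_words G" and e: "e > 0"
  define Z where "Z n = good_models G X (V n) (\<sigma> n) (word_nhd G X u \<mu> W e)" for n
  have "\<exists>\<^sub>F n in sequentially. c < log_enat (cov \<delta> (Z n) (hamming_average (V n) d)) / ereal (real (card (V n)))"
  unfolding Z_def by (rule frequently_less_limsup[OF less_INF_D[OF inf word_nhd_nhd[OF mf metric_codingD(2,3)[OF mc] W e]]])
  then show "\<exists>\<^sub>F i in sequentially. separated_models (b) (V i) (space X) W e (model_error G N T u \<xi> (V i) (\<sigma> i)) \<eta> u J"
  proof (rule frequently_elim1)
  fix n assume big: "c < log_enat (cov \<delta> (Z n) (hamming_average (V n) d)) / ereal (real (card (V n)))"
  let ?H = "hamming_average (V n) d" and ?K = "nat \<lceil>exp (b * real (card (V n)))\<rceil>"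
  have Zsp: "z v : space X" if "z : Z n" "v : V n" for z v using that unfolding Z_def good_models_def by auto
  have "\<exists>S\<subseteq>Z n. finite S & card S = ?K & (ALL x:S. ALL y:S. x ~= y --> ~ ?H x y < \<delta>)" proof (rule separated_subset_exists)
  fix F assume F: "finite F" "F \<subseteq> Z n" "card F < ?K"
  show "EX z:Z n. ALL y:F. ~ ?H z y < \<delta>" proof (rule ccontr)
  assume "~ ?thesis"
  then have cov: "ALL z:Z n. EX y:F. ?H z y < \<delta>" by blast
  note L = log_enat_less_card[OF big Vc F(1,2) cov]
  from c show False proof
  assume "c = ereal b & 0 <= b"
  then have "exp (b * real (card (V n))) < real (card F)" using L(2) by blast
  with F(3) show False by linarith
  next
  assume "c = - \<infinity> & b = 0"
  then have "card F = 0" using F(3) by simp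
  with L(1) F(1) show False by simp
  qed
  qed
  next
  fix z assume "z : Z n"
  then have "?H z z = 0" by (intro Metric_space_hamming(1)[OF M] Zsp)
  with \<delta> show "?H z z < \<delta>" by simp
  next
  fix y z assume "?H y z < \<delta>"
  then show "?H z y < \<delta>" by (simp only: Metric_space_hamming(2)[OF M, of _ z y])
  qed
  then obtain S where S: "S \<subseteq> Z n" "finite S" "card S = ?K" "!!x y. x : S ==> y : S ==> x ~= y ==> ~ ?H x y < \<delta>" by blast
  have far: "\<eta> <= fdist u J (V n) x y" if xy: "x : S" "y : S" "x ~= y" for x y proof -
  have "\<delta> <= ?H x y" using S(4)[OF xy] by simp
  also have "... <= \<delta> / 2 + C * fdist u J (V n) x y" by (rule hamming_le_features[OF V dom]) (use xy S(1) Zsp in auto)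
  finally have "\<delta> / 2 <= C * fdist u J (V n) x y" by linarith
  also have "... <= (C + 1) * fdist u J (V n) x y" using fdist_nonneg[of u J "V n" x y] by (simp add: distrib_right)
  finally show ?thesis using C by (simp add: \<eta>_def divide_le_eq algebra_simps)
  qed
  have "model_error G N T u \<xi> (V n) (\<sigma> n) (word w) x < e" if "x : S" "w : W" for x w
  by (rule good_models_wordD[OF act mc W(2) _ that(2)]) (use that(1) S(1) in \<open>auto simp: Z_def\<close>)
  moreover have "exp (b * real (card (V n))) <= real (card S)" unfolding S(3) by linarith
  ultimately show "separated_models (b) (V n) (space X) W e (model_error G N T u \<xi> (V n) (\<sigma> n)) \<eta> u J"
  using S(1,2) Zsp far by (intro exI[of _ S]) auto
  qed
 qed
qed

text \<open>Points that are separated by features are far apart in the metric, because features are Lipschitz.\<close>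
theorem growth_imp_process_entropy:
 fixes u :: "'j::countable => 'a => real" and V :: "nat => 'v set"
 assumes mc: "metric_coding G N T X d u \<mu> \<xi>" and act: "almost_action G V \<sigma>" and growth: "has_growth G N T (space X) u \<xi> V \<sigma> b"
 shows "ereal b <= process_entropy G V \<sigma> X d \<mu>" proof -
 note mf = metric_codingD(1)[OF mc] and cod = metric_codingD(4)[OF mc]
 have M: "Metric_space (space X) d" using mf unfolding metric_features_def by blast
 have um: "u j : bmeas X" for j using mf unfolding metric_features_def by blast
 obtain L where L: "L > 0" "!!j x y. x : space X ==> y : space X ==> \<bar>u j x - u j y\<bar> <= L * d x y" using mf unfolding metric_features_def by blast
 obtain r S J \<eta> where wit: "growth_wit G N T (space X) u \<xi> V \<sigma> b r S J \<eta>" using growth unfolding has_growth_def by blast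
 note r = growth_witD(1)[OF wit] and good = growth_witD(2)[OF wit] and J = growth_witD(3)[OF wit]
  and \<eta> = growth_witD(4)[OF wit] and S = growth_witD(5,6)[OF wit] and sep = growth_witD(7)[OF wit]
 have Vn: "finite (V n)" "V n ~= {}" "card (V n) > 0" for n using almost_actionD(1,2)[OF act, of n] by (simp_all add: card_gt_0_iff)
 have Ssp: "x v : space X" if "x : S i" "v : V (r i)" for x v i using good that unfolding good_seq_def by simp
 define K where "K = L * (real (card J) + 1)"
 have K: "K > 0" using L by (simp add: K_def)
 define \<delta> where "\<delta> = \<eta> / (2 * K)"
 have \<delta>: "\<delta> > 0" using \<eta> K by (simp add: \<delta>_def)
 have "ereal b <= limsup (%n. log_enat (cov \<delta> (good_models G X (V n) (\<sigma> n) \<O>) (hamming_average (V n) d)) / ereal (real (card (V n))))"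
  if \<O>: "\<O> : weak_star_nhds G X d \<mu>" for \<O> proof (rule limsup_ge_frequently)
  let ?f = "%n. log_enat (cov \<delta> (good_models G X (V n) (\<sigma> n) \<O>) (hamming_average (V n) d)) / ereal (real (card (V n)))"
  obtain W e where W: "finite W" "W \<subseteq> name_words G" "e > 0" "word_nhd G X u \<mu> W e \<subseteq> \<O>"
  using weak_star_openD[OF countable_group mf, of \<O> \<mu>] \<O> unfolding weak_star_nhds_def by blast
  have "EV i. ALL w:W. ALL x:S i. model_error G N T u \<xi> (V (r i)) (\<sigma> (r i)) (word w) x < e" proof (intro eventually_ball_finite W(1) ballI)
  fix w assume "w : W"
  then have "loc_lip G UNIV (word w)" using W(2) by (intro ll_word) auto
  with good W(3) show "EV i. ALL x:S i. model_error G N T u \<xi> (V (r i)) (\<sigma> (r i)) (word w) x < e" unfolding good_seq_def by simp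
  qed
  then have "EV i. ereal b <= ?f (r i)" proof eventually_elim
  case (elim i)
  let ?V = "V (r i)" and ?Z = "good_models G X (V (r i)) (\<sigma> (r i)) \<O>"
  have mem: "restrict x ?V : ?Z" if x: "x : S i" for x proof -
  have rx: "!!v. v : ?V ==> restrict x ?V v : space X" using Ssp[OF x] by simp
  have ed: "prob_space (empirical_distribution G X ?V (\<sigma> (r i)) (restrict x ?V))"
  "sets (empirical_distribution G X ?V (\<sigma> (r i)) (restrict x ?V)) = sets (configs G X)"
  by (rule empirical_distribution_props[OF Vn(1,2) rx almost_actionD(4)[OF act]]; assumption)+
  have "name G u (\<sigma> (r i)) (restrict x ?V) v = name G u (\<sigma> (r i)) x v" if "v : ?V" for v
  using almost_actionD(4)[OF act _ that] by (auto simp: name_def)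
  then have vc: "vavg ?V (%v. wval (name G u (\<sigma> (r i)) (restrict x ?V) v) w) =
  vavg ?V (%v. wval (name G u (\<sigma> (r i)) x v) w)" for w by (intro vavg_cong) simp
  have "(LINT y|empirical_distribution G X ?V (\<sigma> (r i)) (restrict x ?V). wval (cname G u y) w) =
  vavg ?V (%v. wval (name G u (\<sigma> (r i)) x v) w)" for w unfolding vc[symmetric] by (rule empirical_word[OF act rx um])
  moreover have "\<bar>vavg ?V (%v. wval (name G u (\<sigma> (r i)) x v) w) - (LINT x|\<mu>. wval (cname G u x) w)\<bar> < e" if w: "w : W" for w proof -
  have "w : name_words G" using w W(2) by blast
  from metric_codingD(6)[OF mc this] elim w x show ?thesis unfolding model_error_def by force
  qed
  ultimately have "empirical_distribution G X ?V (\<sigma> (r i)) (restrict x ?V) : word_nhd G X u \<mu> W e" using ed(1,2) unfolding word_nhd_def by simp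
  then have "empirical_distribution G X ?V (\<sigma> (r i)) (restrict x ?V) : \<O>" using W(4) by blast
  with rx show ?thesis unfolding good_models_def by auto
  qed
  have lower: "card (S i) <= card F" if F: "finite F" "F \<subseteq> ?Z" "ALL z:?Z. EX y:F. hamming_average ?V d z y < \<delta>" for F proof -
  have "ALL x:S i. EX y:F. hamming_average ?V d (restrict x ?V) y < \<delta>" using F(3) mem by blast
  then obtain h where h: "!!x. x : S i ==> h x : F & hamming_average ?V d (restrict x ?V) (h x) < \<delta>" by metis
  have "inj_on h (S i)" proof (rule inj_onI, rule ccontr)
  fix x y assume xy: "x : S i" "y : S i" "h x = h y" "x ~= y"
  have hsp: "h x v : space X" if "v : ?V" for v using h[OF xy(1)] F(2) that unfolding good_models_def by auto
  have res: "hamming_average ?V d (restrict z ?V) w = hamming_average ?V d z w" for z w by (simp add: hamming_average_def)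
  have "hamming_average ?V d x y <= hamming_average ?V d x (h x) + hamming_average ?V d (h x) y" by (rule Metric_space_hamming(3)[OF M]) (use Ssp xy hsp in auto)
  also have "... < 2 * \<delta>" using h[OF xy(1)] h[OF xy(2)] xy(3) Metric_space_hamming(2)[OF M, of ?V y "h y"] unfolding res by simp
  finally have ham: "hamming_average ?V d x y < 2 * \<delta>" .
  have "\<eta> <= fdist u J ?V x y" by (rule sep[OF xy(1,2,4)])
  also have "... <= vavg ?V (%v. \<Sum>j\<in>J. L * d (x v) (y v))" unfolding fdist_def using Ssp xy by (intro vavg_mono sum_mono L(2)) auto
  also have "... = real (card J) * L * hamming_average ?V d x y" by (simp add: hamming_average_eq_vavg vavg_cmult[symmetric] mult.assoc)
  also have "... <= K * hamming_average ?V d x y" proof -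
  have "0 <= hamming_average ?V d x y" unfolding hamming_average_eq_vavg using Metric_space.nonneg[OF M] by (intro vavg_nonneg) auto
  then show ?thesis using L(1) by (intro mult_right_mono) (auto simp: K_def algebra_simps)
  qed
  also have "... < K * (2 * \<delta>)" using ham K by (intro mult_strict_left_mono) auto
  also have "... = \<eta>" using K by (simp add: \<delta>_def)
  finally show False by simp
  qed
  then show ?thesis using h F(1) by (intro card_inj_on_le[of h]) auto
  qed
  have cv: "enat (card (S i)) <= cov \<delta> ?Z (hamming_average ?V d)" unfolding cov_def by (rule INF_greatest) (use lower in auto)
  have pos: "card (S i) > 0" using S(2)[of i] by (metis exp_gt_zero gr0I not_le of_nat_0)
  have lnS: "b * real (card ?V) <= ln (real (card (S i)))" using S(2)[of i] pos by (subst ln_ge_iff) auto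
  show ?case proof (cases "cov \<delta> ?Z (hamming_average ?V d)")
  case (enat k)
  then have k: "card (S i) <= k" using cv by simp
  then have "ln (real (card (S i))) <= ln (real k)" using pos by simp
  with lnS have "b * real (card ?V) <= ln (real k)" by linarith
  then have "b <= ln (real k) / real (card ?V)" using Vn(3)[of "r i"] by (simp add: le_divide_eq)
  then show ?thesis using enat k pos Vn(3)[of "r i"] by (simp add: log_enat_def)
  next
  case infinity
  then show ?thesis using Vn(3)[of "r i"] by (simp add: log_enat_def)
  qed
  qed
  then show "\<exists>\<^sub>F n in sequentially. ereal b <= ?f n" unfolding frequently_def eventually_sequentially
  by (metis (no_types, lifting) le_cases order.trans r seq_suble)
 qed
 then have "ereal b <= (INF \<O>\<in>weak_star_nhds G X d \<mu>.
  limsup (%n. log_enat (cov \<delta> (good_models G X (V n) (\<sigma> n) \<O>) (hamming_average (V n) d)) / ereal (real (card (V n)))))" by (rule INF_greatest)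
 also have "... <= process_entropy G V \<sigma> X d \<mu>" unfolding process_entropy_def using \<delta> by (intro SUP_upper2[of \<delta>]) auto
 finally show ?thesis .
qed

end

section \<open>Second moments and pair convergence\<close>

lemma metric_features_pair:
 fixes u :: "'j => 'a => real"
 assumes mf: "metric_features X d u"
 shows "metric_features (X xM X) (average_metric d) (pair_feat u u)" proof -
 have M: "Metric_space (space X) d" and comp: "compact_space (Metric_space.mtopology (space X) d)" and um: "!!j. u j : bmeas X" and feat: "features (space X) u"
  and sep: "!!x y. x : space X ==> y : space X ==> (!!j. u j x = u j y) ==> x = y" using mf unfolding metric_features_def by blast+
 obtain L where L: "L > 0" "!!j x y. x : space X ==> y : space X ==> \<bar>u j x - u j y\<bar> <= L * d x y" using mf unfolding metric_features_def by blast
 interpret D: Metric_space "space X" d by fact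
 have P: "Metric_space (space X \<times> space X) (average_metric d)" proof
  show "0 <= average_metric d p q" for p q by (simp add: average_metric_def)
  show "average_metric d p q = average_metric d q p" for p q by (simp add: average_metric_def D.commute)
  show "(average_metric d p q = 0) = (p = q)" if "p : space X \<times> space X" "q : space X \<times> space X" for p q
  using that D.nonneg[of "fst p" "fst q"] D.nonneg[of "snd p" "snd q"] D.zero[of "fst p" "fst q"] D.zero[of "snd p" "snd q"]
  by (auto simp: average_metric_def prod_eq_iff add_nonneg_eq_0_iff)
  show "average_metric d p r <= average_metric d p q + average_metric d q r"
  if "p : space X \<times> space X" "q : space X \<times> space X" "r : space X \<times> space X" for p q r proof -
  have "d (fst p) (fst r) <= d (fst p) (fst q) + d (fst q) (fst r)" "d (snd p) (snd r) <= d (snd p) (snd q) + d (snd q) (snd r)"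
  using that by (auto intro!: D.triangle)
  then have "(d (fst p) (fst r) + d (snd p) (snd r)) / 2 \<le>
  (d (fst p) (fst q) + d (snd p) (snd q) + (d (fst q) (fst r) + d (snd q) (snd r))) / 2" by (intro divide_right_mono) simp_all
  then show ?thesis unfolding average_metric_def by (simp only: add_divide_distrib)
  qed
 qed
 interpret P: Metric_space "space X \<times> space X" "average_metric d" by fact
 have compP: "compact_space P.mtopology" unfolding P.compact_space_sequentially proof (intro allI impI)
  fix s :: "nat => 'a \<times> 'a" assume s: "range s \<subseteq> space X \<times> space X"
  then have s1: "range (fst o s) \<subseteq> space X" and s2: "range (snd o s) \<subseteq> space X" by (auto simp: mem_Times_iff)
  obtain l1 r1 where 1: "l1 : space X" "strict_mono r1" "limitin D.mtopology ((fst o s) o r1) l1 sequentially"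
  using comp s1 unfolding D.compact_space_sequentially by blast
  have s3: "range ((snd o s) o r1) \<subseteq> space X" using s2 by auto
  obtain l2 r2 where 2: "l2 : space X" "strict_mono r2" "limitin D.mtopology (((snd o s) o r1) o r2) l2 sequentially"
  using comp s3 unfolding D.compact_space_sequentially by blast
  have 3: "limitin D.mtopology (((fst o s) o r1) o r2) l1 sequentially" by (rule limitin_subsequence[OF 2(2) 1(3)])
  have "limitin P.mtopology (s o (r1 o r2)) (l1, l2) sequentially" unfolding P.limitin_metric proof (intro conjI allI impI)
  fix e :: real assume e: "e > 0"
  have "\<forall>\<^sub>F n in sequentially. d (fst (s (r1 (r2 n)))) l1 < e" "\<forall>\<^sub>F n in sequentially. d (snd (s (r1 (r2 n)))) l2 < e"
  using 3 2(3) e unfolding D.limitin_metric by (auto elim: eventually_mono)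
  then show "\<forall>\<^sub>F n in sequentially. (s o (r1 o r2)) n : space X \<times> space X & average_metric d ((s o (r1 o r2)) n) (l1, l2) < e"
  by eventually_elim (use s in \<open>auto simp: average_metric_def\<close>)
  qed (use 1 2 in auto)
  with 1 2 show "EX l r. l : space X \<times> space X & strict_mono r & limitin P.mtopology (s o r) l sequentially"
  by (intro exI[of _ "(l1, l2)"] exI[of _ "r1 o r2"]) (auto intro: strict_mono_o)
 qed
 have measP: "pair_feat u u k : bmeas (X xM X)" for k
  by (cases k) (auto simp: pair_feat_def[abs_def] intro!: measurable_compose[OF measurable_fst um] measurable_compose[OF measurable_snd um])
 have lipP: "\<bar>pair_feat u u k p - pair_feat u u k q\<bar> <= (2 * L) * average_metric d p q"
  if "p : space X \<times> space X" "q : space X \<times> space X" for k p q proof -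
  have 0: "0 <= L * d (fst p) (fst q)" "0 <= L * d (snd p) (snd q)" using L(1) by simp_all
  have "(2 * L) * average_metric d p q = L * d (fst p) (fst q) + L * d (snd p) (snd q)" by (simp add: average_metric_def algebra_simps)
  moreover have "\<bar>u j (fst p) - u j (fst q)\<bar> <= L * d (fst p) (fst q)" "\<bar>u j (snd p) - u j (snd q)\<bar> <= L * d (snd p) (snd q)" for j
  using that by (auto intro!: L(2))
  ultimately show ?thesis using 0 by (cases k) (simp_all add: add_increasing add_increasing2)
 qed
 have sepP: "p = q" if "p : space X \<times> space X" "q : space X \<times> space X" "!!k. pair_feat u u k p = pair_feat u u k q" for p q
  using that(1,2) sep[of "fst p" "fst q"] sep[of "snd p" "snd q"] that(3)[of "Inl _"] that(3)[of "Inr _"] by (simp add: prod_eq_iff mem_Times_iff)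
 have featP: "features (space X \<times> space X) (pair_feat u u)" by (rule features_pair[OF feat feat])
 have L2: "2 * L > 0" using L(1) by simp
 show ?thesis unfolding metric_features_def space_pair_measure proof (intro conjI)
  show "\<exists>L>0. ALL k. ALL p:space X \<times> space X. ALL q:space X \<times> space X.
  \<bar>pair_feat u u k p - pair_feat u u k q\<bar> <= L * average_metric d p q" using L2 lipP by (intro exI[of _ "2 * L"] conjI) simp_all
  show "ALL p:space X \<times> space X. ALL q:space X \<times> space X. (ALL k. pair_feat u u k p = pair_feat u u k q) --> p = q"
  by (intro ballI impI) (rule sepP, simp_all)
 qed (simp_all add: P compP measP featP)
qed

definition left_word :: "('g \<times> 'i) list => ('g \<times> ('i + 'j)) list" where
 "left_word w = map (%(g, j). (g, Inl j)) w"
definition right_word :: "('g \<times> 'j) list => ('g \<times> ('i + 'j)) list" where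
 "right_word w = map (%(g, j). (g, Inr j)) w"

lemma left_right_words:
 "w : name_words G ==> left_word w : name_words G" "w : name_words G ==> right_word w : name_words G" by (auto simp: left_word_def right_word_def)

lemma wval_left_right:
 "wval q (left_word w) = wval (%(g, j). q (g, Inl j)) w"
 "wval q (right_word w) = wval (%(g, j). q (g, Inr j)) w" by (induction w) (auto simp: left_word_def right_word_def)

lemma wval_split:
 fixes q :: "'g \<times> ('i + 'j) => real"
 assumes "w : name_words G"
 shows "EX w1 w2. w1 : name_words G & w2 : name_words G &
  (ALL q. wval q w = wval q (left_word w1 @ right_word w2))" using assms proof (induction w)
 case Nil
 then show ?case by (intro exI[of _ "[]"]) (simp add: left_word_def right_word_def)
next
 case (Cons e w)
 then obtain w1 w2 where w: "w1 : name_words G" "w2 : name_words G"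
  "!!q. wval q w = wval q (left_word w1 @ right_word w2)" by auto
 obtain g k where e: "e = (g, k)" by (cases e)
 have g: "g : carrier G" using Cons.hyps e by auto
 show ?case proof (cases k)
  case (Inl i)
  then show ?thesis using w g e by (intro exI[of _ "(g, i) # w1"] exI[of _ w2]) (auto simp: left_word_def)
 next
  case (Inr j)
  then show ?thesis using w g e by (intro exI[of _ w1] exI[of _ "(g, j) # w2"]) (auto simp: right_word_def)
 qed
qed

lemma (in prob_space) integrable_01:
 fixes f :: "'a => real"
 assumes "f : bmeas M" "!!x. x : space M ==> 0 <= f x & f x <= 1"
 shows "integrable M f" using assms by (intro integrable_const_bound[of _ 1]) (auto intro!: AE_I2)

lemma (in prob_space) integral_01:
 fixes f :: "'a => real"
 assumes "f : bmeas M" "!!x. x : space M ==> 0 <= f x & f x <= 1"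
 shows "0 <= (LINT x|M. f x) & (LINT x|M. f x) <= 1" proof
 show "0 <= (LINT x|M. f x)" using assms(2) by (intro Bochner_Integration.integral_nonneg) auto
 have "(LINT x|M. f x) <= (LINT x|M. 1)" using assms integrable_01[OF assms] by (intro integral_mono) auto
 then show "(LINT x|M. f x) <= 1" by (simp add: prob_space)
qed

lemma integral_vavg:
 assumes "!!v. v : V ==> integrable M (f v)"
 shows "(LINT x|M. vavg V (%v. f v x)) = vavg V (%v. \<integral>x. f v x \<partial>M)" "integrable M (%x. vavg V (%v. f v x))" unfolding vavg_def using assms by simp_all

lemma vavg_cmult_right: "vavg V (%v. f v * c) = vavg V f * c" by (simp add: vavg_def sum_distrib_right)

lemma vavg_square: "vavg V f * vavg V g = vavg V (%v. vavg V (%v'. f v * g v'))" by (simp add: vavg_cmult vavg_cmult_right)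

lemma vavg_01: "finite V ==> V ~= {} ==> (!!v. v : V ==> 0 <= f v & f v <= 1) ==> 0 <= vavg V f & vavg V f <= (1::real)" by (intro conjI vavg_nonneg vavg_le_const) auto

theorem (in prob_space) second_moment:
 assumes V: "finite V" "V ~= {}" and a: "!!v. v : V ==> a v : bmeas M"
  and a01: "!!v x. v : V ==> x : space M ==> 0 <= a v x & a v x <= (1::real)" and c: "0 <= c" "c <= 1"
 shows "(LINT x|M. (vavg V (%v. a v x) - c)^2) \<le>
  vavg V (%v. vavg V (%v'. \<bar>(LINT x|M. a v x * a v' x) - c^2\<bar>)) + 2 * vavg V (%v. \<bar>(LINT x|M. a v x) - c\<bar>)"
  "integrable M (%x. (vavg V (%v. a v x) - c)^2)" proof -
 have ia: "integrable M (a v)" if "v : V" for v using a[OF that] a01[OF that] by (rule integrable_01)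
 have iaa: "integrable M (%x. a v x * a v' x)" if "v : V" "v' : V" for v v' using a that a01 by (intro integrable_01) (auto intro: mult_le_one)
 have eq: "(vavg V (%v. a v x) - c)^2 = vavg V (%v. vavg V (%v'. a v x * a v' x)) - 2 * c * vavg V (%v. a v x) + c^2" for x
  unfolding vavg_square[symmetric] by (simp add: power2_eq_square algebra_simps)
 have i1: "integrable M (%x. vavg V (%v'. a v x * a v' x))" if "v : V" for v using iaa[OF that] by (rule integral_vavg(2))
 have i2: "integrable M (%x. vavg V (%v. vavg V (%v'. a v x * a v' x)))" by (rule integral_vavg(2)[OF i1])
 have i3: "integrable M (%x. vavg V (%v. a v x))" by (rule integral_vavg(2)[OF ia])
 show "integrable M (%x. (vavg V (%v. a v x) - c)^2)" unfolding eq using i2 i3 by auto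
 have "(LINT x|M. vavg V (%v. vavg V (%v'. a v x * a v' x))) = vavg V (%v. \<integral>x. vavg V (%v'. a v x * a v' x) \<partial>M)" by (rule integral_vavg(1)[OF i1])
 also have "... = vavg V (%v. vavg V (%v'. \<integral>x. a v x * a v' x \<partial>M))" by (intro vavg_cong integral_vavg(1) iaa)
 finally have sq: "(LINT x|M. vavg V (%v. vavg V (%v'. a v x * a v' x))) = vavg V (%v. vavg V (%v'. \<integral>x. a v x * a v' x \<partial>M))" .
 have "(LINT x|M. (vavg V (%v. a v x) - c)^2) =
  vavg V (%v. vavg V (%v'. \<integral>x. a v x * a v' x \<partial>M)) - 2 * c * vavg V (%v. \<integral>x. a v x \<partial>M) + c^2"
  unfolding eq using i2 i3 by (simp add: sq integral_vavg(1)[OF ia] prob_space)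
 also have "... = vavg V (%v. vavg V (%v'. (LINT x|M. a v x * a v' x) - c^2)) - 2 * c * vavg V (%v. (LINT x|M. a v x) - c)"
  by (simp add: vavg_diff vavg_const[OF V] power2_eq_square algebra_simps)
 also have "... <= vavg V (%v. vavg V (%v'. \<bar>(LINT x|M. a v x * a v' x) - c^2\<bar>)) + 2 * vavg V (%v. \<bar>(LINT x|M. a v x) - c\<bar>)" proof -
  have "vavg V (%v. vavg V (%v'. (LINT x|M. a v x * a v' x) - c^2)) <= vavg V (%v. vavg V (%v'. \<bar>(LINT x|M. a v x * a v' x) - c^2\<bar>))"
  by (intro vavg_mono) simp
  moreover have "\<bar>c * vavg V (%v. (LINT x|M. a v x) - c)\<bar> <= 1 * vavg V (%v. \<bar>(LINT x|M. a v x) - c\<bar>)"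
  unfolding abs_mult using c by (intro mult_mono vavg_abs_le) auto
  ultimately show ?thesis by linarith
 qed
 finally show "(LINT x|M. (vavg V (%v. a v x) - c)^2) \<le>
  vavg V (%v. vavg V (%v'. \<bar>(LINT x|M. a v x * a v' x) - c^2\<bar>)) + 2 * vavg V (%v. \<bar>(LINT x|M. a v x) - c\<bar>)" .
qed

lemma (in prob_space) chebyshev:
 assumes f: "integrable M (%x. (f x)^2)" "f : bmeas M" and e: "e > (0::real)"
 shows "prob {x : space M. e <= \<bar>f x\<bar>} <= (LINT x|M. (f x)^2) / e^2" proof -
 let ?A = "{x : space M. e <= \<bar>f x\<bar>}"
 have A: "?A : events" using f(2) by measurable
 have "(LINT x|M. e^2 * indicator ?A x) <= (LINT x|M. (f x)^2)" proof (rule integral_mono)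
  show "integrable M (%x. e^2 * indicator ?A x :: real)" using A by (simp add: emeasure_eq_measure)
  fix x assume "x : space M"
  show "e^2 * indicator ?A x <= (f x)^2" proof (cases "x : ?A")
  case True
  then have "e^2 <= \<bar>f x\<bar>^2" using e by (intro power_mono) auto
  with True show ?thesis by simp
  qed simp
 qed (rule f(1))
 then have "e^2 * prob ?A <= (LINT x|M. (f x)^2)" using A by simp
 then show ?thesis using e by (simp add: le_divide_eq mult.commute)
qed

lemma integral_product_fun:
 fixes f g :: "'b => real"
 assumes m: "prob_space m" and f: "f : bmeas m" "!!x. x : space m ==> 0 <= f x & f x <= 1" and g: "g : bmeas m" "!!x. x : space m ==> 0 <= g x & g x <= 1"
 shows "(LINT p|(m xM m). f (fst p) * g (snd p)) = (LINT x|m. f x) * (LINT x|m. g x)" proof -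
 interpret m: prob_space m by fact
 interpret mm: pair_prob_space m m ..
 have "integrable (m xM m) (%p. f (fst p) * g (snd p))" by (rule mm.integrable_01) (use f g in \<open>auto simp: space_pair_measure intro: mult_le_one\<close>)
 from mm.integral_fst'[OF this] show ?thesis by simp
qed

text \<open>Double quenching in terms of words: at most vertices, and at most pairs of vertices, the average of a word is what a pair of independent points of the system would give.\<close>
definition pair_convergent ::
 "('g, 'b) monoid_scheme => 'x measure => ('g => 'x => 'x) => ('j => 'a => real) => ('x => 'a) =>
  (nat => 'v set) => (nat => 'g => 'v => 'v) => (nat => ('v => 'a) measure) => bool" where
 "pair_convergent G N T u \<xi> V \<sigma> m \<longleftrightarrow> (ALL w:name_words G.
  (%i. vavg (V i) (%v. \<bar>(LINT x|m i. wval (name G u (\<sigma> i) x v) w) - (LINT p|N. wval (name G u T \<xi> p) w)\<bar>)) ~~> 0 &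
  (%i. vavg (V i) (%v. vavg (V i) (%v'.
  \<bar>(LINT x|m i. wval (name G u (\<sigma> i) x v) w * wval (name G u (\<sigma> i) x v') w) -
  (LINT p|N. wval (name G u T \<xi> p) w)^2\<bar>))) ~~> 0)"

lemma model_word_measurable:
 assumes act: "almost_action G V \<sigma>" and u: "!!j. u j : bmeas X" and v: "v : V i" and m: "sets m = sets (PiM (V i) (%_. X))"
 shows "(%x. wval (name G u (\<sigma> i) x v) w) : bmeas m" proof -
 have e: "(%x. name G u (\<sigma> i) x v e) : bmeas m" for e proof (cases e)
  case (Pair g j)
  have "(%x. u j (x (\<sigma> i g v))) : bmeas m" if "g : carrier G" proof -
  have "(%x. x (\<sigma> i g v)) : measurable m X" using measurable_component_singleton[OF almost_actionD(4)[OF act that v], of "%_. X"]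
  by (simp add: measurable_cong_sets[OF m refl])
  from measurable_compose[OF this u] show ?thesis .
  qed
  then show ?thesis by (cases "g : carrier G") (auto simp: Pair name_def)
 qed
 show ?thesis by (induction w) (simp_all add: e borel_measurable_times)
qed

lemma model_word_01:
 assumes act: "almost_action G V \<sigma>" and feat: "features (space X) u" and v: "v : V i" and m: "sets m = sets (PiM (V i) (%_. X))" and x: "x : space m"
 shows "0 <= wval (name G u (\<sigma> i) x v) w & wval (name G u (\<sigma> i) x v) w <= 1" proof -
 have "x : PiE (V i) (%_. space X)" using x sets_eq_imp_space_eq[OF m] by (simp add: space_PiM)
 then have "x v' : space X" if "v' : V i" for v' using PiE_mem that by metis
 then show ?thesis by (intro wval_01[of _ G] model_name_in_cube[OF act feat _ v]) blast
qed

lemma square_word: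
 fixes m :: "('i => 'a) measure" and G :: "('g, 'b) monoid_scheme"
 assumes m: "prob_space m" "sets m = sets (PiM I (%_. X))" and f: "f : measurable (PiM I (%_. X xM X)) (PiM (carrier G) (%_. X xM X))" and u: "!!j. u j : bmeas X"
  and name: "!!x y e. x : space m ==> y : space m ==> cname G (pair_feat u u) (f (\<lambda>i\<in>I. (x i, y i))) e =
  (case e of (g, Inl j) => h x (g, j) | (g, Inr j) => h y (g, j))" and h: "!!w. (%x. wval (h x) w) : bmeas m"
  "!!x w. x : space m ==> 0 <= wval (h x) w & wval (h x) w <= 1"
 shows "(LINT z|distr (square_measure I X m) (PiM (carrier G) (%_. X xM X)) f. wval (cname G (pair_feat u u) z) (left_word w @ right_word w')
  ) =
  (LINT x|m. wval (h x) w) * (LINT x|m. wval (h x) w')" proof -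
 let ?pair = "%(x, y). \<lambda>i\<in>I. (x i, y i)"
 have pm: "?pair : measurable (m xM m) (PiM I (%_. X xM X))" proof -
  have "(%p. \<lambda>i\<in>I. (fst p i, snd p i)) : measurable (m xM m) (PiM I (%_. X xM X))" proof (rule measurable_restrict)
  fix i assume "i : I"
  then have "(%x. x i) : measurable m X" using measurable_component_singleton[of i I "%_. X"] by (simp add: measurable_cong_sets[OF m(2) refl])
  from measurable_Pair[OF measurable_compose[OF measurable_fst this] measurable_compose[OF measurable_snd this]]
  show "(%p. (fst p i, snd p i)) : measurable (m xM m) (X xM X)" .
  qed
  then show ?thesis by (simp add: case_prod_beta')
 qed
 have um: "pair_feat u u k : bmeas (X xM X)" for k
  by (cases k) (auto simp: pair_feat_def[abs_def] intro!: measurable_compose[OF measurable_fst u] measurable_compose[OF measurable_snd u])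
 have wm: "(%z. wval (cname G (pair_feat u u) z) w) : bmeas (PiM (carrier G) (%_. X xM X))" for w by (rule config_word_measurable[OF um refl])
 have f': "f : measurable (square_measure I X m) (PiM (carrier G) (%_. X xM X))" using f by (simp add: square_measure_def)
 have "(LINT z|distr (square_measure I X m) (PiM (carrier G) (%_. X xM X)) f. wval (cname G (pair_feat u u) z) (left_word w @ right_word w')
  ) =
  (LINT z|square_measure I X m. wval (cname G (pair_feat u u) (f z)) (left_word w @ right_word w'))" by (rule integral_distr[OF f' wm])
 also have "... = (LINT p|(m xM m). wval (cname G (pair_feat u u) (f (?pair p))) (left_word w @ right_word w'))"
  unfolding square_measure_def by (rule integral_distr[OF pm measurable_compose[OF f wm]])
 also have "... = (LINT p|(m xM m). wval (h (fst p)) w * wval (h (snd p)) w')" proof (intro Bochner_Integration.integral_cong refl)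
  fix p assume "p : space (m xM m)"
  then obtain x y where p: "p = (x, y)" "x : space m" "y : space m" by (auto simp: space_pair_measure)
  have "cname G (pair_feat u u) (f (?pair p)) = (%e. case e of (g, Inl j) => h x (g, j) | (g, Inr j) => h y (g, j))"
  using name[OF p(2,3)] by (auto simp: p(1) fun_eq_iff)
  then show "wval (cname G (pair_feat u u) (f (?pair p))) (left_word w @ right_word w') = wval (h (fst p)) w * wval (h (snd p)) w'"
  by (simp add: wval_left_right p(1) case_prod_beta')
 qed
 also have "... = (LINT x|m. wval (h x) w) * (LINT x|m. wval (h x) w')" by (rule integral_product_fun[OF m(1) h(1) h(2) h(1) h(2)])
 finally show ?thesis .
qed

section \<open>Double quenching implies pair convergence\<close>

lemma square_measure_props:
 assumes m: "prob_space m" "sets m = sets (PiM I (%_. X))"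
 shows "(%(x, y). \<lambda>i\<in>I. (x i, y i)) : measurable (m xM m) (PiM I (%_. X xM X))"
  "prob_space (square_measure I X m)" "sets (square_measure I X m) = sets (PiM I (%_. X xM X))" proof -
 interpret m: prob_space m by fact
 interpret mm: pair_prob_space m m ..
 have "(%p. \<lambda>i\<in>I. (fst p i, snd p i)) : measurable (m xM m) (PiM I (%_. X xM X))" proof (rule measurable_restrict)
  fix i assume "i : I"
  then have "(%x. x i) : measurable m X" using measurable_component_singleton[of i I "%_. X"] by (simp add: measurable_cong_sets[OF m(2) refl])
  from measurable_Pair[OF measurable_compose[OF measurable_fst this] measurable_compose[OF measurable_snd this]]
  show "(%p. (fst p i, snd p i)) : measurable (m xM m) (X xM X)" .
 qed
 then show pm: "(%(x, y). \<lambda>i\<in>I. (x i, y i)) : measurable (m xM m) (PiM I (%_. X xM X))" by (simp add: case_prod_beta')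
 show "prob_space (square_measure I X m)" unfolding square_measure_def by (rule mm.prob_space_distr[OF pm])
 show "sets (square_measure I X m) = sets (PiM I (%_. X xM X))" by (simp add: square_measure_def)
qed

lemma pullback_measurable:
 assumes "!!g. g : carrier G ==> s g v : V"
 shows "pullback_name G s v : measurable (PiM V (%_. Z)) (PiM (carrier G) (%_. Z))" proof -
 have "(%x. \<lambda>g\<in>carrier G. x (s g v)) : measurable (PiM V (%_. Z)) (PiM (carrier G) (%_. Z))"
  by (rule measurable_restrict) (rule measurable_component_singleton[OF assms])
 then show ?thesis by (simp add: pullback_name_def[abs_def])
qed

lemma square_process_word:
 assumes mf: "metric_features X d u" and \<mu>: "prob_space \<mu>" "sets \<mu> = sets (configs G X)"
 shows "(LINT z|square_measure (carrier G) X \<mu>. wval (cname G (pair_feat u u) z) (left_word w @ right_word w')) =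
  (LINT x|\<mu>. wval (cname G u x) w) * (LINT x|\<mu>. wval (cname G u x) w')" proof -
 have um: "!!j. u j : bmeas X" and feat: "features (space X) u" using mf unfolding metric_features_def by blast+
 have id: "distr (square_measure (carrier G) X \<mu>) (PiM (carrier G) (%_. X xM X)) (%z. z) = square_measure (carrier G) X \<mu>"
  by (rule distr_id2) (simp add: square_measure_def)
 have h01: "0 <= wval (cname G u x) w & wval (cname G u x) w <= 1" if "x : space \<mu>" for x w proof -
  have "x : PiE (carrier G) (%_. space X)" using that sets_eq_imp_space_eq[OF \<mu>(2)] by (simp add: space_PiM)
  then show ?thesis by (intro wval_01[of _ G] cname_in_cube[OF feat])
 qed
 have nm: "cname G (pair_feat u u) (\<lambda>i\<in>carrier G. (x i, y i)) e =
  (case e of (g, Inl j) => cname G u x (g, j) | (g, Inr j) => cname G u y (g, j))" for x y e by (auto simp: cname_def split: prod.split sum.split)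
 show ?thesis using square_word[OF \<mu>, of "%z. z" G u "cname G u" w w', OF _ um nm config_word_measurable[OF um \<mu>(2)] h01] unfolding id by simp
qed

lemma square_model_word:
 assumes mf: "metric_features X d u" and act: "almost_action G V \<sigma>" and v: "v : V i" and m: "prob_space m" "sets m = sets (PiM (V i) (%_. X))"
 shows "(LINT z|distr (square_measure (V i) X m) (PiM (carrier G) (%_. X xM X)) (pullback_name G (\<sigma> i) v). wval (cname G (pair_feat u u) z) (left_word w @ right_word w')
  ) =
  (LINT x|m. wval (name G u (\<sigma> i) x v) w) * (LINT x|m. wval (name G u (\<sigma> i) x v) w')" proof -
 have um: "!!j. u j : bmeas X" and feat: "features (space X) u" using mf unfolding metric_features_def by blast+
 note sv = almost_actionD(4)[OF act _ v]
 have nm: "cname G (pair_feat u u) (pullback_name G (\<sigma> i) v (\<lambda>i\<in>V i. (x i, y i))) e =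
  (case e of (g, Inl j) => name G u (\<sigma> i) x v (g, j) | (g, Inr j) => name G u (\<sigma> i) y v (g, j))" for x y e
  using sv by (auto simp: cname_def name_def pullback_name_def split: prod.split sum.split)
 show ?thesis
  by (rule square_word[OF m pullback_measurable[of G "\<sigma> i" v "V i", OF sv] um nm model_word_measurable[OF act um v m(2)] model_word_01[OF act feat v m(2)]])
qed

lemma word_nhdD:
 "\<nu> : word_nhd G X u \<mu> W e ==>
  ALL w:W. \<bar>(LINT x|\<nu>. wval (cname G u x) w) - (LINT x|\<mu>. wval (cname G u x) w)\<bar> < e" unfolding word_nhd_def by blast

lemma abs_le_square:
 assumes "s > (0::real)" shows "\<bar>t\<bar> <= s + t^2 / s" proof (cases "\<bar>t\<bar> <= s")
 case True
 have "0 <= t^2 / s" using assms by simp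
 with True show ?thesis by linarith
next
 case False
 then have "s * \<bar>t\<bar> <= \<bar>t\<bar> * \<bar>t\<bar>" by (intro mult_right_mono) auto
 then have "\<bar>t\<bar> <= t^2 / s" using assms by (simp add: le_divide_eq power2_eq_square mult.commute abs_mult_self_eq)
 with assms show ?thesis by linarith
qed

lemma abs_mult_diff_le:
 fixes a b c e :: real
 assumes "\<bar>b\<bar> <= 1" "\<bar>c\<bar> <= 1"
 shows "\<bar>a * b - c * e\<bar> <= \<bar>a - c\<bar> + \<bar>b - e\<bar>" proof -
 have "a * b - c * e = (a - c) * b + c * (b - e)" by (simp add: algebra_simps)
 then have "\<bar>a * b - c * e\<bar> <= \<bar>a - c\<bar> * \<bar>b\<bar> + \<bar>c\<bar> * \<bar>b - e\<bar>" by (metis abs_mult abs_triangle_ineq)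
 also have "... <= \<bar>a - c\<bar> * 1 + 1 * \<bar>b - e\<bar>" using assms by (intro add_mono mult_mono) auto
 finally show ?thesis by simp
qed

lemma tendsto_0I:
 fixes f :: "nat => real"
 assumes "!!i. 0 <= f i" "!!e. e > 0 ==> EV i. f i < e"
 shows "f ~~> 0" by (rule order_tendstoI) (use assms in \<open>auto intro: less_le_trans always_eventually\<close>)

lemma tendsto_0_eventually_less:
 fixes f :: "nat => real"
 assumes "f ~~> 0" "e > 0" shows "EV i. f i < e" using assms by (rule order_tendstoD(2))

lemma tendsto_1_compl:
 fixes f :: "nat => real"
 shows "f ~~> 1 \<longleftrightarrow> (%i. 1 - f i) ~~> 0" proof
 assume "f ~~> 1"
 from tendsto_diff[OF tendsto_const this, of 1] show "(%i. 1 - f i) ~~> 0" by simp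
next
 assume "(%i. 1 - f i) ~~> 0"
 from tendsto_diff[OF tendsto_const this, of 1] show "f ~~> 1" by simp
qed

context pmp_action begin

text \<open>For independent samples $x$ and $y$ the vertex average of $a_v(x)a_v(y)$ is close to $\alpha^2$. Squaring and integrating it produces the squares of the two-point averages of $a$, while convexity of the square and the one-point averages bound their mean from below by nearly $\alpha^2$. Hence most two-point averages are close to $\alpha^2$.\<close>
theorem doubly_quenched_imp_pair_convergent:
 fixes u :: "'j::countable => 'a => real" and V :: "nat => 'v set"
 assumes mc: "metric_coding G N T X d u \<mu> \<xi>" and act: "almost_action G V \<sigma>" and dq: "doubly_quenched_converges G V \<sigma> X d m \<mu>"
 shows "pair_convergent G N T u \<xi> V \<sigma> m" unfolding pair_convergent_def proof (intro ballI)
 fix w :: "('g \<times> 'j) list" assume w: "w : name_words G"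
 note mf = metric_codingD(1)[OF mc] and \<mu> = metric_codingD(2,3)[OF mc]
 note mfp = metric_features_pair[OF mf]
 have um: "!!j. u j : bmeas X" and feat: "features (space X) u" using mf unfolding metric_features_def by blast+
 have pm: "!!j. pair_feat u u j : bmeas (X xM X)" using mfp unfolding metric_features_def by blast
 let ?sq = "square_measure (carrier G) X \<mu>"
 note sq = square_measure_props(2,3)[OF \<mu>]
 define \<alpha> where "\<alpha> = (LINT p|N. wval (name G u T \<xi> p) w)"
 have \<alpha>\<mu>: "(LINT x|\<mu>. wval (cname G u x) w) = \<alpha>" unfolding \<alpha>_def by (rule metric_codingD(6)[OF mc w])
 have ll_w: "loc_lip G UNIV (word w)" using w by (intro ll_word) auto
 have \<alpha>01: "0 <= \<alpha>" "\<alpha> <= 1"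
  using integral_01[OF test_measurable[OF metric_codingD(4)[OF mc] ll_w]] wval_01 orbit_name_in_cube[OF metric_codingD(4)[OF mc]] unfolding \<alpha>_def by blast+
 have m: "prob_space (m i)" "sets (m i) = sets (PiM (V i) (%_. X))" for i using dq unfolding doubly_quenched_converges_def by auto
 have qc: "(%i. proportion (V i) (%v. distr (square_measure (V i) X (m i)) (PiM (carrier G) (%_. X xM X)) (pullback_name G (\<sigma> i) v) : \<O>)) ~~> 1"
  "(%i. measure (square_measure (V i) X (m i)) (good_models G (X xM X) (V i) (\<sigma> i) \<O>)) ~~> 1"
  if "\<O> : weak_star_nhds G (X xM X) (average_metric d) ?sq" for \<O> using dq that unfolding doubly_quenched_converges_def quenched_converges_def by blast+
 have Vn: "finite (V i)" "V i ~= {}" for i using almost_actionD(1,2)[OF act] .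
 define a where "a i v x = wval (name G u (\<sigma> i) x v) w" for i v x
 have am: "a i v : bmeas (m i)" if "v : V i" for i v unfolding a_def by (rule model_word_measurable[OF act um that m(2)])
 have a01: "0 <= a i v x & a i v x <= 1" if "v : V i" "x : space (m i)" for i v x unfolding a_def by (rule model_word_01[OF act feat that(1) m(2) that(2)])
 have ia01: "0 <= (LINT x|m i. a i v x) & (LINT x|m i. a i v x) <= 1" if "v : V i" for i v using prob_space.integral_01[OF m(1) am a01] that by blast
 define D1 where "D1 i = vavg (V i) (%v. \<bar>(LINT x|m i. a i v x) - \<alpha>\<bar>)" for i
 define \<theta> where "\<theta> i v v' = (LINT x|m i. a i v x * a i v' x)" for i v v'
 define D2 where "D2 i = vavg (V i) (%v. vavg (V i) (%v'. \<bar>\<theta> i v v' - \<alpha>^2\<bar>))" for i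
 have D1_lim: "D1 ~~> 0" proof (rule tendsto_0I)
  show "0 <= D1 i" for i unfolding D1_def by (intro vavg_nonneg) simp
  fix e :: real assume "e > 0"
  then have e2: "e / 2 > 0" by simp
  define \<O> where "\<O> = word_nhd G (X xM X) (pair_feat u u) ?sq {left_word w @ right_word []} (e / 2)"
  have lw: "left_word w @ right_word [] : (name_words G :: ('g \<times> ('j + 'j)) list set)"
  using left_right_words(1)[OF w] by (simp add: right_word_def del: in_lists_conv_set)
  have \<O>: "\<O> : weak_star_nhds G (X xM X) (average_metric d) ?sq"
  unfolding \<O>_def by (rule word_nhd_nhd[OF mfp sq _ _ e2]) (use lw in \<open>simp_all del: in_lists_conv_set\<close>)
  have "EV i. 1 - proportion (V i) (%v. distr (square_measure (V i) X (m i)) (PiM (carrier G) (%_. X xM X)) (pullback_name G (\<sigma> i) v) : \<O>) < e / 2"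
  using qc(1)[OF \<O>] e2 unfolding tendsto_1_compl by (rule tendsto_0_eventually_less)
  then show "EV i. D1 i < e" proof eventually_elim
  case (elim i)
  let ?P = "%v. distr (square_measure (V i) X (m i)) (PiM (carrier G) (%_. X xM X)) (pullback_name G (\<sigma> i) v) : \<O>"
  have "D1 i <= vavg (V i) (%v. e / 2 + (if ?P v then 0 else 1))" unfolding D1_def proof (rule vavg_mono)
  fix v assume v: "v : V i"
  show "\<bar>(LINT x|m i. a i v x) - \<alpha>\<bar> <= e / 2 + (if ?P v then 0 else 1)" proof (cases "?P v")
  case True
  have "\<bar>(LINT x|m i. a i v x) * (LINT x|m i. wval (name G u (\<sigma> i) x v) []) -
  \<alpha> * (LINT x|\<mu>. wval (cname G u x) [])\<bar> < e / 2" using bspec[OF word_nhdD[OF True[unfolded \<O>_def]] singletonI]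
  unfolding square_model_word[OF mf act v m] square_process_word[OF mf \<mu>] \<alpha>\<mu> a_def .
  then show ?thesis using True prob_space.prob_space[OF m(1)] prob_space.prob_space[OF \<mu>(1)] by simp
  next
  case False
  then show ?thesis using ia01[OF v] \<alpha>01 e2 by (simp add: abs_le_iff)
  qed
  qed
  also have "... = e / 2 + (1 - proportion (V i) ?P)" by (simp add: vavg_add vavg_const[OF Vn] proportion_compl[OF Vn])
  finally show ?case using elim by linarith
  qed
 qed
 have \<theta>01: "0 <= \<theta> i v v' & \<theta> i v v' <= 1" if "v : V i" "v' : V i" for i v v'
  unfolding \<theta>_def by (rule prob_space.integral_01[OF m(1)]) (use am a01 that in \<open>auto intro: mult_le_one\<close>)
 have key: "vavg (V i) (%v. vavg (V i) (%v'. (\<theta> i v v' - \<alpha>^2)^2)) <= 3 * e + (1 - p) + 4 * D1 i"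
  if e: "0 < e" "e <= 1" and p: "p = measure (square_measure (V i) X (m i)) (good_models G (X xM X) (V i) (\<sigma> i)
  (word_nhd G (X xM X) (pair_feat u u) ?sq {left_word w @ right_word w} e))" for i e p proof -
  interpret mi: prob_space "m i" by (rule m(1))
  interpret mm: pair_prob_space "m i" "m i" ..
  let ?G = "good_models G (X xM X) (V i) (\<sigma> i) (word_nhd G (X xM X) (pair_feat u u) ?sq {left_word w @ right_word w} e)"
  let ?pair = "%(x, y). \<lambda>v\<in>V i. (x v, y v)"
  define b where "b v p = a i v (fst p) * a i v (snd p)" for v p
  define Z where "Z p = vavg (V i) (%v. b v p)" for p
  have afm: "(%p. a i v (fst p)) : bmeas (m i xM m i)" "(%p. a i v (snd p)) : bmeas (m i xM m i)" if "v : V i" for v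
  using measurable_compose[OF measurable_fst am[OF that]] measurable_compose[OF measurable_snd am[OF that]] .
  have bm: "b v : bmeas (m i xM m i)" if "v : V i" for v unfolding b_def[abs_def] using afm[OF that] by (rule borel_measurable_times)
  have b01: "0 <= b v p & b v p <= 1" if "v : V i" "p : space (m i xM m i)" for v p
  using a01[OF that(1)] that(2) by (auto simp: b_def space_pair_measure intro!: mult_le_one)
  have Zm: "Z : bmeas (m i xM m i)" unfolding Z_def[abs_def] vavg_def using bm by measurable
  have Z01: "0 <= Z p & Z p <= 1" if "p : space (m i xM m i)" for p unfolding Z_def using b01 that by (intro vavg_01[OF Vn]) auto
  define B where "B = {p : space (m i xM m i). \<bar>Z p - \<alpha>^2\<bar> < e}"
  have Bm: "B : sets (m i xM m i)" unfolding B_def using Zm by measurable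
  have pB: "p <= measure (m i xM m i) B" proof (cases "?G : sets (PiM (V i) (%_. X xM X))")
  case False
  then have "p = 0" unfolding p by (intro measure_notin_sets) (simp add: square_measure_def)
  then show ?thesis by simp
  next
  case True
  have "p = measure (m i xM m i) (?pair -` ?G \<inter> space (m i xM m i))"
  unfolding p square_measure_def[of "V i" X "m i"] by (rule measure_distr[OF square_measure_props(1)[OF m] True])
  also have "... <= measure (m i xM m i) B" proof (rule mm.finite_measure_mono[OF _ Bm], rule subsetI)
  fix q assume q: "q : ?pair -` ?G \<inter> space (m i xM m i)"
  obtain x y where xy: "q = (x, y)" by (cases q)
  let ?z = "\<lambda>v\<in>V i. (x v, y v)"
  have zG: "?z : ?G" using q xy by simp
  have zs: "!!v. v : V i ==> ?z v : space (X xM X)" using zG unfolding good_models_def by auto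
  have "\<bar>(LINT z|empirical_distribution G (X xM X) (V i) (\<sigma> i) ?z. wval (cname G (pair_feat u u) z) (left_word w @ right_word w)) - \<alpha> * \<alpha>\<bar> < e"
  proof -
  have "empirical_distribution G (X xM X) (V i) (\<sigma> i) ?z \<in>
  word_nhd G (X xM X) (pair_feat u u) ?sq {left_word w @ right_word w} e" using zG unfolding good_models_def by blast
  from bspec[OF word_nhdD[OF this] singletonI]
  show ?thesis unfolding square_process_word[OF mf \<mu>] \<alpha>\<mu> .
  qed
  moreover have "(LINT z|empirical_distribution G (X xM X) (V i) (\<sigma> i) ?z. wval (cname G (pair_feat u u) z) (left_word w @ right_word w)) =
  vavg (V i) (%v. wval (name G (pair_feat u u) (\<sigma> i) ?z v) (left_word w @ right_word w))" by (rule empirical_word[OF act zs pm])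
  moreover have "... = Z q" unfolding Z_def proof (rule vavg_cong)
  fix v assume v: "v : V i"
  have "(%(g, j). name G (pair_feat u u) (\<sigma> i) ?z v (g, Inl j)) = name G u (\<sigma> i) x v"
  "(%(g, j). name G (pair_feat u u) (\<sigma> i) ?z v (g, Inr j)) = name G u (\<sigma> i) y v"
  using almost_actionD(4)[OF act _ v] by (auto simp: name_def fun_eq_iff)
  then show "wval (name G (pair_feat u u) (\<sigma> i) ?z v) (left_word w @ right_word w) = b v q" by (simp add: wval_left_right b_def a_def xy)
  qed
  ultimately show "q : B" using q unfolding B_def by (simp add: power2_eq_square)
  qed
  finally show ?thesis .
  qed
  have ibb: "integrable (m i xM m i) (%p. b v p * b v' p)" if "v : V i" "v' : V i" for v v'
  by (rule mm.integrable_01) (use bm b01 that in \<open>auto intro: mult_le_one\<close>)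
  have bb: "(LINT p|(m i xM m i). b v p * b v' p) = (\<theta> i v v')^2" if v: "v : V i" "v' : V i" for v v' proof -
  have "(LINT p|(m i xM m i). b v p * b v' p) = (LINT p|(m i xM m i). (a i v (fst p) * a i v' (fst p)) * (a i v (snd p) * a i v' (snd p)))"
  by (simp add: b_def mult_ac)
  also have "... = \<theta> i v v' * \<theta> i v v'" unfolding \<theta>_def
  by (rule integral_product_fun[OF m(1)]) (use am a01 v in \<open>auto intro: mult_le_one\<close>)
  finally show ?thesis by (simp add: power2_eq_square)
  qed
  have Z2: "(Z p)^2 = vavg (V i) (%v. vavg (V i) (%v'. b v p * b v' p))" for p unfolding Z_def by (simp add: power2_eq_square vavg_square)
  have iZ2: "integrable (m i xM m i) (%p. (Z p)^2)" by (rule mm.integrable_01) (use Zm Z01 in \<open>auto simp: power_le_one\<close>)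
  have EZ: "(LINT p|(m i xM m i). (Z p)^2) = vavg (V i) (%v. vavg (V i) (%v'. (\<theta> i v v')^2))" proof -
  have "(LINT p|(m i xM m i). (Z p)^2) = vavg (V i) (%v. \<integral>p. vavg (V i) (%v'. b v p * b v' p) \<partial>(m i xM m i))"
  unfolding Z2 by (intro integral_vavg(1) integral_vavg(2) ibb)
  also have "... = vavg (V i) (%v. vavg (V i) (%v'. (\<theta> i v v')^2))" proof (rule vavg_cong)
  fix v assume v: "v : V i"
  have "(LINT p|(m i xM m i). vavg (V i) (%v'. b v p * b v' p)) = vavg (V i) (%v'. \<integral>p. b v p * b v' p \<partial>(m i xM m i))"
  by (rule integral_vavg(1)[OF ibb[OF v]])
  also have "... = vavg (V i) (%v'. (\<theta> i v v')^2)" by (intro vavg_cong bb v)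
  finally show "(LINT p|(m i xM m i). vavg (V i) (%v'. b v p * b v' p)) = vavg (V i) (%v'. (\<theta> i v v')^2)" .
  qed
  finally show ?thesis .
  qed
  have up: "(LINT p|(m i xM m i). (Z p)^2) <= (\<alpha>^2 + e)^2 + (1 - p)" proof -
  have "(LINT p|(m i xM m i). (Z p)^2) <= (LINT p|(m i xM m i). (\<alpha>^2 + e)^2 + indicator (space (m i xM m i) - B) p)" proof (rule integral_mono[OF iZ2])
  show "integrable (m i xM m i) (%p. (\<alpha>^2 + e)^2 + indicator (space (m i xM m i) - B) p :: real)"
  using Bm by (intro Bochner_Integration.integrable_add mm.integrable_const mm.integrable_01) (auto simp: indicator_def)
  fix p assume p: "p : space (m i xM m i)"
  show "(Z p)^2 <= (\<alpha>^2 + e)^2 + indicator (space (m i xM m i) - B) p" proof (cases "p : B")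
  case True
  then have "Z p <= \<alpha>^2 + e" unfolding B_def by auto
  then have "(Z p)^2 <= (\<alpha>^2 + e)^2" using Z01[OF p] by (intro power_mono) auto
  then show ?thesis by (simp add: indicator_def)
  next
  case False
  have "(Z p)^2 <= 1" using Z01[OF p] by (simp add: power_le_one)
  moreover have "0 <= (\<alpha>^2 + e)^2" by simp
  moreover have "indicator (space (m i xM m i) - B) p = (1::real)" using False p by simp
  ultimately show ?thesis by linarith
  qed
  qed
  also have "... = (\<alpha>^2 + e)^2 + (1 - measure (m i xM m i) B)" proof -
  have "integrable (m i xM m i) (indicator (space (m i xM m i) - B) :: _ => real)" using Bm by (intro mm.integrable_01) (auto simp: indicator_def)
  then show ?thesis using Bm by (simp add: mm.prob_space mm.prob_compl)
  qed
  also have "... <= (\<alpha>^2 + e)^2 + (1 - p)" using pB by simp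
  finally show ?thesis .
  qed
  have iaa: "integrable (m i) (%x. a i v x * a i v' x)" if "v : V i" "v' : V i" for v v'
  by (rule mi.integrable_01) (use am a01 that in \<open>auto intro: mult_le_one\<close>)
  have ia: "integrable (m i) (a i v)" if "v : V i" for v by (rule mi.integrable_01) (use am a01 that in auto)
  have iv: "integrable (m i) (%x. vavg (V i) (%v. a i v x))" by (rule integral_vavg(2)[OF ia])
  have ev: "(LINT x|m i. vavg (V i) (%v. a i v x)) = vavg (V i) (%v. \<integral>x. a i v x \<partial>m i)" by (rule integral_vavg(1)[OF ia])
  have low: "\<alpha>^2 - 2 * D1 i <= vavg (V i) (%v. vavg (V i) (%v'. \<theta> i v v'))" proof -
  have "vavg (V i) (%v. vavg (V i) (%v'. \<theta> i v v')) = vavg (V i) (%v. \<integral>x. vavg (V i) (%v'. a i v x * a i v' x) \<partial>m i)"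
  unfolding \<theta>_def by (intro vavg_cong integral_vavg(1)[symmetric] iaa)
  also have "... = (LINT x|m i. vavg (V i) (%v. vavg (V i) (%v'. a i v x * a i v' x)))" by (intro integral_vavg(1)[symmetric] integral_vavg(2) iaa)
  also have "... = (LINT x|m i. (vavg (V i) (%v. a i v x))^2)" by (simp add: power2_eq_square vavg_square)
  also have "... >= (LINT x|m i. 2 * \<alpha> * vavg (V i) (%v. a i v x) - \<alpha>^2)" proof (rule integral_mono)
  show "integrable (m i) (%x. 2 * \<alpha> * vavg (V i) (%v. a i v x) - \<alpha>^2)" using iv by auto
  show "integrable (m i) (%x. (vavg (V i) (%v. a i v x))^2)" unfolding power2_eq_square vavg_square by (intro integral_vavg(2) iaa)
  show "2 * \<alpha> * vavg (V i) (%v. a i v x) - \<alpha>^2 <= (vavg (V i) (%v. a i v x))^2" for x proof -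
  have "0 <= (vavg (V i) (%v. a i v x) - \<alpha>)^2" by simp
  then show ?thesis by (simp add: power2_eq_square algebra_simps)
  qed
  qed
  also have "(LINT x|m i. 2 * \<alpha> * vavg (V i) (%v. a i v x) - \<alpha>^2) = 2 * \<alpha> * vavg (V i) (%v. \<integral>x. a i v x \<partial>m i) - \<alpha>^2"
  using iv by (simp add: ev mi.prob_space)
  finally have 1: "2 * \<alpha> * vavg (V i) (%v. \<integral>x. a i v x \<partial>m i) - \<alpha>^2 <= vavg (V i) (%v. vavg (V i) (%v'. \<theta> i v v'))" .
  have "\<bar>vavg (V i) (%v. (LINT x|m i. a i v x) - \<alpha>)\<bar> <= D1 i" unfolding D1_def by (rule vavg_abs_le)
  then have "\<bar>vavg (V i) (%v. \<integral>x. a i v x \<partial>m i) - \<alpha>\<bar> <= D1 i" by (simp add: vavg_diff vavg_const[OF Vn])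
  moreover define t where "t = \<alpha> * (vavg (V i) (%v. \<integral>x. a i v x \<partial>m i) - \<alpha>)"
  have t1: "2 * \<alpha> * vavg (V i) (%v. \<integral>x. a i v x \<partial>m i) - \<alpha>^2 = \<alpha>^2 + 2 * t"
  unfolding t_def by (simp add: power2_eq_square algebra_simps)
  have "\<bar>t\<bar> <= 1 * \<bar>vavg (V i) (%v. \<integral>x. a i v x \<partial>m i) - \<alpha>\<bar>"
  unfolding t_def abs_mult using \<alpha>01 by (intro mult_right_mono) auto
  ultimately have "\<bar>t\<bar> <= D1 i" by simp
  then have "- t <= D1 i" by (rule abs_le_D2)
  then have "\<alpha>^2 - 2 * D1 i <= \<alpha>^2 + 2 * t" by simp
  also have "... <= vavg (V i) (%v. vavg (V i) (%v'. \<theta> i v v'))" using 1 unfolding t1 .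
  finally show ?thesis .
  qed
  have "vavg (V i) (%v. vavg (V i) (%v'. (\<theta> i v v' - \<alpha>^2)^2)) =
  vavg (V i) (%v. vavg (V i) (%v'. (\<theta> i v v')^2)) - 2 * \<alpha>^2 * vavg (V i) (%v. vavg (V i) (%v'. \<theta> i v v')) + (\<alpha>^2)^2"
  by (simp add: power2_diff vavg_add vavg_diff vavg_const[OF Vn] vavg_cmult vavg_cmult_right mult.commute mult.left_commute)
  also have "... <= (\<alpha>^2 + e)^2 + (1 - p) - 2 * \<alpha>^2 * (\<alpha>^2 - 2 * D1 i) + (\<alpha>^2)^2" proof -
  have "2 * \<alpha>^2 * (\<alpha>^2 - 2 * D1 i) <= 2 * \<alpha>^2 * vavg (V i) (%v. vavg (V i) (%v'. \<theta> i v v'))" using low by (intro mult_left_mono) auto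
  then show ?thesis using up unfolding EZ by linarith
  qed
  also have "... = 2 * (\<alpha>^2 * e) + e * e + (1 - p) + 4 * (\<alpha>^2 * D1 i)" by (simp add: power2_eq_square algebra_simps)
  also have "... <= 2 * (1 * e) + 1 * e + (1 - p) + 4 * (1 * D1 i)" proof -
  have "\<alpha>^2 <= 1" using \<alpha>01 by (simp add: power_le_one)
  moreover have "0 <= D1 i" unfolding D1_def by (intro vavg_nonneg) simp
  ultimately have "\<alpha>^2 * e <= 1 * e" "\<alpha>^2 * D1 i <= 1 * D1 i" using e by (simp_all only: mult_right_mono less_imp_le)
  moreover have "e * e <= 1 * e" using e by (simp only: mult_right_mono less_imp_le)
  ultimately show ?thesis by simp
  qed
  finally show ?thesis by simp
 qed
 have D2_lim: "D2 ~~> 0" proof (rule tendsto_0I)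
  show "0 <= D2 i" for i unfolding D2_def by (intro vavg_nonneg) simp
  fix e :: real assume e: "e > 0"
  define s where "s = e / 2"
  have s: "s > 0" using e by (simp add: s_def)
  define t where "t = min 1 (s^2 / 9)"
  have t: "0 < t" "t <= 1" "3 * t <= s^2 / 3" using s by (auto simp: t_def min_def)
  define \<O> where "\<O> = word_nhd G (X xM X) (pair_feat u u) ?sq {left_word w @ right_word w} t"
  have \<O>: "\<O> : weak_star_nhds G (X xM X) (average_metric d) ?sq" unfolding \<O>_def
  by (rule word_nhd_nhd[OF mfp sq _ _ t(1)]) (use left_right_words[OF w] in \<open>simp_all del: in_lists_conv_set\<close>)
  have "EV i. 1 - measure (square_measure (V i) X (m i)) (good_models G (X xM X) (V i) (\<sigma> i) \<O>) < s^2 / 3"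
  using qc(2)[OF \<O>] s unfolding tendsto_1_compl by (intro tendsto_0_eventually_less) auto
  moreover have "EV i. D1 i < s^2 / 12" using D1_lim s by (intro tendsto_0_eventually_less) auto
  ultimately show "EV i. D2 i < e" proof eventually_elim
  case (elim i)
  have "vavg (V i) (%v. vavg (V i) (%v'. (\<theta> i v v' - \<alpha>^2)^2)) < s^2" using key[OF t(1,2) refl, of i] elim t(3) unfolding \<O>_def by linarith
  then have "vavg (V i) (%v. vavg (V i) (%v'. (\<theta> i v v' - \<alpha>^2)^2)) / s < s^2 / s" using s by (intro divide_strict_right_mono)
  then have small: "vavg (V i) (%v. vavg (V i) (%v'. (\<theta> i v v' - \<alpha>^2)^2)) / s < s" using s by (simp add: power2_eq_square)
  have "D2 i <= vavg (V i) (%v. vavg (V i) (%v'. s + (\<theta> i v v' - \<alpha>^2)^2 / s))" unfolding D2_def by (intro vavg_mono abs_le_square s)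
  also have "... = s + vavg (V i) (%v. vavg (V i) (%v'. (\<theta> i v v' - \<alpha>^2)^2)) / s"
  by (simp add: vavg_add vavg_const[OF Vn] divide_inverse vavg_cmult_right)
  finally show ?case using small by (simp add: s_def)
  qed
 qed
 show "(%i. vavg (V i) (%v. \<bar>(LINT x|m i. wval (name G u (\<sigma> i) x v) w) - (LINT p|N. wval (name G u T \<xi> p) w)\<bar>)) ~~> 0 &
  (%i. vavg (V i) (%v. vavg (V i) (%v'.
  \<bar>(LINT x|m i. wval (name G u (\<sigma> i) x v) w * wval (name G u (\<sigma> i) x v') w) -
  (LINT p|N. wval (name G u T \<xi> p) w)^2\<bar>))) ~~> 0" using D1_lim D2_lim unfolding D1_def D2_def \<theta>_def a_def \<alpha>_def by blast
qed

end

section \<open>Pair convergence implies double quenching\<close>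

lemma good_models_measurable:
 fixes u :: "'j::countable => 'a => real" and G :: "('g, 'b) monoid_scheme" and V :: "nat => 'v set"
 assumes G: "countable (carrier G)" and mf: "metric_features X d u" and act: "almost_action G V \<sigma>" and \<O>: "openin (weak_star G X d) \<O>"
 shows "good_models G X (V i) (\<sigma> i) \<O> : sets (PiM (V i) (%_. X))" proof -
 have um: "!!j. u j : bmeas X" using mf unfolding metric_features_def by blast
 let ?Words = "name_words G :: ('g \<times> 'j) list set"
 have cW: "countable ?Words" using G by (intro countable_lists countable_SIGMA) auto
 define \<Phi> where "\<Phi> \<nu> = (%n. \<integral>x. wval (cname G u x) (from_nat_into ?Words n) \<partial>\<nu>)" for \<nu>
 define inside where "inside \<rho> W e \<longleftrightarrow> finite W & W \<subseteq> ?Words & e > 0 & word_nhd G X u \<rho> W e \<subseteq> \<O>" for \<rho> W and e :: real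
 define B where "B \<rho> W e = {y :: nat => real. ALL w:W. \<bar>y (to_nat_on ?Words w) - \<Phi> \<rho> (to_nat_on ?Words w)\<bar> < e}" for \<rho> W e
 define U where "U = \<Union>{B \<rho> W e | \<rho> W e. \<rho> : \<O> & inside \<rho> W e}"
 have "open (B \<rho> W e)" if "finite W" for \<rho> W e proof -
  have "B \<rho> W e = (\<Inter>w\<in>W. {y. \<bar>y (to_nat_on ?Words w) - \<Phi> \<rho> (to_nat_on ?Words w)\<bar> < e})" unfolding B_def by auto
  also have "open ..." by (intro open_INT that ballI open_Collect_less continuous_intros continuous_on_product_coordinates)
  finally show ?thesis .
 qed
 then have openU: "open U" unfolding U_def inside_def by (intro open_Union) auto
 have \<Phi>w: "\<Phi> \<nu> (to_nat_on ?Words w) = (LINT x|\<nu>. wval (cname G u x) w)" if "w : ?Words" for w \<nu>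
  unfolding \<Phi>_def by (simp add: from_nat_into_to_nat_on[OF cW that])
 have iff: "\<nu> : \<O> \<longleftrightarrow> \<Phi> \<nu> : U" if \<nu>: "prob_space \<nu>" "sets \<nu> = sets (configs G X)" for \<nu> proof
  assume n: "\<nu> : \<O>"
  from weak_star_openD[OF G mf \<O> n] obtain W e where "finite W" "W \<subseteq> ?Words" "e > 0"
  "word_nhd G X u \<nu> W e \<subseteq> \<O>" by (elim conjE exE)
  then have We: "inside \<nu> W e" unfolding inside_def by (intro conjI)
  have "\<Phi> \<nu> : B \<nu> W e" using We unfolding B_def inside_def by simp
  with n We show "\<Phi> \<nu> : U" unfolding U_def by blast
 next
  assume "\<Phi> \<nu> : U"
  then obtain \<rho> W e where r: "\<rho> : \<O>" "inside \<rho> W e" "\<Phi> \<nu> : B \<rho> W e" unfolding U_def by blast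
  have "\<bar>(LINT x|\<nu>. wval (cname G u x) w) - (LINT x|\<rho>. wval (cname G u x) w)\<bar> < e" if w: "w : W" for w proof -
  have wW: "w : ?Words" using r(2) w unfolding inside_def by blast
  show ?thesis using r(3) w unfolding B_def \<Phi>w[OF wW, symmetric] by blast
  qed
  then have "\<nu> : word_nhd G X u \<rho> W e" unfolding word_nhd_def using \<nu> by simp
  then show "\<nu> : \<O>" using r(2) unfolding inside_def by blast
 qed
 define \<Psi> where "\<Psi> x = (%n. vavg (V i) (%v. wval (name G u (\<sigma> i) x v) (from_nat_into ?Words n)))" for x
 have "\<Psi> : bmeas (PiM (V i) (%_. X))" proof (rule measurable_coordinatewise_then_product)
  fix n
  have "(%x. wval (name G u (\<sigma> i) x v) (from_nat_into ?Words n)) : bmeas (PiM (V i) (%_. X))" if "v : V i" for v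
  by (rule model_word_measurable[OF act um that refl])
  then show "(%x. \<Psi> x n) : bmeas (PiM (V i) (%_. X))" unfolding \<Psi>_def vavg_def by measurable
 qed
 then have "\<Psi> -` U \<inter> space (PiM (V i) (%_. X)) : sets (PiM (V i) (%_. X))" using openU by (intro measurable_sets[of _ _ borel]) auto
 also have "\<Psi> -` U \<inter> space (PiM (V i) (%_. X)) = good_models G X (V i) (\<sigma> i) \<O>" proof -
  have "empirical_distribution G X (V i) (\<sigma> i) x : \<O> \<longleftrightarrow> \<Psi> x : U" if x: "x : PiE (V i) (%_. space X)" for x proof -
  have xs: "!!v. v : V i ==> x v : space X" using PiE_mem[OF x] .
  have p: "prob_space (empirical_distribution G X (V i) (\<sigma> i) x)"
  "sets (empirical_distribution G X (V i) (\<sigma> i) x) = sets (configs G X)"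
  by (rule empirical_distribution_props[OF almost_actionD(1,2)[OF act] xs almost_actionD(4)[OF act]]; assumption)+
  have "\<Phi> (empirical_distribution G X (V i) (\<sigma> i) x) = \<Psi> x" unfolding \<Phi>_def \<Psi>_def by (rule ext) (rule empirical_word[OF act xs um])
  with iff[OF p] show ?thesis by simp
  qed
  then show ?thesis unfolding good_models_def space_PiM by auto
 qed
 finally show ?thesis .
qed

lemma tendsto_0_squeeze:
 fixes f g :: "nat => real"
 assumes "g ~~> 0" "!!i. 0 <= f i" "!!i. f i <= g i"
 shows "f ~~> 0" using assms by (intro tendsto_sandwich[of "%_. 0" f sequentially g 0]) (auto intro!: always_eventually)

context pmp_action begin

text \<open>Words of the square are products of a word in each factor, so their one- and two-point averages factor over the two independent copies; the second moment bound makes most samples of the square good models.\<close>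
theorem pair_convergent_imp_doubly_quenched:
 fixes u :: "'j::countable => 'a => real" and V :: "nat => 'v set"
 assumes mc: "metric_coding G N T X d u \<mu> \<xi>" and act: "almost_action G V \<sigma>" and m: "!!i. prob_space (m i)" "!!i. sets (m i) = sets (PiM (V i) (%_. X))"
  and pc: "pair_convergent G N T u \<xi> V \<sigma> m"
 shows "doubly_quenched_converges G V \<sigma> X d m \<mu>" proof -
 note mf = metric_codingD(1)[OF mc] and \<mu> = metric_codingD(2,3)[OF mc]
 note mfp = metric_features_pair[OF mf]
 have um: "!!j. u j : bmeas X" and feat: "features (space X) u" using mf unfolding metric_features_def by blast+
 have pm: "!!j. pair_feat u u j : bmeas (X xM X)" using mfp unfolding metric_features_def by blast
 let ?sq = "square_measure (carrier G) X \<mu>"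
 note sq = square_measure_props(2,3)[OF \<mu>]
 have Vn: "finite (V i)" "V i ~= {}" for i using almost_actionD(1,2)[OF act] .
 define \<alpha> where "\<alpha> w = (LINT p|N. wval (name G u T \<xi> p) w)" for w
 have \<alpha>\<mu>: "(LINT x|\<mu>. wval (cname G u x) w) = \<alpha> w" if "w : name_words G" for w unfolding \<alpha>_def by (rule metric_codingD(6)[OF mc that])
 have \<alpha>01: "0 <= \<alpha> w & \<alpha> w <= 1" if w: "w : name_words G" for w proof -
  have ll_w: "loc_lip G UNIV (word w)" using w by (intro ll_word) auto
  show ?thesis using integral_01[OF test_measurable[OF metric_codingD(4)[OF mc] ll_w]] wval_01 orbit_name_in_cube[OF metric_codingD(4)[OF mc]]
  unfolding \<alpha>_def by blast
 qed
 define a where "a w i v x = wval (name G u (\<sigma> i) x v) w" for w i v x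
 have am: "a w i v : bmeas (m i)" if "v : V i" for w i v unfolding a_def by (rule model_word_measurable[OF act um that m(2)])
 have a01: "0 <= a w i v x & a w i v x <= 1" if "v : V i" "x : space (m i)" for w i v x unfolding a_def by (rule model_word_01[OF act feat that(1) m(2) that(2)])
 have ia01: "0 <= (LINT x|m i. a w i v x) & (LINT x|m i. a w i v x) <= 1" if "v : V i" for w i v using prob_space.integral_01[OF m(1) am a01] that by blast
 define \<theta> where "\<theta> w i v v' = (LINT x|m i. a w i v x * a w i v' x)" for w i v v'
 have \<theta>01: "0 <= \<theta> w i v v' & \<theta> w i v v' <= 1" if "v : V i" "v' : V i" for w i v v'
  unfolding \<theta>_def by (rule prob_space.integral_01[OF m(1)]) (use am a01 that in \<open>auto intro: mult_le_one\<close>)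
 define D1 where "D1 w i = vavg (V i) (%v. \<bar>(LINT x|m i. a w i v x) - \<alpha> w\<bar>)" for w i
 define D2 where "D2 w i = vavg (V i) (%v. vavg (V i) (%v'. \<bar>\<theta> w i v v' - (\<alpha> w)^2\<bar>))" for w i
 have D_lim: "D1 w ~~> 0" "D2 w ~~> 0" if "w : name_words G" for w
  using bspec[OF pc[unfolded pair_convergent_def] that] unfolding D1_def[abs_def] D2_def[abs_def] \<theta>_def a_def \<alpha>_def by blast+
 have main: "(%i. proportion (V i) (%v. distr (square_measure (V i) X (m i)) (PiM (carrier G) (%_. X xM X)) (pullback_name G (\<sigma> i) v) : \<O>)) ~~> 1 &
  (%i. measure (square_measure (V i) X (m i)) (good_models G (X xM X) (V i) (\<sigma> i) \<O>)) ~~> 1"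
  if \<O>: "\<O> : weak_star_nhds G (X xM X) (average_metric d) ?sq" for \<O> proof -
  have op: "openin (weak_star G (X xM X) (average_metric d)) \<O>" and sqO: "?sq : \<O>" using \<O> unfolding weak_star_nhds_def by auto
  obtain W e where W: "finite W" "W \<subseteq> name_words G" "e > 0"
  "word_nhd G (X xM X) (pair_feat u u) ?sq W e \<subseteq> \<O>" using weak_star_openD[OF countable_group mfp op sqO] by (elim conjE exE)
  have "EX w1 w2. w1 : name_words G & w2 : name_words G & (ALL q. wval q w = wval q (left_word w1 @ right_word w2))"
  if "w : W" for w using wval_split W(2) that by blast
  then obtain l r where lr: "!!w. w : W ==> l w : name_words G" "!!w. w : W ==> r w : name_words G"
  "!!w q. w : W ==> wval q w = wval q (left_word (l w) @ right_word (r w))" by metis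
  have sqw: "(LINT z|?sq. wval (cname G (pair_feat u u) z) w) = \<alpha> (l w) * \<alpha> (r w)" if w: "w : W" for w
  unfolding lr(3)[OF w] square_process_word[OF mf \<mu>] \<alpha>\<mu>[OF lr(1)[OF w]] \<alpha>\<mu>[OF lr(2)[OF w]] ..
  have "(%i. 1 - proportion (V i) (%v. distr (square_measure (V i) X (m i)) (PiM (carrier G) (%_. X xM X)) (pullback_name G (\<sigma> i) v) : \<O>)) ~~> 0"
  proof (rule tendsto_0_squeeze)
  show "(%i. (\<Sum>w\<in>W. D1 (l w) i + D1 (r w) i) / e) ~~> 0" proof -
  have "(%i. (\<Sum>w\<in>W. D1 (l w) i + D1 (r w) i) / e) ~~> (\<Sum>w\<in>W. 0 + 0) / e" using W(3) lr by (intro tendsto_intros D_lim) auto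
  then show ?thesis by simp
  qed
  fix i
  let ?P = "%v. distr (square_measure (V i) X (m i)) (PiM (carrier G) (%_. X xM X)) (pullback_name G (\<sigma> i) v) : \<O>"
  have eq: "1 - proportion (V i) ?P = vavg (V i) (%v. if ?P v then 0 else 1)" by (rule proportion_compl[OF Vn, symmetric])
  show "0 <= 1 - proportion (V i) ?P" unfolding eq by (intro vavg_nonneg) simp
  have "vavg (V i) (%v. if ?P v then 0 else 1) <= vavg (V i) (%v. (\<Sum>w\<in>W. \<bar>(LINT x|m i. a (l w) i v x) - \<alpha> (l w)\<bar> + \<bar>(LINT x|m i. a (r w) i v x) - \<alpha> (r w)\<bar>) * inverse e)"
  proof (rule vavg_mono)
  fix v assume v: "v : V i"
  let ?f = "%w. \<bar>(LINT x|m i. a (l w) i v x) - \<alpha> (l w)\<bar> + \<bar>(LINT x|m i. a (r w) i v x) - \<alpha> (r w)\<bar>"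
  have f0: "0 <= sum ?f W" by (intro sum_nonneg) simp
  show "(if ?P v then 0 else 1) <= sum ?f W * inverse e" proof (cases "?P v")
  case True
  then show ?thesis using f0 W(3) by simp
  next
  case False
  let ?\<nu> = "distr (square_measure (V i) X (m i)) (PiM (carrier G) (%_. X xM X)) (pullback_name G (\<sigma> i) v)"
  have pmeas: "pullback_name G (\<sigma> i) v : measurable (square_measure (V i) X (m i)) (PiM (carrier G) (%_. X xM X))"
  using pullback_measurable[of G "\<sigma> i" v "V i", OF almost_actionD(4)[OF act _ v]] by (simp add: square_measure_def)
  have \<nu>: "prob_space ?\<nu>" "sets ?\<nu> = sets (PiM (carrier G) (%_. X xM X))"
  using prob_space.prob_space_distr[OF square_measure_props(2)[OF m] pmeas] by simp_all
  have "?\<nu> ~: word_nhd G (X xM X) (pair_feat u u) ?sq W e" using False W(4) by blast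
  then obtain w where w: "w : W" and far: "~ \<bar>(LINT z|?\<nu>. wval (cname G (pair_feat u u) z) w) -
  (LINT z|?sq. wval (cname G (pair_feat u u) z) w)\<bar> < e" using \<nu> unfolding word_nhd_def by blast
  have "(LINT z|?\<nu>. wval (cname G (pair_feat u u) z) w) = (LINT x|m i. a (l w) i v x) * (LINT x|m i. a (r w) i v x)"
  unfolding lr(3)[OF w] square_model_word[OF mf act v m] a_def ..
  with far have "e <= \<bar>(LINT x|m i. a (l w) i v x) * (LINT x|m i. a (r w) i v x) - \<alpha> (l w) * \<alpha> (r w)\<bar>" unfolding sqw[OF w] by simp
  also have "... <= ?f w" using ia01[OF v] \<alpha>01[OF lr(1)[OF w]] by (intro abs_mult_diff_le) (auto simp: abs_le_iff)
  also have "... <= sum ?f W" using w W(1) by (intro member_le_sum) auto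
  finally have "1 <= sum ?f W * inverse e" using W(3) by (simp add: field_simps)
  with False show ?thesis by simp
  qed
  qed
  also have "... = (\<Sum>w\<in>W. D1 (l w) i + D1 (r w) i) / e" by (simp add: vavg_cmult_right vavg_sum vavg_add D1_def divide_inverse)
  finally show "1 - proportion (V i) ?P <= (\<Sum>w\<in>W. D1 (l w) i + D1 (r w) i) / e" unfolding eq .
  qed
  moreover have "(%i. 1 - measure (square_measure (V i) X (m i)) (good_models G (X xM X) (V i) (\<sigma> i) \<O>)) ~~> 0" proof (rule tendsto_0_squeeze)
  show "(%i. (\<Sum>w\<in>W. ((D2 (l w) i + D2 (r w) i) + 2 * (D1 (l w) i + D1 (r w) i)) / e^2)) ~~> 0" proof -
  have "(%i. (\<Sum>w\<in>W. ((D2 (l w) i + D2 (r w) i) + 2 * (D1 (l w) i + D1 (r w) i)) / e^2)) ~~> (\<Sum>w\<in>W. ((0 + 0) + 2 * (0 + 0)) / e^2)"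
  using W(3) lr by (intro tendsto_intros D_lim) auto
  then show ?thesis by simp
  qed
  fix i
  interpret mi: prob_space "m i" by (rule m(1))
  interpret mm: pair_prob_space "m i" "m i" ..
  interpret S: prob_space "square_measure (V i) X (m i)" by (rule square_measure_props(2)[OF m])
  let ?G = "good_models G (X xM X) (V i) (\<sigma> i) \<O>"
  let ?pair = "%(x, y). \<lambda>v\<in>V i. (x v, y v)"
  show "0 <= 1 - measure (square_measure (V i) X (m i)) ?G" using S.prob_le_1 by simp
  have Gm: "?G : sets (PiM (V i) (%_. X xM X))" by (rule good_models_measurable[OF countable_group mfp act op])
  define b where "b w v p = a (l w) i v (fst p) * a (r w) i v (snd p)" for w v p
  have bm: "b w v : bmeas (m i xM m i)" if "v : V i" for w v unfolding b_def[abs_def]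
  using measurable_compose[OF measurable_fst am[OF that]] measurable_compose[OF measurable_snd am[OF that]] by (rule borel_measurable_times)
  have b01: "0 <= b w v p & b w v p <= 1" if "v : V i" "p : space (m i xM m i)" for w v p
  using a01[OF that(1)] that(2) by (auto simp: b_def space_pair_measure intro!: mult_le_one)
  define Z where "Z w p = vavg (V i) (%v. b w v p) - \<alpha> (l w) * \<alpha> (r w)" for w p
  have Zm: "Z w : bmeas (m i xM m i)" for w unfolding Z_def[abs_def] vavg_def using bm by measurable
  define Bad where "Bad w = {p : space (m i xM m i). e <= \<bar>Z w p\<bar>}" for w
  have Badm: "Bad w : sets (m i xM m i)" for w unfolding Bad_def using Zm by measurable
  have bad: "measure (m i xM m i) (Bad w) <= ((D2 (l w) i + D2 (r w) i) + 2 * (D1 (l w) i + D1 (r w) i)) / e^2" if w: "w : W" for w proof -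
  note l01 = \<alpha>01[OF lr(1)[OF w]] and r01 = \<alpha>01[OF lr(2)[OF w]]
  have c01: "0 <= \<alpha> (l w) * \<alpha> (r w)" "\<alpha> (l w) * \<alpha> (r w) <= 1" using l01 r01 by (auto intro: mult_le_one)
  note sm = mm.second_moment[where a = "b w" and V = "V i" and c = "\<alpha> (l w) * \<alpha> (r w)", OF Vn bm b01 c01]
  have "measure (m i xM m i) (Bad w) <= (LINT p|(m i xM m i). (Z w p)^2) / e^2" unfolding Bad_def using sm(2) by (intro mm.chebyshev Zm W(3)) (simp add: Z_def)
  also have "(LINT p|(m i xM m i). (Z w p)^2) \<le>
  vavg (V i) (%v. vavg (V i) (%v'. \<bar>(LINT p|(m i xM m i). b w v p * b w v' p) - (\<alpha> (l w) * \<alpha> (r w))^2\<bar>)) +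
  2 * vavg (V i) (%v. \<bar>(LINT p|(m i xM m i). b w v p) - \<alpha> (l w) * \<alpha> (r w)\<bar>)" unfolding Z_def by (rule sm(1))
  also have "... <= vavg (V i) (%v. vavg (V i) (%v'. \<bar>\<theta> (l w) i v v' - (\<alpha> (l w))^2\<bar> + \<bar>\<theta> (r w) i v v' - (\<alpha> (r w))^2\<bar>)) +
  2 * vavg (V i) (%v. \<bar>(LINT x|m i. a (l w) i v x) - \<alpha> (l w)\<bar> + \<bar>(LINT x|m i. a (r w) i v x) - \<alpha> (r w)\<bar>)"
  proof (intro add_mono mult_left_mono vavg_mono)
  fix v v' assume v: "v : V i" "v' : V i"
  have "(LINT p|(m i xM m i). b w v p * b w v' p) = (LINT p|(m i xM m i). (a (l w) i v (fst p) * a (l w) i v' (fst p)) * (a (r w) i v (snd p) * a (r w) i v' (snd p)))"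
  by (simp add: b_def mult_ac)
  also have "... = \<theta> (l w) i v v' * \<theta> (r w) i v v'" unfolding \<theta>_def
  by (rule integral_product_fun[OF m(1)]) (use am a01 v in \<open>auto intro: mult_le_one\<close>)
  finally have "\<bar>(LINT p|(m i xM m i). b w v p * b w v' p) - (\<alpha> (l w) * \<alpha> (r w))^2\<bar> =
  \<bar>\<theta> (l w) i v v' * \<theta> (r w) i v v' - (\<alpha> (l w))^2 * (\<alpha> (r w))^2\<bar>" by (simp add: power_mult_distrib)
  also have "... <= \<bar>\<theta> (l w) i v v' - (\<alpha> (l w))^2\<bar> + \<bar>\<theta> (r w) i v v' - (\<alpha> (r w))^2\<bar>"
  using \<theta>01[OF v] l01 by (intro abs_mult_diff_le) (auto simp: abs_le_iff power_le_one intro: order_trans[of _ 0])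
  finally show "\<bar>(LINT p|(m i xM m i). b w v p * b w v' p) - (\<alpha> (l w) * \<alpha> (r w))^2\<bar> <= \<bar>\<theta> (l w) i v v' - (\<alpha> (l w))^2\<bar> + \<bar>\<theta> (r w) i v v' - (\<alpha> (r w))^2\<bar>" .
  next
  fix v assume v: "v : V i"
  have "(LINT p|(m i xM m i). b w v p) = (LINT x|m i. a (l w) i v x) * (LINT x|m i. a (r w) i v x)"
  unfolding b_def by (rule integral_product_fun[OF m(1)]) (use am a01 v in auto)
  then show "\<bar>(LINT p|(m i xM m i). b w v p) - \<alpha> (l w) * \<alpha> (r w)\<bar> <= \<bar>(LINT x|m i. a (l w) i v x) - \<alpha> (l w)\<bar> + \<bar>(LINT x|m i. a (r w) i v x) - \<alpha> (r w)\<bar>"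
  using ia01[OF v] l01 by (simp only:) (intro abs_mult_diff_le, auto simp: abs_le_iff)
  qed simp
  also have "... = (D2 (l w) i + D2 (r w) i) + 2 * (D1 (l w) i + D1 (r w) i)" by (simp add: vavg_add D1_def D2_def)
  finally show ?thesis using W(3) by (simp add: divide_right_mono)
  qed
  have "1 - measure (square_measure (V i) X (m i)) ?G = measure (m i xM m i) (space (m i xM m i) - (?pair -` ?G \<inter> space (m i xM m i)))" proof -
  have "measure (square_measure (V i) X (m i)) ?G = measure (m i xM m i) (?pair -` ?G \<inter> space (m i xM m i))"
  unfolding square_measure_def[of "V i" X "m i"] by (rule measure_distr[OF square_measure_props(1)[OF m] Gm])
  moreover have "?pair -` ?G \<inter> space (m i xM m i) : sets (m i xM m i)" by (rule measurable_sets[OF square_measure_props(1)[OF m] Gm])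
  ultimately show ?thesis by (simp add: mm.prob_compl)
  qed
  also have "... <= measure (m i xM m i) (\<Union>w\<in>W. Bad w)" proof (rule mm.finite_measure_mono)
  show "(\<Union>w\<in>W. Bad w) : sets (m i xM m i)" using W(1) Badm by (intro sets.finite_UN)
  show "space (m i xM m i) - (?pair -` ?G \<inter> space (m i xM m i)) \<subseteq> (\<Union>w\<in>W. Bad w)" proof
  fix q assume q: "q : space (m i xM m i) - (?pair -` ?G \<inter> space (m i xM m i))"
  obtain x y where xy: "q = (x, y)" by (cases q)
  let ?z = "\<lambda>v\<in>V i. (x v, y v)"
  have zP: "?z : space (PiM (V i) (%_. X xM X))" using measurable_space[OF square_measure_props(1)[OF m], of q] q xy by auto
  then have zPE: "?z : PiE (V i) (%_. space (X xM X))" by (simp only: space_PiM)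
  have zs: "!!v. v : V i ==> ?z v : space (X xM X)" using PiE_mem[OF zPE] .
  have "?z ~: ?G" using q xy by auto
  then have "empirical_distribution G (X xM X) (V i) (\<sigma> i) ?z ~: \<O>" using zPE unfolding good_models_def by blast
  then have "empirical_distribution G (X xM X) (V i) (\<sigma> i) ?z ~: word_nhd G (X xM X) (pair_feat u u) ?sq W e" using W(4) by blast
  moreover have "prob_space (empirical_distribution G (X xM X) (V i) (\<sigma> i) ?z)"
  "sets (empirical_distribution G (X xM X) (V i) (\<sigma> i) ?z) = sets (PiM (carrier G) (%_. X xM X))"
  by (rule empirical_distribution_props[OF Vn zs almost_actionD(4)[OF act]]; assumption)+
  ultimately obtain w where w: "w : W" and far: "~ \<bar>(LINT z|empirical_distribution G (X xM X) (V i) (\<sigma> i) ?z. wval (cname G (pair_feat u u) z) w) -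
  (LINT z|?sq. wval (cname G (pair_feat u u) z) w)\<bar> < e" unfolding word_nhd_def by blast
  have "(LINT z|empirical_distribution G (X xM X) (V i) (\<sigma> i) ?z. wval (cname G (pair_feat u u) z) w) =
  vavg (V i) (%v. wval (name G (pair_feat u u) (\<sigma> i) ?z v) w)" by (rule empirical_word[OF act zs pm])
  also have "... = vavg (V i) (%v. b w v q)" proof (rule vavg_cong)
  fix v assume v: "v : V i"
  have "(%(g, j). name G (pair_feat u u) (\<sigma> i) ?z v (g, Inl j)) = name G u (\<sigma> i) x v"
  "(%(g, j). name G (pair_feat u u) (\<sigma> i) ?z v (g, Inr j)) = name G u (\<sigma> i) y v"
  using almost_actionD(4)[OF act _ v] by (auto simp: name_def fun_eq_iff)
  then show "wval (name G (pair_feat u u) (\<sigma> i) ?z v) w = b w v q" by (simp add: lr(3)[OF w] wval_left_right b_def a_def xy)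
  qed
  finally have "e <= \<bar>Z w q\<bar>" using far unfolding sqw[OF w] Z_def by simp
  with q w show "q : (\<Union>w\<in>W. Bad w)" unfolding Bad_def by blast
  qed
  qed
  also have "... <= (\<Sum>w\<in>W. measure (m i xM m i) (Bad w))" using W(1) Badm by (intro mm.finite_measure_subadditive_finite) auto
  also have "... <= (\<Sum>w\<in>W. ((D2 (l w) i + D2 (r w) i) + 2 * (D1 (l w) i + D1 (r w) i)) / e^2)" by (intro sum_mono bad)
  finally show "1 - measure (square_measure (V i) X (m i)) ?G <= (\<Sum>w\<in>W. ((D2 (l w) i + D2 (r w) i) + 2 * (D1 (l w) i + D1 (r w) i)) / e^2)" .
  qed
  ultimately show ?thesis unfolding tendsto_1_compl[symmetric] by blast
 qed
 show ?thesis unfolding doubly_quenched_converges_def quenched_converges_def using m square_measure_props(2,3)[OF m] main by simp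
qed

end

section \<open>From doubly-quenched measures to models of powers\<close>

definition component :: "nat => ('g \<times> (nat \<times> 'j)) list => ('g \<times> 'j) list" where
 "component l w = map (%(g, l', j). (g, j)) (filter (%e. fst (snd e) = l) w)"

lemma component_in_words: "w : name_words G ==> component l w : name_words G" by (auto simp: component_def in_lists_conv_set)

lemma wval_components:
 assumes "!!g l j. q (g, (l, j)) = (if l < k then h l (g, j) else (0::real))"
 shows "wval q w =
  (if ALL e:set w. fst (snd e) < k then \<Prod>l<k. wval (h l) (component l w) else 0)" proof (induction w)
 case Nil
 show ?case by (simp add: component_def)
next
 case (Cons e w)
 obtain g l j where e: "e = (g, (l, j))" by (cases e) auto
 have "wval (h l') (component l' (e # w)) = (if l' = l then h l' (g, j) else 1) * wval (h l') (component l' w)" for l' by (simp add: component_def e)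
 then have "(\<Prod>l<k. wval (h l) (component l (e # w))) =
  (if l < k then h l (g, j) else 1) * (\<Prod>l<k. wval (h l) (component l w))" by (simp add: prod.distrib)
 then show ?case using assms[of g l j] Cons.IH by (simp add: e)
qed

lemma integral_power_product:
 fixes f :: "nat => 'x => real"
 assumes m: "prob_space m" and f: "!!l. l < k ==> f l : bmeas m"
  "!!l x. l < k ==> x : space m ==> 0 <= f l x & f l x <= 1"
 shows "(LINT x|power_space k m. (\<Prod>l<k. f l (x l))) = (\<Prod>l<k. \<integral>x. f l x \<partial>m)" proof -
 interpret m: prob_space m by fact
 interpret product_sigma_finite "%_. m" ..
 show ?thesis unfolding power_space_def by (rule product_integral_prod) (auto intro!: m.integrable_01 f)
qed

definition tuple_model :: "nat => (nat => 'v => 'a) => 'v => nat => 'a" where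
 "tuple_model k x v = (\<lambda>l\<in>{..<k}. x l v)"

lemma wval_tuple_model:
 "wval (name G (pow_feat k u) s (tuple_model k x) v) w =
  (if ALL e:set w. fst (snd e) < k then \<Prod>l<k. wval (name G u s (x l) v) (component l w) else 0)"
 by (rule wval_components) (auto simp: name_def pow_feat_def tuple_model_def)

lemma wval_power_orbit:
 "wval (name G (pow_feat k u) (power_action k T) (pow_code k \<xi>) p) w =
  (if ALL e:set w. fst (snd e) < k then \<Prod>l<k. wval (name G u T \<xi> (p l)) (component l w) else 0)"
 by (rule wval_components) (auto simp: name_def pow_feat_def pow_code_def power_action_def)

lemma abs_prod_diff_le:
 fixes x y :: "'i => real"
 assumes "!!l. l : L ==> 0 <= x l & x l <= 1" "!!l. l : L ==> 0 <= y l & y l <= 1"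
 shows "\<bar>prod x L - prod y L\<bar> <= (\<Sum>l\<in>L. \<bar>x l - y l\<bar>)" using norm_prod_diff[of L x y] assms by (auto simp: abs_le_iff)

context pmp_action begin

lemma orbit_word_01:
 assumes "coding N A u \<xi>" "p : space N"
 shows "0 <= wval (name G u T \<xi> p) w & wval (name G u T \<xi> p) w <= 1" by (rule wval_01[OF orbit_name_in_cube[OF assms]])

lemma orbit_word_measurable:
 assumes "coding N A u \<xi>" "w : name_words G"
 shows "(%p. wval (name G u T \<xi> p) w) : bmeas N" using test_measurable[OF assms(1) ll_word[OF assms(2)]] .

text \<open>By independence the one- and two-point averages of a word of the power are products of those of its components, so the second moment bound applies.\<close>
theorem power_concentration:
 fixes u :: "'j => 'a => real" and V :: "nat => 'v set" and k :: nat
 assumes cod: "coding N (space X) u \<xi>" and um: "!!j. u j : bmeas X" and act: "almost_action G V \<sigma>"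
  and m: "!!i. prob_space (m i)" "!!i. sets (m i) = sets (PiM (V i) (%_. X))" and pc: "pair_convergent G N T u \<xi> V \<sigma> m" and w: "w : name_words G"
 defines "err \<equiv> %i x. vavg (V i) (%v. wval (name G (pow_feat k u) (\<sigma> i) (tuple_model k x) v) w) -
  (LINT p|power_space k N. wval (name G (pow_feat k u) (power_action k T) (pow_code k \<xi>) p) w)"
 shows "(%i. \<integral>x. (err i x)^2 \<partial>power_space k (m i)) ~~> 0"
  "err i : bmeas (power_space k (m i))" "integrable (power_space k (m i)) (%x. (err i x)^2)" proof -
 have feat: "features (space X) u" using cod unfolding coding_def by blast
 have "(%i. \<integral>x. (err i x)^2 \<partial>power_space k (m i)) ~~> 0 & (ALL i. err i : bmeas (power_space k (m i)) &
  integrable (power_space k (m i)) (%x. (err i x)^2))" proof (cases "ALL e:set w. fst (snd e) < k")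
  case False
  then have "err i = (%_. 0)" for i unfolding err_def wval_tuple_model wval_power_orbit if_not_P[OF False] by (simp add: vavg_def)
  then show ?thesis by simp
 next
  case True
  define c where "c l = component l w" for l
  have c: "c l : name_words G" for l unfolding c_def by (rule component_in_words[OF w])
  define b where "b i l v x = wval (name G u (\<sigma> i) x v) (c l)" for i l v x
  define al where "al l = (LINT p|N. wval (name G u T \<xi> p) (c l))" for l
  define A where "A = (\<Prod>l<k. al l)"
  have al: "0 <= al l & al l <= 1" for l unfolding al_def by (rule integral_01[OF orbit_word_measurable[OF cod c] orbit_word_01[OF cod]])
  have A01: "0 <= A" "A <= 1" unfolding A_def using al by (auto intro: prod_nonneg prod_le_1)
  have err: "err i x = vavg (V i) (%v. \<Prod>l<k. b i l v (x l)) - A" for i x proof -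
  have "(LINT p|power_space k N. (\<Prod>l<k. wval (name G u T \<xi> (p l)) (c l))) = A" unfolding A_def al_def
  by (rule integral_power_product[OF prob_space_axioms orbit_word_measurable[OF cod c] orbit_word_01[OF cod]])
  then show ?thesis unfolding err_def wval_tuple_model wval_power_orbit if_P[OF True] b_def c_def by simp
  qed
  define D1 where "D1 l i = vavg (V i) (%v. \<bar>(LINT x|m i. b i l v x) - al l\<bar>)" for l i
  define D2 where "D2 l i = vavg (V i) (%v. vavg (V i) (%v'. \<bar>(LINT x|m i. b i l v x * b i l v' x) - (al l)^2\<bar>))" for l i
  have D: "D1 l ~~> 0" "D2 l ~~> 0" for l using pc c[of l] unfolding D1_def[abs_def] D2_def[abs_def] b_def al_def pair_convergent_def by simp_all
  note V = almost_actionD(1,2)[OF act]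
  have step: "err i : bmeas (power_space k (m i)) & integrable (power_space k (m i)) (%x. (err i x)^2) &
  (LINT x|power_space k (m i). (err i x)^2) <= (\<Sum>l<k. D2 l i) + 2 * (\<Sum>l<k. D1 l i)" for i proof -
  interpret mi: prob_space "m i" by (rule m)
  have "prob_space (power_space k (m i))" unfolding power_space_def by (intro prob_space_PiM mi.prob_space_axioms)
  then interpret P: prob_space "power_space k (m i)" .
  have bm: "b i l v : bmeas (m i)" if "v : V i" for l v unfolding b_def[abs_def] by (rule model_word_measurable[OF act um that m(2)])
  have b01: "0 <= b i l v x & b i l v x <= 1" if "v : V i" "x : space (m i)" for l v x unfolding b_def by (rule model_word_01[OF act feat that(1) m(2) that(2)])
  have bb01: "0 <= b i l v x * b i l v' x & b i l v x * b i l v' x <= 1" if "v : V i" "v' : V i" "x : space (m i)" for l v v' x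
  using b01[OF that(1,3), of l] b01[OF that(2,3), of l] by (auto intro: mult_le_one)
  let ?a = "%v x. \<Prod>l<k. b i l v (x l)"
  have am: "?a v : bmeas (power_space k (m i))" if "v : V i" for v proof (rule borel_measurable_prod)
  fix l assume "l : {..<k}"
  then have "(%x. x l) : measurable (power_space k (m i)) (m i)" unfolding power_space_def by (intro measurable_component_singleton)
  from measurable_compose[OF this bm[OF that]] show "(%x. b i l v (x l)) : bmeas (power_space k (m i))" .
  qed
  have a01: "0 <= ?a v x & ?a v x <= 1" if "v : V i" "x : space (power_space k (m i))" for v x proof -
  have "0 <= b i l v (x l) & b i l v (x l) <= 1" if "l : {..<k}" for l
  using \<open>x : _\<close> that by (intro b01 \<open>v : V i\<close>) (auto simp: space_power_space)
  then show ?thesis by (auto intro: prod_nonneg prod_le_1)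
  qed
  note sm = P.second_moment[OF V, of i ?a A, OF am a01 A01, folded err]
  have 1: "\<bar>(LINT x|power_space k (m i). ?a v x * ?a v' x) - A^2\<bar> <= (\<Sum>l<k. \<bar>(LINT x|m i. b i l v x * b i l v' x) - (al l)^2\<bar>)"
  if v: "v : V i" "v' : V i" for v v' proof -
  have "(LINT x|power_space k (m i). ?a v x * ?a v' x) = (\<Prod>l<k. \<integral>x. b i l v x * b i l v' x \<partial>m i)" unfolding prod.distrib[symmetric]
  by (rule integral_power_product[OF m(1)]) (use bm v bb01 in auto)
  moreover have "A^2 = (\<Prod>l<k. (al l)^2)" unfolding A_def by (rule prod_power_distrib)
  moreover have "0 <= (LINT x|m i. b i l v x * b i l v' x) & (LINT x|m i. b i l v x * b i l v' x) <= 1" for l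
  by (rule mi.integral_01[OF borel_measurable_times[OF bm bm]]) (use v bb01 in auto)
  ultimately show ?thesis using al by (simp only:) (rule abs_prod_diff_le, auto intro: power_le_one)
  qed
  have 2: "\<bar>(LINT x|power_space k (m i). ?a v x) - A\<bar> <= (\<Sum>l<k. \<bar>(LINT x|m i. b i l v x) - al l\<bar>)" if v: "v : V i" for v proof -
  have "(LINT x|power_space k (m i). ?a v x) = (\<Prod>l<k. \<integral>x. b i l v x \<partial>m i)" by (rule integral_power_product[OF m(1)]) (use bm v b01 in auto)
  moreover have "0 <= (LINT x|m i. b i l v x) & (LINT x|m i. b i l v x) <= 1" for l by (rule mi.integral_01[OF bm]) (use v b01 in auto)
  ultimately show ?thesis using al unfolding A_def by (simp only:) (rule abs_prod_diff_le, auto)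
  qed
  have "(LINT x|power_space k (m i). (err i x)^2) \<le>
  vavg (V i) (%v. vavg (V i) (%v'. \<Sum>l<k. \<bar>(LINT x|m i. b i l v x * b i l v' x) - (al l)^2\<bar>)) +
  2 * vavg (V i) (%v. \<Sum>l<k. \<bar>(LINT x|m i. b i l v x) - al l\<bar>)" by (rule order_trans[OF sm(1)] add_mono mult_left_mono vavg_mono 1 2 | simp)+
  then show ?thesis using sm(2) am unfolding err[abs_def] vavg_sum D1_def D2_def by (auto simp: vavg_def intro!: borel_measurable_sum)
  qed
  have lim: "(%i. (\<Sum>l<k. D2 l i) + 2 * (\<Sum>l<k. D1 l i)) ~~> 0"
  using tendsto_add[OF tendsto_sum[of "{..<k}" D2 "%_. 0"] tendsto_mult[OF tendsto_const[of 2] tendsto_sum[of "{..<k}" D1 "%_. 0"]]] D by simp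
  show ?thesis using step by (auto intro!: tendsto_0_squeeze[OF lim])
 qed
 then show "(%i. \<integral>x. (err i x)^2 \<partial>power_space k (m i)) ~~> 0"
  "err i : bmeas (power_space k (m i))" "integrable (power_space k (m i)) (%x. (err i x)^2)" by blast+
qed

lemma good_tuples_likely:
 fixes u :: "'j => 'a => real" and V :: "nat => 'v set" and k :: nat
 assumes cod: "coding N (space X) u \<xi>" and um: "!!j. u j : bmeas X" and act: "almost_action G V \<sigma>"
  and m: "!!i. prob_space (m i)" "!!i. sets (m i) = sets (PiM (V i) (%_. X))"
  and pc: "pair_convergent G N T u \<xi> V \<sigma> m" and W: "finite W" "W \<subseteq> name_words G" and e: "e > 0" and \<eta>: "\<eta> > 0"
 defines "bad \<equiv> %i. {x : space (power_space k (m i)). EX w:W. e <= power_error G N T k u \<xi> (V i) (\<sigma> i) (word w) (tuple_model k x)}"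
 shows "EV i. bad i : sets (power_space k (m i)) & measure (power_space k (m i)) (bad i) < \<eta>" proof -
 define err where "err w i x = vavg (V i) (%v. wval (name G (pow_feat k u) (\<sigma> i) (tuple_model k x) v) w) -
  (LINT p|power_space k N. wval (name G (pow_feat k u) (power_action k T) (pow_code k \<xi>) p) w)" for w i x
 note con = power_concentration[OF cod um act m pc, where k = k, folded err_def]
 define B where "B w i = {x : space (power_space k (m i)). e <= \<bar>err w i x\<bar>}" for w i
 have bad: "bad i = (\<Union>w\<in>W. B w i)" for i unfolding bad_def B_def model_error_def err_def by auto
 have Bm: "B w i : sets (power_space k (m i))" if "w : W" for w i proof -
  have [measurable]: "err w i : bmeas (power_space k (m i))" using con(2) W(2) that by blast
  show ?thesis unfolding B_def by measurable
 qed
 have le: "measure (power_space k (m i)) (bad i) <= (\<Sum>w\<in>W. (LINT x|power_space k (m i). (err w i x)^2) / e^2)" for i proof -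
  have "prob_space (power_space k (m i))" unfolding power_space_def by (intro prob_space_PiM m)
  then interpret P: prob_space "power_space k (m i)" .
  have "P.prob (bad i) <= (\<Sum>w\<in>W. P.prob (B w i))" unfolding bad using Bm by (intro P.finite_measure_subadditive_finite W) auto
  also have "... <= (\<Sum>w\<in>W. (LINT x|power_space k (m i). (err w i x)^2) / e^2)" unfolding B_def by (intro sum_mono P.chebyshev e con(2,3) subsetD[OF W(2)])
  finally show ?thesis .
 qed
 have "(%i. \<Sum>w\<in>W. (LINT x|power_space k (m i). (err w i x)^2) / e^2) ~~> (\<Sum>w\<in>W. 0 / e^2)"
  by (rule tendsto_sum, rule tendsto_divide[OF con(1) tendsto_const]) (use W e in auto)
 then have "(%i. \<Sum>w\<in>W. (LINT x|power_space k (m i). (err w i x)^2) / e^2) ~~> 0" by simp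
 from tendsto_0_eventually_less[OF this \<eta>] show ?thesis proof eventually_elim
  case (elim i)
  have "bad i : sets (power_space k (m i))" unfolding bad by (intro sets.finite_UN W Bm)
  with order_le_less_trans[OF le elim] show ?case by blast
 qed
qed

end

lemma has_growth_of_subsequence:
 assumes "has_growth G N T A u \<xi> (V o r) (\<sigma> o r) c" "strict_mono r"
 shows "has_growth G N T A u \<xi> V \<sigma> c" proof -
 obtain r' S J \<eta> where wit: "growth_wit G N T A u \<xi> (V o r) (\<sigma> o r) c r' S J \<eta>" using assms(1) unfolding has_growth_def by blast
 have "growth_wit G N T A u \<xi> V \<sigma> c (r o r') S J \<eta>" using wit strict_mono_o[OF assms(2), of r'] unfolding growth_wit_def by (simp add: o_assoc)
 then show ?thesis unfolding has_growth_def by blast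
qed

text \<open>Choose centres greedily, each of which captures more than $1/n$ of new mass. Since $n$ balls never capture everything, the choice gets stuck, and the mass that is left over is spread out.\<close>
lemma greedy_spread:
 assumes m: "prob_space m" and n: "0 < n" and \<epsilon>: "\<epsilon> > 0" and ball: "!!y. y : space m ==> {z : space m. D z y < \<delta>} : sets m"
  and small: "!!F. finite F ==> F \<subseteq> space m ==> card F <= n ==> measure m {z : space m. EX y:F. D z y < \<delta>} <= 1 - \<epsilon>"
 shows "EX R:sets m. \<epsilon> <= measure m R & (ALL y:space m. measure m ({z : space m. D z y < (\<delta>::real)} \<inter> R) <= 1 / real n)" proof (rule ccontr)
 interpret prob_space m by fact
 assume "~ ?thesis"
 then have no: "EX y:space m. 1 / real n < prob ({z : space m. D z y < \<delta>} \<inter> R)" if "R : events" "\<epsilon> <= prob R" for R using that by (meson not_le)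
 have "t <= n ==> EX F. finite F & F \<subseteq> space m & card F <= t & real t / real n <= prob {z : space m. EX y:F. D z y < \<delta>}" for t proof (induction t)
  case 0
  show ?case by (rule exI[of _ "{}"]) simp
 next
  case (Suc t)
  then obtain F where F: "finite F" "F \<subseteq> space m" "card F <= t" "real t / real n <= prob {z : space m. EX y:F. D z y < \<delta>}" by auto
  let ?B = "{z : space m. EX y:F. D z y < \<delta>}"
  have "?B = (\<Union>y\<in>F. {z : space m. D z y < \<delta>})" by auto
  then have B: "?B : events" using ball F by (auto intro!: sets.finite_UN)
  have "\<epsilon> <= prob (space m - ?B)" using small[OF F(1,2)] F(3) Suc.prems prob_compl[OF B] by simp
  then obtain y where y: "y : space m" "1 / real n < prob ({z : space m. D z y < \<delta>} \<inter> (space m - ?B))" using no[of "space m - ?B"] B by blast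
  have "{z : space m. EX y:insert y F. D z y < \<delta>} = ?B \<union> ({z : space m. D z y < \<delta>} \<inter> (space m - ?B))" by auto
  moreover have "prob ... = prob ?B + prob ({z : space m. D z y < \<delta>} \<inter> (space m - ?B))" using B ball[OF y(1)] by (intro finite_measure_Union) auto
  ultimately have "prob {z : space m. EX y:insert y F. D z y < \<delta>} =
  prob ?B + prob ({z : space m. D z y < \<delta>} \<inter> (space m - ?B))" by (simp only:)
  then have "real t / real n + 1 / real n <= prob {z : space m. EX y:insert y F. D z y < \<delta>}" using F(4) y(2) by linarith
  then show ?case using F y(1) card_insert_le_m1[of "Suc t" F y] by (intro exI[of _ "insert y F"]) (auto simp: add_divide_distrib)
 qed
 from this[of n] obtain F where "finite F" "F \<subseteq> space m" "card F <= n" "1 <= prob {z : space m. EX y:F. D z y < \<delta>}" using n by auto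
 with small[of F] \<epsilon> show False by linarith
qed

lemma log_enat_div_le:
 assumes "c <= enat n" "real n <= exp (b * real K)" "0 < K"
 shows "log_enat c / ereal (real K) <= ereal b" proof -
 obtain p where p: "c = enat p" "p <= n" using assms(1) by (cases c) auto
 show ?thesis proof (cases "p = 0")
  case True
  with p assms(3) show ?thesis by (simp add: log_enat_def)
 next
  case False
  then have "ln (real p) <= ln (exp (b * real K))" using p assms(2) by (intro ln_mono) auto
  with p False assms(3) show ?thesis by (simp add: log_enat_def divide_le_eq)
 qed
qed

lemma hamming_measurable:
 fixes G :: "('g, 'b) monoid_scheme" and u :: "'j::countable => 'a => real"
 assumes G: "group G" "countable (carrier G)" and mf: "metric_features X d u" and m: "sets m = sets (PiM V (%_. X))" and y: "y : space m"
 shows "(%z. hamming_average V d z y) : bmeas m" proof -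
 interpret G: group G by fact
 have ms: "Metric_space (space X) d" using mf unfolding metric_features_def by blast
 have yv: "y v : space X" if "v : V" for v using y that sets_eq_imp_space_eq[OF m] by (auto simp: space_PiM)
 have "(%a. d a b) : bmeas X" if b: "b : space X" for b proof -
  have "continuous_map (Metric_space.mtopology (space X) d) euclideanreal (%a. d a b)" proof (rule continuous_map_lipschitz_real[OF ms zero_less_one])
  fix x y assume "x : space X" "y : space X"
  then show "\<bar>d x b - d y b\<bar> <= 1 * d x y" using Metric_space.mdist_reverse_triangle[OF ms, of x b y] Metric_space.commute[OF ms] b by simp
  qed
  then have "continuous_map (config_topology G X d) euclideanreal (%x. d (x \<one>\<^bsub>G\<^esub>) b)" unfolding config_topology_def
  by (rule continuous_map_compose[OF continuous_map_product_projection, unfolded o_def, OF G.one_closed])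
  from continuous_map_config_measurable[OF G(2) mf this refl]
  have 1: "(%x. d (x \<one>\<^bsub>G\<^esub>) b) : bmeas (configs G X)" .
  have "(%a. \<lambda>g\<in>carrier G. a) : measurable X (configs G X)" by (rule measurable_restrict) simp
  from measurable_compose[OF this 1] show ?thesis by simp
 qed
 then have dm: "(%a. d a (y v)) : bmeas X" if "v : V" for v using yv[OF that] .
 have "(%z. d (z v) (y v)) : bmeas (PiM V (%_. X))" if "v : V" for v using measurable_compose[OF measurable_component_singleton[OF that] dm[OF that]] by simp
 then have "(%z. d (z v) (y v)) : bmeas m" if "v : V" for v using that measurable_cong_sets[OF m refl] by blast
 then show ?thesis unfolding hamming_average_def by (auto intro!: borel_measurable_sum)
qed

lemma tuple_fdist:
 assumes "finite J" "l < k"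
 shows "fdist u J V (x l) (y l) \<le>
  fdist (pow_feat k u) ({..<k} \<times> J) V (tuple_model k x) (tuple_model k y)" unfolding fdist_def proof (rule vavg_mono)
 fix v
 have "(\<Sum>j\<in>J. \<bar>u j (x l v) - u j (y l v)\<bar>) =
  (\<Sum>p\<in>Pair l ` J. \<bar>pow_feat k u p (tuple_model k x v) - pow_feat k u p (tuple_model k y v)\<bar>)"
  using assms by (subst sum.reindex) (auto simp: inj_on_def pow_feat_def tuple_model_def)
 also have "... <= (\<Sum>p\<in>{..<k} \<times> J. \<bar>pow_feat k u p (tuple_model k x v) - pow_feat k u p (tuple_model k y v)\<bar>)"
  using assms by (intro sum_mono2) auto
 finally show "(\<Sum>j\<in>J. \<bar>u j (x l v) - u j (y l v)\<bar>) \<le>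
  (\<Sum>p\<in>{..<k} \<times> J. \<bar>pow_feat k u p (tuple_model k x v) - pow_feat k u p (tuple_model k y v)\<bar>)" .
qed

context pmp_action begin

text \<open>Among pairs of vertices the diagonal has weight $1/|V|$. If $|V|$ stays bounded, pair convergence controls the second moment at each single vertex, so the measure concentrates in one ball. Growing covering numbers therefore force $|V|$ to infinity, which absorbs the constants lost later.\<close>
lemma bounded_vertex_sets_concentrate:
 fixes u :: "'j::countable => 'a => real" and V :: "nat => 'v set"
 assumes mc: "metric_coding G N T X d u \<mu> \<xi>" and act: "almost_action G V \<sigma>" and m: "!!i. prob_space (m i)" "!!i. sets (m i) = sets (PiM (V i) (%_. X))"
  and pc: "pair_convergent G N T u \<xi> V \<sigma> m" and \<delta>: "\<delta> > 0" and \<epsilon>: "\<epsilon> > 0"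
 shows "EV i. card (V i) <= K -->
  (EX y:space (m i). 1 - \<epsilon> < measure (m i) {z : space (m i). hamming_average (V i) d z y < \<delta>})" proof -
 note mf = metric_codingD(1)[OF mc] and cod = metric_codingD(4)[OF mc] and V = almost_actionD(1,2)[OF act]
 have um: "!!j. u j : bmeas X" and feat: "features (space X) u" using mf unfolding metric_features_def by blast+
 obtain J C where J: "finite J" and C: "0 <= C" and dom: "!!x y. x : space X ==> y : space X ==> d x y <= \<delta> / 2 + C * (\<Sum>j\<in>J. \<bar>u j x - u j y\<bar>)"
  using metric_codingD(7)[OF mc, of "\<delta> / 2"] \<delta> by auto
 define w where "w j = [(\<one>, j)]" for j :: 'j
 have w: "w j : name_words G" for j by (simp add: w_def)
 define al where "al j = (LINT p|N. wval (name G u T \<xi> p) (w j))" for j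
 have al: "0 <= al j & al j <= 1" for j unfolding al_def by (rule integral_01[OF orbit_word_measurable[OF cod w] orbit_word_01[OF cod]])
 define a where "a i j v x = wval (name G u (\<sigma> i) x v) (w j)" for i j v x
 have a_eq: "a i j v x = u j (x (\<sigma> i \<one> v))" for i j v x by (simp add: a_def w_def name_def)
 define D1 where "D1 j i = vavg (V i) (%v. \<bar>(LINT x|m i. a i j v x) - al j\<bar>)" for j i
 define D2 where "D2 j i = vavg (V i) (%v. vavg (V i) (%v'. \<bar>(LINT x|m i. a i j v x * a i j v' x) - (al j)^2\<bar>))" for j i
 have D: "D1 j ~~> 0" "D2 j ~~> 0" for j using pc w[of j] unfolding D1_def[abs_def] D2_def[abs_def] a_def al_def pair_convergent_def by simp_all
 define Y where "Y i x = (\<Sum>j\<in>J. vavg (V i) (%v. (a i j v x - al j)^2))" for i x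
 define \<theta> where "\<theta> = \<delta> / (8 * (C + 1) * (real (card J) + 1))"
 have \<theta>: "\<theta> > 0" using \<delta> C by (simp add: \<theta>_def)
 define e where "e = \<theta>^2"
 have e: "e > 0" using \<theta> by (simp add: e_def)
 define B where "B i = (\<Sum>j\<in>J. real K * D2 j i + 2 * D1 j i)" for i
 have "B ~~> (\<Sum>j\<in>J. real K * 0 + 2 * 0)" unfolding B_def[abs_def] by (intro tendsto_intros D)
 then have "B ~~> 0" by simp
 moreover have "min \<epsilon> 1 * e > 0" using \<epsilon> e by simp
 ultimately have "EV i. B i < min \<epsilon> 1 * e" by (rule tendsto_0_eventually_less)
 then show ?thesis proof (rule eventually_mono, intro impI)
  fix i assume elim: "B i < min \<epsilon> 1 * e" and cardK: "card (V i) <= K"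
  interpret mi: prob_space "m i" by (rule m)
  have am: "a i j v : bmeas (m i)" if "v : V i" for j v unfolding a_def[abs_def] by (rule model_word_measurable[OF act um that m(2)])
  have a01: "0 <= a i j v x & a i j v x <= 1" if "v : V i" "x : space (m i)" for j v x unfolding a_def by (rule model_word_01[OF act feat that(1) m(2) that(2)])
  have ia: "integrable (m i) (a i j v)" if "v : V i" for j v by (rule mi.integrable_01[OF am a01]) (use that in auto)
  have iaa: "integrable (m i) (%x. a i j v x * a i j v x)" if "v : V i" for j v
  by (rule mi.integrable_01[OF borel_measurable_times[OF am am]]) (use that a01 in \<open>auto intro: mult_le_one\<close>)
  have sq: "(a i j v x - al j)^2 = a i j v x * a i j v x - 2 * al j * a i j v x + (al j)^2" for j v x by (simp add: power2_eq_square algebra_simps)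
  have i2: "integrable (m i) (%x. (a i j v x - al j)^2)" if "v : V i" for j v unfolding sq using ia[OF that] iaa[OF that] by auto
  have EY: "(LINT x|m i. Y i x) <= B i" and iY: "integrable (m i) (Y i)" proof -
  have *: "(LINT x|m i. (a i j v x - al j)^2) \<le>
  real K * vavg (V i) (%v'. \<bar>(LINT x|m i. a i j v x * a i j v' x) - (al j)^2\<bar>) + 2 * \<bar>(LINT x|m i. a i j v x) - al j\<bar>" if v: "v : V i" for j v
  proof -
  define E1 E2 where "E1 = (LINT x|m i. a i j v x) - al j" and "E2 v' = \<bar>(LINT x|m i. a i j v x * a i j v' x) - (al j)^2\<bar>" for v'
  have "(LINT x|m i. (a i j v x - al j)^2) = ((LINT x|m i. a i j v x * a i j v x) - (al j)^2) - 2 * (al j * E1)"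
  unfolding sq E1_def using ia[OF v] iaa[OF v] by (simp add: mi.prob_space algebra_simps power2_eq_square)
  moreover have "\<bar>al j * E1\<bar> <= 1 * \<bar>E1\<bar>" unfolding abs_mult using al by (intro mult_mono) auto
  moreover have "E2 v <= (\<Sum>v'\<in>V i. E2 v')" using v V by (intro member_le_sum) (auto simp: E2_def)
  moreover have "(\<Sum>v'\<in>V i. E2 v') = real (card (V i)) * vavg (V i) E2" using V[of i] by (simp add: vavg_def)
  moreover have "real (card (V i)) * vavg (V i) E2 <= real K * vavg (V i) E2" using cardK by (intro mult_right_mono vavg_nonneg) (auto simp: E2_def)
  ultimately show ?thesis unfolding E1_def[symmetric] E2_def[symmetric] unfolding E2_def[of v] by linarith
  qed
  have "(LINT x|m i. Y i x) = (\<Sum>j\<in>J. vavg (V i) (%v. \<integral>x. (a i j v x - al j)^2 \<partial>m i))" unfolding Y_def by (simp add: integral_vavg[OF i2])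
  also have "... <= (\<Sum>j\<in>J. vavg (V i) (%v. real K * vavg (V i) (%v'. \<bar>(LINT x|m i. a i j v x * a i j v' x) - (al j)^2\<bar>) +
  2 * \<bar>(LINT x|m i. a i j v x) - al j\<bar>))" by (intro sum_mono vavg_mono *)
  also have "... = B i" unfolding B_def D1_def D2_def by (simp add: vavg_add vavg_cmult)
  finally show "(LINT x|m i. Y i x) <= B i" .
  show "integrable (m i) (Y i)" unfolding Y_def[abs_def] by (intro Bochner_Integration.integrable_sum integral_vavg(2) i2)
  qed
  have Y0: "0 <= Y i x" for x unfolding Y_def by (intro sum_nonneg vavg_nonneg) simp
  have Ym[measurable]: "Y i : bmeas (m i)" using iY by simp
  define Bad where "Bad = {x : space (m i). sqrt e <= \<bar>sqrt (Y i x)\<bar>}"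
  have Bm: "Bad : sets (m i)" unfolding Bad_def by measurable
  have "mi.prob Bad <= (LINT x|m i. (sqrt (Y i x))^2) / (sqrt e)^2" unfolding Bad_def using e iY Y0 by (intro mi.chebyshev) simp_all
  also have "... <= B i / e" using e EY Y0 by (simp add: divide_right_mono)
  also have "... < min \<epsilon> 1" using elim e by (simp only: pos_divide_less_eq)
  finally have pB: "mi.prob Bad < min \<epsilon> 1" .
  have pG: "1 - min \<epsilon> 1 < mi.prob (space (m i) - Bad)" using pB mi.prob_compl[OF Bm] by simp
  have close: "hamming_average (V i) d z y < \<delta>" if z: "z : space (m i) - Bad" and y: "y : space (m i) - Bad" for z y proof -
  have sp: "x v : space X" if "x : space (m i)" "v : V i" for x v using that sets_eq_imp_space_eq[OF m(2)[of i]] by (auto simp: space_PiM)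
  have near: "vavg (V i) (%v. \<bar>u j (x v) - al j\<bar>) <= 2 * \<theta>" if x: "x : space (m i) - Bad" and j: "j : J" for x j proof -
  have "Y i x < e" using x by (auto simp: Bad_def Y0 not_le)
  moreover have "vavg (V i) (%v. (a i j v x - al j)^2) <= Y i x" unfolding Y_def by (rule member_le_sum[OF j _ J]) (simp add: vavg_nonneg)
  ultimately have le: "vavg (V i) (%v. (a i j v x - al j)^2) / \<theta> <= \<theta>" using \<theta> by (simp add: e_def divide_le_eq power2_eq_square)
  have "vavg (V i) (%v. \<bar>u j (x v) - al j\<bar>) = vavg (V i) (%v. \<bar>a i j v x - al j\<bar>)"
  unfolding a_eq by (rule vavg_permuted_name[OF act one_closed, symmetric])
  also have "... <= vavg (V i) (%v. \<theta> + (1 / \<theta>) * (a i j v x - al j)^2)" using abs_le_square[OF \<theta>] by (intro vavg_mono) simp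
  also have "... = \<theta> + vavg (V i) (%v. (a i j v x - al j)^2) / \<theta>" unfolding vavg_add vavg_cmult vavg_const[OF V] by simp
  finally show ?thesis using le by linarith
  qed
  have "fdist u J (V i) z y <= (\<Sum>j\<in>J. 4 * \<theta>)" unfolding fdist_def vavg_sum proof (rule sum_mono)
  fix j assume j: "j : J"
  have "vavg (V i) (%v. \<bar>u j (z v) - u j (y v)\<bar>) <= vavg (V i) (%v. \<bar>u j (z v) - al j\<bar> + \<bar>u j (y v) - al j\<bar>)"
  by (rule vavg_mono) linarith
  also have "... <= 4 * \<theta>" unfolding vavg_add using near[OF z j] near[OF y j] by linarith
  finally show "vavg (V i) (%v. \<bar>u j (z v) - u j (y v)\<bar>) <= 4 * \<theta>" .
  qed
  then have "C * fdist u J (V i) z y <= C * (real (card J) * (4 * \<theta>))" using C by (intro mult_left_mono) simp_all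
  also have "... < (C + 1) * ((real (card J) + 1) * (4 * \<theta>))" by (rule mult_strict_mono') (use C \<theta> in auto)
  also have "... = \<delta> / 2" proof -
  have "a * (b * (4 * (\<delta> / (8 * a * b)))) = \<delta> / 2" if "a > 0" "b > 0" for a b :: real using that by (simp add: field_simps)
  then show ?thesis unfolding \<theta>_def by this (use C in auto)
  qed
  finally have "C * fdist u J (V i) z y < \<delta> / 2" .
  moreover have "hamming_average (V i) d z y <= \<delta> / 2 + C * fdist u J (V i) z y" by (rule hamming_le_features[OF V dom]) (use sp z y in auto)
  ultimately show ?thesis by linarith
  qed
  have "mi.prob (space (m i) - Bad) > 0" using pG by linarith
  then have "space (m i) - Bad ~= {}" by (metis measure_empty less_irrefl)
  then obtain y where y: "y : space (m i) - Bad" by blast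
  have "{z : space (m i). hamming_average (V i) d z y < \<delta>} : sets (m i)" proof -
  have [measurable]: "(%z. hamming_average (V i) d z y) : bmeas (m i)" using y by (intro hamming_measurable[OF group_axioms countable_group mf m(2)]) simp
  show ?thesis by measurable
  qed
  then have "mi.prob (space (m i) - Bad) <= mi.prob {z : space (m i). hamming_average (V i) d z y < \<delta>}" using close y by (intro mi.finite_measure_mono) auto
  with pG y show "EX y:space (m i). 1 - \<epsilon> < mi.prob {z : space (m i). hamming_average (V i) d z y < \<delta>}" by (intro bexI[of _ y]) auto
 qed
qed

text \<open>Most independent samples are good, so good models exist.\<close>
theorem pair_convergent_power_growth_zero:
 fixes u :: "'j::countable => 'a => real" and V :: "nat => 'v set"
 assumes mc: "metric_coding G N T X d u \<mu> \<xi>" and act: "almost_action G V \<sigma>" and m: "!!i. prob_space (m i)" "!!i. sets (m i) = sets (PiM (V i) (%_. X))"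
  and pc: "pair_convergent G N T u \<xi> V \<sigma> m"
 shows "power_growth G N T k (space X) u \<xi> V \<sigma> 0" proof -
 interpret P: pmp_action G "power_space k N" "power_action k T" by (rule pmp_action_power)
 note mf = metric_codingD(1)[OF mc] and cod = metric_codingD(4)[OF mc]
 have um: "!!j. u j : bmeas X" using mf unfolding metric_features_def by blast
 show ?thesis proof (rule P.has_growthI_words[OF coding_power[OF cod] act finite.emptyI zero_less_one])
  fix W :: "('g \<times> (nat \<times> 'j)) list set" and e :: real assume W: "finite W" "W \<subseteq> name_words G" and e: "e > 0"
  note ev = good_tuples_likely[OF cod um act m pc W e zero_less_one, of k]
  show "\<exists>\<^sub>F i in sequentially. separated_models (0) (V i) (pow_alpha k (space X)) W e (power_error G N T k u \<xi> (V i) (\<sigma> i)) 1 (pow_feat k u) {}"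
  proof (rule eventually_frequently[OF sequentially_bot], rule eventually_mono[OF ev])
  fix i
  let ?bad = "{x : space (power_space k (m i)). EX w:W. e <= power_error G N T k u \<xi> (V i) (\<sigma> i) (word w) (tuple_model k x)}"
  assume i: "?bad : sets (power_space k (m i)) & measure (power_space k (m i)) ?bad < 1"
  have "prob_space (power_space k (m i))" unfolding power_space_def by (intro prob_space_PiM m)
  then have "?bad ~= space (power_space k (m i))" using i by (metis prob_space.prob_space less_irrefl)
  then obtain x where x: "x : space (power_space k (m i))" "x ~: ?bad" by blast
  have "x l v : space X" if "l < k" "v : V i" for l v
  using x(1) that sets_eq_imp_space_eq[OF m(2)[of i]] by (auto simp: space_power_space space_PiM dest!: PiE_mem[of x _ _ l])
  then have "tuple_model k x v : pow_alpha k (space X)" if "v : V i" for v using that by (simp add: tuple_model_def)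
  then show "separated_models (0) (V i) (pow_alpha k (space X)) W e (power_error G N T k u \<xi> (V i) (\<sigma> i)) 1 (pow_feat k u) {}"
  using x by (intro exI[of _ "{tuple_model k x}"]) (auto simp: not_le)
  qed
 qed
qed

text \<open>Tuples with entries in the spread-out set $R$ have mass at least $\epsilon^k$, at least half of this mass consists of good tuples, and a product of $k$ balls captures at most $n^{-k}$ of them, where $n$ is about $\exp(b^\prime|V|)$.\<close>
theorem pair_convergent_power_growth:
 fixes u :: "'j::countable => 'a => real" and V :: "nat => 'v set"
 assumes mc: "metric_coding G N T X d u \<mu> \<xi>" and act: "almost_action G V \<sigma>" and m: "!!i. prob_space (m i)" "!!i. sets (m i) = sets (PiM (V i) (%_. X))"
  and pc: "pair_convergent G N T u \<xi> V \<sigma> m" and \<delta>: "\<delta> > 0" and \<epsilon>: "\<epsilon> > 0" and k: "k >= 1" and b: "0 <= b" "b < b'"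
  and lim: "ereal b' < limsup (%i. cov_rate (V i) d \<epsilon> \<delta> (m i))"
 shows "power_growth G N T k (space X) u \<xi>
  V \<sigma> (real k * b)" proof -
 interpret P: pmp_action G "power_space k N" "power_action k T" by (rule pmp_action_power)
 note mf = metric_codingD(1)[OF mc] and cod = metric_codingD(4)[OF mc] and V = almost_actionD(1,2)[OF act]
 have um: "!!j. u j : bmeas X" and ms: "Metric_space (space X) d" using mf unfolding metric_features_def by blast+
 obtain J C where J: "finite J" and C: "0 <= C" and dom: "!!x y. x : space X ==> y : space X ==> d x y <= \<delta> / 2 + C * (\<Sum>j\<in>J. \<bar>u j x - u j y\<bar>)"
  using metric_codingD(7)[OF mc, of "\<delta> / 2"] \<delta> by auto
 define \<eta> where "\<eta> = \<delta> / (2 * (C + 1))"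
 have \<eta>: "\<eta> > 0" using \<delta> C by (simp add: \<eta>_def)
 \<comment> \<open>Beyond \<open>K\<close> vertices the gap between \<open>b\<close> and \<open>b'\<close> outweighs the constant lost from \<open>\<epsilon>\<close>.\<close>
 define K where "K = nat \<lceil>2 * (2 / \<epsilon>) ^ k / (b' - b)\<rceil>"
 show ?thesis proof (rule P.has_growthI_words[OF coding_power[OF cod] act _ \<eta>, of "{..<k} \<times> J"])
  show "finite ({..<k} \<times> J)" using J by simp
  fix W :: "('g \<times> (nat \<times> 'j)) list set" and e :: real assume W: "finite W" "W \<subseteq> name_words G" and e: "e > 0"
  define bad where "bad i = {x : space (power_space k (m i)). EX w:W. e <= power_error G N T k u \<xi> (V i) (\<sigma> i) (word w) (tuple_model k x)}" for i
  have "\<epsilon> ^ k / 2 > 0" using \<epsilon> by simp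
  note ev1 = good_tuples_likely[OF cod um act m pc W e this, of k, folded bad_def]
  note ev2 = bounded_vertex_sets_concentrate[OF mc act m pc \<delta> \<epsilon>, of K]
  have fr: "\<exists>\<^sub>F i in sequentially. ereal b' < cov_rate (V i) d \<epsilon> \<delta> (m i)" by (rule frequently_less_limsup[OF lim])
  show "\<exists>\<^sub>F i in sequentially. EX S. finite S & exp (real k * b * real (card (V i))) <= real (card S) &
  (ALL x:S. (ALL v:V i. x v : pow_alpha k (space X)) & (ALL w:W. power_error G N T k u \<xi> (V i) (\<sigma> i) (word w) x < e)) &
  (ALL x:S. ALL y:S. x ~= y --> \<eta> <= fdist (pow_feat k u) ({..<k} \<times> J) (V i) x y)"
  proof (rule frequently_elim1[OF frequently_eventually_conj[OF frequently_eventually_conj[OF fr ev1] ev2]], elim conjE)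
  fix i
  assume conc: "card (V i) <= K --> (EX y:space (m i). 1 - \<epsilon> < measure (m i) {z : space (m i). hamming_average (V i) d z y < \<delta>})"
  and bad: "bad i : sets (power_space k (m i))" "measure (power_space k (m i)) (bad i) < \<epsilon> ^ k / 2"
  and big: "ereal b' < cov_rate (V i) d \<epsilon> \<delta> (m i)"
  interpret mi: prob_space "m i" by (rule m)
  interpret P': product_prob_space "%_. m i" "{..<k}" ..
  interpret P': finite_product_prob_space "%_. m i" "{..<k}" by unfold_locales simp
  let ?P = "power_space k (m i)" and ?H = "hamming_average (V i) d"
  define s where "s = real (card (V i))"
  have s: "s > 0" using V[of i] by (simp add: s_def card_gt_0_iff)
  define n where "n = nat \<lfloor>exp (b' * s)\<rfloor>"
  have "exp (b' * s) >= 1" using b s by simp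
  moreover from this have "real n = of_int \<lfloor>exp (b' * s)\<rfloor>" "1 <= \<lfloor>exp (b' * s)\<rfloor>" unfolding n_def by simp_all
  ultimately have n: "n >= 1" "real n <= exp (b' * s)" "exp (b' * s) <= 2 * real n" by linarith+
  have small: "mi.prob {z : space (m i). EX y:F. ?H z y < \<delta>} <= 1 - \<epsilon>" if F: "finite F" "F \<subseteq> space (m i)" "card F <= n" for F
  proof (rule ccontr)
  assume "~ ?thesis"
  then have "cov_measure \<epsilon> \<delta> (m i) ?H <= enat (card F)" unfolding cov_measure_def using F(1,2) by (intro INF_lower) auto
  from log_enat_div_le[OF this, of b' "card (V i)"] have "log_enat (cov_measure \<epsilon> \<delta> (m i) ?H) / ereal s <= ereal b'"
  using F(3) n(2) s unfolding s_def by simp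
  with big show False unfolding s_def by simp
  qed
  have ball: "{z : space (m i). ?H z y < \<delta>} : sets (m i)" if "y : space (m i)" for y proof -
  note [measurable] = hamming_measurable[OF group_axioms countable_group mf m(2) that]
  show ?thesis by measurable
  qed
  obtain R where R: "R : sets (m i)" "\<epsilon> <= mi.prob R"
  and thin: "!!y. y : space (m i) ==> mi.prob ({z : space (m i). ?H z y < \<delta>} \<inter> R) <= 1 / real n"
  using greedy_spread[OF m(1) less_le_trans[OF zero_less_one n(1)] \<epsilon> ball small] by blast
  have "~ card (V i) <= K" proof
  assume "card (V i) <= K"
  with conc obtain y where "y : space (m i)" "1 - \<epsilon> < mi.prob {z : space (m i). ?H z y < \<delta>}" by blast
  with small[of "{y}"] n(1) show False by simp
  qed
  then have "2 * (2 / \<epsilon>) ^ k / (b' - b) <= s" unfolding K_def s_def by linarith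
  then have "2 * (2 / \<epsilon>) ^ k <= (b' - b) * s" using b by (simp add: divide_le_eq mult.commute)
  also have "... <= real k * ((b' - b) * s)" using mult_right_mono[of 1 "real k" "(b' - b) * s"] k b s by simp
  also have "... < exp (real k * ((b' - b) * s))" using exp_ge_add_one_self[of "real k * ((b' - b) * s)"] by linarith
  finally have exp_big: "2 * (2 / \<epsilon>) ^ k < exp (real k * ((b' - b) * s))" .
  define Z where "Z = {x : space ?P. x ~: bad i & (\<forall>l<k. x l : R)}"
  define D where "D x y \<longleftrightarrow> (\<forall>l<k. ?H (x l) (y l) < \<delta>)" for x y
  have spm: "x l : space (m i)" if "x : space ?P" "l < k" for x l using PiE_mem[OF that(1)[unfolded space_power_space], of l] that(2) by simp
  have sp: "x l v : space X" if "x : space ?P" "l < k" "v : V i" for x l v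
  using spm[OF that(1,2)] that(3) sets_eq_imp_space_eq[OF m(2)[of i]] by (auto simp: space_PiM)
  have ZP: "Z \<subseteq> space ?P" unfolding Z_def by blast
  let ?M = "nat \<lceil>exp (real k * b * s)\<rceil>"
  have "\<exists>S\<subseteq>Z. finite S & card S = ?M & (ALL x:S. ALL y:S. x ~= y --> ~ D x y)" proof (rule separated_subset_exists)
  fix F assume F: "finite F" "F \<subseteq> Z" "card F < ?M"
  show "EX z:Z. ALL y:F. ~ D z y" proof (rule ccontr)
  assume "~ ?thesis"
  then have cov: "!!z. z : Z ==> EX y:F. D z y" by blast
  define Q where "Q y = (\<Pi>\<^sub>E l\<in>{..<k}. {z : space (m i). ?H z (y l) < \<delta>} \<inter> R)" for y
  define Box where "Box = (\<Pi>\<^sub>E l\<in>{..<k}. R)"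
  have Qs: "Q y : sets ?P" and Qp: "P'.prob (Q y) <= (1 / real n) ^ k" if "y : F" for y proof -
  have y: "y l : space (m i)" if "l < k" for l using spm[OF _ that] F(2) ZP \<open>y : F\<close> by blast
  show "Q y : sets ?P" unfolding Q_def power_space_def using ball y R(1) by (intro sets_PiM_I_finite) auto
  have "P'.prob (Q y) = (\<Prod>l<k. mi.prob ({z : space (m i). ?H z (y l) < \<delta>} \<inter> R))"
  unfolding Q_def using ball y R(1) by (intro P'.prob_times) auto
  also have "... <= (\<Prod>l<k. 1 / real n)" using thin y by (intro prod_mono) auto
  finally show "P'.prob (Q y) <= (1 / real n) ^ k" by simp
  qed
  have Bs: "Box : sets ?P" unfolding Box_def power_space_def using R(1) by (intro sets_PiM_I_finite) auto
  have Bp: "\<epsilon> ^ k <= P'.prob Box" proof -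
  have "P'.prob Box = (\<Prod>l<k. mi.prob R)" unfolding Box_def using R(1) by (intro P'.prob_times) auto
  then show ?thesis using R(2) \<epsilon> by (simp add: power_mono)
  qed
  have "Box \<subseteq> bad i \<union> (\<Union>y\<in>F. Q y)" proof
  fix x assume x: "x : Box"
  have xP: "x : space ?P" using sets.sets_into_space[OF Bs] x by blast
  have xR: "x l : R" if "l < k" for l using PiE_mem[OF x[unfolded Box_def], of l] that by simp
  show "x : bad i \<union> (\<Union>y\<in>F. Q y)" proof (cases "x : bad i")
  case False
  then have "x : Z" using xP xR unfolding Z_def by blast
  from cov[OF this] obtain y where y: "y : F" "D x y" by blast
  have "x : Q y" unfolding Q_def proof (rule PiE_I)
  fix l assume "l : {..<k}"
  then show "x l : {z : space (m i). ?H z (y l) < \<delta>} \<inter> R" using xR spm[OF xP] y(2) unfolding D_def by simp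
  next
  fix l assume "l ~: {..<k}"
  with PiE_arb[OF xP[unfolded space_power_space]] show "x l = undefined" .
  qed
  with y(1) show ?thesis by blast
  qed simp
  qed
  then have "P'.prob Box <= P'.prob (bad i \<union> (\<Union>y\<in>F. Q y))"
  using bad(1) Qs F(1) unfolding power_space_def by (intro P'.finite_measure_mono sets.Un sets.finite_UN) auto
  also have "... <= P'.prob (bad i) + P'.prob (\<Union>y\<in>F. Q y)" using bad(1) Qs F(1) unfolding power_space_def by (intro measure_Un_le sets.finite_UN) auto
  also have "P'.prob (\<Union>y\<in>F. Q y) <= (\<Sum>y\<in>F. P'.prob (Q y))"
  using Qs F(1) unfolding power_space_def by (intro P'.finite_measure_subadditive_finite) auto
  also have "... <= (\<Sum>y\<in>F. (1 / real n) ^ k)" by (rule sum_mono[OF Qp])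
  also have "... = real (card F) / real n ^ k" by (simp add: power_one_over)
  finally have 1: "\<epsilon> ^ k / 2 < real (card F) / real n ^ k" using Bp bad(2) unfolding power_space_def by linarith
  have "real (card F) <= exp (real k * b * s)" using F(3) by linarith
  then have "real (card F) / real n ^ k <= exp (real k * b * s) / real n ^ k" by (rule divide_right_mono) simp
  also have "... <= exp (real k * b * s) / (exp (b' * s) / 2) ^ k" using n by (intro divide_left_mono power_mono mult_pos_pos) auto
  also have "... = 2 ^ k / exp (real k * ((b' - b) * s))" proof -
  have "exp (b' * s) ^ k = exp (real k * b * s) * exp (real k * ((b' - b) * s))" by (simp add: exp_of_nat_mult[symmetric] exp_add[symmetric] algebra_simps)
  then show ?thesis by (simp add: power_divide)
  qed
  also have "... < 2 ^ k / (2 * (2 / \<epsilon>) ^ k)" using exp_big \<epsilon> by (intro divide_strict_left_mono mult_pos_pos) auto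
  also have "... = \<epsilon> ^ k / 2" using \<epsilon> by (simp add: power_divide)
  finally show False using 1 by linarith
  qed
  next
  fix z assume "z : Z"
  then have "z : space ?P" using ZP by blast
  then have "?H (z l) (z l) = 0" if "l < k" for l using sp that by (intro Metric_space_hamming(1)[OF ms]) blast
  then show "D z z" using \<delta> unfolding D_def by simp
  next
  fix y z assume "D y z"
  then show "D z y" unfolding D_def by (simp only: Metric_space_hamming(2)[OF ms, of "V i" "z _" "y _"])
  qed
  then obtain S where S: "S \<subseteq> Z" "finite S" "card S = ?M" "!!x y. x : S ==> y : S ==> x ~= y ==> ~ D x y" by blast
  have SP: "x : space ?P" if "x : S" for x using that S(1) ZP by blast
  have far: "\<eta> <= fdist (pow_feat k u) ({..<k} \<times> J) (V i) (tuple_model k x) (tuple_model k y)" if xy: "x : S" "y : S" "x ~= y" for x y proof -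
  obtain l where l: "l < k" "\<delta> <= ?H (x l) (y l)" using S(4)[OF xy] unfolding D_def by (auto simp: not_less)
  have "\<delta> <= \<delta> / 2 + C * fdist u J (V i) (x l) (y l)"
  by (rule order_trans[OF l(2) hamming_le_features[OF V dom]]) (use sp[OF SP[OF xy(1)] l(1)] sp[OF SP[OF xy(2)] l(1)] in auto)
  then have "\<delta> / 2 <= C * fdist u J (V i) (x l) (y l)" by linarith
  also have "... <= (C + 1) * fdist u J (V i) (x l) (y l)" using fdist_nonneg[of u J "V i" "x l" "y l"] by (simp add: distrib_right)
  finally have "\<eta> <= fdist u J (V i) (x l) (y l)" using C by (simp add: \<eta>_def divide_le_eq algebra_simps)
  also note tuple_fdist[OF J l(1), of u "V i" x y]
  finally show ?thesis .
  qed
  have far': "\<eta> <= fdist (pow_feat k u) ({..<k} \<times> J) (V i) (tuple_model k x) (tuple_model k y)"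
  if "x : S" "y : S" "tuple_model k x ~= tuple_model k y" for x y by (rule far) (use that in auto)
  have inj: "inj_on (tuple_model k) S" proof (rule inj_onI, rule ccontr)
  fix x y assume xy: "x : S" "y : S" "tuple_model k x = tuple_model k y" "x ~= y"
  from far[OF xy(1,2,4)] \<eta> show False unfolding xy(3) by (simp add: fdist_def vavg_def)
  qed
  have "real (card (tuple_model k ` S)) >= exp (real k * b * s)" unfolding card_image[OF inj] S(3) by linarith
  moreover have "tuple_model k x v : pow_alpha k (space X)" if "x : S" "v : V i" for x v using sp[OF SP[OF that(1)] _ that(2)] by (simp add: tuple_model_def)
  moreover have "power_error G N T k u \<xi> (V i) (\<sigma> i)
  (word w) (tuple_model k x) < e" if "x : S" "w : W" for x w using that S(1) SP[OF that(1)] unfolding Z_def bad_def by (auto simp: not_le)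
  ultimately show "EX S. finite S & exp (real k * b * real (card (V i))) <= real (card S) &
  (ALL x:S. (ALL v:V i. x v : pow_alpha k (space X)) & (ALL w:W. power_error G N T k u \<xi> (V i) (\<sigma> i) (word w) x < e)) &
  (ALL x:S. ALL y:S. x ~= y --> \<eta> <= fdist (pow_feat k u) ({..<k} \<times> J) (V i) x y)"
  using S(2) far' unfolding s_def[symmetric] by (intro exI[of _ "tuple_model k ` S"]) auto
  qed
 qed
qed

end

section \<open>From models of powers to doubly-quenched measures\<close>

lemma vavg_swap: "vavg V (%v. vavg L (%l. f v l)) = vavg L (%l. vavg V (%v. f v l))"
 unfolding vavg_def by (simp add: sum_divide_distrib) (subst sum.swap, simp add: mult.commute)

lemma vavg_diagonal_le:
 assumes k: "k >= 1" and c: "!!l l'. l < k ==> l' < k ==> c l l' <= \<beta> + (if l = l' then 1 else 0)"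
 shows "vavg {..<k} (%l. vavg {..<k} (%l'. c l l')) <= \<beta> + 1 / real k" proof -
 have L: "finite {..<k}" "{..<k} ~= {}" using k by (simp_all add: lessThan_empty_iff)
 have "vavg {..<k} (%l. vavg {..<k} (%l'. c l l')) <= vavg {..<k} (%l. vavg {..<k} (%l'. \<beta> + (if l = l' then 1 else 0)))" using c by (intro vavg_mono) auto
 also have "... = vavg {..<k} (%l. \<beta> + 1 / real k)" by (rule vavg_cong) (simp add: vavg_add vavg_const[OF L], simp add: vavg_def)
 finally show ?thesis by (simp add: vavg_const[OF L])
qed

text \<open>The law of large numbers for the $k$ coordinates of one model: different coordinates are uncorrelated up to $\eta$, so the average over the coordinates has variance at most $1/k$ up to a multiple of $\eta$.\<close>
lemma averages_concentrate:
 fixes a :: "nat => 'v => real"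
 assumes V: "finite V" "V ~= {}" and k: "k >= 1" and a: "!!l v. l < k ==> v : V ==> 0 <= a l v & a l v <= 1"
  and \<alpha>: "0 <= \<alpha>" "\<alpha> <= 1" and one: "!!l. l < k ==> \<bar>vavg V (a l) - \<alpha>\<bar> <= \<eta>"
  and two: "!!l l'. l < k ==> l' < k ==> l ~= l' ==> \<bar>vavg V (%v. a l v * a l' v) - \<alpha>^2\<bar> <= \<eta>" and e: "e > 0" "1 / real k + 6 * \<eta> <= e^2 / 4"
 shows "vavg V (%v. \<bar>vavg {..<k} (%l. a l v) - \<alpha>\<bar>) <= e"
  "vavg V (%v. vavg V (%v'. \<bar>vavg {..<k} (%l. a l v * a l v') - \<alpha>^2\<bar>)) <= e" proof -
 let ?L = "{..<k}"
 have L: "finite ?L" "?L ~= {}" using k by (simp_all add: lessThan_empty_iff)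
 define p where "p l = vavg V (a l)" for l
 define q where "q l l' = vavg V (%v. a l v * a l' v)" for l l'
 have p: "0 <= p l & p l <= 1" if "l < k" for l unfolding p_def using a[OF that] V by (intro vavg_01) auto
 have q: "0 <= q l l' & q l l' <= 1" if "l < k" "l' < k" for l l' unfolding q_def using a that V by (intro vavg_01) (auto intro: mult_le_one)
 have \<eta>: "0 <= \<eta>" using one[of 0] k by fastforce
 have \<alpha>2: "\<alpha>^2 <= 1" using \<alpha> by (simp add: power_le_one)
 have qle: "q l l' <= \<alpha>^2 + \<eta> + (if l = l' then 1 else 0)" if "l < k" "l' < k" for l l'
  using two[OF that] q[OF that] \<eta> unfolding q_def by (auto simp: abs_le_iff add_increasing)
 have q2le: "q l l' * q l l' <= \<alpha>^2 * \<alpha>^2 + 2 * \<eta> + (if l = l' then 1 else 0)" if l: "l < k" "l' < k" for l l' proof (cases "l = l'")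
  case True
  have "q l l' * q l l' <= 1" using q[OF l] by (simp add: mult_le_one)
  with True \<eta> show ?thesis by (simp add: add_increasing)
 next
  case False
  have "\<bar>q l l' * q l l' - \<alpha>^2 * \<alpha>^2\<bar> <= \<bar>q l l' - \<alpha>^2\<bar> + \<bar>q l l' - \<alpha>^2\<bar>"
  using q[OF l] \<alpha>2 by (intro abs_mult_diff_le) auto
  moreover have "\<bar>q l l' - \<alpha>^2\<bar> <= \<eta>" using two[OF l False] unfolding q_def .
  ultimately have "q l l' * q l l' <= \<alpha>^2 * \<alpha>^2 + 2 * \<eta>" by linarith
  then show ?thesis using False by simp
 qed
 have p2: "\<alpha> * \<alpha> - 2 * \<eta> <= p l * p l" if "l < k" for l
  using abs_mult_diff_le[of "p l" \<alpha> "p l" \<alpha>] p[OF that] \<alpha> one[OF that] unfolding p_def by linarith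
 have bound: "vavg U f <= e" if U: "finite U" "U ~= {}" and f: "vavg U (%x. (f x)^2) <= 1 / real k + 6 * \<eta>" "!!x. 0 <= f x" for U :: "'u set" and f proof -
  have "vavg U f <= vavg U (%x. e / 2 + (2 / e) * (f x)^2)" proof (rule vavg_mono)
  fix v
  show "f v <= e / 2 + (2 / e) * (f v)^2" using abs_le_square[of "e / 2" "f v"] e(1) f(2)[of v] by simp
  qed
  also have "... = e / 2 + (2 / e) * vavg U (%x. (f x)^2)" unfolding vavg_add vavg_cmult vavg_const[OF U] ..
  also have "(2 / e) * vavg U (%x. (f x)^2) <= (2 / e) * (e^2 / 4)" using e f(1) by (intro mult_left_mono) auto
  also have "... = e / 2" using e(1) by (simp add: power2_eq_square)
  finally show ?thesis by simp
 qed
 show "vavg V (%v. \<bar>vavg ?L (%l. a l v) - \<alpha>\<bar>) <= e" proof (rule bound[OF V])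
  have "vavg V (%v. \<bar>vavg ?L (%l. a l v) - \<alpha>\<bar>^2) =
  vavg V (%v. vavg ?L (%l. a l v) * vavg ?L (%l. a l v) - (2 * \<alpha>) * vavg ?L (%l. a l v) + \<alpha>^2)" by (simp add: power2_eq_square algebra_simps)
  also have "... = vavg ?L (%l. vavg ?L (%l'. q l l')) - (2 * \<alpha>) * vavg ?L p + \<alpha>^2" proof -
  have "vavg V (%v. vavg ?L (%l. a l v) * vavg ?L (%l. a l v)) = vavg ?L (%l. vavg ?L (%l'. q l l'))" unfolding vavg_square vavg_swap[of V ?L] q_def ..
  moreover have "vavg V (%v. vavg ?L (%l. a l v)) = vavg ?L p" unfolding vavg_swap[of V ?L] p_def ..
  ultimately show ?thesis unfolding vavg_add vavg_diff vavg_cmult vavg_const[OF V] by simp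
  qed
  also have "... <= (\<alpha>^2 + \<eta> + 1 / real k) - (2 * \<alpha>) * (\<alpha> - \<eta>) + \<alpha>^2" proof -
  have "vavg ?L (%_. \<alpha> - \<eta>) <= vavg ?L p" using one unfolding p_def by (intro vavg_mono) (fastforce simp: abs_le_iff)
  then have "(2 * \<alpha>) * (\<alpha> - \<eta>) <= (2 * \<alpha>) * vavg ?L p" using \<alpha> unfolding vavg_const[OF L] by (intro mult_left_mono) auto
  with vavg_diagonal_le[OF k qle] show ?thesis by linarith
  qed
  also have "... = \<eta> + 1 / real k + 2 * (\<alpha> * \<eta>)" by (simp add: power2_eq_square algebra_simps)
  also have "... <= 1 / real k + 6 * \<eta>" using mult_right_mono[of \<alpha> 1 \<eta>] \<alpha> \<eta> by linarith
  finally show "vavg V (%v. \<bar>vavg ?L (%l. a l v) - \<alpha>\<bar>^2) <= 1 / real k + 6 * \<eta>" .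
 qed simp
 have pair: "vavg V (%v. vavg V (%v'. f v v')) = vavg (V \<times> V) (%(v, v'). f v v')" for f
  unfolding vavg_def by (simp add: sum.cartesian_product sum_divide_distrib[symmetric] card_cartesian_product)
 show "vavg V (%v. vavg V (%v'. \<bar>vavg ?L (%l. a l v * a l v') - \<alpha>^2\<bar>)) <= e" unfolding pair proof (rule bound)
  have "vavg (V \<times> V) (%x. (case x of (v, v') => \<bar>vavg ?L (%l. a l v * a l v') - \<alpha>^2\<bar>)^2) =
  vavg V (%v. vavg V (%v'. vavg ?L (%l. a l v * a l v') * vavg ?L (%l. a l v * a l v') -
  (2 * \<alpha>^2) * vavg ?L (%l. a l v * a l v') + \<alpha>^2 * \<alpha>^2))" unfolding pair by (intro vavg_cong) (auto simp: power2_eq_square algebra_simps)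
  also have "... = vavg ?L (%l. vavg ?L (%l'. q l l' * q l l')) - (2 * \<alpha>^2) * vavg ?L (%l. p l * p l) + \<alpha>^2 * \<alpha>^2" proof -
  have "vavg V (%v. vavg V (%v'. vavg ?L (%l. a l v * a l v') * vavg ?L (%l. a l v * a l v'))) =
  vavg ?L (%l. vavg ?L (%l'. q l l' * q l l'))" unfolding q_def vavg_square vavg_swap[of V ?L] by (simp add: mult_ac)
  moreover have "vavg V (%v. vavg V (%v'. vavg ?L (%l. a l v * a l v'))) = vavg ?L (%l. p l * p l)" unfolding p_def vavg_square vavg_swap[of V ?L] ..
  ultimately show ?thesis unfolding vavg_add vavg_diff vavg_cmult vavg_const[OF V] by simp
  qed
  also have "... <= (\<alpha>^2 * \<alpha>^2 + 2 * \<eta> + 1 / real k) - (2 * \<alpha>^2) * (\<alpha> * \<alpha> - 2 * \<eta>) + \<alpha>^2 * \<alpha>^2" proof -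
  have "vavg ?L (%_. \<alpha> * \<alpha> - 2 * \<eta>) <= vavg ?L (%l. p l * p l)" using p2 by (intro vavg_mono) simp
  then have "(2 * \<alpha>^2) * (\<alpha> * \<alpha> - 2 * \<eta>) <= (2 * \<alpha>^2) * vavg ?L (%l. p l * p l)"
  unfolding vavg_const[OF L] by (intro mult_left_mono) auto
  with vavg_diagonal_le[OF k q2le] show ?thesis by linarith
  qed
  also have "... = 2 * \<eta> + 1 / real k + 4 * (\<alpha>^2 * \<eta>)" by (simp add: power2_eq_square algebra_simps)
  also have "... <= 1 / real k + 6 * \<eta>" using mult_right_mono[of "\<alpha>^2" 1 \<eta>] \<alpha>2 \<eta> by linarith
  finally show "vavg (V \<times> V) (%x. (case x of (v, v') => \<bar>vavg ?L (%l. a l v * a l v') - \<alpha>^2\<bar>)^2) <= 1 / real k + 6 * \<eta>" .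
 qed (use V in auto)
qed

text \<open>Summing over all words of length $|V|$ factorises over the vertices. The last summand is a floor for the weight of words far from all centres.\<close>
lemma total_weight_le:
 assumes V: "finite V" "V ~= {}" and F: "finite F" "F ~= {}"
 shows "(\<Sum>a\<in>PiE V (%_. {..<R}). (\<Sum>z\<in>F. exp (- s * real (card {v : V. a v ~= c z v}))) + exp (- s * real (card V)))
  <= real (card F) * (1 + 2 * real R * exp (- s)) ^ card V" proof -
 have single: "(\<Sum>a\<in>PiE V (%_. {..<R}). exp (- s * real (card {v : V. a v ~= c z v}))) <= (1 + real R * exp (- s)) ^ card V" for z proof -
  have "exp (- s * real (card {v : V. a v ~= c z v})) = (\<Prod>v\<in>V. if a v = c z v then 1 else exp (- s))" for a proof -
  have "(\<Prod>v\<in>V. if a v = c z v then 1 else exp (- s)) = (\<Prod>v\<in>{v : V. a v ~= c z v}. exp (- s))"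
  by (rule prod.mono_neutral_cong_right) (use V in auto)
  also have "... = exp (- s * real (card {v : V. a v ~= c z v}))" by (simp add: exp_of_nat_mult[symmetric] mult.commute)
  finally show ?thesis ..
  qed
  then have "(\<Sum>a\<in>PiE V (%_. {..<R}). exp (- s * real (card {v : V. a v ~= c z v}))) =
  (\<Prod>v\<in>V. \<Sum>j<R. if j = c z v then 1 else exp (- s))"
  using V by (simp only:) (rule prod_sum_PiE[symmetric, of V "%_. {..<R}" "%v j. if j = c z v then 1 else exp (- s)"], auto)
  also have "... <= (\<Prod>v\<in>V. 1 + real R * exp (- s))" proof (rule prod_mono, intro conjI)
  fix v
  show "0 <= (\<Sum>j<R. if j = c z v then 1 else exp (- s))" by (intro sum_nonneg) auto
  have "(\<Sum>j<R. if j = c z v then 1 else exp (- s)) <= (\<Sum>j<R. (if j = c z v then 1 else 0) + exp (- s))" by (intro sum_mono) auto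
  also have "... <= 1 + real R * exp (- s)" by (simp add: sum.distrib)
  finally show "(\<Sum>j<R. if j = c z v then 1 else exp (- s)) <= 1 + real R * exp (- s)" .
  qed
  finally show ?thesis by simp
 qed
 have "(\<Sum>a\<in>PiE V (%_. {..<R}). (\<Sum>z\<in>F. exp (- s * real (card {v : V. a v ~= c z v}))) + exp (- s * real (card V))) =
  (\<Sum>z\<in>F. \<Sum>a\<in>PiE V (%_. {..<R}). exp (- s * real (card {v : V. a v ~= c z v}))) + (real R * exp (- s)) ^ card V" unfolding sum.distrib using V
  by (subst sum.swap) (simp add: card_PiE power_mult_distrib exp_of_nat_mult[symmetric] mult.commute)
 also have "... <= real (card F) * (1 + real R * exp (- s)) ^ card V + real (card F) * (real R * exp (- s)) ^ card V" proof (rule add_mono)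
  show "(\<Sum>z\<in>F. \<Sum>a\<in>PiE V (%_. {..<R}). exp (- s * real (card {v : V. a v ~= c z v}))) <= real (card F) * (1 + real R * exp (- s)) ^ card V"
  by (rule order_trans[OF sum_mono[OF single]]) simp
  have "1 <= real (card F)" using F by (simp add: Suc_le_eq card_gt_0_iff)
  then show "(real R * exp (- s)) ^ card V <= real (card F) * (real R * exp (- s)) ^ card V"
  using mult_right_mono[of 1 "real (card F)" "(real R * exp (- s)) ^ card V"] by simp
 qed
 also have "... <= real (card F) * ((1 + real R * exp (- s)) + real R * exp (- s)) ^ card V" proof -
  have pw: "x ^ Suc n + y ^ Suc n <= (x + y) ^ Suc n" if "0 <= x" "0 <= y" for x y :: real and n proof -
  have "x * x ^ n + y * y ^ n <= x * (x + y) ^ n + y * (x + y) ^ n" using that by (intro add_mono mult_left_mono power_mono) auto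
  then show ?thesis by (simp add: distrib_right)
  qed
  obtain n where n: "card V = Suc n" using V by (metis card_0_eq not0_implies_Suc)
  show ?thesis unfolding distrib_left[symmetric] n by (intro mult_left_mono pw) auto
 qed
 finally show ?thesis by (simp add: algebra_simps)
qed

text \<open>Give a label word the weight $\exp(-s h)$, where $h$ is its number of disagreements with a centre, summed over the centres. A tuple with mostly covered entries has a product of weights that is not too small, on average by convexity of the exponential, while the weights of all tuples add up to the $k$-th power of the total weight.\<close>
lemma labelled_tuples_count:
 fixes lab :: "'x => nat => 'v => nat"
 assumes V: "finite V" "V ~= {}" and F: "finite F" "F ~= {}" and S: "finite S" "S ~= {}" and k: "k >= 1" and lab: "!!x l v. x : S ==> l < k ==> v : V ==> lab x l v < R"
  and inj: "!!x y. x : S ==> y : S ==> x ~= y ==> \<exists>l<k. EX v:V. lab x l v ~= lab y l v"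
  and s: "s >= 0" "\<theta> >= 0" and U: "U \<subseteq> S \<times> {..<k}" "real (card U) <= \<epsilon> * (real (card S) * real k)"
  and cov: "!!x l. x : S ==> l < k ==> (x, l) ~: U ==> EX z:F. real (card {v : V. lab x l v ~= c z v}) <= \<theta> * real (card V)"
 shows "ln (real (card S)) <= real k * (real (card V) * (s * (\<theta> + \<epsilon>) + 2 * real R * exp (- s)) + ln (real (card F)))" proof -
 define n where "n = real (card V)"
 define w where "w a = (\<Sum>z\<in>F. exp (- s * real (card {v : V. a v ~= c z v}))) + exp (- s * n)" for a
 have n: "0 <= n" by (simp add: n_def)
 have w0: "0 < w a" for a unfolding w_def by (intro add_nonneg_pos sum_nonneg) auto
 define L where "L x = (\<lambda>l\<in>{..<k}. \<lambda>v\<in>V. lab x l v)" for x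
 define y where "y x = s * n * (\<theta> * real k + real (card {l : {..<k}. (x, l) : U}))" for x
 have low: "exp (- y x) <= (\<Prod>l<k. w (L x l))" if x: "x : S" for x proof -
  have "exp (- (s * n * (\<theta> + (if (x, l) : U then 1 else 0)))) <= w (L x l)" if l: "l < k" for l proof (cases "(x, l) : U")
  case True
  have "exp (- (s * n * (\<theta> + 1))) <= exp (- s * n)" using s n by (simp add: distrib_left)
  also have "... <= w (L x l)" unfolding w_def by (simp add: sum_nonneg)
  finally show ?thesis using True by simp
  next
  case False
  obtain z where z: "z : F" "real (card {v : V. lab x l v ~= c z v}) <= \<theta> * n" using cov[OF x l False] unfolding n_def by blast
  have "{v : V. L x l v ~= c z v} = {v : V. lab x l v ~= c z v}" using l by (auto simp: L_def)
  then have "exp (- (s * n * \<theta>)) <= exp (- s * real (card {v : V. L x l v ~= c z v}))" using mult_left_mono[OF z(2) s(1)] by (simp add: mult_ac)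
  also have "... <= (\<Sum>z\<in>F. exp (- s * real (card {v : V. L x l v ~= c z v})))" by (rule member_le_sum[OF z(1)]) (use F in auto)
  also have "... <= w (L x l)" unfolding w_def by simp
  finally show ?thesis using False by simp
  qed
  then have "(\<Prod>l<k. exp (- (s * n * (\<theta> + (if (x, l) : U then 1 else 0))))) <= (\<Prod>l<k. w (L x l))" by (intro prod_mono) auto
  also have "(\<Prod>l<k. exp (- (s * n * (\<theta> + (if (x, l) : U then 1 else 0))))) = exp (- y x)" proof -
  have "(\<Sum>l<k. if (x, l) : U then 1 else (0::real)) = real (card {l : {..<k}. (x, l) : U})" by (simp add: sum.If_cases Int_def)
  then have "(\<Sum>l<k. - (s * n * (\<theta> + (if (x, l) : U then 1 else 0)))) = - y x" unfolding sum_negf sum_distrib_left[symmetric] sum.distrib y_def by simp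
  then show ?thesis unfolding exp_sum[OF finite_lessThan, symmetric] by (rule arg_cong)
  qed
  finally show ?thesis .
 qed
 define Y where "Y = s * n * (real k * (\<theta> + \<epsilon>))"
 have "real (card S) * exp (- Y) <= (\<Sum>x\<in>S. exp (- Y) * (1 + (Y - y x)))" proof -
  have "(\<Sum>x\<in>S. real (card {l : {..<k}. (x, l) : U})) = real (card U)" proof -
  have "U = (SIGMA x:S. {l : {..<k}. (x, l) : U})" using U(1) by auto
  then have "card U = card (SIGMA x:S. {l : {..<k}. (x, l) : U})" by (rule arg_cong)
  also have "... = (\<Sum>x\<in>S. card {l : {..<k}. (x, l) : U})" by (rule card_SigmaI) (use S in auto)
  finally show ?thesis by simp
  qed
  then have "(\<Sum>x\<in>S. y x) = s * n * (\<theta> * real k * real (card S) + real (card U))"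
  unfolding y_def by (simp add: sum_distrib_left[symmetric] sum.distrib mult.commute)
  also have "... <= s * n * (\<theta> * real k * real (card S) + \<epsilon> * (real (card S) * real k))" using U(2) s n by (intro mult_left_mono) auto
  also have "... = real (card S) * Y" unfolding Y_def by (simp add: algebra_simps)
  finally have "(\<Sum>x\<in>S. y x) <= real (card S) * Y" .
  then have "real (card S) <= (\<Sum>x\<in>S. 1 + (Y - y x))" by (simp add: sum.distrib sum_subtractf)
  then show ?thesis unfolding sum_distrib_left[symmetric] by (simp add: mult.commute)
 qed
 also have "... <= (\<Sum>x\<in>S. exp (- y x))" proof (rule sum_mono)
  fix x
  have "exp (- Y) * (1 + (Y - y x)) <= exp (- Y) * exp (Y - y x)" by (intro mult_left_mono exp_ge_add_one_self) simp
  then show "exp (- Y) * (1 + (Y - y x)) <= exp (- y x)" by (simp add: exp_add[symmetric])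
 qed
 also have "... <= (\<Sum>x\<in>S. \<Prod>l<k. w (L x l))" by (rule sum_mono[OF low])
 also have "... = (\<Sum>f\<in>L ` S. \<Prod>l<k. w (f l))" proof -
  have "inj_on L S" proof (rule inj_onI, rule ccontr)
  fix x x' assume x: "x : S" "x' : S" "L x = L x'" "x ~= x'"
  from inj[OF x(1,2,4)] obtain l v where lv: "l < k" "v : V" "lab x l v ~= lab x' l v" by blast
  have "L x l v = L x' l v" unfolding x(3) ..
  with lv show False by (simp add: L_def)
  qed
  then show ?thesis by (simp add: sum.reindex)
 qed
 also have "... <= (\<Sum>f\<in>PiE {..<k} (%_. PiE V (%_. {..<R})). \<Prod>l<k. w (f l))" proof (rule sum_mono2)
  show "finite (PiE {..<k} (%_. PiE V (%_. {..<R})))" using V by (intro finite_PiE) auto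
  show "L ` S \<subseteq> PiE {..<k} (%_. PiE V (%_. {..<R}))" using lab by (auto simp: L_def)
  show "0 <= (\<Prod>l<k. w (f l))" for f using w0 by (intro prod_nonneg) (auto intro: less_imp_le)
 qed
 also have "... = (\<Prod>l<k. \<Sum>a\<in>PiE V (%_. {..<R}). w a)"
  by (rule prod_sum_PiE[symmetric, of "{..<k}" "%_. PiE V (%_. {..<R})" "%_ a. w a"]) (use V in \<open>auto intro: finite_PiE\<close>)
 also have "... <= (\<Prod>l<k. real (card F) * (1 + 2 * real R * exp (- s)) ^ card V)" proof (intro prod_mono conjI)
  show "0 <= (\<Sum>a\<in>PiE V (%_. {..<R}). w a)" by (intro sum_nonneg less_imp_le w0)
  show "(\<Sum>a\<in>PiE V (%_. {..<R}). w a) <= real (card F) * (1 + 2 * real R * exp (- s)) ^ card V"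
  using total_weight_le[OF V F, where R = R and s = s and c = c] unfolding w_def n_def .
 qed
 also have "... <= (real (card F) * exp (n * (2 * real R * exp (- s)))) ^ k" proof -
  have "(1 + 2 * real R * exp (- s)) ^ card V <= exp (2 * real R * exp (- s)) ^ card V" by (intro power_mono exp_ge_add_one_self) simp
  then show ?thesis unfolding n_def exp_of_nat_mult prod_constant card_lessThan by (intro power_mono mult_left_mono) auto
 qed
 finally have le: "real (card S) * exp (- Y) <= (real (card F) * exp (n * (2 * real R * exp (- s)))) ^ k" .
 have cS: "real (card S) > 0" "real (card F) > 0" using S F by (simp_all add: card_gt_0_iff)
 have "ln (real (card S) * exp (- Y)) <= ln ((real (card F) * exp (n * (2 * real R * exp (- s)))) ^ k)" by (rule ln_mono[OF le]) (use cS in simp)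
 then have "ln (real (card S)) - Y <= real k * (ln (real (card F)) + n * (2 * real R * exp (- s)))" using cS by (simp add: ln_mult ln_realpow)
 then show ?thesis unfolding Y_def n_def[symmetric] by (simp add: algebra_simps)
qed

lemma vavg_Times: "vavg (U \<times> V) (%(x, y). f x y) = vavg U (%x. vavg V (%y. f x y))"
 unfolding vavg_def by (simp add: sum.cartesian_product sum_divide_distrib[symmetric] card_cartesian_product)

lemma wval_right_word:
 "wval q (right_word w :: ('g \<times> ('i + 'j)) list) = wval (%(g, j). q (g, Inr j)) w" by (induction w) (auto simp: right_word_def)

definition label_feat :: "nat => nat => real" where
 "label_feat j a = (if a = j then 1 else 0)"

definition lift_word :: "nat => ('g \<times> 'j) list => ('g \<times> (nat \<times> 'j)) list" where
 "lift_word l w = map (%(g, j). (g, (l, j))) w"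

lemma lift_word_in_words: "w : name_words G ==> lift_word l w : name_words G" by (auto simp: lift_word_def in_lists_conv_set)

lemma wval_lift_model:
 "l < k ==> wval (name G (pow_feat k f) s x v) (lift_word l w) = wval (name G f s (%v. x v l) v) w"
 unfolding wval_def lift_word_def by (rule arg_cong[of _ _ prod_list]) (auto simp: name_def pow_feat_def)

lemma wval_lift_orbit:
 "l < k ==> wval (name G (pow_feat k f) (power_action k T) (pow_code k \<psi>) p) (lift_word l w) = wval (name G f T \<psi> (p l)) w" unfolding wval_def lift_word_def
 by (rule arg_cong[of _ _ prod_list]) (auto simp: name_def pow_feat_def pow_code_def power_action_def)

text \<open>Models of the $k$-th power whose coordinates look good and pairwise independent on the words in $W$, and which the labels tell apart.\<close>
definition tuple_stage ::
 "('g, 'b) monoid_scheme => 'x measure => ('g => 'x => 'x) => (nat \<times> 'a) set => ('j => nat \<times> 'a => real) => ('x => nat \<times> 'a) =>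
  real => nat => ('g \<times> 'j) list set => real => 'v set => ('g => 'v => 'v) => ('v => nat => nat \<times> 'a) set => bool" where
 "tuple_stage G N T B f \<psi> b k W \<eta> V s S \<longleftrightarrow> finite S & exp (real k * b * real (card V)) <= real (card S) &
  (ALL x:S. ALL v:V. \<forall>l<k. x v l : B) &
  (ALL w:W. \<forall>l<k. ALL x:S. \<bar>vavg V (%v. wval (name G f s (%v. x v l) v) w) - (LINT p|N. wval (name G f T \<psi> p) w)\<bar> < \<eta>) &
  (ALL w:W. \<forall>l<k. \<forall>l'<k. l ~= l' --> (ALL x:S. \<bar>vavg V (%v. wval (name G f s (%v. x v l) v) w * wval (name G f s (%v. x v l') v) w) -
  (LINT p|N. wval (name G f T \<psi> p) w)^2\<bar> < \<eta>)) &
  (ALL x:S. ALL y:S. x ~= y --> (\<exists>l<k. EX v:V. fst (x v l) ~= fst (y v l)))"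

lemma tuple_stageD:
 assumes "tuple_stage G N T B f \<psi> b k W \<eta> V s S"
 shows "finite S" "exp (real k * b * real (card V)) <= real (card S)"
  "x : S ==> v : V ==> l < k ==> x v l : B"
  "w : W ==> l < k ==> x : S ==>
  \<bar>vavg V (%v. wval (name G f s (%v. x v l) v) w) - (LINT p|N. wval (name G f T \<psi> p) w)\<bar> < \<eta>"
  "w : W ==> l < k ==> l' < k ==> l ~= l' ==> x : S ==>
  \<bar>vavg V (%v. wval (name G f s (%v. x v l) v) w * wval (name G f s (%v. x v l') v) w) -
  (LINT p|N. wval (name G f T \<psi> p) w)^2\<bar> < \<eta>"
  "x : S ==> y : S ==> x ~= y ==> \<exists>l<k. EX v:V. fst (x v l) ~= fst (y v l)" using assms unfolding tuple_stage_def by simp_all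

context pmp_action begin

lemma lifted_word_integral:
 assumes cod: "coding N B f \<psi>" and w: "w : name_words G" and l: "l < k"
 shows "(LINT p|power_space k N. wval (name G (pow_feat k f) (power_action k T) (pow_code k \<psi>) p) (lift_word l w)) =
  (LINT p|N. wval (name G f T \<psi> p) w)" unfolding wval_lift_orbit[OF l]
 using integral_distr[OF power_component_measurable[OF l] orbit_word_measurable[OF cod w]] power_component_distr[OF l] by simp

lemma lifted_pair_integral:
 assumes cod: "coding N B f \<psi>" and w: "w : name_words G" and l: "l < k" "l' < k" "l ~= l'"
 shows "(LINT p|power_space k N. wval (name G (pow_feat k f) (power_action k T) (pow_code k \<psi>) p) (lift_word l w @ lift_word l' w)) =
  (LINT p|N. wval (name G f T \<psi> p) w)^2" proof -
 define A where "A p = wval (name G f T \<psi> p) w" for p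
 define h where "h i p = (if i = l then A p else 1) * (if i = l' then A p else 1)" for i p
 note A = orbit_word_measurable[OF cod w, folded A_def] orbit_word_01[OF cod, of _ w, folded A_def]
 have h: "h i : bmeas N" "p : space N ==> 0 <= h i p & h i p <= 1" for i p using A l(3) unfolding h_def[abs_def] by auto
 have "wval (name G (pow_feat k f) (power_action k T) (pow_code k \<psi>) p) (lift_word l w @ lift_word l' w) =
  (\<Prod>i<k. h i (p i))" for p using l by (simp add: wval_lift_orbit A_def[symmetric] h_def prod.distrib)
 then have "(LINT p|power_space k N. wval (name G (pow_feat k f) (power_action k T) (pow_code k \<psi>) p) (lift_word l w @ lift_word l' w)) =
  (\<Prod>i<k. \<integral>p. h i p \<partial>N)" using integral_power_product[OF prob_space_axioms h, of k] by simp
 also have "... = (\<Prod>i<k. (if i = l then \<integral>p. A p \<partial>N else 1) * (if i = l' then \<integral>p. A p \<partial>N else 1))"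
  using l(3) by (intro prod.cong refl) (auto simp: h_def prob_space)
 also have "... = (LINT p|N. A p)^2" using l by (simp add: prod.distrib power2_eq_square)
 finally show ?thesis unfolding A_def .
qed

lemma tuple_stages_exist:
 fixes u :: "'j::countable => 'a => real" and V :: "nat => 'v set" and \<zeta> :: "'x => nat"
 defines "f \<equiv> pair_feat label_feat u"
 assumes cX: "coding N A u \<xi>" and act: "almost_action G V \<sigma>" and cL: "coding N {..<R} label_feat \<zeta>" and gL: "generates G N T label_feat \<zeta> UNIV"
  and growth: "power_growth G N T k ({..<R} \<times> A) f (%m. (\<zeta> m, \<xi> m)) V \<sigma> (real k * b)"
  and W: "finite W" "W \<subseteq> name_words G" and \<eta>: "\<eta> > 0"
 shows "\<exists>\<^sub>F i in sequentially. EX S. tuple_stage G N T ({..<R} \<times> A) f (%m. (\<zeta> m, \<xi> m)) b k W \<eta> (V i) (\<sigma> i) S" proof -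
 let ?\<psi> = "%m. (\<zeta> m, \<xi> m)"
 interpret P: pmp_action G "power_space k N" "power_action k T" by (rule pmp_action_power)
 note cY = coding_pair[OF cL cX, folded f_def]
 note cP = coding_power[OF cY, of k]
 have gP: "generates G (power_space k N) (power_action k T) (pow_feat k f) (pow_code k ?\<psi>) (range (%(l, j). (l, Inl j)))"
  by (rule P.generates_reindex[OF generates_power[OF cL gL]]) (auto simp: pow_feat_def pow_code_def f_def)
 obtain r S J d where wit: "growth_wit G (power_space k N) (power_action k T) (pow_alpha k ({..<R} \<times> A)) (pow_feat k f)
  (pow_code k ?\<psi>) V \<sigma> (real k * b) r S J d" using growth unfolding has_growth_def by blast
 note r = growth_witD(1)[OF wit] and good = growth_witD(2)[OF wit] and J = growth_witD(3)[OF wit]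
  and d = growth_witD(4)[OF wit] and S = growth_witD(5,6)[OF wit] and sep = growth_witD(7)[OF wit]
 note act' = almost_action_subseq[OF act r]
 have d2: "d / 2 > 0" using d by simp
 obtain J' C where J': "finite J'" "J' \<subseteq> range (%(l, j). (l, Inl j))" and C: "0 <= C"
  and rec: "EV i. ALL x:S i. ALL y:S i. fdist (pow_feat k f) J ((V o r) i) x y \<le>
  d / 2 + C * fdist (pow_feat k f) J' ((V o r) i) x y" using P.recover_features[OF cP gP act' good J d2] by blast
 have test: "EV i. ALL x:S i. power_error G N T k f ?\<psi>
  (V (r i)) (\<sigma> (r i)) (word w) x < \<eta>" if "w : name_words G" for w using good ll_word[OF that] \<eta> unfolding good_seq_def by simp
 have ev1: "EV i. ALL w:W. ALL l:{..<k}. ALL x:S i. \<bar>vavg (V (r i)) (%v. wval (name G f (\<sigma> (r i)) (%v. x v l) v) w) -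
  (LINT p|N. wval (name G f T ?\<psi> p) w)\<bar> < \<eta>" proof (intro eventually_ball_finite ballI W finite_lessThan)
  fix w l assume w: "w : W" and "l : {..<k}"
  then have l: "l < k" by simp
  have "w : name_words G" using w W by blast
  from test[OF lift_word_in_words[OF this, of l]] show "EV i. ALL x:S i.
  \<bar>vavg (V (r i)) (%v. wval (name G f (\<sigma> (r i)) (%v. x v l) v) w) - (LINT p|N. wval (name G f T ?\<psi> p) w)\<bar> < \<eta>"
  unfolding model_error_def lifted_word_integral[OF cY \<open>w : name_words G\<close> l] unfolding wval_lift_model[OF l] .
 qed
 have ev2: "EV i. ALL w:W. ALL l:{..<k}. ALL l':{..<k} - {l}. ALL x:S i. \<bar>vavg (V (r i)) (%v. wval (name G f (\<sigma> (r i)) (%v. x v l) v) w *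
  wval (name G f (\<sigma> (r i)) (%v. x v l') v) w) - (LINT p|N. wval (name G f T ?\<psi> p) w)^2\<bar> < \<eta>"
 proof (intro eventually_ball_finite ballI W finite_lessThan finite_Diff)
  fix w l l' assume w: "w : W" and "l : {..<k}" "l' : {..<k} - {l}"
  then have l: "l < k" "l' < k" "l ~= l'" by auto
  have w': "w : name_words G" using w W by blast
  then have "lift_word l w @ lift_word l' w : name_words G" using lift_word_in_words[of w G] by simp
  from test[OF this] show "EV i. ALL x:S i. \<bar>vavg (V (r i)) (%v. wval (name G f (\<sigma> (r i)) (%v. x v l) v) w *
  wval (name G f (\<sigma> (r i)) (%v. x v l') v) w) - (LINT p|N. wval (name G f T ?\<psi> p) w)^2\<bar> < \<eta>"
  unfolding model_error_def lifted_pair_integral[OF cY w' l] unfolding wval_simps wval_lift_model[OF l(1)] wval_lift_model[OF l(2)] .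
 qed
 have "EV i. tuple_stage G N T ({..<R} \<times> A) f ?\<psi> b k W \<eta> (V (r i)) (\<sigma> (r i)) (S i)" using ev1 ev2 rec proof eventually_elim
  case (elim i)
  have mem: "x v l : {..<R} \<times> A" if "x : S i" "v : V (r i)" "l < k" for x v l proof -
  have "x v : pow_alpha k ({..<R} \<times> A)" using good that(1,2) unfolding good_seq_def by auto
  from PiE_mem[OF this, of l] that(3) show ?thesis by simp
  qed
  have lab: "\<exists>l<k. EX v:V (r i). fst (x v l) ~= fst (y v l)" if xy: "x : S i" "y : S i" "x ~= y" for x y proof (rule ccontr)
  assume "~ ?thesis"
  then have same: "!!l v. l < k ==> v : V (r i) ==> fst (x v l) = fst (y v l)" by blast
  have "fdist (pow_feat k f) J' ((V o r) i) x y = vavg ((V o r) i) (%_. 0)" unfolding fdist_def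
  by (intro vavg_cong sum.neutral ballI) (use J'(2) same in \<open>auto simp: pow_feat_def f_def\<close>)
  then have "fdist (pow_feat k f) J' ((V o r) i) x y = 0" by (simp add: vavg_def)
  with elim(3) xy(1,2) have "fdist (pow_feat k f) J (V (r i)) x y <= d / 2" by force
  with sep[OF xy] d show False by linarith
  qed
  show ?case unfolding tuple_stage_def using S mem lab elim(1,2) by (intro conjI) auto
 qed
 then have "EV i. EX S. tuple_stage G N T ({..<R} \<times> A) f ?\<psi> b k W \<eta> (V (r i)) (\<sigma> (r i)) S" by (rule eventually_mono) blast
 then show ?thesis unfolding eventually_sequentially frequently_sequentially by (meson le_trans nat_le_linear seq_suble[OF r])
qed

text \<open>The measures are the distributions of a uniformly random coordinate of a uniformly random tuple from stages with growing $k$.\<close>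
theorem doubly_quenched_from_power_growth:
 fixes u :: "'j::countable => 'a => real" and V :: "nat => 'v set" and \<zeta> :: "'x => nat"
 assumes mc: "metric_coding G N T X d u \<mu> \<xi>" and act: "almost_action G V \<sigma>"
  and cL: "coding N {..<R} label_feat \<zeta>" and gL: "generates G N T label_feat \<zeta> UNIV"
  and growth: "!!k. k >= 1 ==> power_growth G N T k ({..<R} \<times> space X) (pair_feat label_feat u) (%m. (\<zeta> m, \<xi> m)) V \<sigma> (real k * b)"
 shows "EX r m. strict_mono r & doubly_quenched_converges G (V o r) (\<sigma> o r) X d m \<mu> &
  (\<forall>\<kappa>>0. \<exists>\<delta>>0. \<exists>\<epsilon>>0. ereal (b - \<kappa>) <= limsup (%i. cov_rate (V (r i)) d \<epsilon> \<delta> (m i)))" proof -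
 note mf = metric_codingD(1)[OF mc] and cX = metric_codingD(4)[OF mc]
 have um: "!!j. u j : bmeas X" and feat: "features (space X) u" and ms: "Metric_space (space X) d" using mf unfolding metric_features_def by blast+
 define f where "f = pair_feat label_feat u"
 define \<psi> where "\<psi> m = (\<zeta> m, \<xi> m)" for m
 define B where "B = {..<R} \<times> space X"
 have cY: "coding N B f \<psi>" using coding_pair[OF cL cX] unfolding B_def f_def \<psi>_def[abs_def] .
 \<comment> \<open>With these choices the variance bound at stage \<open>t\<close> is below \<open>(1 / (t + 1))^2 / 4\<close>.\<close>
 define k where "k t = 8 * Suc t ^ 2" for t
 define \<eta> where "\<eta> t = 1 / (48 * real (Suc t) ^ 2)" for t
 have k1: "k t >= 1" and \<eta>0: "\<eta> t > 0" for t by (simp_all add: k_def \<eta>_def)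
 let ?Words = "name_words G :: ('g \<times> (nat + 'j)) list set"
 have cW: "countable ?Words" using countable_group by (intro countable_lists countable_SIGMA) auto
 define W where "W t = from_nat_into ?Words ` {..t}" for t :: nat
 have Wsub: "W t \<subseteq> ?Words" for t proof -
  have "[] : ?Words" by simp
  then have "?Words ~= {}" by blast
  from from_nat_into[OF this] show ?thesis unfolding W_def by (rule image_subsetI)
 qed
 have Win: "EX n. \<forall>t\<ge>n. w : W t" if "w : ?Words" for w using from_nat_into_surj[OF cW that] unfolding W_def by (metis atMost_iff image_eqI)
 define stage where "stage t i S \<longleftrightarrow> tuple_stage G N T B f \<psi> b (k t) (W t) (\<eta> t) (V i) (\<sigma> i) S" for t i S
 have "\<exists>\<^sub>F i in sequentially. EX S. stage t i S" for t unfolding stage_def B_def f_def \<psi>_def[abs_def]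
  by (rule tuple_stages_exist[OF cX act cL gL growth[OF k1] _ Wsub \<eta>0]) (simp add: W_def)
 from frequently_subsequence[of "%t i. EX S. stage t i S", OF this]
 obtain r where r: "strict_mono r" and "ALL t. EX S. stage t (r t) S" by blast
 then obtain S where "!!t. stage t (r t) (S t)" by metis
 note st = tuple_stageD[OF this[unfolded stage_def]]
 note act' = almost_action_subseq[OF act r] and V = almost_actionD(1,2)[OF act]
 have \<sigma>V: "\<sigma> i g v : V i" if "g : carrier G" "v : V i" for i g v by (rule almost_actionD(4)[OF act that])
 have Sne: "S t ~= {}" for t proof
  assume "S t = {}"
  with st(2)[of t] show False using not_exp_le_zero by simp
 qed
 have L: "finite {..<k t}" "{..<k t} ~= {}" for t using k1[of t] by (simp_all add: lessThan_empty_iff)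
 define I where "I t = S t \<times> {..<k t}" for t
 have I: "finite (I t)" "I t ~= {}" for t using st(1) Sne L unfolding I_def by auto
 define h where "h t p = (\<lambda>v\<in>V (r t). snd (fst p v (snd p)))" for t and p :: "('v => nat => nat \<times> 'a) \<times> nat"
 define m where "m t = distr (uniform_count_measure (I t)) (PiM (V (r t)) (%_. X)) (h t)" for t
 have hX: "snd (x v l) : space X" if "x : S t" "v : V (r t)" "l < k t" for t x v l using st(3)[OF that] by (auto simp: B_def)
 have hs: "h t p : space (m t)" if "p : I t" for t p using that hX by (auto simp: h_def m_def I_def space_PiM)
 have hm: "h t : measurable (uniform_count_measure (I t)) (PiM (V (r t)) (%_. X))" for t proof (rule measurableI)
  show "h t p : space (PiM (V (r t)) (%_. X))" if "p : space (uniform_count_measure (I t))" for p using that hs[of p t] by (simp add: space_uniform_count_measure m_def)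
 qed (auto simp: space_uniform_count_measure sets_uniform_count_measure)
 have m: "prob_space (m t)" "sets (m t) = sets (PiM (V (r t)) (%_. X))" for t
  unfolding m_def using hm by (auto intro: prob_space.prob_space_distr[OF prob_space_uniform_count_measure[OF I]])
 have mI: "(LINT x|m t. g x) = vavg (S t) (%x. vavg {..<k t} (%l. g (h t (x, l))))" if "g : bmeas (m t)" for g t proof -
  have "g : bmeas (PiM (V (r t)) (%_. X))" using that unfolding m_def by simp
  then have "(LINT x|m t. g x) = vavg (I t) (%p. g (h t p))" unfolding m_def by (simp add: integral_distr[OF hm] vavg_eq_integral[OF I(1)])
  also have "... = vavg (S t \<times> {..<k t}) (%(x, l). g (h t (x, l)))" unfolding I_def by (rule vavg_cong) auto
  finally show ?thesis unfolding vavg_Times .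
 qed
 have pc: "pair_convergent G N T u \<xi> (V o r) (\<sigma> o r) m" unfolding pair_convergent_def proof
  fix w :: "('g \<times> 'j) list" assume w: "w : name_words G"
  define rw where "rw = (right_word w :: ('g \<times> (nat + 'j)) list)"
  have rw: "rw : ?Words" unfolding rw_def by (rule left_right_words(2)[OF w])
  define al where "al = (LINT p|N. wval (name G f T \<psi> p) rw)"
  have al_eq: "al = (LINT p|N. wval (name G u T \<xi> p) w)" unfolding al_def rw_def wval_right_word
  by (intro Bochner_Integration.integral_cong refl arg_cong[of _ _ "%q. wval q w"]) (auto simp: name_def f_def \<psi>_def fun_eq_iff)
  have al: "0 <= al" "al <= 1" unfolding al_def using integral_01[OF orbit_word_measurable[OF cY rw] orbit_word_01[OF cY]] by auto
  define a where "a t v x = wval (name G u (\<sigma> (r t)) x v) w" for t v x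
  have am: "a t v : bmeas (m t)" if "v : V (r t)" for t v
  unfolding a_def[abs_def] using model_word_measurable[OF act' um, where i = t and m = "m t" and v = v] that m(2) by simp
  have ah: "a t v (h t (x, l)) = wval (name G f (\<sigma> (r t)) (%v. x v l) v) rw" if "v : V (r t)" for t v x l unfolding a_def rw_def wval_right_word
  using \<sigma>V[OF _ that] by (intro arg_cong[of _ _ "%q. wval q w"]) (auto simp: name_def f_def h_def fun_eq_iff)
  have a01: "0 <= a t v (h t (x, l)) & a t v (h t (x, l)) <= 1" if "v : V (r t)" "x : S t" "l < k t" for t v x l proof -
  have "h t (x, l) : space (m t)" using that by (intro hs) (auto simp: I_def)
  with model_word_01[OF act' feat, where i = t and m = "m t" and v = v] that(1) m(2) show ?thesis unfolding a_def by simp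
  qed
  obtain n where n: "!!t. t >= n ==> rw : W t" using Win[OF rw] by blast
  have conc: "vavg (V (r t)) (%v. \<bar>vavg {..<k t} (%l. a t v (h t (x, l))) - al\<bar>) <= 1 / real (Suc t) &
  vavg (V (r t)) (%v. vavg (V (r t)) (%v'. \<bar>vavg {..<k t} (%l. a t v (h t (x, l)) * a t v' (h t (x, l))) - al^2\<bar>)) <= 1 / real (Suc t)"
  if t: "n <= t" and x: "x : S t" for t x proof (rule conjI; rule averages_concentrate[where \<eta> = "\<eta> t"])
  have cong: "vavg (V (r t)) (%v. a t v (h t (x, l))) = vavg (V (r t)) (%v. wval (name G f (\<sigma> (r t)) (%v. x v l) v) rw)" for l by (rule vavg_cong) (rule ah)
  show "\<bar>vavg (V (r t)) (%v. a t v (h t (x, l))) - al\<bar> <= \<eta> t" if "l < k t" for l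
  unfolding cong al_def by (rule less_imp_le[OF st(4)[OF n[OF t] that x]])
  then show "\<bar>vavg (V (r t)) (%v. a t v (h t (x, l))) - al\<bar> <= \<eta> t" if "l < k t" for l using that .
  have cong2: "vavg (V (r t)) (%v. a t v (h t (x, l)) * a t v (h t (x, l'))) =
  vavg (V (r t)) (%v. wval (name G f (\<sigma> (r t)) (%v. x v l) v) rw * wval (name G f (\<sigma> (r t)) (%v. x v l') v) rw)" for l l'
  by (rule vavg_cong) (simp only: ah)
  show "\<bar>vavg (V (r t)) (%v. a t v (h t (x, l)) * a t v (h t (x, l'))) - al^2\<bar> <= \<eta> t" if "l < k t" "l' < k t" "l ~= l'" for l l'
  unfolding cong2 al_def by (rule less_imp_le[OF st(5)[OF n[OF t] that x]])
  then show "\<bar>vavg (V (r t)) (%v. a t v (h t (x, l)) * a t v (h t (x, l'))) - al^2\<bar> <= \<eta> t" if "l < k t" "l' < k t" "l ~= l'" for l l' using that .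
  show "1 / real (k t) + 6 * \<eta> t <= (1 / real (Suc t))^2 / 4" "1 / real (k t) + 6 * \<eta> t <= (1 / real (Suc t))^2 / 4"
  by (simp_all add: k_def \<eta>_def power_divide del: of_nat_Suc)
  qed (use V k1 al a01 x in auto)
  have D1: "vavg (V (r t)) (%v. \<bar>(LINT x|m t. a t v x) - al\<bar>) <= 1 / real (Suc t)" if t: "n <= t" for t proof -
  have "vavg (V (r t)) (%v. \<bar>(LINT x|m t. a t v x) - al\<bar>) =
  vavg (V (r t)) (%v. \<bar>vavg (S t) (%x. vavg {..<k t} (%l. a t v (h t (x, l))) - al)\<bar>)"
  by (intro vavg_cong) (simp add: mI[OF am] vavg_diff vavg_const[OF st(1) Sne])
  also have "... <= vavg (V (r t)) (%v. vavg (S t) (%x. \<bar>vavg {..<k t} (%l. a t v (h t (x, l))) - al\<bar>))" by (intro vavg_mono vavg_abs_le)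
  also have "... <= 1 / real (Suc t)" unfolding vavg_swap[of "V (r t)" "S t"] by (rule vavg_le_const[OF st(1) Sne]) (use conc[OF t] in blast)
  finally show ?thesis .
  qed
  have D2: "vavg (V (r t)) (%v. vavg (V (r t)) (%v'. \<bar>(LINT x|m t. a t v x * a t v' x) - al^2\<bar>)) <= 1 / real (Suc t)" if t: "n <= t" for t proof -
  have "vavg (V (r t)) (%v. vavg (V (r t)) (%v'. \<bar>(LINT x|m t. a t v x * a t v' x) - al^2\<bar>)) =
  vavg (V (r t)) (%v. vavg (V (r t)) (%v'. \<bar>vavg (S t) (%x. vavg {..<k t} (%l. a t v (h t (x, l)) * a t v' (h t (x, l))) - al^2)\<bar>))"
  by (intro vavg_cong) (simp add: mI[OF borel_measurable_times[OF am am]] vavg_diff vavg_const[OF st(1) Sne])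
  also have "... <= vavg (V (r t)) (%v. vavg (V (r t)) (%v'. vavg (S t) (%x. \<bar>vavg {..<k t} (%l. a t v (h t (x, l)) * a t v' (h t (x, l))) - al^2\<bar>)))"
  by (intro vavg_mono vavg_abs_le)
  also have "... <= 1 / real (Suc t)" unfolding vavg_swap[of "V (r t)" "S t"] by (rule vavg_le_const[OF st(1) Sne]) (use conc[OF t] in blast)
  finally show ?thesis .
  qed
  have lim: "(%t. 1 / real (Suc t)) ~~> 0" by real_asymp
  show "(%i. vavg ((V o r) i) (%v. \<bar>(LINT x|m i. wval (name G u ((\<sigma> o r) i) x v) w) - (LINT p|N. wval (name G u T \<xi> p) w)\<bar>)) ~~> 0 &
  (%i. vavg ((V o r) i) (%v. vavg ((V o r) i) (%v'.
  \<bar>(LINT x|m i. wval (name G u ((\<sigma> o r) i) x v) w * wval (name G u ((\<sigma> o r) i) x v') w) -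
  (LINT p|N. wval (name G u T \<xi> p) w)^2\<bar>))) ~~> 0" unfolding al_eq[symmetric] a_def[symmetric] o_def
  by (intro conjI; rule tendsto_sandwich[OF always_eventually eventually_sequentiallyI tendsto_const lim])
  (auto intro!: vavg_nonneg D1 D2 simp: a_def[symmetric] simp del: of_nat_Suc)
 qed
 have dq: "doubly_quenched_converges G (V o r) (\<sigma> o r) X d m \<mu>" by (rule pair_convergent_imp_doubly_quenched[OF mc act' m(1) _ pc]) (simp add: m(2))
 define Q where "Q t = (%p v. fst p v (snd p)) ` I t" for t
 have goodQ: "good_seq G N T B f \<psi> (V o r) (\<sigma> o r) Q" proof (rule good_seq_words[OF cY act'])
  show "x v : B" if "x : Q i" "v : (V o r) i" for i x v using that st(3) unfolding Q_def I_def by auto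
  fix w :: "('g \<times> (nat + 'j)) list" and e :: real assume w: "w : name_words G" and e: "e > 0"
  obtain n where n: "!!t. t >= n ==> w : W t" using Win[OF w] by blast
  have "\<eta> ~~> 0" unfolding \<eta>_def[abs_def] by real_asymp
  from tendsto_0_eventually_less[OF this e] eventually_ge_at_top[of n]
  show "EV i. ALL x:Q i. model_error G N T f \<psi> ((V o r) i) ((\<sigma> o r) i) (word w) x < e" proof eventually_elim
  case (elim t)
  have "model_error G N T f \<psi> (V (r t)) (\<sigma> (r t)) (word w) (%v. x v l) < e" if "x : S t" "l < k t" for x l
  using st(4)[OF n[OF elim(2)] that(2,1)] elim(1) unfolding model_error_def by linarith
  then show ?case by (auto simp: Q_def I_def)
  qed
 qed
 have bound: "\<exists>\<delta>>0. \<exists>\<epsilon>>0. ereal (b - \<kappa>) <= limsup (%i. cov_rate (V (r i)) d \<epsilon> \<delta> (m i))"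
  if \<kappa>: "\<kappa> > 0" for \<kappa> proof -
  \<comment> \<open>The three losses in \<open>labelled_tuples_count\<close> are made at most \<open>\<kappa> / 3\<close> each: first \<open>s\<close>, then \<open>\<theta>\<close>, then \<open>\<epsilon>\<close>.\<close>
  define s where "s = ln (1 + 6 * real R / \<kappa>)"
  have pos: "1 + 6 * real R / \<kappa> >= 1" using \<kappa> by simp
  have s: "s >= 0" unfolding s_def using pos by (rule ln_ge_zero)
  have sR: "2 * real R * exp (- s) <= \<kappa> / 3" proof -
  have "exp s = 1 + 6 * real R / \<kappa>" unfolding s_def using pos by simp
  then have "6 * real R = \<kappa> * (exp s - 1)" using \<kappa> by (simp add: field_simps)
  also have "... <= \<kappa> * exp s" using \<kappa> by (intro mult_left_mono) auto
  finally have "6 * real R * exp (- s) <= \<kappa> * exp s * exp (- s)" by (intro mult_right_mono) auto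
  also have "... = \<kappa>" by (simp add: exp_minus)
  finally show ?thesis by linarith
  qed
  define \<theta> where "\<theta> = \<kappa> / (3 * (s + 1))"
  have \<theta>: "\<theta> > 0" using \<kappa> s by (simp add: \<theta>_def)
  have s\<theta>: "s * \<theta> <= \<kappa> / 3" proof -
  have "s * \<theta> <= (s + 1) * \<theta>" using \<theta> by (intro mult_right_mono) auto
  also have "... = \<kappa> / 3" proof -
  have "q * (\<kappa> / (3 * q)) = \<kappa> / 3" if "q ~= 0" for q using that by simp
  then show ?thesis unfolding \<theta>_def by this (use s in simp)
  qed
  finally show ?thesis .
  qed
  define \<epsilon> where "\<epsilon> = min 1 \<theta>"
  have \<epsilon>: "\<epsilon> > 0" "\<epsilon> <= 1" "\<epsilon> <= \<theta>" using \<theta> by (auto simp: \<epsilon>_def)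
  have total: "s * (\<theta> + \<epsilon>) + 2 * real R * exp (- s) <= \<kappa>" using mult_left_mono[OF \<epsilon>(3) s] s\<theta> sR by (simp add: distrib_left)
  have gX: "generates G N T f \<psi> (range Inr)" by (rule generates_reindex[OF metric_codingD(5)[OF mc]]) (simp add: f_def \<psi>_def)
  have fin: "finite (Inl ` {..<R})" by simp
  obtain J' C where J': "finite J'" "J' \<subseteq> range Inr" and C: "0 <= C"
  and rec: "EV i. ALL x:Q i. ALL y:Q i. fdist f (Inl ` {..<R}) ((V o r) i) x y <= \<theta> + C * fdist f J' ((V o r) i) x y"
  using recover_features[OF cY gX act' goodQ fin \<theta>] by blast
  obtain Lc where Lc: "Lc > 0" "!!j x y. x : space X ==> y : space X ==> \<bar>u j x - u j y\<bar> <= Lc * d x y" using mf unfolding metric_features_def by blast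
  define D where "D = (C + 1) * ((real (card J') + 1) * Lc)"
  have D: "D > 0" using C Lc(1) by (simp add: D_def)
  have CD: "C * (real (card J') * Lc) <= D" unfolding D_def using C Lc(1) by (intro mult_mono) auto
  define \<delta> where "\<delta> = \<theta> / (2 * D)"
  have \<delta>: "\<delta> > 0" using \<theta> D by (simp add: \<delta>_def)
  have "EV t. ereal (b - \<kappa>) <= cov_rate (V (r t)) d \<epsilon> \<delta> (m t)" using rec proof eventually_elim
  case (elim t)
  let ?H = "hamming_average (V (r t)) d"
  define n where "n = real (card (V (r t)))"
  have n: "n > 0" using V[of "r t"] by (simp add: n_def card_gt_0_iff)
  have close: "real (card {v : V (r t). fst (fst p v (snd p)) ~= fst (fst p' v (snd p'))}) <= \<theta> * n"
  if p: "p : I t" "p' : I t" and H: "?H (h t p) (h t p') < 2 * \<delta>" for p p' proof -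
  define x y where "x v = fst p v (snd p)" and "y v = fst p' v (snd p')" for v
  have xy: "x : Q t" "y : Q t" using p unfolding x_def[abs_def] y_def[abs_def] Q_def by auto
  have xyB: "x v : B" "y v : B" if "v : V (r t)" for v using p st(3) that unfolding x_def y_def I_def by auto
  have "fdist f J' (V (r t)) x y <= vavg (V (r t)) (%v. (real (card J') * Lc) * d (h t p v) (h t p' v))" unfolding fdist_def proof (rule vavg_mono)
  fix v assume v: "v : V (r t)"
  have "(\<Sum>j\<in>J'. \<bar>f j (x v) - f j (y v)\<bar>) <= (\<Sum>j\<in>J'. Lc * d (h t p v) (h t p' v))" proof (rule sum_mono)
  fix j assume "j : J'"
  then obtain j' where "j = Inr j'" using J'(2) by blast
  then show "\<bar>f j (x v) - f j (y v)\<bar> <= Lc * d (h t p v) (h t p' v)"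
  using Lc(2)[of "snd (x v)" "snd (y v)" j'] xyB[OF v] v by (auto simp: f_def h_def x_def y_def B_def)
  qed
  then show "(\<Sum>j\<in>J'. \<bar>f j (x v) - f j (y v)\<bar>) <= (real (card J') * Lc) * d (h t p v) (h t p' v)" by (simp add: mult.assoc)
  qed
  also have "... = (real (card J') * Lc) * ?H (h t p) (h t p')" unfolding vavg_cmult hamming_average_eq_vavg ..
  also have "... <= (real (card J') * Lc) * (2 * \<delta>)" using H Lc(1) by (intro mult_left_mono) auto
  finally have "C * fdist f J' (V (r t)) x y <= C * ((real (card J') * Lc) * (2 * \<delta>))" using C by (rule mult_left_mono)
  also have "... <= D * (2 * \<delta>)" using mult_right_mono[OF CD, of "2 * \<delta>"] \<delta> by (simp add: mult.assoc)
  also have "... = \<theta>" using D by (simp add: \<delta>_def)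
  finally have fd: "fdist f (Inl ` {..<R}) (V (r t)) x y <= 2 * \<theta>" using elim xy by fastforce
  have "2 * real (card {v : V (r t). fst (x v) ~= fst (y v)}) = (\<Sum>v\<in>V (r t). if fst (x v) ~= fst (y v) then 2 else 0)"
  using V(1) by (simp add: sum.If_cases Int_def)
  also have "... <= (\<Sum>v\<in>V (r t). \<Sum>j\<in>Inl ` {..<R}. \<bar>f j (x v) - f j (y v)\<bar>)" proof (rule sum_mono)
  fix v assume v: "v : V (r t)"
  have lt: "fst (x v) < R" "fst (y v) < R" using xyB[OF v] by (auto simp: B_def)
  have "(\<Sum>j\<in>Inl ` {..<R}. \<bar>f j (x v) - f j (y v)\<bar>) =
  (\<Sum>j<R. \<bar>label_feat j (fst (x v)) - label_feat j (fst (y v))\<bar>)" by (simp add: sum.reindex f_def)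
  moreover have "2 <= ..." if ne: "fst (x v) ~= fst (y v)" proof -
  have "(\<Sum>j\<in>{fst (x v), fst (y v)}. \<bar>label_feat j (fst (x v)) - label_feat j (fst (y v))\<bar>) \<le>
  (\<Sum>j<R. \<bar>label_feat j (fst (x v)) - label_feat j (fst (y v))\<bar>)" using lt by (intro sum_mono2) auto
  then show ?thesis using ne by (simp add: label_feat_def)
  qed
  ultimately show "(if fst (x v) ~= fst (y v) then 2 else 0) <= (\<Sum>j\<in>Inl ` {..<R}. \<bar>f j (x v) - f j (y v)\<bar>)" by (auto intro: sum_nonneg)
  qed
  also have "... = fdist f (Inl ` {..<R}) (V (r t)) x y * n" using n unfolding fdist_def vavg_def n_def by simp
  also have "... <= 2 * \<theta> * n" using fd n by (intro mult_right_mono) auto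
  finally show ?thesis unfolding x_def y_def by simp
  qed
  have cov: "exp ((b - \<kappa>) * n) <= real (card F)"
  if F: "finite F" "F \<subseteq> space (m t)" and Fcov: "measure (m t) {z : space (m t). EX y:F. ?H z y < \<delta>} > 1 - \<epsilon>" for F proof -
  have Fne: "F ~= {}" using Fcov \<epsilon>(2) by auto
  define U where "U = {p : I t. ~ (EX y:F. ?H (h t p) y < \<delta>)}"
  have Zs: "{z : space (m t). EX y:F. ?H z y < \<delta>} : sets (m t)" proof -
  have "{z : space (m t). ?H z y < \<delta>} : sets (m t)" if "y : F" for y proof -
  note [measurable] = hamming_measurable[OF group_axioms countable_group mf m(2) subsetD[OF F(2) that]]
  show ?thesis by measurable
  qed
  moreover have "{z : space (m t). EX y:F. ?H z y < \<delta>} = (\<Union>y\<in>F. {z : space (m t). ?H z y < \<delta>})" by auto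
  ultimately show ?thesis using F(1) by (auto intro!: sets.finite_UN)
  qed
  have U: "U \<subseteq> S t \<times> {..<k t}" "real (card U) <= \<epsilon> * (real (card (S t)) * real (k t))" proof -
  show "U \<subseteq> S t \<times> {..<k t}" unfolding U_def I_def by blast
  have "measure (m t) {z : space (m t). EX y:F. ?H z y < \<delta>} = measure (uniform_count_measure (I t)) (I t - U)" using Zs hs[of _ t] unfolding m_def
  by (subst measure_distr[OF hm]) (auto simp: space_uniform_count_measure m_def U_def intro!: arg_cong[of _ _ "measure _"])
  also have "... = real (card (I t - U)) / real (card (I t))" using I by (intro measure_uniform_count_measure) auto
  also have "real (card (I t - U)) = real (card (I t)) - real (card U)"
  using I(1) card_mono[of "I t" U] by (subst card_Diff_subset) (auto simp: U_def of_nat_diff)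
  finally have "1 - \<epsilon> < (real (card (I t)) - real (card U)) / real (card (I t))" using Fcov by simp
  then have "(1 - \<epsilon>) * real (card (I t)) < real (card (I t)) - real (card U)" using I[of t] by (simp add: less_divide_eq card_gt_0_iff)
  then have "real (card U) <= \<epsilon> * real (card (I t))" by (simp add: algebra_simps)
  then show "real (card U) <= \<epsilon> * (real (card (S t)) * real (k t))" by (simp add: I_def card_cartesian_product)
  qed
  \<comment> \<open>Centres of the cover need not be models, so each is replaced by a coordinate in its ball.\<close>
  define P where "P y = (SOME p. p : I t & ?H (h t p) y < \<delta>)" for y
  have Pcov: "EX z:F. real (card {v : V (r t). fst (x v l) ~= fst (fst (P z) v (snd (P z)))}) <= \<theta> * real (card (V (r t)))"
  if "x : S t" "l < k t" "(x, l) ~: U" for x l proof -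
  have p: "(x, l) : I t" using that by (simp add: I_def)
  with that(3) obtain y where y: "y : F" "?H (h t (x, l)) y < \<delta>" unfolding U_def by blast
  have P: "P y : I t & ?H (h t (P y)) y < \<delta>" unfolding P_def by (rule someI[of _ "(x, l)"]) (use p y in simp)
  have sp: "z v : space X" if "z : space (m t)" "v : V (r t)" for z v using that sets_eq_imp_space_eq[OF m(2)[of t]] by (auto simp: space_PiM)
  have "?H (h t (x, l)) (h t (P y)) <= ?H (h t (x, l)) y + ?H y (h t (P y))" by (rule Metric_space_hamming(3)[OF ms]) (use sp hs p P y F(2) in blast)+
  also have "?H y (h t (P y)) = ?H (h t (P y)) y" by (rule Metric_space_hamming(2)[OF ms])
  finally have "?H (h t (x, l)) (h t (P y)) < 2 * \<delta>" using y(2) P by linarith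
  from close[OF p _ this] P y(1) show ?thesis unfolding n_def by auto
  qed
  have labR: "fst (x v l) < R" if "x : S t" "l < k t" "v : V (r t)" for x l v using st(3)[OF that(1,3,2)] by (auto simp: B_def)
  have "ln (real (card (S t))) <= real (k t) * (n * (s * (\<theta> + \<epsilon>) + 2 * real R * exp (- s)) + ln (real (card F)))" unfolding n_def
  proof (rule labelled_tuples_count[where U = U and lab = "%x l v. fst (x v l)" and c = "%z v. fst (fst (P z) v (snd (P z)))"])
  show "\<exists>l<k t. EX v:V (r t). fst (x v l) ~= fst (y v l)" if "x : S t" "y : S t" "x ~= y" for x y by (rule st(6)[OF that])
  show "fst (x v l) < R" if "x : S t" "l < k t" "v : V (r t)" for x l v by (rule labR[OF that])
  show "EX z:F. real (card {v : V (r t). fst (x v l) ~= fst (fst (P z) v (snd (P z)))}) <= \<theta> * real (card (V (r t)))"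
  if "x : S t" "l < k t" "(x, l) ~: U" for x l by (rule Pcov[OF that])
  qed (use V F(1) Fne st(1) Sne k1 s \<theta> U in \<open>simp_all del: One_nat_def\<close>)
  also have "... <= real (k t) * (n * \<kappa> + ln (real (card F)))" using total n by (intro mult_left_mono add_right_mono) auto
  finally have "ln (real (card (S t))) <= real (k t) * (n * \<kappa> + ln (real (card F)))" .
  moreover have "real (k t) * (b * n) <= ln (real (card (S t)))"
  using st(1)[of t] Sne[of t] st(2)[of t] unfolding n_def by (subst ln_ge_iff) (auto simp: card_gt_0_iff mult.assoc)
  ultimately have "real (k t) * (b * n) <= real (k t) * (n * \<kappa> + ln (real (card F)))" by linarith
  then have "b * n <= n * \<kappa> + ln (real (card F))" using k1[of t] by (simp add: mult_le_cancel_left)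
  then have "(b - \<kappa>) * n <= ln (real (card F))" by (simp add: algebra_simps)
  then show ?thesis using F(1) Fne by (subst (asm) ln_ge_iff) (auto simp: card_gt_0_iff)
  qed
  have "enat (nat \<lceil>exp ((b - \<kappa>) * n)\<rceil>) <= cov_measure \<epsilon> \<delta> (m t) ?H" unfolding cov_measure_def
  proof (rule INF_greatest, elim CollectE conjE)
  fix F assume "finite F" "F \<subseteq> space (m t)" "1 - \<epsilon> < measure (m t) {z : space (m t). EX y:F. ?H z y < \<delta>}"
  from cov[OF this] show "enat (nat \<lceil>exp ((b - \<kappa>) * n)\<rceil>) <= enat (card F)" by (simp add: ceiling_le_iff nat_le_iff)
  qed
  moreover have "exp ((b - \<kappa>) * n) <= real (nat \<lceil>exp ((b - \<kappa>) * n)\<rceil>)" by linarith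
  ultimately show ?case proof (cases "cov_measure \<epsilon> \<delta> (m t) ?H")
  case (enat q)
  assume "enat (nat \<lceil>exp ((b - \<kappa>) * n)\<rceil>) <= cov_measure \<epsilon> \<delta> (m t) ?H"
  "exp ((b - \<kappa>) * n) <= real (nat \<lceil>exp ((b - \<kappa>) * n)\<rceil>)"
  then have q: "exp ((b - \<kappa>) * n) <= real q" unfolding enat by simp
  then have "real q > 0" by (rule less_le_trans[OF exp_gt_zero])
  with q have "(b - \<kappa>) * n <= ln (real q)" by (subst ln_ge_iff) auto
  then show ?thesis using \<open>real q > 0\<close> n unfolding enat log_enat_def n_def[symmetric] by (simp add: le_divide_eq)
  next
  case infinity
  then show ?thesis using n unfolding n_def[symmetric] by (simp add: log_enat_def)
  qed
  qed
  then have "ereal (b - \<kappa>) <= limsup (%i. cov_rate (V (r i)) d \<epsilon> \<delta> (m i))" by (intro limsup_ge_frequently eventually_frequently sequentially_bot)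
  then show ?thesis using \<delta> \<epsilon>(1) by blast
 qed
 show ?thesis using r dq bound by blast
qed

end

section \<open>Blocks of coordinates, and processes as codings\<close>

lemma maximal_separated_subset:
 assumes "finite Z" and D: "!!z. D z z"
 shows "\<exists>E\<subseteq>Z. (ALL x:E. ALL y:E. x ~= y --> ~ D x y \<or> ~ D y x) & (ALL z:Z. EX y:E. D z y)" using assms(1) proof (induction Z)
 case (insert z Z)
 then obtain E where E: "E \<subseteq> Z" "ALL x:E. ALL y:E. x ~= y --> ~ D x y \<or> ~ D y x" "ALL z:Z. EX y:E. D z y" by blast
 show ?case proof (cases "EX y:E. D z y")
  case True
  with E show ?thesis by (intro exI[of _ E]) auto
 next
  case False
  with E D show ?thesis by (intro exI[of _ "insert z E"]) auto
 qed
qed simp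

text \<open>The last block is moved to the left so that it fits. It may overlap its predecessor, which is harmless for an upper bound and keeps the projection injective on indices.\<close>
definition block_start :: "nat => nat => nat => nat" where
 "block_start k m q = min (q * k) (m - k)"

definition block :: "nat => nat => nat => (nat => 'a) => nat => 'a" where
 "block k m q a = (\<lambda>l\<in>{..<k}. a (block_start k m q + l))"

lemma block_cover:
 assumes "1 <= k" "k <= m" "j < m"
 shows "\<exists>q<(m + k - 1) div k. \<exists>l<k. j = block_start k m q + l" proof (intro exI conjI)
 show "j div k < (m + k - 1) div k" proof -
  have "j + k <= m + k - 1" using assms by simp
  then have "(j + k) div k <= (m + k - 1) div k" by (rule div_le_mono)
  then show ?thesis using assms by simp
 qed
 have "block_start k m (j div k) <= j" unfolding block_start_def by (rule min.coboundedI1) simp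
 then show "j = block_start k m (j div k) + (j - block_start k m (j div k))" by simp
 show "j - block_start k m (j div k) < k" proof -
  have "j - j div k * k < k" using assms by (simp add: minus_div_mult_eq_mod)
  then show ?thesis using assms unfolding block_start_def min_def by auto
 qed
qed

context pmp_action begin

lemma block_projection:
 assumes "k <= m"
 shows "block k m q : measurable (power_space m N) (power_space k N)" "distr (power_space m N) (power_space k N) (block k m q) = power_space k N" proof -
 have lt: "block_start k m q + l < m" if "l < k" for l using assms that by (simp add: block_start_def)
 show "block k m q : measurable (power_space m N) (power_space k N)"
  unfolding block_def[abs_def] power_space_def using lt by (intro measurable_restrict measurable_component_singleton) auto
 show "distr (power_space m N) (power_space k N) (block k m q) = power_space k N" unfolding block_def[abs_def] power_space_def
  by (rule distr_PiM_reindex[where M = "%_. N" and f = "%l. block_start k m q + l"]) (use lt prob_space_axioms in \<open>auto simp: inj_on_def\<close>)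
qed

text \<open>A model of the $m$-th power is determined up to small distance by the nearest points of maximal separated sets in its blocks, so one of the blocks has at least the corresponding root of the number of models.\<close>
theorem power_growth_of_blocks:
 fixes u :: "'j::countable => 'a => real" and V :: "nat => 'v set"
 assumes cod: "coding N A u \<xi>" and act: "almost_action G V \<sigma>" and k: "1 <= k" "k <= m" and growth: "power_growth G N T m A u \<xi> V \<sigma> c"
 shows "power_growth G N T k A u \<xi> V \<sigma>
  (c / real ((m + k - 1) div k))" proof -
 interpret M: pmp_action G "power_space m N" "power_action m T" by (rule pmp_action_power)
 interpret K: pmp_action G "power_space k N" "power_action k T" by (rule pmp_action_power)
 define n where "n = (m + k - 1) div k"
 have n: "n >= 1" using k div_le_mono[of k "m + k - 1" k] unfolding n_def by simp
 obtain r S J \<eta> where wit: "growth_wit G (power_space m N) (power_action m T) (pow_alpha m A) (pow_feat m u) (pow_code m \<xi>) V \<sigma> c r S J \<eta>"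
  using growth unfolding has_growth_def by blast
 note r = growth_witD(1)[OF wit] and good = growth_witD(2)[OF wit] and J = growth_witD(3)[OF wit]
  and \<eta> = growth_witD(4)[OF wit] and S = growth_witD(5,6)[OF wit] and sep = growth_witD(7)[OF wit]
 note act' = almost_action_subseq[OF act r] and V = almost_actionD(1,2)[OF act]
 define S' where "S' q i = (%x v. block k m q (x v)) ` S i" for q i
 have lt: "block_start k m q + l < m" if "l < k" for q l using k that by (simp add: block_start_def)
 have good': "good_seq G (power_space k N) (power_action k T) (pow_alpha k A) (pow_feat k u) (pow_code k \<xi>) (V o r) (\<sigma> o r) (S' q)" for q
  unfolding S'_def[abs_def] by (rule good_seq_factor[where p = "block k m q" and \<pi> = "block k m q" and
  \<iota> = "%(l, j). (if l < k then block_start k m q + l else m, j)", OF M.pmp_action_axioms K.pmp_action_axioms coding_power[OF cod] coding_power[OF cod]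
  block_projection[OF k(2)] _ _ _ act' good]) (use lt in \<open>auto simp: pow_feat_def pow_code_def power_action_def block_def\<close>)
 define J2 where "J2 = {..<k} \<times> snd ` J"
 have J2: "finite J2" using J by (simp add: J2_def)
 define fd where "fd i x y = fdist (pow_feat k u) J2 (V (r i)) x y" for i x y
 have fd0: "0 <= fd i x y" for i x y unfolding fd_def by (rule fdist_nonneg)
 define \<theta> where "\<theta> = \<eta> / (2 * (real n * (real (card J) + 1)))"
 have \<theta>: "\<theta> > 0" using \<eta> n by (simp add: \<theta>_def)
 have split: "fdist (pow_feat m u) J (V (r i)) x y \<le>
  real (card J) * (\<Sum>q<n. fd i (%v. block k m q (x v)) (%v. block k m q (y v)))" for i x y proof -
  let ?t = "%v q. \<Sum>p\<in>J2. \<bar>pow_feat k u p (block k m q (x v)) - pow_feat k u p (block k m q (y v))\<bar>"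
  have "\<bar>pow_feat m u p (x v) - pow_feat m u p (y v)\<bar> <= (\<Sum>q<n. ?t v q)" if p: "p : J" for p v proof (cases "fst p < m")
  case True
  then obtain q l where ql: "q < n" "l < k" "fst p = block_start k m q + l" using block_cover[OF k] unfolding n_def by blast
  have "\<bar>pow_feat m u p (x v) - pow_feat m u p (y v)\<bar> =
  \<bar>pow_feat k u (l, snd p) (block k m q (x v)) - pow_feat k u (l, snd p) (block k m q (y v))\<bar>" using True ql by (simp add: pow_feat_def block_def)
  also have "... <= ?t v q" using J2 ql(2) p by (intro member_le_sum) (auto simp: J2_def)
  also have "... <= (\<Sum>q<n. ?t v q)" using ql(1) by (intro member_le_sum) (auto intro: sum_nonneg)
  finally show ?thesis .
  qed (auto simp: pow_feat_def intro!: sum_nonneg)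
  then have "(\<Sum>p\<in>J. \<bar>pow_feat m u p (x v) - pow_feat m u p (y v)\<bar>) <= real (card J) * (\<Sum>q<n. ?t v q)" for v by (rule sum_bounded_above)
  then have "fdist (pow_feat m u) J (V (r i)) x y <= vavg (V (r i)) (%v. real (card J) * (\<Sum>q<n. ?t v q))" unfolding fdist_def by (rule vavg_mono)
  then show ?thesis unfolding vavg_cmult vavg_sum fd_def fdist_def .
 qed
 have "\<exists>q<n. \<exists>E\<subseteq>S' q i. exp (c / real n * real (card (V (r i)))) <= real (card E) & (ALL x:E. ALL y:E. x ~= y --> \<theta> <= fd i x y)" for i
 proof -
  have fin: "finite (S' q i)" for q using S by (simp add: S'_def)
  have "\<exists>E\<subseteq>S' q i. (ALL x:E. ALL y:E. x ~= y --> ~ fd i x y < \<theta> \<or> ~ fd i y x < \<theta>) & (ALL z:S' q i. EX y:E. fd i z y < \<theta>)" for q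
  using \<theta> by (intro maximal_separated_subset[OF fin]) (simp add: fd_def fdist_def vavg_def)
  then obtain E where E: "!!q. E q \<subseteq> S' q i" "!!q x y. x : E q ==> y : E q ==> x ~= y ==> ~ fd i x y < \<theta> \<or> ~ fd i y x < \<theta>"
  "!!q z. z : S' q i ==> EX y:E q. fd i z y < \<theta>" by metis
  have sym: "fd i x y = fd i y x" for x y unfolding fd_def fdist_def by (simp add: abs_minus_commute)
  have finE: "finite (E q)" for q using finite_subset[OF E(1) fin] .
  define cen where "cen x q = (SOME y. y : E q & fd i (%v. block k m q (x v)) y < \<theta>)" for x q
  have cen: "cen x q : E q & fd i (%v. block k m q (x v)) (cen x q) < \<theta>" if "x : S i" for x q proof -
  have "EX y. y : E q & fd i (%v. block k m q (x v)) y < \<theta>" using E(3)[of "%v. block k m q (x v)" q] that by (auto simp: S'_def)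
  from someI_ex[OF this] show ?thesis unfolding cen_def .
  qed
  have "inj_on (%x. \<lambda>q\<in>{..<n}. cen x q) (S i)" proof (rule inj_onI, rule ccontr)
  fix x y assume xy: "x : S i" "y : S i" "(\<lambda>q\<in>{..<n}. cen x q) = (\<lambda>q\<in>{..<n}. cen y q)" "x ~= y"
  have "fd i (%v. block k m q (x v)) (%v. block k m q (y v)) <= 2 * \<theta>" if "q < n" for q proof -
  have eq: "cen x q = cen y q" using fun_cong[OF xy(3), of q] that by simp
  have "fd i x' y' <= fd i x' z + fd i y' z" for x' y' z
  unfolding fd_def fdist_def vavg_add[symmetric] sum.distrib[symmetric] by (intro vavg_mono sum_mono) linarith
  from this[of "%v. block k m q (x v)" "%v. block k m q (y v)" "cen x q"] conjunct2[OF cen[OF xy(1), of q]] conjunct2[OF cen[OF xy(2), of q], folded eq]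
  show ?thesis by linarith
  qed
  then have "(\<Sum>q<n. fd i (%v. block k m q (x v)) (%v. block k m q (y v))) <= real n * (2 * \<theta>)"
  using sum_bounded_above[of "{..<n}" "%q. fd i (%v. block k m q (x v)) (%v. block k m q (y v))" "2 * \<theta>"] by simp
  then have "\<eta> <= real (card J) * (real n * (2 * \<theta>))"
  using order_trans[OF sep[OF xy(1,2,4)] split] mult_left_mono[of _ "real n * (2 * \<theta>)" "real (card J)"] by (meson of_nat_0_le_iff order_trans)
  moreover have "(real (card J) + 1) * (real n * (2 * \<theta>)) = \<eta>" proof -
  have "a * (b * (2 * (\<eta> / (2 * (b * a))))) = \<eta>" if "a > 0" "b > 0" for a b using that by simp
  then show ?thesis unfolding \<theta>_def by this (use n in auto)
  qed
  moreover have "real n * (2 * \<theta>) > 0" using n \<theta> by simp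
  ultimately show False by (simp add: distrib_right)
  qed
  moreover have "(%x. \<lambda>q\<in>{..<n}. cen x q) ` S i \<subseteq> PiE {..<n} E" using cen by auto
  ultimately have "card (S i) <= card (PiE {..<n} E)" using finE by (intro card_inj_on_le) (auto intro: finite_PiE)
  also have "... = (\<Prod>q<n. card (E q))" by (simp add: card_PiE)
  finally have le: "exp (c * real (card (V (r i)))) <= (\<Prod>q<n. real (card (E q)))" using S(2)[of i] by (simp flip: of_nat_prod)
  have "\<exists>q<n. exp (c / real n * real (card (V (r i)))) <= real (card (E q))" proof (rule ccontr)
  assume "~ ?thesis"
  then have less: "real (card (E q)) < exp (c / real n * real (card (V (r i))))" if "q < n" for q using that by (auto simp: not_le)
  have "(\<Prod>q<n. real (card (E q))) < (\<Prod>q<n. exp (c / real n * real (card (V (r i)))))"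
  by (rule prod_mono_strict[of 0]) (use n less in \<open>auto intro: less_imp_le\<close>)
  also have "... = exp (real n * (c / real n * real (card (V (r i)))))" unfolding exp_of_nat_mult by simp
  also have "real n * (c / real n * real (card (V (r i)))) = c * real (card (V (r i)))" using n by simp
  finally show False using le by linarith
  qed
  then obtain q where q: "q < n" "exp (c / real n * real (card (V (r i)))) <= real (card (E q))" by blast
  have "\<theta> <= fd i x y" if "x : E q" "y : E q" "x ~= y" for x y using E(2)[OF that] sym[of x y] by linarith
  then show ?thesis using q E(1) by blast
 qed
 then obtain q E where q: "!!i. q i < n" and E: "!!i. E i \<subseteq> S' (q i) i" "!!i. exp (c / real n * real (card (V (r i)))) <= real (card (E i))"
  "!!i x y. x : E i ==> y : E i ==> x ~= y ==> \<theta> <= fd i x y" by metis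
 have "power_growth G N T k A u \<xi> (V o r) (\<sigma> o r) (c / real n)"
 proof (rule K.has_growthI_words[OF coding_power[OF cod] act' J2 \<theta>], rule eventually_frequently[OF sequentially_bot])
  fix W :: "('g \<times> (nat \<times> 'j)) list set" and e :: real assume W: "finite W" "W \<subseteq> name_words G" and e: "e > 0"
  have "EV i. ALL q:{..<n}. ALL w:W. ALL x:S' q i. power_error G N T k u \<xi>
  ((V o r) i) ((\<sigma> o r) i) (word w) x < e" proof (intro eventually_ball_finite ballI finite_lessThan W)
  fix q w assume "w : W"
  with W have "w : name_words G" by blast
  from ll_word[OF this] good'[of q] e show "EV i. ALL x:S' q i. power_error G N T k u \<xi>
  ((V o r) i) ((\<sigma> o r) i) (word w) x < e" unfolding good_seq_def by blast
  qed
  then show "EV i. EX S. finite S & exp (c / real n * real (card ((V o r) i))) <= real (card S) &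
  (ALL x:S. (ALL v:(V o r) i. x v : pow_alpha k A) & (ALL w:W. power_error G N T k u \<xi> ((V o r) i) ((\<sigma> o r) i) (word w) x < e)) &
  (ALL x:S. ALL y:S. x ~= y --> \<theta> <= fdist (pow_feat k u) J2 ((V o r) i) x y)" proof eventually_elim
  case (elim i)
  have "finite (E i)" using finite_subset[OF E(1)[of i]] S(1)[of i] by (simp add: S'_def)
  moreover have "x v : pow_alpha k A" if "x : E i" "v : (V o r) i" for x v proof -
  have "x : S' (q i) i" using that(1) E(1) by blast
  with good'[of "q i"] that(2) show ?thesis unfolding good_seq_def by blast
  qed
  moreover have "power_error G N T k u \<xi> ((V o r) i) ((\<sigma> o r) i)
  (word w) x < e" if "x : E i" "w : W" for x w using elim q[of i] that E(1)[of i] by blast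
  ultimately show ?case using E(2)[of i] E(3)[of _ i] unfolding fd_def by (intro exI[of _ "E i"]) simp
  qed
 qed
 then show ?thesis unfolding n_def[symmetric] by (rule has_growth_of_subsequence[OF _ r])
qed

end

lemma compact_metric_nets:
 fixes M :: "'a set"
 assumes M: "Metric_space M d" and comp: "compact_space (Metric_space.mtopology M d)" and ne: "M ~= {}"
 shows "\<exists>q :: nat => 'a. (ALL j. q j : M) & (\<forall>e>0. EX J. finite J & (ALL x:M. EX j:J. d x (q j) < e)) & (\<exists>B>0. ALL x:M. ALL y:M. d x y <= B)"
proof -
 interpret Metric_space M d by fact
 have cM: "compactin mtopology M" using comp by (simp add: compact_space_def)
 have "ALL n. EX K. finite K & K \<subseteq> M & M \<subseteq> (\<Union>x\<in>K. mball x (1 / real (Suc n)))"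
  using compactin_imp_mtotally_bounded[OF cM] unfolding mtotally_bounded_def by (auto simp del: of_nat_Suc)
 then obtain K where K: "!!n. finite (K n)" "!!n. K n \<subseteq> M" "!!n. M \<subseteq> (\<Union>x\<in>K n. mball x (1 / real (Suc n)))" by metis
 let ?Q = "\<Union>(range K)"
 have Q: "countable ?Q" "?Q \<subseteq> M" using K by (auto intro: countable_finite)
 have Qne: "?Q ~= {}" using ne K(3)[of 0] by auto
 define q where "q = from_nat_into ?Q"
 have qM: "q j : M" for j using from_nat_into[OF Qne, of j] Q(2) unfolding q_def by blast
 have net: "EX J. finite J & (ALL x:M. EX j:J. d x (q j) < e)" if e: "e > 0" for e proof -
  obtain n where n: "1 / real (Suc n) < e" using e by (metis nat_approx_posE)
  have "EX j:(to_nat_on ?Q) ` K n. d x (q j) < e" if x: "x : M" for x proof -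
  obtain a where a: "a : K n" "x : mball a (1 / real (Suc n))" using K(3) x by blast
  then have "q (to_nat_on ?Q a) = a" unfolding q_def using Q(1) by (intro from_nat_into_to_nat_on) auto
  then show ?thesis using a n commute[of x a] by (intro bexI[of _ "to_nat_on ?Q a"]) (auto simp del: of_nat_Suc)
  qed
  then show ?thesis using K(1) by blast
 qed
 obtain B where B: "!!x y. x : M ==> y : M ==> d x y <= B" using compactin_imp_mbounded[OF cM] unfolding mbounded_alt by blast
 have "\<exists>B>0. ALL x:M. ALL y:M. d x y <= B" using B by (intro exI[of _ "max 1 B"]) (auto simp: max.coboundedI2)
 with qM net show ?thesis by blast
qed

text \<open>The features are the distances to a dense sequence of letters.\<close>
theorem (in pmp_action) metric_process_coding:
 fixes X :: "'a measure"
 assumes mp: "metric_process G X d \<mu>" and iso: "isomorphic_systems G N T \<mu> (shift G)"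
 shows "\<exists>(u :: nat => 'a => real) \<xi>. metric_coding G N T X d u \<mu> \<xi>" proof -
 have ms: "Metric_space (space X) d" and comp: "compact_space (Metric_space.mtopology (space X) d)"
  and sX: "sets X = sigma_sets (space X) {U. openin (Metric_space.mtopology (space X) d) U}"
  and \<mu>: "prob_space \<mu>" "sets \<mu> = sets (configs G X)" using mp unfolding metric_process_def by auto
 interpret X: Metric_space "space X" d by (rule ms)
 note sp\<mu> = sets_eq_imp_space_eq[OF \<mu>(2)]
 obtain \<phi> \<psi> where \<phi>: "\<phi> : measurable N \<mu>" and \<psi>: "\<psi> : measurable \<mu> N" and d\<phi>: "distr N \<mu> \<phi> = \<mu>"
  and inv: "AE x in N. \<psi> (\<phi> x) = x" and eqv0: "ALL g:carrier G. AE x in N. \<phi> (T g x) = shift G g (\<phi> x)"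
  using iso unfolding isomorphic_systems_def by (elim exE conjE) (rule that)
 note eqv = bspec[OF eqv0]
 have \<phi>E: "\<phi> x : PiE (carrier G) (%_. space X)" if "x : space N" for x using measurable_space[OF \<phi> that] unfolding sp\<mu> by (simp add: space_PiM)
 define \<xi> where "\<xi> x = \<phi> x \<one>" for x
 have \<xi>X: "\<xi> x : space X" if "x : space N" for x using PiE_mem[OF \<phi>E[OF that] one_closed] by (simp add: \<xi>_def)
 have "space X ~= {}" using \<xi>X not_empty by blast
 from compact_metric_nets[OF ms comp this] obtain q :: "nat => 'a" and B where q0: "ALL j. q j : space X"
  and net0: "\<forall>e>0. EX J. finite J & (ALL x:space X. EX j:J. d x (q j) < e)"
  and B0: "B > 0" "ALL x:space X. ALL y:space X. d x y <= B" by (elim exE conjE) (rule that)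
 note q = spec[OF q0] and net = net0[rule_format] and B = B0(1) B0(2)[rule_format]
 define u where "u j x = d x (q j) / B" for j :: nat and x
 have lip: "\<bar>u j x - u j y\<bar> <= 1 / B * d x y" if "x : space X" "y : space X" for j x y using X.mdist_reverse_triangle[of x "q j" y] X.commute that q[of j] B(1)
  by (simp add: u_def diff_divide_distrib[symmetric] divide_right_mono)
 have uX: "u j : bmeas X" for j proof (rule borel_measurableI)
  fix S :: "real set" assume "open S"
  then have "openin X.mtopology {x : topspace X.mtopology. u j x : S}" using continuous_map_lipschitz_real[OF ms _ lip] B(1) unfolding continuous_map_def by auto
  then show "u j -` S \<inter> space X : sets X" unfolding sX by (intro sigma_sets.Basic) (auto simp: vimage_def Int_def conj_commute)
 qed
 have feat: "features (space X) u" using q B unfolding features_def u_def by (simp add: divide_le_eq)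
 have near: "d x y < 2 * e + B * \<bar>u j x - u j y\<bar>" if "x : space X" "y : space X" "d x (q j) < e" for x y e j proof -
  have "B * (u j x - u j y) = d x (q j) - d y (q j)" using B(1) by (simp add: u_def right_diff_distrib)
  then have "\<bar>d x (q j) - d y (q j)\<bar> = B * \<bar>u j x - u j y\<bar>" using B(1) by (metis abs_mult abs_of_pos)
  moreover have "d x y <= d x (q j) + d y (q j)" using X.triangle[of x "q j" y] X.commute that q by simp
  ultimately show ?thesis using that(3) by linarith
 qed
 have dom: "EX J C. finite J & 0 <= C & (ALL x:space X. ALL y:space X. d x y <= \<delta> + C * (\<Sum>j\<in>J. \<bar>u j x - u j y\<bar>))" if "\<delta> > 0" for \<delta>
 proof -
  obtain J where J: "finite J" "!!x. x : space X ==> EX j:J. d x (q j) < \<delta> / 2" using net[of "\<delta> / 2"] \<open>\<delta> > 0\<close> by auto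
  have "d x y <= \<delta> + B * (\<Sum>j\<in>J. \<bar>u j x - u j y\<bar>)" if xy: "x : space X" "y : space X" for x y proof -
  obtain j where j: "j : J" "d x (q j) < \<delta> / 2" using J(2) xy by blast
  have "B * \<bar>u j x - u j y\<bar> <= B * (\<Sum>j\<in>J. \<bar>u j x - u j y\<bar>)" using B(1) J(1) j(1) by (intro mult_left_mono member_le_sum) auto
  with near[OF xy j(2)] show ?thesis by linarith
  qed
  then show ?thesis using J(1) B(1) by (intro exI[of _ J] exI[of _ B]) auto
 qed
 have sep: "x = y" if xy: "x : space X" "y : space X" and eq: "ALL j. u j x = u j y" for x y proof (rule ccontr)
  assume "x ~= y"
  then have "d x y / 2 > 0" using xy X.mdist_pos_less by simp
  from net[OF this] obtain j where "d x (q j) < d x y / 2" using xy(1) by blast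
  from near[OF xy this] eq show False by simp
 qed
 have mf: "metric_features X d u" unfolding metric_features_def using ms comp uX feat lip sep B(1) by (intro conjI exI[of _ "1 / B"]) auto
 have \<xi>m: "\<xi> : measurable N X" unfolding \<xi>_def[abs_def]
  by (rule measurable_compose[OF _ measurable_component_singleton[OF one_closed]]) (use \<phi> measurable_cong_sets[OF refl \<mu>(2)] in blast)
 have cod: "coding N (space X) u \<xi>" unfolding coding_def using feat \<xi>X measurable_compose[OF \<xi>m uX] by auto
 have ae: "AE x in N. ALL g:carrier G. \<xi> (T g x) = \<phi> x g" proof (subst AE_ball_countable[OF countable_group], rule ballI)
  fix g assume g: "g : carrier G"
  from eqv[OF g] show "AE x in N. \<xi> (T g x) = \<phi> x g" by eventually_elim (simp add: \<xi>_def shift_def g)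
 qed
 have words: "(LINT x|\<mu>. wval (cname G u x) w) = (LINT m|N. wval (name G u T \<xi> m) w)" if w: "w : name_words G" for w proof -
  note cm = config_word_measurable[OF uX \<mu>(2), where w = w]
  have "(LINT x|\<mu>. wval (cname G u x) w) = (LINT m|N. wval (cname G u (\<phi> m)) w)" using integral_distr[OF \<phi> cm] d\<phi> by simp
  also have "... = (LINT m|N. wval (name G u T \<xi> m) w)" proof (rule integral_cong_AE[OF measurable_compose[OF \<phi> cm] orbit_word_measurable[OF cod w]])
  show "AE m in N. wval (cname G u (\<phi> m)) w = wval (name G u T \<xi> m) w"
  using ae by eventually_elim (rule arg_cong[of _ _ "%q. wval q w"], auto simp: cname_def name_def fun_eq_iff)
  qed
  finally show ?thesis .
 qed
 have gen: "generates G N T u \<xi> UNIV" proof (rule generatesI[OF cod])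
  let ?\<B> = "{{m : space N. u j (\<xi> (T g m)) < r} | g j r. g : carrier G & j : UNIV}"
  define N' where "N' = sigma (space N) ?\<B>"
  have N': "space N' = space N" "sets N' = sigma_sets (space N) ?\<B>" proof -
  have "?\<B> \<subseteq> Pow (space N)" by auto
  then show "space N' = space N" "sets N' = sigma_sets (space N) ?\<B>" unfolding N'_def by (rule space_measure_of, rule sets_measure_of)
  qed
  have half: "{m : space N. d (\<xi> (T g m)) (q j) < r} : sets N'" if "g : carrier G" for g j r proof -
  have "{m : space N. d (\<xi> (T g m)) (q j) < r} = {m : space N. u j (\<xi> (T g m)) < r / B}" using B(1) by (auto simp: u_def divide_less_cancel)
  then show ?thesis unfolding N'(2) using that by (intro sigma_sets.Basic) blast
  qed
  have T\<xi>: "(%m. \<xi> (T g m)) : measurable N' X" if g: "g : carrier G" for g proof (rule measurable_sigma_sets[OF sX])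
  show "{U. openin X.mtopology U} \<subseteq> Pow (space X)" using openin_subset by force
  show "(%m. \<xi> (T g m)) : space N' \<rightarrow> space X" using \<xi>X T_space[OF g] N'(1) by auto
  fix U assume "U : {U. openin X.mtopology U}"
  then have U: "U \<subseteq> space X" "!!x. x : U ==> \<exists>e>0. X.mball x e \<subseteq> U" unfolding X.openin_mtopology by auto
  define I where "I = {(j, n). {x : space X. d x (q j) < 1 / real (Suc n)} \<subseteq> U}"
  have "x : (\<Union>(j, n)\<in>I. {x : space X. d x (q j) < 1 / real (Suc n)})" if x: "x : U" for x proof -
  from U(2)[OF x] obtain e where e: "e > 0" "X.mball x e \<subseteq> U" by (elim exE conjE) (rule that)
  obtain n where n: "1 / real (Suc n) < e / 2" using e(1) by (metis nat_approx_posE half_gt_zero)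
  obtain j where j: "d x (q j) < 1 / real (Suc n)" using net[of "1 / real (Suc n)"] x U(1) by (auto simp del: of_nat_Suc)
  have "{y : space X. d y (q j) < 1 / real (Suc n)} \<subseteq> U" proof
  fix y assume y: "y : {y : space X. d y (q j) < 1 / real (Suc n)}"
  then have yX: "y : space X" and dy: "d y (q j) < 1 / real (Suc n)" by simp_all
  have xX: "x : space X" using x U(1) by (rule rev_subsetD)
  have "d x y <= d x (q j) + d y (q j)" using X.triangle[OF xX q yX, of j] by (simp only: X.commute[of y])
  then have "d x y < e" using j dy n by linarith
  then have "y : X.mball x e" using xX yX by simp
  then show "y : U" by (rule subsetD[OF e(2)])
  qed
  then have "(j, n) : I" unfolding I_def by (simp del: of_nat_Suc)
  moreover have "x : space X" using x U(1) by (rule rev_subsetD)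
  ultimately show ?thesis using j by (intro UN_I[of "(j, n)"]) (simp_all del: of_nat_Suc)
  qed
  then have "U \<subseteq> (\<Union>(j, n)\<in>I. {x : space X. d x (q j) < 1 / real (Suc n)})" by (rule subsetI)
  moreover have "(\<Union>(j, n)\<in>I. {x : space X. d x (q j) < 1 / real (Suc n)}) \<subseteq> U" by (rule UN_least) (simp add: I_def split: prod.splits)
  ultimately have "U = (\<Union>(j, n)\<in>I. {x : space X. d x (q j) < 1 / real (Suc n)})" by (rule equalityI)
  then have "(%m. \<xi> (T g m)) -` U \<inter> space N' = (\<Union>(j, n)\<in>I. {m : space N. d (\<xi> (T g m)) (q j) < 1 / real (Suc n)})"
  using \<xi>X T_space[OF g] N'(1) by (simp del: of_nat_Suc) (auto simp del: of_nat_Suc)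
  also have "... : sets N'" by (rule sets.countable_UN'') (use half[OF g] in auto)
  finally show "(%m. \<xi> (T g m)) -` U \<inter> space N' : sets N'" .
  qed
  define \<Phi> where "\<Phi> m = (\<lambda>g\<in>carrier G. \<xi> (T g m))" for m
  have \<Phi>: "\<Phi> : measurable N' \<mu>" proof -
  have "\<Phi> : measurable N' (configs G X)" unfolding \<Phi>_def[abs_def] using T\<xi> by (rule measurable_restrict)
  then show ?thesis using measurable_cong_sets[OF refl \<mu>(2), of N'] by blast
  qed
  fix D assume D: "D : sets N"
  let ?B = "\<Phi> -` (\<psi> -` D \<inter> space \<mu>) \<inter> space N'"
  have BB: "?B : sets N'" by (rule measurable_sets[OF \<Phi> measurable_sets[OF \<psi> D]])
  have sub: "?B : sets N" proof -
  have "?\<B> \<subseteq> sets N" using approximable_halfspace(1)[OF cod] by blast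
  then have "sets N' \<subseteq> sets N" unfolding N'(2) by (rule sets.sigma_sets_subset)
  with BB show ?thesis by blast
  qed
  have "AE m in N. m ~: (D - ?B) \<union> (?B - D)" using ae inv AE_space proof eventually_elim
  case (elim m)
  have "\<Phi> m = \<phi> m" using elim(1) PiE_arb[OF \<phi>E[OF elim(3)]] unfolding \<Phi>_def by (auto simp: fun_eq_iff)
  then show ?case using elim(2,3) measurable_space[OF \<phi> elim(3)] N'(1) by auto
  qed
  then have "(D - ?B) \<union> (?B - D) : null_sets N" using D sub by (subst AE_iff_null_sets) auto
  then show "EX B:sigma_sets (space N) ?\<B>. (D - B) \<union> (B - D) : null_sets N" using BB unfolding N'(2) by blast
 qed
 show ?thesis unfolding metric_coding_def using mf \<mu> cod gen words dom by blast
qed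

section \<open>Existence of processes, and the comparison\<close>

definition hilbert_cube_code :: "'x measure => ('x => nat => real) => ((nat => real) => 'x) => bool" where
 "hilbert_cube_code N e \<psi> \<longleftrightarrow> e : measurable N borel & \<psi> : measurable borel N &
  (ALL x:space N. (ALL n. 0 <= e x n & e x n <= 1) & \<psi> (e x) = x)"

text \<open>Truncated distances to a dense sequence embed the space into the Hilbert cube. The image is completely metrizable, hence a $G_\delta$ set, so the inverse extends to a Borel map.\<close>
lemma standard_borel_code:
 assumes sb: "standard_borel N" and ne: "space N ~= {}"
 shows "EX e \<psi>. hilbert_cube_code N e \<psi>" proof -
 obtain \<tau> where \<tau>: "topspace \<tau> = space N" "completely_metrizable_space \<tau>" "second_countable \<tau>"
  and sN: "sets N = sigma_sets (space N) {U. openin \<tau> U}" using sb unfolding standard_borel_def by blast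
 from \<tau>(2) obtain M' d where "Metric_space M' d" "\<tau> = Metric_space.mtopology M' d" unfolding completely_metrizable_space_def by blast
 then have ms: "Metric_space (space N) d" and \<tau>d: "\<tau> = Metric_space.mtopology (space N) d" using \<tau>(1) Metric_space.topspace_mtopology by fastforce+
 interpret Metric_space "space N" d by (rule ms)
 obtain C where C: "countable C" "C \<subseteq> space N" "\<tau> closure_of C = space N"
  using second_countable_imp_separable_space[OF \<tau>(3)] unfolding separable_space_def \<tau>(1) by blast
 have "C ~= {}" using C(3) ne by auto
 define q where "q = from_nat_into C"
 have q: "q n : space N" for n using from_nat_into[OF \<open>C ~= {}\<close>] C(2) unfolding q_def by blast
 have dense: "EX n. d x (q n) < r" if x: "x : space N" and r: "r > 0" for x r proof -
  have "x : mtopology closure_of C" using C(3) x \<tau>d by simp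
  then obtain y where "y : C" "y : mball x r" using r unfolding metric_closure_of by blast
  moreover obtain n where "y = q n" using from_nat_into_surj[OF C(1) \<open>y : C\<close>] unfolding q_def by metis
  ultimately show ?thesis by auto
 qed
 define e where "e x n = min 1 (d x (q n))" for x n
 have e01: "0 <= e x n & e x n <= 1" for x n by (simp add: e_def)
 have near: "d x y < r" if xy: "x : space N" "y : space N" and r: "e x n < r / 2" "e y n < r / 2" "r <= 1" for x y r n proof -
  have "d x (q n) < r / 2" "d y (q n) < r / 2" using r by (auto simp: e_def min_def split: if_splits)
  then show ?thesis using triangle[OF xy(1) q xy(2), of n] commute[of y "q n"] by linarith
 qed
 have inj: "inj_on e (space N)" proof (rule inj_onI, rule ccontr)
  fix x y assume xy: "x : space N" "y : space N" "e x = e y" "x ~= y"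
  define r where "r = min 1 (d x y)"
  have "r > 0" using xy by (simp add: r_def)
  then obtain n where "d x (q n) < r / 2" using dense[OF xy(1), of "r / 2"] by auto
  then have n: "e x n < r / 2" by (simp add: e_def)
  have "d x y < r" by (rule near[OF xy(1,2) n n[unfolded xy(3)]]) (simp add: r_def)
  then show False by (simp add: r_def)
 qed
 let ?E = "e ` space N"
 have image: "EX W. open W & e ` U = W \<inter> ?E" if U: "openin \<tau> U" for U proof -
  define I where "I = {(n, r). {x : space N. e x n < r} \<subseteq> U}"
  define W where "W = (\<Union>(n, r)\<in>I. {y. y n < r})"
  have UN: "U \<subseteq> space N" and ball: "!!x. x : U ==> \<exists>r>0. mball x r \<subseteq> U" using U unfolding \<tau>d openin_mtopology by auto
  have "open {y :: nat => real. y n < r}" for n r by (rule open_Collect_less[OF continuous_on_product_coordinates continuous_on_const])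
  then have "open W" unfolding W_def by (intro open_UN) auto
  moreover have "e x : W" if x: "x : U" for x proof -
  obtain r0 where r0: "r0 > 0" "mball x r0 \<subseteq> U" using ball[OF x] by blast
  define r where "r = min 1 r0"
  have xN: "x : space N" using x UN by blast
  have "r > 0" using r0 by (simp add: r_def)
  then obtain n where "d x (q n) < r / 2" using dense[OF xN, of "r / 2"] by auto
  then have n: "e x n < r / 2" by (simp add: e_def)
  have "y : U" if y: "y : space N" "e y n < r / 2" for y proof -
  have "d x y < r" by (rule near[OF xN y(1) n y(2)]) (simp add: r_def)
  then have "y : mball x r0" using xN y(1) by (simp add: r_def)
  then show ?thesis using r0(2) by blast
  qed
  then have "(n, r / 2) : I" unfolding I_def by blast
  then show ?thesis unfolding W_def using n by blast
  qed
  moreover have "x : U" if "x : space N" "e x : W" for x using that unfolding W_def I_def by blast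
  ultimately show ?thesis using UN by (intro exI[of _ W]) blast
 qed
 have cont: "continuous_map \<tau> euclidean e" proof -
  have "continuous_map \<tau> euclideanreal (%x. e x n)" for n unfolding \<tau>d proof (rule continuous_map_lipschitz_real[OF ms zero_less_one])
  fix x y assume xy: "x : space N" "y : space N"
  have "\<bar>d x (q n) - d y (q n)\<bar> <= d x y" using mdist_reverse_triangle[OF xy(1) q xy(2)] commute[of y "q n"] by simp
  then show "\<bar>e x n - e y n\<bar> <= 1 * d x y" unfolding e_def by (auto simp: min_def abs_le_iff)
  qed
  then have "continuous_map \<tau> (product_topology (%_. euclideanreal) UNIV) e" by (simp add: continuous_map_componentwise_UNIV)
  then show ?thesis by (simp add: euclidean_product_topology)
 qed
 have "homeomorphic_map \<tau> (subtopology euclidean ?E) e" proof (rule bijective_open_imp_homeomorphic_map)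
  show "continuous_map \<tau> (subtopology euclidean ?E) e" using cont \<tau>(1) by (simp add: continuous_map_in_subtopology)
  show "open_map \<tau> (subtopology euclidean ?E) e" unfolding open_map_def openin_subtopology using image by auto
 qed (use \<tau>(1) inj in auto)
 then have "\<tau> homeomorphic_space subtopology euclidean ?E" by (rule homeomorphic_map_imp_homeomorphic_space)
 then have "completely_metrizable_space (subtopology euclidean ?E)" using \<tau>(2) homeomorphic_completely_metrizable_space by blast
 then have "gdelta_in euclidean ?E" by (intro completely_metrizable_space_imp_gdelta_in metrizable_space_euclidean) auto
 then obtain \<U> where \<U>: "countable \<U>" "\<U> \<subseteq> Collect open" "\<Inter>\<U> = ?E" unfolding gdelta_in_alt intersection_of_def by auto
 have "(\<Inter>U\<in>\<U>. U) : sets borel" using \<U>(1,2) by (intro sets.countable_INT'') auto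
 then have E: "?E : sets borel" using \<U>(3) by simp
 have em: "e : measurable N borel" proof (rule borel_measurableI)
  fix S :: "(nat => real) set" assume "open S"
  then have "openin \<tau> {x : topspace \<tau>. e x : S}" using cont unfolding continuous_map_def by auto
  then show "e -` S \<inter> space N : sets N" unfolding sN \<tau>(1) by (intro sigma_sets.Basic) (auto simp: vimage_def Int_def conj_commute)
 qed
 obtain x0 where x0: "x0 : space N" using ne by blast
 define \<psi> where "\<psi> y = (if y : ?E then inv_into (space N) e y else x0)" for y
 have \<psi>e: "\<psi> (e x) = x" if "x : space N" for x using that inj by (simp add: \<psi>_def)
 have "\<psi> : measurable borel N" proof (rule measurable_sigma_sets[OF sN])
  show "{U. openin \<tau> U} \<subseteq> Pow (space N)" using openin_subset \<tau>(1) by fastforce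
  show "\<psi> : space borel \<rightarrow> space N" using x0 by (auto simp: \<psi>_def inv_into_into)
  fix U assume "U : {U. openin \<tau> U}"
  then have U: "openin \<tau> U" "U \<subseteq> space N" using openin_subset \<tau>(1) by fastforce+
  obtain W where W: "open W" "e ` U = W \<inter> ?E" using image[OF U(1)] by blast
  have "\<psi> y : U \<longleftrightarrow> y : e ` U" if "y : ?E" for y using that \<psi>e U(2) inj by (auto dest: inj_onD)
  moreover have "\<psi> y = x0" if "y ~: ?E" for y using that by (simp add: \<psi>_def)
  ultimately have "\<psi> y : U \<longleftrightarrow> y : e ` U \<union> (if x0 : U then - ?E else {})" for y using U(2) by (cases "y : ?E") auto
  then have "\<psi> -` U \<inter> space borel = (W \<inter> ?E) \<union> (if x0 : U then - ?E else {})"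
  unfolding W(2)[symmetric] by (simp only: vimage_def space_borel Int_UNIV_right Collect_mem_eq)
  also have "... : sets borel" using W(1) E by auto
  finally show "\<psi> -` U \<inter> space borel : sets borel" .
 qed
 then show ?thesis unfolding hilbert_cube_code_def using em e01 \<psi>e by blast
qed

text \<open>The codes of the coordinates are interleaved.\<close>
lemma hilbert_cube_code_power:
 assumes c: "hilbert_cube_code N e \<psi>" and k: "k >= 1"
 shows "hilbert_cube_code (power_space k N) (%x n. e (x (n mod k)) (n div k)) (%y. \<lambda>l\<in>{..<k}. \<psi> (%n. y (n * k + l)))" proof -
 have e: "e : measurable N borel" and \<psi>: "\<psi> : measurable borel N"
  and x: "!!x n. x : space N ==> 0 <= e x n & e x n <= 1" "!!x. x : space N ==> \<psi> (e x) = x" using c unfolding hilbert_cube_code_def by blast+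
 have sp: "x l : space N" if "x : space (power_space k N)" "l < k" for x l using PiE_mem[OF that(1)[unfolded space_power_space], of l] that(2) by simp
 have "(%x n. e (x (n mod k)) (n div k)) : measurable (power_space k N) borel" proof (rule measurable_coordinatewise_then_product)
  fix n
  have "(%x. x (n mod k)) : measurable (power_space k N) N" unfolding power_space_def using k by (intro measurable_component_singleton) auto
  from measurable_compose[OF measurable_compose[OF this e] borel_measurable_continuous_onI[OF continuous_on_product_coordinates]]
  show "(%x. e (x (n mod k)) (n div k)) : bmeas (power_space k N)" .
 qed
 moreover have "(%y. \<lambda>l\<in>{..<k}. \<psi> (%n. y (n * k + l))) : measurable borel (power_space k N)" unfolding power_space_def proof (rule measurable_restrict)
  fix l
  have "(%y :: nat => real. %n. y (n * k + l)) : measurable borel borel"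
  by (intro measurable_coordinatewise_then_product borel_measurable_continuous_onI continuous_on_product_coordinates)
  from measurable_compose[OF this \<psi>] show "(%y. \<psi> (%n. y (n * k + l))) : measurable borel N" .
 qed
 moreover have "(\<lambda>l\<in>{..<k}. \<psi> (%n. e (x ((n * k + l) mod k)) ((n * k + l) div k))) = x" if X: "x : space (power_space k N)" for x proof
  fix l
  show "(\<lambda>l\<in>{..<k}. \<psi> (%n. e (x ((n * k + l) mod k)) ((n * k + l) div k))) l = x l"
  using sp[OF X] x(2) PiE_arb[OF X[unfolded space_power_space]] by (cases "l < k") simp_all
 qed
 ultimately show ?thesis unfolding hilbert_cube_code_def using sp x(1) k by simp
qed

lemma hilbert_cube_metric:
 defines "Q \<equiv> {x :: nat => real. ALL n. 0 <= x n & x n <= 1}"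
 shows "Q : sets borel" "Metric_space Q dist" "compact_space (Metric_space.mtopology Q dist)"
  "second_countable (Metric_space.mtopology Q dist)"
  "sets (restrict_space borel Q) = sigma_sets Q {U. openin (Metric_space.mtopology Q dist) U}" proof -
 have "compactin (product_topology (%_. euclidean) UNIV) (PiE UNIV (%_. {0..1::real}) :: (nat => real) set)" by (subst compactin_PiE) auto
 moreover have "PiE UNIV (%_. {0..1}) = Q" unfolding Q_def by (auto simp: PiE_def)
 ultimately have Q: "compact Q" by (simp add: euclidean_product_topology)
 then show Qb: "Q : sets borel" by (intro borel_closed compact_imp_closed)
 interpret S: Submetric UNIV "dist :: (nat => real) => _" Q by (simp add: Submetric_def Submetric_axioms_def Met_TC.Metric_space_axioms)
 have top: "Metric_space.mtopology Q dist = subtopology euclidean Q" using S.mtopology_submetric by simp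
 show "Metric_space Q dist" by (rule S.sub.Metric_space_axioms)
 show "compact_space (Metric_space.mtopology Q dist)" unfolding top using Q by (simp add: compact_space_subtopology)
 obtain B :: "(nat => real) set set" where B: "countable B" "topological_basis B" using ex_countable_basis by blast
 have "second_countable (euclidean :: (nat => real) topology)" unfolding second_countable_def proof (intro exI[of _ B] conjI ballI allI impI)
  show "openin euclidean V" if "V : B" for V using topological_basis_open[OF B(2) that] by simp
  fix U x assume "openin euclidean U & x : (U :: (nat => real) set)"
  then have "open U" "x : U" by auto
  then obtain V where "V : B" "x : V" "V \<subseteq> U" by (rule topological_basisE[OF B(2)])
  then show "EX V:B. x : V & V \<subseteq> U" by blast
 qed (rule B(1))
 then show "second_countable (Metric_space.mtopology Q dist)" unfolding top by (rule second_countable_subtopology)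
 have "sets (restrict_space borel Q) = (\<inter>) Q ` sigma_sets UNIV (Collect open)" by (simp add: sets_restrict_space borel_def)
 also have "... = sigma_sets Q ((\<inter>) Q ` Collect open)" using Qb by (intro sigma_sets_Int) (auto simp: borel_def)
 also have "(\<inter>) Q ` Collect open = {U. openin (Metric_space.mtopology Q dist) U}" unfolding top openin_subtopology by auto
 finally show "sets (restrict_space borel Q) = sigma_sets Q {U. openin (Metric_space.mtopology Q dist) U}" .
qed

text \<open>The Hilbert cube serves as the alphabet, and a point is mapped to the sequence of codes along its orbit. Thus the process in the definition of the entropies exists.\<close>
theorem (in pmp_action) metric_process_exists:
 assumes c: "hilbert_cube_code N e \<psi>0"
 shows "\<exists>(X :: (nat => real) measure) d \<mu>. metric_process G X d \<mu> & isomorphic_systems G N T \<mu> (shift G)" proof -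
 have e: "e : measurable N borel" and \<psi>0: "\<psi>0 : measurable borel N"
  and e01: "!!x n. x : space N ==> 0 <= e x n & e x n <= 1" and inv: "!!x. x : space N ==> \<psi>0 (e x) = x" using c unfolding hilbert_cube_code_def by blast+
 define Q where "Q = {x :: nat => real. ALL n. 0 <= x n & x n <= 1}"
 note Q = hilbert_cube_metric[folded Q_def]
 define X where "X = restrict_space borel Q"
 have spX: "space X = Q" by (simp add: X_def space_restrict_space)
 have eX: "e : measurable N X" unfolding X_def using e e01 by (intro measurable_restrict_space2) (auto simp: Q_def)
 have idX: "(%x. x) : measurable X borel" unfolding X_def by (rule measurable_restrict_space1) simp
 let ?P = "PiM (carrier G) (%_. X)"
 define \<Phi> where "\<Phi> x = (\<lambda>h\<in>carrier G. e (T h x))" for x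
 have \<Phi>: "\<Phi> : measurable N ?P" unfolding \<Phi>_def[abs_def] using measurable_compose[OF T_measurable eX] by (intro measurable_restrict)
 define \<mu> where "\<mu> = distr N ?P \<Phi>"
 have s\<mu>: "sets \<mu> = sets ?P" "space \<mu> = space ?P" by (simp_all add: \<mu>_def)
 have mm: "measurable N \<mu> = measurable N ?P" by (rule measurable_cong_sets[OF refl s\<mu>(1)])
 have shm: "shift G g : measurable ?P ?P" if g: "g : carrier G" for g
  unfolding shift_def[abs_def] using g by (intro measurable_restrict measurable_component_singleton) auto
 have eqv: "\<Phi> (T g x) = shift G g (\<Phi> x)" if "g : carrier G" "x : space N" for g x using that by (auto simp: \<Phi>_def shift_def fun_eq_iff T_mult)
 have inv\<mu>: "distr \<mu> \<mu> (shift G g) = \<mu>" if g: "g : carrier G" for g proof -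
  have "distr \<mu> \<mu> (shift G g) = distr (distr N ?P \<Phi>) ?P (shift G g)" by (rule distr_cong) (simp_all add: \<mu>_def)
  also have "... = distr N ?P (%x. shift G g (\<Phi> x))" using distr_distr[OF shm[OF g] \<Phi>] by (simp add: o_def)
  also have "... = distr N ?P (%x. \<Phi> (T g x))" by (rule distr_cong) (simp_all add: eqv[OF g])
  also have "... = distr (distr N N (T g)) ?P \<Phi>" using distr_distr[OF \<Phi> T_measurable[OF g]] by (simp add: o_def)
  finally show ?thesis by (simp add: T_preserves[OF g] \<mu>_def)
 qed
 have sb: "standard_borel X" unfolding standard_borel_def spX proof (intro exI[of _ "Metric_space.mtopology Q dist"] conjI)
  show "completely_metrizable_space (Metric_space.mtopology Q dist)"
  unfolding completely_metrizable_space_def using Q(2) Metric_space.compact_space_imp_mcomplete[OF Q(2,3)] by blast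
 qed (use Q(4,5) Metric_space.topspace_mtopology[OF Q(2)] in \<open>auto simp: X_def\<close>)
 have mp: "metric_process G X dist \<mu>"
  unfolding metric_process_def spX using sb Q(2,3,5) s\<mu>(1) inv\<mu> prob_space_distr[OF \<Phi>] by (auto simp: X_def \<mu>_def)
 define \<psi> where "\<psi> y = \<psi>0 (y \<one>)" for y
 have \<psi>: "\<psi> : measurable ?P N"
  unfolding \<psi>_def[abs_def] by (rule measurable_compose[OF measurable_component_singleton[OF one_closed] measurable_compose[OF idX \<psi>0]])
 have left: "\<psi> (\<Phi> x) = x" if "x : space N" for x using that by (simp add: \<psi>_def \<Phi>_def T_one inv)
 have right: "AE y in \<mu>. \<Phi> (\<psi> y) = y" proof -
  have coord: "(%y. y h n) : bmeas ?P" "(%y. e (T h (\<psi> y)) n) : bmeas ?P" if h: "h : carrier G" for h n proof -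
  have pr: "(%z :: nat => real. z n) : bmeas borel" by (rule borel_measurable_continuous_onI[OF continuous_on_product_coordinates])
  show "(%y. y h n) : bmeas ?P" by (rule measurable_compose[OF measurable_component_singleton[OF h] measurable_compose[OF idX pr]])
  show "(%y. e (T h (\<psi> y)) n) : bmeas ?P" by (rule measurable_compose[OF measurable_compose[OF \<psi> T_measurable[OF h]] measurable_compose[OF e pr]])
  qed
  have one: "{y : space ?P. e (T h (\<psi> y)) n = y h n} : sets ?P" if "h : carrier G" for h n proof -
  note [measurable] = coord[OF that, of n]
  show ?thesis by measurable
  qed
  have eq: "{y : space ?P. \<Phi> (\<psi> y) = y} = {y : space ?P. ALL h:carrier G. ALL n. e (T h (\<psi> y)) n = y h n}"
  by (auto simp: \<Phi>_def fun_eq_iff space_PiM PiE_iff extensional_def)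
  have "{y : space ?P. ALL h:carrier G. ALL n. e (T h (\<psi> y)) n = y h n} =
  (\<Inter>h\<in>carrier G. \<Inter>n. {y : space ?P. e (T h (\<psi> y)) n = y h n})" using one_closed by auto
  also have "... : sets ?P" proof (rule sets.countable_INT'[OF countable_group])
  have "(\<Inter>n. {y : space ?P. e (T h (\<psi> y)) n = y h n}) : sets ?P" if "h : carrier G" for h by (rule sets.countable_INT) (use one[OF that] in auto)
  then show "(%h. \<Inter>n. {y : space ?P. e (T h (\<psi> y)) n = y h n}) ` carrier G \<subseteq> sets ?P" by blast
  qed (use one_closed in blast)
  finally have "{y : space ?P. ALL h:carrier G. ALL n. e (T h (\<psi> y)) n = y h n} : sets ?P" .
  then have "{y : space ?P. \<Phi> (\<psi> y) = y} : sets ?P" unfolding eq .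
  then show ?thesis unfolding \<mu>_def by (subst AE_distr_iff[OF \<Phi>]) (use left in auto)
 qed
 have "isomorphic_systems G N T \<mu> (shift G)" unfolding isomorphic_systems_def proof (intro exI[of _ \<Phi>] exI[of _ \<psi>] conjI ballI)
  show "\<psi> : measurable \<mu> N" using \<psi> measurable_cong_sets[OF s\<mu>(1) refl] by blast
  show "distr N \<mu> \<Phi> = \<mu>" unfolding \<mu>_def by (rule distr_cong) simp_all
 qed (use \<Phi> mm left right eqv in auto)
 then show ?thesis using mp by blast
qed

lemma generates_mono: "generates G N T u \<xi> I ==> I \<subseteq> I' ==> generates G N T u \<xi> I'" unfolding generates_def by (meson ll_mono)

lemma isomorphic_process_spec:
 assumes "\<exists>(X :: (nat => real) measure) d \<mu>. metric_process G X d \<mu> & isomorphic_systems G N T \<mu> (shift G)" "isomorphic_process G N T = (X, d, \<mu>)"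
 shows "metric_process G X d \<mu>" "isomorphic_systems G N T \<mu> (shift G)" proof -
 have "case isomorphic_process G N T of (X, d, \<mu>) => metric_process G X d \<mu> & isomorphic_systems G N T \<mu> (shift G)"
  unfolding isomorphic_process_def by (rule someI_ex) (use assms(1) in auto)
 then show "metric_process G X d \<mu>" "isomorphic_systems G N T \<mu> (shift G)" unfolding assms(2) by auto
qed

lemma (in pmp_action) sofic_entropy_growth:
 fixes u :: "'j::countable => 'a => real" and V :: "nat => 'v set"
 assumes c: "hilbert_cube_code N e \<psi>" and act: "almost_action G V \<sigma>" and cod: "coding N A u \<xi>" and gen: "generates G N T u \<xi> UNIV"
 shows "c < sofic_entropy G V \<sigma> N T ==> c = ereal b & 0 <= b \<or> c = - \<infinity> & b = 0 ==> has_growth G N T A u \<xi> V \<sigma> b"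
  "has_growth G N T A u \<xi> V \<sigma> b ==> ereal b <= sofic_entropy G V \<sigma> N T" proof -
 obtain X d \<mu> where P: "isomorphic_process G N T = (X, d, \<mu>)" by (metis prod.exhaust)
 note sp = isomorphic_process_spec[OF metric_process_exists[OF c] P]
 obtain u' :: "nat => (nat => real) => real" and \<xi>' where mc: "metric_coding G N T X d u' \<mu> \<xi>'" using metric_process_coding[OF sp] by blast
 note D = metric_codingD(4,5)[OF mc]
 have E: "sofic_entropy G V \<sigma> N T = process_entropy G V \<sigma> X d \<mu>" by (simp add: sofic_entropy_def P)
 show "has_growth G N T A u \<xi> V \<sigma> b" if "c < sofic_entropy G V \<sigma> N T" "c = ereal b & 0 <= b \<or> c = - \<infinity> & b = 0"
  by (rule has_growth_invariant[OF D cod gen act process_entropy_imp_growth[OF mc act that[unfolded E]]])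
 show "ereal b <= sofic_entropy G V \<sigma> N T" if "has_growth G N T A u \<xi> V \<sigma> b"
  unfolding E by (rule growth_imp_process_entropy[OF mc act has_growth_invariant[OF cod gen D act that]])
qed

text \<open>Fekete-type argument: $a_m \le \lceil m/k \rceil a_k$ bounds the upper limit of $a_m/m$ by each $a_k/k$.\<close>
lemma quotient_sequence_limit:
 fixes a :: "nat => ereal"
 assumes nonneg: "!!k. k >= 1 ==> a k = - \<infinity> \<or> 0 <= a k" and block: "!!k m. 1 <= k ==> k <= m ==> a m <= ereal (real ((m + k - 1) div k)) * a k"
 shows "(%k. a k / ereal (real k)) ~~> (INF k\<in>{1..}. a k / ereal (real k))" proof (rule order_tendstoI)
 fix y assume y: "y < (INF k\<in>{1..}. a k / ereal (real k))"
 have "y < a k / ereal (real k)" if "k >= 1" for k using less_INF_D[OF y, of k] that by simp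
 then show "\<forall>\<^sub>F k in sequentially. y < a k / ereal (real k)" by (intro eventually_sequentiallyI[of 1]) auto
next
 fix y assume "(INF k\<in>{1..}. a k / ereal (real k)) < y"
 then obtain k where k: "k >= 1" "a k / ereal (real k) < y" unfolding INF_less_iff by auto
 show "\<forall>\<^sub>F m in sequentially. a m / ereal (real m) < y" proof (cases "a k")
  case MInf
  have "a m / ereal (real m) = - \<infinity>" if m: "m >= k" for m proof -
  have "(m + k - 1) div k > 0" using k(1) m by (simp add: div_greater_zero_iff)
  then have "a m = - \<infinity>" using block[OF k(1) m] unfolding MInf by simp
  then show ?thesis using k(1) m by simp
  qed
  then show ?thesis using k(2) by (intro eventually_sequentiallyI[of k]) (auto simp: less_ereal.simps dest: order_le_less_trans[of "- \<infinity>"])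
 next
  case PInf
  then show ?thesis using k by simp
 next
  case (real A)
  have A: "A >= 0" using nonneg[OF k(1)] real by auto
  have le: "a m / ereal (real m) <= ereal (A / real k + A / real m)" if m: "m >= k" for m proof -
  define n where "n = (m + k - 1) div k"
  have "n * k <= m + k" unfolding n_def using div_times_less_eq_dividend[of "m + k - 1" k] by linarith
  then have "real n * real k <= real m + real k" by (metis of_nat_add of_nat_le_iff of_nat_mult)
  then have "real n <= real m / real k + 1" using k(1) by (simp add: field_simps)
  then have "real n * A <= (real m / real k + 1) * A" using A by (rule mult_right_mono)
  moreover have "a m <= ereal (real n * A)" using block[OF k(1) m] real unfolding n_def by simp
  ultimately have "a m <= ereal ((real m / real k + 1) * A)" using order_trans by (metis ereal_less_eq(3))
  then have "a m / ereal (real m) <= ereal ((real m / real k + 1) * A) / ereal (real m)" using k(1) m by (intro ereal_divide_right_mono) auto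
  also have "... = ereal (A / real k + A / real m)" using k(1) m by (simp add: field_simps)
  finally show ?thesis .
  qed
  have "(%m. ereal (A / real k + A / real m)) ~~> ereal (A / real k + 0)" by (intro tendsto_ereal tendsto_add tendsto_const) real_asymp
  moreover have "ereal (A / real k + 0) < y" using k real by simp
  ultimately have "\<forall>\<^sub>F m in sequentially. ereal (A / real k + A / real m) < y" by (rule order_tendstoD)
  then show ?thesis using eventually_ge_at_top[of k] by eventually_elim (rule order_le_less_trans[OF le])
 qed
qed

lemma (in pmp_action) partition_labels:
 assumes "finite_generating_partition G N T P"
 shows "\<exists>(R :: nat) \<zeta>. coding N {..<R} label_feat \<zeta> & generates G N T label_feat \<zeta> UNIV" proof -
 have fin: "finite P" and part: "partition_on (space N) P" and meas: "P \<subseteq> sets N"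
  and gen: "!!A. A : sets N ==> EX B:sigma_sets (space N) {T g -` C \<inter> space N |g C. g : carrier G & C : P}. (A - B) \<union> (B - A) : null_sets N"
  using assms unfolding finite_generating_partition_def by blast+
 obtain C where C: "bij_betw C {..<card P} P" using ex_bij_betw_nat_finite[OF fin] by (auto simp: atLeast0LessThan)
 have CP: "C j : P" if "j < card P" for j using bij_betwE[OF C] that by simp
 have ex: "\<exists>j<card P. x : C j" if "x : space N" for x proof -
  from that have "x : \<Union>P" unfolding partition_onD1[OF part] .
  then obtain D where D: "x : D" "D : P" by (rule UnionE)
  then have "D : C ` {..<card P}" using bij_betw_imp_surj_on[OF C] by simp
  with D(1) show ?thesis by blast
 qed
 have uniq: "j = j'" if "j < card P" "j' < card P" "x : C j" "x : C j'" for x j j' proof -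
  have "C j = C j'" using partition_onD2[OF part] CP that unfolding disjoint_def by blast
  then show ?thesis using inj_onD[OF bij_betw_imp_inj_on[OF C]] that(1,2) by simp
 qed
 define \<zeta> where "\<zeta> x = (SOME j. j < card P & x : C j)" for x
 have \<zeta>: "\<zeta> x < card P & x : C (\<zeta> x)" if "x : space N" for x unfolding \<zeta>_def by (rule someI_ex) (use ex[OF that] in blast)
 have \<zeta>_iff: "\<zeta> x = j \<longleftrightarrow> x : C j" if "x : space N" "j < card P" for x j using \<zeta>[OF that(1)] uniq that(2) by blast
 have "(%x. label_feat j (\<zeta> x)) : bmeas N" for j proof (cases "j < card P")
  case True
  have "C j : sets N" using CP[OF True] meas by blast
  then have "(indicator (C j) :: 'x => real) : bmeas N" by simp
  moreover have "label_feat j (\<zeta> x) = indicator (C j) x" if "x : space N" for x using \<zeta>_iff[OF that True] by (auto simp: label_feat_def indicator_def)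
  ultimately show ?thesis using measurable_cong[of N "%x. label_feat j (\<zeta> x)" "indicator (C j)"] by blast
 next
  case False
  then have "label_feat j (\<zeta> x) = 0" if "x : space N" for x using \<zeta>[OF that] by (auto simp: label_feat_def)
  then show ?thesis using measurable_cong[of N "%x. label_feat j (\<zeta> x)" "%_. 0"] by simp
 qed
 then have cod: "coding N {..<card P} label_feat \<zeta>" unfolding coding_def features_def using \<zeta> by (auto simp: label_feat_def)
 let ?\<B> = "{{m : space N. label_feat j (\<zeta> (T g m)) < r} | g j r. g : carrier G & j : UNIV}"
 have "T g -` D \<inter> space N : sigma_sets (space N) ?\<B>" if g: "g : carrier G" and D: "D : P" for g D proof -
  have "D : C ` {..<card P}" using D bij_betw_imp_surj_on[OF C] by simp
  then obtain j where j: "j < card P" "D = C j" by blast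
  have "T g -` D \<inter> space N = space N - {m : space N. label_feat j (\<zeta> (T g m)) < 1}"
  using \<zeta>_iff[OF T_space[OF g] j(1)] by (auto simp: j(2) label_feat_def split: if_splits)
  moreover have "{m : space N. label_feat j (\<zeta> (T g m)) < 1} : ?\<B>" using g by blast
  ultimately show ?thesis by (simp only:) (intro sigma_sets.Compl sigma_sets.Basic)
 qed
 then have "sigma_sets (space N) {T g -` C \<inter> space N |g C. g : carrier G & C : P} \<subseteq> sigma_sets (space N) ?\<B>" by (intro sigma_sets_mono) blast
 then have "generates G N T label_feat \<zeta> UNIV" using gen by (intro generatesI[OF cod]) blast
 with cod show ?thesis by blast
qed

theorem theoremD:
  fixes G :: "('g, 'b) monoid_scheme"
    and V :: "nat \<Rightarrow> 'v set" and \<sigma> :: "nat \<Rightarrow> 'g \<Rightarrow> 'v \<Rightarrow> 'v"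
    and M :: "'x measure" and T :: "'g \<Rightarrow> 'x \<Rightarrow> 'x"
  assumes "group G" and "countable (carrier G)"
    and "sofic_approximation G V \<sigma>"
    and "G_system G M T"
  shows "ps_entropy G V \<sigma> M T \<ge> dq_entropy G V \<sigma> M T \<and>
         ((\<exists>P. finite_generating_partition G M T P) \<longrightarrow>
            ps_entropy G V \<sigma> M T = dq_entropy G V \<sigma> M T)"
proof -
 have act: "almost_action G V \<sigma>" by (rule almost_action_sofic[OF assms(3)])
 have pM: "prob_space M" and sbM: "standard_borel M" using assms(4) unfolding G_system_def by blast+
 interpret prob_space M by (rule pM)
 interpret pmp_action G M T using assms unfolding G_system_def by (intro pmp_action.intro pmp_action_axioms.intro) auto
 obtain e \<psi> where code: "hilbert_cube_code M e \<psi>" using standard_borel_code[OF sbM not_empty] by blast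
 define a where "a k = sofic_entropy G V \<sigma> (power_space k M) (power_action k T)" for k
 have upper: "power_growth G M T k A u \<xi> V \<sigma> b"
  if "coding M A u \<xi>" "generates G M T u \<xi> UNIV" "k >= 1" "c < a k" "c = ereal b & 0 <= b \<or> c = - \<infinity> & b = 0"
  for k A and u :: "'j::countable => 'c => real" and \<xi> b c
  using pmp_action.sofic_entropy_growth(1)[OF pmp_action_power hilbert_cube_code_power[OF code that(3)] act coding_power[OF that(1)] generates_power[OF that(1,2)]]
  that(4,5) unfolding a_def by blast
 have lower: "ereal b <= a k" if "coding M A u \<xi>" "generates G M T u \<xi> UNIV" "k >= 1"
  "power_growth G M T k A u \<xi> V \<sigma> b" for k A and u :: "'j::countable => 'c => real" and \<xi> b
  using pmp_action.sofic_entropy_growth(2)[OF pmp_action_power hilbert_cube_code_power[OF code that(3)] act coding_power[OF that(1)] generates_power[OF that(1,2)]]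
  that(4) unfolding a_def by blast
 obtain X d \<mu> where P: "isomorphic_process G M T = (X, d, \<mu>)" by (metis prod.exhaust)
 obtain u :: "nat => (nat => real) => real" and \<xi> where mc: "metric_coding G M T X d u \<mu> \<xi>"
  using metric_process_coding[OF isomorphic_process_spec[OF metric_process_exists[OF code] P]] by blast
 note cod = metric_codingD(4)[OF mc] and gen = metric_codingD(5)[OF mc]
 have dqE: "dq_entropy G V \<sigma> M T = process_dq_entropy G V \<sigma> X d \<mu>" by (simp add: dq_entropy_def P)
 have a0: "a k = - \<infinity> \<or> 0 <= a k" if k: "k >= 1" for k proof (cases "a k = - \<infinity>")
  case False
  then have "- \<infinity> < a k" by simp
  from lower[OF cod gen k upper[OF cod gen k this, of 0]] show ?thesis by (simp add: zero_ereal_def)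
 qed simp
 have block: "a m <= ereal (real ((m + k - 1) div k)) * a k" if k: "1 <= k" "k <= m" for k m proof (rule ccontr)
  define n where "n = real ((m + k - 1) div k)"
  have n: "n > 0" using k unfolding n_def by (simp add: div_greater_zero_iff)
  have m: "m >= 1" using k by simp
  note red = power_growth_of_blocks[OF cod act k, folded n_def]
  assume "~ ?thesis"
  then have less: "ereal n * a k < a m" by (simp add: n_def)
  then have "- \<infinity> < a m" by (rule order_le_less_trans[rotated]) simp
  from lower[OF cod gen k(1) red[OF upper[OF cod gen m this, of 0]]] have ak: "0 <= a k" by (simp add: zero_ereal_def)
  obtain c where c: "ereal n * a k < ereal c" "ereal c < a m" using ereal_dense2[OF less] by blast
  have "0 <= ereal n * a k" using n ak by simp
  then have c0: "0 <= c" using c(1) by (metis ereal_less(2) less_imp_le order_le_less_trans)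
  have "ereal (c / n) <= a k" using lower[OF cod gen k(1) red[OF upper[OF cod gen m c(2), of c]]] c0 by simp
  then have "ereal n * ereal (c / n) <= ereal n * a k" using n by (intro ereal_mult_left_mono) auto
  with c(1) n show False by simp
 qed
 define I where "I = (INF k\<in>{1..}. a k / ereal (real k))"
 have ps: "ps_entropy G V \<sigma> M T = I" using limI[OF quotient_sequence_limit[OF a0 block]] unfolding ps_entropy_def a_def I_def by simp
 have le: "dq_entropy G V \<sigma> M T <= I" unfolding dqE process_dq_entropy_def I_def proof (rule INF_greatest, rule SUP_least)
  fix k p assume "k : {1 :: nat..}" and p: "p : {(r, m). strict_mono r & doubly_quenched_converges G (V o r) (\<sigma> o r) X d m \<mu>}"
  then have k1: "k >= 1" by simp
  obtain r m where pe: "p = (r, m)" by (cases p)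
  have r: "strict_mono r" and dq: "doubly_quenched_converges G (V o r) (\<sigma> o r) X d m \<mu>" using p unfolding pe by simp_all
  note act' = almost_action_subseq[OF act r]
  have m: "prob_space (m i)" "sets (m i) = sets (PiM ((V o r) i) (%_. X))" for i using dq unfolding doubly_quenched_converges_def by blast+
  note pc = doubly_quenched_imp_pair_convergent[OF mc act' dq]
  note lower' = lower[OF cod gen k1 has_growth_of_subsequence[OF _ r]]
  have ak: "0 <= a k" using lower'[OF pair_convergent_power_growth_zero[OF mc act' m pc]] by (simp add: zero_ereal_def)
  have bound: "limsup (%i. cov_rate (V (r i)) d \<epsilon> \<delta> (m i)) <= a k / ereal (real k)" if pos: "\<delta> > 0" "\<epsilon> > 0" for \<delta> \<epsilon>
  proof (rule ccontr)
  assume "~ limsup (%i. cov_rate (V (r i)) d \<epsilon> \<delta> (m i)) <= a k / ereal (real k)"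
  then have "a k / ereal (real k) < limsup (%i. cov_rate ((V o r) i) d \<epsilon> \<delta> (m i))" by (simp add: not_le)
  then obtain b' where b': "a k / ereal (real k) < ereal b'"
  "ereal b' < limsup (%i. cov_rate ((V o r) i) d \<epsilon> \<delta> (m i))" using ereal_dense2 by blast
  obtain b where b: "a k / ereal (real k) < ereal b" "ereal b < ereal b'" using ereal_dense2[OF b'(1)] by blast
  have "0 <= a k / ereal (real k)" using ak k1 by simp
  then have "0 <= b" using b(1) by (metis ereal_less(2) less_imp_le order_le_less_trans)
  then have "ereal (real k * b) <= a k" using pos b(2) by (intro lower' pair_convergent_power_growth[OF mc act' m pc _ _ k1 _ _ b'(2)]) auto
  then have "ereal b <= a k / ereal (real k)" using k1 by (subst ereal_le_divide_pos) auto
  with b(1) show False by simp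
  qed
  show "(case p of (r, m) => SUP (\<delta>, \<epsilon>)\<in>{0<..} \<times> {0<..}. limsup (%i. cov_rate (V (r i)) d \<epsilon> \<delta> (m i))) <= a k / ereal (real k)"
  unfolding pe split_conv by (rule SUP_least) (use bound in auto)
 qed
 have "I <= dq_entropy G V \<sigma> M T" if part: "finite_generating_partition G M T Pt" for Pt proof (rule ccontr)
  assume "~ ?thesis"
  then have less: "dq_entropy G V \<sigma> M T < I" by simp
  obtain R :: nat and \<zeta> where cL: "coding M {..<R} label_feat \<zeta>" and gL: "generates G M T label_feat \<zeta> UNIV" using partition_labels[OF part] by blast
  have "generates G M T (pair_feat label_feat u) (%m. (\<zeta> m, \<xi> m)) (range Inl)" by (rule generates_reindex[OF gL]) simp
  then have gY: "generates G M T (pair_feat label_feat u) (%m. (\<zeta> m, \<xi> m)) UNIV" by (rule generates_mono) simp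
  note cY = coding_pair[OF cL cod]
  have key: "ereal b <= dq_entropy G V \<sigma> M T"
  if b: "!!k. k >= 1 ==> power_growth G M T k ({..<R} \<times> space X) (pair_feat label_feat u) (%m. (\<zeta> m, \<xi> m)) V \<sigma> (real k * b)" for b proof -
  obtain r m where r: "strict_mono r" "doubly_quenched_converges G (V o r) (\<sigma> o r) X d m \<mu>"
  and big: "!!\<kappa>. \<kappa> > 0 ==> \<exists>\<delta>>0. \<exists>\<epsilon>>0. ereal (b - \<kappa>) <= limsup (%i. cov_rate (V (r i)) d \<epsilon> \<delta> (m i))"
  using doubly_quenched_from_power_growth[OF mc act cL gL b] by blast
  have "ereal (b - \<kappa>) <= process_dq_entropy G V \<sigma> X d \<mu>" if \<kappa>: "\<kappa> > 0" for \<kappa> proof -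
  obtain \<delta> \<epsilon> where *: "\<delta> > 0" "\<epsilon> > 0"
  "ereal (b - \<kappa>) <= limsup (%i. cov_rate (V (r i)) d \<epsilon> \<delta> (m i))" using big[OF \<kappa>] by blast
  have "ereal (b - \<kappa>) <= (SUP (\<delta>, \<epsilon>)\<in>{0<..} \<times> {0<..}. limsup (%i. cov_rate (V (r i)) d \<epsilon> \<delta> (m i)))"
  by (rule SUP_upper2[of "(\<delta>, \<epsilon>)"]) (use * in simp_all)
  also have "... <= process_dq_entropy G V \<sigma> X d \<mu>" unfolding process_dq_entropy_def by (rule SUP_upper2[of "(r, m)"]) (use r in simp_all)
  finally show ?thesis .
  qed
  then have "ereal b <= process_dq_entropy G V \<sigma> X d \<mu> + ereal \<kappa>" if "\<kappa> > 0" for \<kappa>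
  using ereal_minus_le[of "ereal \<kappa>" "ereal b" "process_dq_entropy G V \<sigma> X d \<mu>"] that by simp
  then show ?thesis unfolding dqE by (rule ereal_le_epsilon2[rule_format])
  qed
  have aI: "I <= a k / ereal (real k)" if "k >= 1" for k unfolding I_def using that by (intro INF_lower) simp
  have "ereal 0 <= dq_entropy G V \<sigma> M T" proof (rule key)
  fix k :: nat assume k: "k >= 1"
  have "a k ~= - \<infinity>" using aI[OF k] less k by auto
  then have "- \<infinity> < a k" by simp
  from upper[OF cY gY k this, of 0] show "power_growth G M T k ({..<R} \<times> space X) (pair_feat label_feat u) (%m. (\<zeta> m, \<xi> m)) V \<sigma> (real k * 0)" by simp
  qed
  moreover obtain b where b: "dq_entropy G V \<sigma> M T < ereal b" "ereal b < I" using ereal_dense2[OF less] by blast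
  ultimately have b0: "0 <= b" by (metis ereal_less_eq(3) less_imp_le order_le_less_trans)
  have "ereal b <= dq_entropy G V \<sigma> M T" proof (rule key)
  fix k :: nat assume k: "k >= 1"
  have "ereal b < a k / ereal (real k)" using b(2) aI[OF k] by (rule less_le_trans)
  then have "ereal (real k * b) < a k" using k by (subst (asm) ereal_less_divide_pos) auto
  from upper[OF cY gY k this, of "real k * b"] b0 show "power_growth G M T k ({..<R} \<times> space X) (pair_feat label_feat u) (%m. (\<zeta> m, \<xi> m)) V \<sigma> (real k * b)" by simp
  qed
  with b(1) show False by simp
 qed
 with le show ?thesis unfolding ps by (auto intro: order_antisym)
qed

end
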